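(* Write $\bar\theta:=\mathbb{E}[\theta]$ and $\kappa:=\mathbb{E}\big[(\mu/\sigma)^2\beta\big]$. For $t\in[0,T]$ and $\overline{Z}\in\mathcal{C}_T$ let $$\begin{aligned}G(t,\overline{Z}):={}&\frac{x_0}{T+1}\Big(1-\frac{\bar\theta}{(1-\bar\theta)T+1}\Big)+\int_0^t\frac{\bar\theta}{(T+1-s)^2}\int_s^T\overline{Z}_v\,dv\,ds-\int_0^t\frac{\bar\theta}{T+1-s}\overline{Z}_s\,ds\\&-\frac{\bar\theta^2}{(1-\bar\theta)T+1}\int_0^T\Big(\frac{1}{(T+1-s)^2}\int_s^T\overline{Z}_v\,dv-\frac{1}{T+1-s}\overline{Z}_s\Big)ds-\frac{\bar\theta}{T+1-t}\int_t^T\overline{Z}_s\,ds\\&+\frac{\kappa}{4}\Big[T+1+2t-\frac{1}{T+1}\Big]-\frac14\,\frac{\bar\theta}{T+1}\,\kappa\,\frac{3T^2+4T}{(1-\bar\theta)T+1}.\end{aligned}$$ Then there exists a unique deterministic $\overline{Z}\in\mathcal{C}_T$ solving the functional ODE $$d\overline{Z}_t=\big[(-\delta+\delta\bar\theta)\overline{Z}_t+\delta\,G(t,\overline{Z})\big]dt,\quad t\in[0,T],\qquad \overline{Z}_0=z_0.$$ Consequently, with this $\overline{Z}$ and $$\overline{X}_T:=\frac{x_0}{(1-\bar\theta)T+1}+\frac{\kappa}{4}\,\frac{3T^2+4T}{(1-\bar\theta)T+1}+\frac{\bar\theta(T+1)}{(1-\bar\theta)T+1}\int_0^T\Big(\frac{1}{(T+1-s)^2}\int_s^T\overline{Z}_v\,dv-\frac{1}{T+1-s}\overline{Z}_s\Big)ds,$$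 the control $(\Pi^*,C^* )$ defined via the feedback functions $$\Pi^*(t,x)=\beta\frac{\mu}{\sigma^2}(T+1-t),$$ $$C^*(t,x)=\frac{x-\theta\overline{X}_T}{T+1-t}+\theta\overline{Z}_t-\frac{\theta}{T+1-t}\int_t^T\overline{Z}_s\,ds+\frac14\beta\Big(\frac{\mu}{\sigma}\Big)^2\Big((T+1-t)-\frac{1}{T+1-t}\Big)$$ is the unique mean field equilibrium.
   Context: Setting (mean field game, exponential utility). Fix $T>0$, $x_0>0$, $z_0>0$, $\delta>0$, and finitely many types $o_k=(\mu_k,\sigma_k,\beta_k,\theta_k)$, $k=1,\dots,K$, with $\mu_k,\sigma_k,\beta_k>0$, $\theta_k\in(0,1]$, together with a probability distribution $(F(\{1\}),\dots,F(\{K\}))$ on $\{1,\dots,K\}$. On a filtered probability space $(\Omega,\mathcal{F},(\mathcal{F}_t)_{t\in[0,T]},\mathbb{P})$ satisfying the usual conditions there are a Brownian motion $W$ and an $\mathcal{F}_0$-measurable random type $o=(\mu,\sigma,\beta,\theta)$, independent of $W$, with law $m$, $m(o=o_k)=F(\{k\})$. $\mathcal{C}_T:=C([0,T];\mathbb{R})$. The representative agent's wealth is $dX_t=\Pi_t\mu\,dt+\Pi_t\sigma\,dW_t-C_t\,dt$, $X_0=x_0$. Admissible controls $\mathcal{A}^{r,e}_0$: progressively measurable $(\Pi,C)$ (real-valued) with $\mathbb{E}\int_0^T(\Pi_s^2+C_s^2)\,ds<\infty$. Given $\overline{Z}\in\mathcal{C}_T$ and $\overline{X}_T\in\mathbb{R}$,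 the agent maximizes over $\mathcal{A}^{r,e}_0$ $$\mathbb{E}\Big[\int_0^T-\exp\big\{-\tfrac1\beta(C_s-\theta\overline{Z}_s)\big\}ds-\exp\big\{-\tfrac1\beta(X_T-\theta\overline{X}_T)\big\}\Big].$$ Mean field equilibrium: a control $(\Pi^*,C^* )\in\mathcal{A}^{r,e}_0$ that is optimal for this problem for some $(\overline{Z},\overline{X}_T)\in\mathcal{C}_T\times\mathbb{R}$ and satisfies the consistency conditions $\overline{Z}_t=z_0e^{-\delta t}+\int_0^t\delta e^{\delta(s-t)}\mathbb{E}[C^*_s]\,ds$ for $t\in[0,T]$ and $\overline{X}_T=\mathbb{E}[X^*_T]$, where $X^*$ is the wealth process under $(\Pi^*,C^* )$ with $X^*_0=x_0$. The control defined via feedback functions is $\Pi^*_t=\Pi^*(t,X^*_t)$, $C^*_t=C^*(t,X^*_t)$, where $X^*$ solves the wealth equation under this feedback with $X^*_0=x_0$, and $(\mu,\sigma,\beta,\theta)=o$ is the random type. *)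

theory Defs
  imports "HOL-Probability.Probability"
begin

section \<open>Stochastic basis and stochastic integral\<close>

text \<open>
  A filtration on the time interval \<open>[0,T]\<close> is a family \<open>F :: real \<Rightarrow> 'a measure\<close> of which only the
  sigma-algebras \<open>sets (F t)\<close> with \<open>t \<in> {0..T}\<close> matter; the probability measure is \<open>M\<close>.
\<close>

definition usual_filtration :: "'a measure \<Rightarrow> real \<Rightarrow> (real \<Rightarrow> 'a measure) \<Rightarrow> bool" where
  "usual_filtration M T F \<longleftrightarrow>
     complete_measure M \<and>
     (\<forall>t\<in>{0..T}. subalgebra M (F t)) \<and>
     (\<forall>s\<in>{0..T}. \<forall>t\<in>{0..T}. s \<le> t \<longrightarrow> sets (F s) \<subseteq> sets (F t)) \<and>
     (\<forall>t\<in>{0..<T}. sets (F t) = (\<Inter>u\<in>{t<..T}. sets (F u))) \<and>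
     null_sets M \<subseteq> sets (F 0)"

definition brownian_motion ::
    "'a measure \<Rightarrow> real \<Rightarrow> (real \<Rightarrow> 'a measure) \<Rightarrow> (real \<Rightarrow> 'a \<Rightarrow> real) \<Rightarrow> bool" where
  "brownian_motion M T F W \<longleftrightarrow>
     (\<forall>t\<in>{0..T}. W t \<in> borel_measurable (F t)) \<and>
     (AE \<omega> in M. W 0 \<omega> = 0) \<and>
     (AE \<omega> in M. continuous_on {0..T} (\<lambda>t. W t \<omega>)) \<and>
     (\<forall>s\<in>{0..T}. \<forall>t\<in>{0..T}. s < t \<longrightarrow>
        distributed M lborel (\<lambda>\<omega>. W t \<omega> - W s \<omega>) (normal_density 0 (sqrt (t - s))) \<and>
        prob_space.indep_set M (sets (F s))
          (sets (vimage_algebra (space M) (\<lambda>\<omega>. W t \<omega> - W s \<omega>) borel)))"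

definition prog_measurable ::
    "real \<Rightarrow> (real \<Rightarrow> 'a measure) \<Rightarrow> (real \<Rightarrow> 'a \<Rightarrow> real) \<Rightarrow> bool" where
  "prog_measurable T F H \<longleftrightarrow>
     (\<forall>t\<in>{0..T}. (\<lambda>(s, \<omega>). H s \<omega>) \<in> borel_measurable (restrict_space borel {0..t} \<Otimes>\<^sub>M F t))"

text \<open>
  A simple integrand is \<open>\<Sum>i<n. \<xi> i * 1_(\<tau> i, \<tau> (i+1)]\<close> with bounded \<open>F (\<tau> i)\<close>-measurable \<open>\<xi> i\<close>.
\<close>

definition simple_integrand ::
    "'a measure \<Rightarrow> real \<Rightarrow> (real \<Rightarrow> 'a measure) \<Rightarrow> nat \<Rightarrow> (nat \<Rightarrow> real) \<Rightarrow> (nat \<Rightarrow> 'a \<Rightarrow> real) \<Rightarrow> bool" where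
  "simple_integrand M T F n \<tau> \<xi> \<longleftrightarrow>
     0 \<le> \<tau> 0 \<and> \<tau> n \<le> T \<and> (\<forall>i<n. \<tau> i \<le> \<tau> (Suc i)) \<and>
     (\<forall>i<n. \<xi> i \<in> borel_measurable (F (\<tau> i)) \<and> (\<exists>B. \<forall>\<omega>\<in>space M. \<bar>\<xi> i \<omega>\<bar> \<le> B))"

definition simple_process ::
    "nat \<Rightarrow> (nat \<Rightarrow> real) \<Rightarrow> (nat \<Rightarrow> 'a \<Rightarrow> real) \<Rightarrow> real \<Rightarrow> 'a \<Rightarrow> real" where
  "simple_process n \<tau> \<xi> s \<omega> = (\<Sum>i<n. \<xi> i \<omega> * indicator {\<tau> i<..\<tau> (Suc i)} s)"

definition simple_integral ::
    "(real \<Rightarrow> 'a \<Rightarrow> real) \<Rightarrow> nat \<Rightarrow> (nat \<Rightarrow> real) \<Rightarrow> (nat \<Rightarrow> 'a \<Rightarrow> real) \<Rightarrow> real \<Rightarrow> 'a \<Rightarrow> real" where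
  "simple_integral W n \<tau> \<xi> t \<omega> =
     (\<Sum>i<n. \<xi> i \<omega> * (W (min t (\<tau> (Suc i))) \<omega> - W (min t (\<tau> i)) \<omega>))"

text \<open>
  \<open>ito_integral M T F W H I\<close>: the process \<open>I\<close> is (a continuous version of) \<open>\<integral>\<^sub>0 H dW\<close> on \<open>[0,T]\<close>,
  i.e. the \<open>L\<^sup>2\<close>-limit of the integrals of simple integrands converging to \<open>H\<close> in
  \<open>L\<^sup>2([0,T] \<times> \<Omega>)\<close>. By the Ito isometry \<open>I\<close> is determined by \<open>H\<close> up to indistinguishability;
  the convergence forces \<open>E \<integral>\<^sub>0\<^sup>T H\<^sup>2 ds < \<infinity>\<close>.
\<close>

definition ito_integral ::
    "'a measure \<Rightarrow> real \<Rightarrow> (real \<Rightarrow> 'a measure) \<Rightarrow> (real \<Rightarrow> 'a \<Rightarrow> real) \<Rightarrow>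
     (real \<Rightarrow> 'a \<Rightarrow> real) \<Rightarrow> (real \<Rightarrow> 'a \<Rightarrow> real) \<Rightarrow> bool" where
  "ito_integral M T F W H I \<longleftrightarrow>
     prog_measurable T F H \<and> prog_measurable T F I \<and>
     (AE \<omega> in M. continuous_on {0..T} (\<lambda>t. I t \<omega>)) \<and>
     (\<exists>n \<tau> \<xi>.
        (\<forall>m. simple_integrand M T F (n m) (\<tau> m) (\<xi> m)) \<and>
        (\<lambda>m. \<integral>\<^sup>+\<omega>. (\<integral>\<^sup>+s\<in>{0..T}. ennreal ((H s \<omega> - simple_process (n m) (\<tau> m) (\<xi> m) s \<omega>)\<^sup>2) \<partial>lborel) \<partial>M)
          \<longlonglongrightarrow> 0 \<and>
        (\<forall>t\<in>{0..T}.
           (\<lambda>m. \<integral>\<^sup>+\<omega>. ennreal ((I t \<omega> - simple_integral W (n m) (\<tau> m) (\<xi> m) t \<omega>)\<^sup>2) \<partial>M)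
             \<longlonglongrightarrow> 0))"


section \<open>The mean field game\<close>

text \<open>Controls are pairs of processes \<open>P\<close> (investment) and \<open>C\<close> (consumption).\<close>

definition admissible ::
    "'a measure \<Rightarrow> real \<Rightarrow> (real \<Rightarrow> 'a measure) \<Rightarrow> (real \<Rightarrow> 'a \<Rightarrow> real) \<Rightarrow> (real \<Rightarrow> 'a \<Rightarrow> real) \<Rightarrow> bool" where
  "admissible M T F P C \<longleftrightarrow>
     prog_measurable T F P \<and> prog_measurable T F C \<and>
     (\<integral>\<^sup>+\<omega>. (\<integral>\<^sup>+s\<in>{0..T}. ennreal ((P s \<omega>)\<^sup>2 + (C s \<omega>)\<^sup>2) \<partial>lborel) \<partial>M) < \<infinity>"

definition wealth ::
    "'a measure \<Rightarrow> real \<Rightarrow> (real \<Rightarrow> 'a measure) \<Rightarrow> (real \<Rightarrow> 'a \<Rightarrow> real) \<Rightarrow> real \<Rightarrow>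
     ('a \<Rightarrow> real) \<Rightarrow> ('a \<Rightarrow> real) \<Rightarrow>
     (real \<Rightarrow> 'a \<Rightarrow> real) \<Rightarrow> (real \<Rightarrow> 'a \<Rightarrow> real) \<Rightarrow> (real \<Rightarrow> 'a \<Rightarrow> real) \<Rightarrow> bool" where
  "wealth M T F W x0 \<mu> \<sigma> P C X \<longleftrightarrow>
     prog_measurable T F X \<and>
     (AE \<omega> in M. continuous_on {0..T} (\<lambda>t. X t \<omega>)) \<and>
     (AE \<omega> in M. set_integrable lborel {0..T} (\<lambda>s. P s \<omega> * \<mu> \<omega>)) \<and>
     (AE \<omega> in M. set_integrable lborel {0..T} (\<lambda>s. C s \<omega>)) \<and>
     (\<exists>I. ito_integral M T F W (\<lambda>s \<omega>. P s \<omega> * \<sigma> \<omega>) I \<and>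
        (AE \<omega> in M. \<forall>t\<in>{0..T}.
           X t \<omega> = x0 + (LBINT s:{0..t}. P s \<omega> * \<mu> \<omega>) + I t \<omega> - (LBINT s:{0..t}. C s \<omega>)))"

text \<open>
  The expected utility as an element of \<open>[-\<infinity>, 0]\<close>: the integrand is negative, so the expectation
  always exists in the extended reals but may be \<open>-\<infinity>\<close> for an admissible control.
\<close>

definition payoff ::
    "'a measure \<Rightarrow> real \<Rightarrow> ('a \<Rightarrow> real) \<Rightarrow> ('a \<Rightarrow> real) \<Rightarrow> (real \<Rightarrow> real) \<Rightarrow> real \<Rightarrow>
     (real \<Rightarrow> 'a \<Rightarrow> real) \<Rightarrow> (real \<Rightarrow> 'a \<Rightarrow> real) \<Rightarrow> ereal" where
  "payoff M T \<beta> \<theta> Z Xb C X =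
     - enn2ereal (\<integral>\<^sup>+\<omega>.
          ((\<integral>\<^sup>+s\<in>{0..T}. ennreal (exp (- (1 / \<beta> \<omega>) * (C s \<omega> - \<theta> \<omega> * Z s))) \<partial>lborel)
           + ennreal (exp (- (1 / \<beta> \<omega>) * (X T \<omega> - \<theta> \<omega> * Xb)))) \<partial>M)"

text \<open>
  The wealth process of an admissible control is unique up to indistinguishability, so the choice
  of \<open>X\<close> and \<open>X'\<close> below is immaterial.
\<close>

definition optimal ::
    "'a measure \<Rightarrow> real \<Rightarrow> (real \<Rightarrow> 'a measure) \<Rightarrow> (real \<Rightarrow> 'a \<Rightarrow> real) \<Rightarrow> real \<Rightarrow>
     ('a \<Rightarrow> real) \<Rightarrow> ('a \<Rightarrow> real) \<Rightarrow> ('a \<Rightarrow> real) \<Rightarrow> ('a \<Rightarrow> real) \<Rightarrow> (real \<Rightarrow> real) \<Rightarrow> real \<Rightarrow>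
     (real \<Rightarrow> 'a \<Rightarrow> real) \<Rightarrow> (real \<Rightarrow> 'a \<Rightarrow> real) \<Rightarrow> bool" where
  "optimal M T F W x0 \<mu> \<sigma> \<beta> \<theta> Z Xb P C \<longleftrightarrow>
     admissible M T F P C \<and>
     (\<exists>X. wealth M T F W x0 \<mu> \<sigma> P C X \<and>
        (\<forall>P' C' X'. admissible M T F P' C' \<longrightarrow> wealth M T F W x0 \<mu> \<sigma> P' C' X' \<longrightarrow>
           payoff M T \<beta> \<theta> Z Xb C' X' \<le> payoff M T \<beta> \<theta> Z Xb C X))"

text \<open>
  \<open>C([0,T]; \<real>)\<close>; extensionality makes elements that agree on \<open>[0,T]\<close> equal.
\<close>

definition CT :: "real \<Rightarrow> (real \<Rightarrow> real) set" where
  "CT T = {Z \<in> extensional {0..T}. continuous_on {0..T} Z}"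

definition mean_field_equilibrium ::
    "'a measure \<Rightarrow> real \<Rightarrow> (real \<Rightarrow> 'a measure) \<Rightarrow> (real \<Rightarrow> 'a \<Rightarrow> real) \<Rightarrow> real \<Rightarrow> real \<Rightarrow> real \<Rightarrow>
     ('a \<Rightarrow> real) \<Rightarrow> ('a \<Rightarrow> real) \<Rightarrow> ('a \<Rightarrow> real) \<Rightarrow> ('a \<Rightarrow> real) \<Rightarrow>
     (real \<Rightarrow> 'a \<Rightarrow> real) \<Rightarrow> (real \<Rightarrow> 'a \<Rightarrow> real) \<Rightarrow> bool" where
  "mean_field_equilibrium M T F W x0 z0 \<delta> \<mu> \<sigma> \<beta> \<theta> P C \<longleftrightarrow>
     (\<exists>Z\<in>CT T. \<exists>Xb X.
        optimal M T F W x0 \<mu> \<sigma> \<beta> \<theta> Z Xb P C \<and>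
        (\<forall>t\<in>{0..T}. Z t = z0 * exp (- \<delta> * t)
            + (LBINT s:{0..t}. \<delta> * exp (\<delta> * (s - t)) * prob_space.expectation M (C s))) \<and>
        wealth M T F W x0 \<mu> \<sigma> P C X \<and> Xb = prob_space.expectation M (X T))"

text \<open>
  Controls are identified when they agree \<open>dt \<otimes> \<P>\<close>-almost everywhere on \<open>[0,T] \<times> \<Omega>\<close>; changing a
  control on such a null set affects neither its wealth process nor its payoff.
\<close>

definition same_control ::
    "'a measure \<Rightarrow> real \<Rightarrow> (real \<Rightarrow> 'a \<Rightarrow> real) \<Rightarrow> (real \<Rightarrow> 'a \<Rightarrow> real) \<Rightarrow>
     (real \<Rightarrow> 'a \<Rightarrow> real) \<Rightarrow> (real \<Rightarrow> 'a \<Rightarrow> real) \<Rightarrow> bool" where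
  "same_control M T P C P' C' \<longleftrightarrow>
     (AE (s, \<omega>) in restrict_space lborel {0..T} \<Otimes>\<^sub>M M. P s \<omega> = P' s \<omega> \<and> C s \<omega> = C' s \<omega>)"

definition unique_mean_field_equilibrium ::
    "'a measure \<Rightarrow> real \<Rightarrow> (real \<Rightarrow> 'a measure) \<Rightarrow> (real \<Rightarrow> 'a \<Rightarrow> real) \<Rightarrow> real \<Rightarrow> real \<Rightarrow> real \<Rightarrow>
     ('a \<Rightarrow> real) \<Rightarrow> ('a \<Rightarrow> real) \<Rightarrow> ('a \<Rightarrow> real) \<Rightarrow> ('a \<Rightarrow> real) \<Rightarrow>
     (real \<Rightarrow> 'a \<Rightarrow> real) \<Rightarrow> (real \<Rightarrow> 'a \<Rightarrow> real) \<Rightarrow> bool" where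
  "unique_mean_field_equilibrium M T F W x0 z0 \<delta> \<mu> \<sigma> \<beta> \<theta> P C \<longleftrightarrow>
     mean_field_equilibrium M T F W x0 z0 \<delta> \<mu> \<sigma> \<beta> \<theta> P C \<and>
     (\<forall>P' C'. mean_field_equilibrium M T F W x0 z0 \<delta> \<mu> \<sigma> \<beta> \<theta> P' C' \<longrightarrow> same_control M T P' C' P C)"


section \<open>The explicit solution\<close>

text \<open>\<open>tb\<close> stands for \<open>E[\<theta>]\<close> and \<open>\<kappa>\<close> for \<open>E[(\<mu>/\<sigma>)\<^sup>2 \<beta>]\<close>.\<close>

definition G :: "real \<Rightarrow> real \<Rightarrow> real \<Rightarrow> real \<Rightarrow> real \<Rightarrow> (real \<Rightarrow> real) \<Rightarrow> real" where
  "G T x0 tb \<kappa> t Z =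
     x0 / (T + 1) * (1 - tb / ((1 - tb) * T + 1))
     + (LBINT s:{0..t}. tb / (T + 1 - s)\<^sup>2 * (LBINT v:{s..T}. Z v))
     - (LBINT s:{0..t}. tb / (T + 1 - s) * Z s)
     - tb\<^sup>2 / ((1 - tb) * T + 1) *
         (LBINT s:{0..T}. 1 / (T + 1 - s)\<^sup>2 * (LBINT v:{s..T}. Z v) - 1 / (T + 1 - s) * Z s)
     - tb / (T + 1 - t) * (LBINT s:{t..T}. Z s)
     + \<kappa> / 4 * (T + 1 + 2 * t - 1 / (T + 1))
     - 1 / 4 * (tb / (T + 1)) * \<kappa> * ((3 * T\<^sup>2 + 4 * T) / ((1 - tb) * T + 1))"

definition solves_functional_ode ::
    "real \<Rightarrow> real \<Rightarrow> real \<Rightarrow> real \<Rightarrow> real \<Rightarrow> real \<Rightarrow> (real \<Rightarrow> real) \<Rightarrow> bool" where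
  "solves_functional_ode T x0 z0 \<delta> tb \<kappa> Z \<longleftrightarrow>
     (\<forall>t\<in>{0..T}. (Z has_real_derivative ((- \<delta> + \<delta> * tb) * Z t + \<delta> * G T x0 tb \<kappa> t Z))
        (at t within {0..T})) \<and>
     Z 0 = z0"

definition mean_terminal_wealth ::
    "real \<Rightarrow> real \<Rightarrow> real \<Rightarrow> real \<Rightarrow> (real \<Rightarrow> real) \<Rightarrow> real" where
  "mean_terminal_wealth T x0 tb \<kappa> Z =
     x0 / ((1 - tb) * T + 1)
     + \<kappa> / 4 * ((3 * T\<^sup>2 + 4 * T) / ((1 - tb) * T + 1))
     + tb * (T + 1) / ((1 - tb) * T + 1) *
         (LBINT s:{0..T}. 1 / (T + 1 - s)\<^sup>2 * (LBINT v:{s..T}. Z v) - 1 / (T + 1 - s) * Z s)"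

text \<open>In the two feedback functions \<open>m, s, b, h\<close> are the values of \<open>\<mu>, \<sigma>, \<beta>, \<theta>\<close>.\<close>

definition feedback_investment ::
    "real \<Rightarrow> real \<Rightarrow> real \<Rightarrow> real \<Rightarrow> real \<Rightarrow> real \<Rightarrow> real" where
  "feedback_investment T m s b t x = b * (m / s\<^sup>2) * (T + 1 - t)"

definition feedback_consumption ::
    "real \<Rightarrow> (real \<Rightarrow> real) \<Rightarrow> real \<Rightarrow> real \<Rightarrow> real \<Rightarrow> real \<Rightarrow> real \<Rightarrow> real \<Rightarrow> real \<Rightarrow> real" where
  "feedback_consumption T Z Xb m s b h t x =
     (x - h * Xb) / (T + 1 - t) + h * Z t - h / (T + 1 - t) * (LBINT v:{t..T}. Z v)
     + 1 / 4 * b * (m / s)\<^sup>2 * ((T + 1 - t) - 1 / (T + 1 - t))"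

end

theory Submission
  imports Defs
begin

text \<open>
  The functional equation is less nonlocal than it looks. The two terms of \<open>G\<close> under the outer
  integral are, up to sign, the derivative of \<open>(1 / (T + 1 - s)) * \<integral>\<^sub>s\<^sup>T Z\<close> (\<open>weighted_tail_integral\<close>),
  so that \<open>G\<close> depends on \<open>Z\<close> only through the number \<open>a = \<integral>\<^sub>0\<^sup>T Z\<close>, and affinely (\<open>G_eq\<close>). For a
  given \<open>a\<close> the equation is a linear ordinary one; integrating its solution gives one scalar affine
  equation for \<open>a\<close>, whose coefficient is positive (\<open>nonlocal_ode_ex1\<close>).

  For a given mean field the feedback control has an explicit wealth process, affine in the Brownian
  motion. Along it the marginal utility of consumption at time \<open>s\<close>, and that of terminal wealth, are
  one and the same type-dependent constant times the state price density
  \<open>Y\<^sub>s = exp (- l W\<^sub>s - l\<^sup>2 s / 2)\<close> with \<open>l = \<mu> / \<sigma>\<close> (\<open>marginal_utility\<close>). Every admissible control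
  satisfies the budget equation: the value of its consumption and terminal wealth at these prices,
  given the type, is \<open>x0\<close> (\<open>budget\<close>). Since the exponential lies above its tangents and touches each of
  them only once, the explicit control is optimal, and every other optimal control has the same
  consumption and the same terminal wealth (\<open>verification\<close>). The budget equation on \<open>[t,T]\<close> then
  determines the wealth at time \<open>t\<close> (\<open>state_determined\<close>), and the Ito isometry the investment
  (\<open>control_determined\<close>).

  An equilibrium is therefore an explicit control whose mean field is consistent. The expectations of
  its consumption and terminal wealth are explicit: the condition on terminal wealth is a scalar
  equation solved by \<open>mean_terminal_wealth\<close> (\<open>terminal_consistency\<close>), and the condition on consumption is
  the functional equation in integrated form (\<open>consumption_consistency\<close>). Existence and uniqueness of its
  solution become existence and uniqueness of the equilibrium.

  The stochastic analysis behind this is elementary, because the type takes finitely many values and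
  is known at time \<open>0\<close>: on each event of constant type \<open>\<mu>\<close>, \<open>\<sigma>\<close> and \<open>Y\<close> have deterministic parameters.
  Three properties of the Ito integral suffice, each proved for step processes and extended by \<open>L\<^sup>2\<close>
  limits: the isometry up to a constant (\<open>ito_isometry\<close>), the drift of the integral under the density
  \<open>Y\<^sub>T\<close> (\<open>ito_duality\<close>), and the value of the integral of \<open>T + 1 - s\<close> (\<open>ito_linear_integrand\<close>). All
  of this is done for a Brownian motion with regular paths, to which the general one is reduced at the
  end (\<open>regular_version\<close>).
\<close>

section \<open>The functional equation for the mean field\<close>

lemma set_integral_eq_HK:
  fixes f :: "real \<Rightarrow> real"
  assumes "continuous_on {a..b} f"
  shows "(LBINT x:{a..b}. f x) = integral {a..b} f"
  by (rule set_borel_integral_eq_integral(2)) (rule borel_integrable_atLeastAtMost'[OF assms])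

lemma tail_integral_eq:
  fixes Z :: "real \<Rightarrow> real"
  assumes Z: "continuous_on {0..T} Z" and s: "s \<in> {0..T}"
  shows "(LBINT v:{s..T}. Z v) = (LBINT v:{0..T}. Z v) - integral {0..s} Z"
proof -
  have "continuous_on {s..T} Z" using Z s by (auto intro: continuous_on_subset)
  moreover have "integral {0..s} Z + integral {s..T} Z = integral {0..T} Z"
    using s Z by (intro Henstock_Kurzweil_Integration.integral_combine integrable_continuous_interval) auto
  ultimately show ?thesis using Z by (simp add: set_integral_eq_HK)
qed

lemma tail_integral_deriv:
  fixes Z :: "real \<Rightarrow> real"
  assumes Z: "continuous_on {0..T} Z" and s: "s \<in> {0..T}"
  shows "((\<lambda>s. LBINT v:{s..T}. Z v) has_real_derivative - Z s) (at s within {0..T})"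
proof -
  have "((\<lambda>s. (LBINT v:{0..T}. Z v) - integral {0..s} Z) has_real_derivative 0 - Z s) (at s within {0..T})"
    by (intro DERIV_diff DERIV_const integral_has_real_derivative[OF Z s])
  then have "((\<lambda>s. (LBINT v:{0..T}. Z v) - integral {0..s} Z) has_real_derivative - Z s) (at s within {0..T})"
    by simp
  then show ?thesis
    by (rule has_field_derivative_transform_within[OF _ zero_less_one s]) (rule tail_integral_eq[OF Z, symmetric])
qed

text \<open>The two terms of \<open>G\<close> that look into the future are, up to sign, the derivative of
  \<open>(1 / (T + 1 - s)) * \<integral>\<^sub>s\<^sup>T Z\<close>. This is why the functional equation only sees \<open>Z\<close> through its
  total integral.\<close>

lemma weighted_tail_integral:
  fixes Z :: "real \<Rightarrow> real"
  assumes Z: "continuous_on {0..T} Z" and t: "t \<in> {0..T}"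
  shows "(LBINT s:{0..t}. 1 / (T + 1 - s)\<^sup>2 * (LBINT v:{s..T}. Z v) - 1 / (T + 1 - s) * Z s)
    = (LBINT v:{t..T}. Z v) / (T + 1 - t) - (LBINT v:{0..T}. Z v) / (T + 1)"
proof -
  let ?A = "\<lambda>s. LBINT v:{s..T}. Z v"
  have contA: "continuous_on {0..T} ?A"
    by (rule DERIV_continuous_on[OF tail_integral_deriv[OF Z]])
  have sub: "{0..t} \<subseteq> {0..T}" using t by auto
  have cont: "continuous_on {0..t} (\<lambda>s. 1 / (T + 1 - s)\<^sup>2 * ?A s - 1 / (T + 1 - s) * Z s)"
    using t by (intro continuous_intros continuous_on_subset[OF contA sub] continuous_on_subset[OF Z sub]) auto
  have "((\<lambda>s. ?A s / (T + 1 - s)) has_real_derivative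
      1 / (T + 1 - s)\<^sup>2 * ?A s - 1 / (T + 1 - s) * Z s) (at s within {0..t})" if s: "s \<in> {0..t}" for s
  proof -
    have s': "s \<in> {0..T}" using s t by auto
    have "((\<lambda>s. ?A s / (T + 1 - s)) has_real_derivative
      ((- Z s) * (T + 1 - s) - ?A s * (0 - 1)) / ((T + 1 - s) * (T + 1 - s))) (at s within {0..T})"
      using s' by (intro DERIV_divide tail_integral_deriv[OF Z s'] derivative_intros) auto
    moreover have "((- Z s) * (T + 1 - s) - ?A s * (0 - 1)) / ((T + 1 - s) * (T + 1 - s))
       = 1 / (T + 1 - s)\<^sup>2 * ?A s - 1 / (T + 1 - s) * Z s"
      using s' by (simp add: power2_eq_square divide_simps)
    ultimately show ?thesis using sub by (auto intro: DERIV_subset)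
  qed
  then have "integral {0..t} (\<lambda>s. 1 / (T + 1 - s)\<^sup>2 * ?A s - 1 / (T + 1 - s) * Z s)
      = ?A t / (T + 1 - t) - ?A 0 / (T + 1 - 0)"
    using t by (intro integral_unique fundamental_theorem_of_calculus)
      (simp_all only: has_real_derivative_iff_has_vector_derivative[symmetric] atLeastAtMost_iff)
  then show ?thesis unfolding set_integral_eq_HK[OF cont] by simp
qed

lemma weighted_tail_integral_total:
  fixes Z :: "real \<Rightarrow> real"
  assumes T: "T > 0" and Z: "continuous_on {0..T} Z"
  shows "(LBINT s:{0..T}. 1 / (T + 1 - s)\<^sup>2 * (LBINT v:{s..T}. Z v) - 1 / (T + 1 - s) * Z s)
      = - (LBINT v:{0..T}. Z v) / (T + 1)"
proof -
  have "(LBINT v:{T..T}. Z v) = 0" using tail_integral_eq[OF Z, of T] T set_integral_eq_HK[OF Z] by simp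
  moreover have "T \<in> {0..T}" using T by simp
  ultimately show ?thesis unfolding weighted_tail_integral[OF Z \<open>T \<in> {0..T}\<close>] by simp
qed

text \<open>The same identity at \<open>t = T\<close> leaves \<open>- (\<integral>\<^sub>0\<^sup>T Z) / (T + 1)\<close>, which cancels the factor \<open>T + 1\<close> of
  the last summand.\<close>

lemma mean_terminal_wealth_eq:
  fixes Z :: "real \<Rightarrow> real"
  assumes T: "T > 0" and Z: "continuous_on {0..T} Z" and D: "(1 - tb) * T + 1 > 0"
  shows "mean_terminal_wealth T x0 tb \<kappa> Z
    = (x0 - tb * (LBINT v:{0..T}. Z v) + \<kappa> / 4 * (3 * T\<^sup>2 + 4 * T)) / ((1 - tb) * T + 1)"
proof -
  have w: "(LBINT s:{0..T}. 1 / (T + 1 - s)\<^sup>2 * (LBINT v:{s..T}. Z v) - 1 / (T + 1 - s) * Z s)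
      = - (LBINT v:{0..T}. Z v) / (T + 1)"
    by (rule weighted_tail_integral_total[OF T Z])
  have alg: "x / D + k / 4 * (w / D) + b * S / D * (- A0 / S) = (x - b * A0 + k / 4 * w) / D"
    if "D \<noteq> 0" "S \<noteq> 0" for x S b D A0 k w :: real
    using that by (simp add: field_simps)
  show ?thesis unfolding mean_terminal_wealth_def w using T D by (intro alg) auto
qed

lemma G_eq:
  fixes Z :: "real \<Rightarrow> real"
  assumes T: "T > 0" and Z: "continuous_on {0..T} Z" and D: "(1 - tb) * T + 1 > 0" and t: "t \<in> {0..T}"
  shows "G T x0 tb \<kappa> t Z = x0 / (T + 1)
     - tb * (mean_terminal_wealth T x0 tb \<kappa> Z + (LBINT v:{0..T}. Z v)) / (T + 1)
     + \<kappa> / 4 * (T + 1 + 2 * t - 1 / (T + 1))"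
proof -
  let ?A = "\<lambda>s. LBINT v:{s..T}. Z v"
  let ?w = "\<lambda>s. 1 / (T + 1 - s)\<^sup>2 * ?A s - 1 / (T + 1 - s) * Z s"
  have sub: "{0..t} \<subseteq> {0..T}" using t by auto
  have contA: "continuous_on {0..T} ?A"
    by (rule DERIV_continuous_on[OF tail_integral_deriv[OF Z]])
  have i1: "set_integrable lborel {0..t} (\<lambda>s. tb / (T + 1 - s)\<^sup>2 * ?A s)"
    using t by (intro borel_integrable_atLeastAtMost' continuous_intros continuous_on_subset[OF contA sub]) auto
  have i2: "set_integrable lborel {0..t} (\<lambda>s. tb / (T + 1 - s) * Z s)"
    using t by (intro borel_integrable_atLeastAtMost' continuous_intros continuous_on_subset[OF Z sub]) auto
  have "(LBINT s:{0..t}. tb / (T + 1 - s)\<^sup>2 * ?A s) - (LBINT s:{0..t}. tb / (T + 1 - s) * Z s)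
      = (LBINT s:{0..t}. tb * ?w s)"
    using set_integral_diff(2)[OF i1 i2] by (simp add: algebra_simps)
  also have "\<dots> = tb * (?A t / (T + 1 - t) - ?A 0 / (T + 1))"
    by (simp only: set_integral_mult_right weighted_tail_integral[OF Z t])
  finally have e: "(LBINT s:{0..t}. tb / (T + 1 - s)\<^sup>2 * ?A s) - (LBINT s:{0..t}. tb / (T + 1 - s) * Z s)
      = tb * (?A t / (T + 1 - t) - ?A 0 / (T + 1))" .
  have w: "(LBINT s:{0..T}. ?w s) = - ?A 0 / (T + 1)"
    by (rule weighted_tail_integral_total[OF T Z])
  have g: "G T x0 tb \<kappa> t Z = x0 / (T + 1) * (1 - tb / ((1 - tb) * T + 1))
     + tb * (?A t / (T + 1 - t) - ?A 0 / (T + 1))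
     - tb\<^sup>2 / ((1 - tb) * T + 1) * (- ?A 0 / (T + 1))
     - tb / (T + 1 - t) * ?A t
     + \<kappa> / 4 * (T + 1 + 2 * t - 1 / (T + 1))
     - 1 / 4 * (tb / (T + 1)) * \<kappa> * ((3 * T\<^sup>2 + 4 * T) / ((1 - tb) * T + 1))"
    unfolding G_def w e[symmetric] by (simp only: add_diff_eq)
  have alg: "x / S * (1 - b / D) + b * (At / r - A0 / S) - b\<^sup>2 / D * (- A0 / S) - b / r * At + k
       - 1 / 4 * (b / S) * q * (w / D)
     = x / S - b * ((x - b * A0 + q / 4 * w) / D + A0) / S + k"
    if "D \<noteq> 0" "S \<noteq> 0" "r \<noteq> 0" for x S b D At A0 r k q w :: real
    using that by (simp add: field_simps power2_eq_square)
  show ?thesis unfolding g mean_terminal_wealth_eq[OF T Z D]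
    using T t D by (intro alg) auto
qed

text \<open>Variation of constants: the equation says that \<open>exp (l * t) * Z t - \<integral>\<^sub>0\<^sup>t exp (l * s) * q s ds\<close>
  is constant.\<close>

lemma linear_ode_iff:
  fixes q :: "real \<Rightarrow> real"
  assumes q: "continuous_on {0..T} q" and T: "0 \<le> T"
  shows "((\<forall>t\<in>{0..T}. (Z has_real_derivative (- l * Z t + q t)) (at t within {0..T})) \<and> Z 0 = z0)
    \<longleftrightarrow> (\<forall>t\<in>{0..T}. Z t = exp (- l * t) * (z0 + integral {0..t} (\<lambda>s. exp (l * s) * q s)))"
    (is "?L \<longleftrightarrow> ?R")
proof -
  have ceq: "continuous_on {0..T} (\<lambda>s. exp (l * s) * q s)"
    by (intro continuous_intros q)
  show ?thesis
  proof
    assume L: ?L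
    show ?R
    proof
      fix t assume t: "t \<in> {0..T}"
      have "((\<lambda>s. exp (l * s) * Z s) has_real_derivative exp (l * s) * q s) (at s within {0..t})"
        if "s \<in> {0..t}" for s
      proof -
        have "(Z has_real_derivative (- l * Z s + q s)) (at s within {0..t})"
        proof (rule DERIV_subset)
          show "(Z has_real_derivative (- l * Z s + q s)) (at s within {0..T})"
            by (rule bspec[OF conjunct1[OF L]]) (use that t in auto)
        qed (use t in auto)
        moreover have "((\<lambda>s. exp (l * s)) has_real_derivative l * exp (l * s)) (at s within {0..t})"
          by (auto intro!: derivative_eq_intros)
        ultimately have "((\<lambda>s. exp (l * s) * Z s) has_real_derivative
            l * exp (l * s) * Z s + (- l * Z s + q s) * exp (l * s)) (at s within {0..t})"
          by (intro DERIV_mult)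
        then show ?thesis by (simp add: algebra_simps)
      qed
      then have "((\<lambda>s. exp (l * s) * q s) has_integral exp (l * t) * Z t - exp (l * 0) * Z 0) {0..t}"
        using t by (intro fundamental_theorem_of_calculus)
          (simp_all only: has_real_derivative_iff_has_vector_derivative[symmetric] atLeastAtMost_iff)
      then have "integral {0..t} (\<lambda>s. exp (l * s) * q s) = exp (l * t) * Z t - z0"
        using conjunct2[OF L] by (simp add: integral_unique)
      then show "Z t = exp (- l * t) * (z0 + integral {0..t} (\<lambda>s. exp (l * s) * q s))"
        by (simp add: exp_minus)
    qed
  next
    assume R: ?R
    have "(Z has_real_derivative (- l * Z t + q t)) (at t within {0..T})" if t: "t \<in> {0..T}" for t
    proof -
      let ?I = "\<lambda>t. integral {0..t} (\<lambda>s. exp (l * s) * q s)"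
      have "((\<lambda>t. exp (- l * t) * (z0 + ?I t)) has_real_derivative
        (- l * exp (- l * t)) * (z0 + ?I t) + (0 + exp (l * t) * q t) * exp (- l * t)) (at t within {0..T})"
      proof (intro DERIV_mult DERIV_add DERIV_const integral_has_real_derivative[OF ceq t])
        show "((\<lambda>t. exp (- l * t)) has_real_derivative - l * exp (- l * t)) (at t within {0..T})"
          by (auto intro!: derivative_eq_intros)
      qed
      moreover have "(- l * exp (- l * t)) * (z0 + ?I t) + (0 + exp (l * t) * q t) * exp (- l * t) = - l * Z t + q t"
        using R t by (simp add: exp_minus)
      ultimately have "((\<lambda>t. exp (- l * t) * (z0 + ?I t)) has_real_derivative - l * Z t + q t) (at t within {0..T})"
        by simp
      then show ?thesis
        by (rule has_field_derivative_transform_within[OF _ zero_less_one t]) (use R in auto)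
    qed
    then show ?L using R T by auto
  qed
qed

text \<open>After the simplification of \<open>G\<close> the equation is an ordinary linear one whose source depends
  affinely, with a non-positive slope \<open>- c\<close>, on the number \<open>\<integral>\<^sub>0\<^sup>T Z\<close>. Integrating the solution
  formula turns it into \<open>a = \<alpha> - c * \<gamma> * a\<close> for this number, and \<open>1 + c * \<gamma> > 0\<close>.\<close>

lemma nonlocal_ode_ex1:
  fixes h :: "real \<Rightarrow> real"
  assumes T: "0 < T" and h: "continuous_on {0..T} h" and c: "0 \<le> c"
  shows "\<exists>!Z. Z \<in> CT T \<and> (\<forall>t\<in>{0..T}. (Z has_real_derivative
      (- l * Z t + (h t - c * (LBINT v:{0..T}. Z v)))) (at t within {0..T})) \<and> Z 0 = z0"
proof -
  define \<psi> where "\<psi> t = exp (- l * t) * integral {0..t} (\<lambda>s. exp (l * s))" for t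
  define b where "b t = exp (- l * t) * (z0 + integral {0..t} (\<lambda>s. exp (l * s) * h s))" for t
  have ce: "continuous_on {0..T} (\<lambda>s. exp (l * s))" by (intro continuous_intros)
  have ch: "continuous_on {0..T} (\<lambda>s. exp (l * s) * h s)" by (intro continuous_intros h)
  have c\<psi>: "continuous_on {0..T} \<psi>" unfolding \<psi>_def
    by (intro continuous_intros DERIV_continuous_on[OF integral_has_real_derivative[OF ce]])
  have cb: "continuous_on {0..T} b" unfolding b_def
    by (intro continuous_intros DERIV_continuous_on[OF integral_has_real_derivative[OF ch]])
  define \<alpha> \<gamma> where "\<alpha> = integral {0..T} b" and "\<gamma> = integral {0..T} \<psi>"
  have "\<gamma> \<ge> 0" unfolding \<gamma>_def
  proof (rule integral_nonneg)
    show "0 \<le> \<psi> x" if "x \<in> {0..T}" for x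
    proof -
      have "continuous_on {0..x} (\<lambda>s. exp (l * s))" by (intro continuous_intros)
      then have "0 \<le> integral {0..x} (\<lambda>s. exp (l * s))"
        by (intro integral_nonneg integrable_continuous_interval) auto
      then show ?thesis unfolding \<psi>_def by simp
    qed
  qed (intro integrable_continuous_interval c\<psi>)
  then have pos: "1 + c * \<gamma> > 0" using c by (simp add: add_pos_nonneg)
  have sol: "((\<forall>t\<in>{0..T}. (Z has_real_derivative (- l * Z t + (h t - c * a))) (at t within {0..T})) \<and> Z 0 = z0)
     \<longleftrightarrow> (\<forall>t\<in>{0..T}. Z t = b t - c * a * \<psi> t)" for Z a
  proof -
    have i: "integral {0..t} (\<lambda>s. exp (l * s) * (h s - c * a)) =
        integral {0..t} (\<lambda>s. exp (l * s) * h s) - c * a * integral {0..t} (\<lambda>s. exp (l * s))"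
      if t: "t \<in> {0..T}" for t
    proof -
      have "(\<lambda>s. exp (l * s)) integrable_on {0..t}" "(\<lambda>s. exp (l * s) * h s) integrable_on {0..t}"
        using t by (auto intro!: integrable_continuous_interval continuous_on_subset[OF ch] continuous_intros)
      then show ?thesis
        by (simp add: right_diff_distrib integral_diff integrable_on_mult_right mult.commute)
    qed
    have "exp (- l * t) * (z0 + integral {0..t} (\<lambda>s. exp (l * s) * (h s - c * a))) = b t - c * a * \<psi> t"
      if "t \<in> {0..T}" for t
      unfolding i[OF that] b_def \<psi>_def by (simp add: algebra_simps)
    moreover have "continuous_on {0..T} (\<lambda>s. h s - c * a)" by (intro continuous_intros h)
    ultimately show ?thesis using linear_ode_iff[of T "\<lambda>s. h s - c * a" Z l z0] T by simp
  qed
  have int: "(LBINT v:{0..T}. Z v) = \<alpha> - c * a * \<gamma>" if "\<forall>t\<in>{0..T}. Z t = b t - c * a * \<psi> t" for Z a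
  proof -
    have "continuous_on {0..T} Z \<longleftrightarrow> continuous_on {0..T} (\<lambda>t. b t - c * a * \<psi> t)"
      using that by (intro continuous_on_cong) auto
    then have "continuous_on {0..T} Z" by (auto intro!: continuous_intros cb c\<psi>)
    then have "(LBINT v:{0..T}. Z v) = integral {0..T} Z" by (rule set_integral_eq_HK)
    also have "\<dots> = integral {0..T} (\<lambda>t. b t - c * a * \<psi> t)"
      using that by (intro integral_cong) auto
    also have "\<dots> = \<alpha> - c * a * \<gamma>" unfolding \<alpha>_def \<gamma>_def
      using cb c\<psi> by (simp add: integral_diff integrable_on_mult_right integrable_continuous_interval)
    finally show ?thesis .
  qed
  \<comment> \<open>The only possible total integral of a solution.\<close>
  define a where "a = \<alpha> / (1 + c * \<gamma>)"
  have a: "\<alpha> - c * a * \<gamma> = a" using pos by (simp add: a_def field_simps)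
  show ?thesis
  proof (rule ex1I)
    define Z where "Z = restrict (\<lambda>t. b t - c * a * \<psi> t) {0..T}"
    have Z: "\<forall>t\<in>{0..T}. Z t = b t - c * a * \<psi> t" by (simp add: Z_def)
    have "continuous_on {0..T} Z \<longleftrightarrow> continuous_on {0..T} (\<lambda>t. b t - c * a * \<psi> t)"
      using Z by (intro continuous_on_cong) auto
    then have "Z \<in> CT T" unfolding CT_def by (auto simp: Z_def intro!: continuous_intros cb c\<psi>)
    then show "Z \<in> CT T \<and> (\<forall>t\<in>{0..T}. (Z has_real_derivative
      (- l * Z t + (h t - c * (LBINT v:{0..T}. Z v)))) (at t within {0..T})) \<and> Z 0 = z0"
      using Z sol[of Z a] int[OF Z] a by simp
  next
    fix Y assume Y: "Y \<in> CT T \<and> (\<forall>t\<in>{0..T}. (Y has_real_derivative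
      (- l * Y t + (h t - c * (LBINT v:{0..T}. Y v)))) (at t within {0..T})) \<and> Y 0 = z0"
    then have Y': "\<forall>t\<in>{0..T}. Y t = b t - c * (LBINT v:{0..T}. Y v) * \<psi> t" using sol by blast
    from int[OF this] have "(LBINT v:{0..T}. Y v) = a"
      using pos by (simp add: a_def field_simps)
    with Y' Y show "Y = restrict (\<lambda>t. b t - c * a * \<psi> t) {0..T}"
      unfolding CT_def by (auto intro!: extensionalityI[of _ "{0..T}"])
  qed
qed

text \<open>The slope of \<open>\<delta> * G\<close> in \<open>\<integral>\<^sub>0\<^sup>T Z\<close> is \<open>- \<delta> * tb * (1 - tb) / ((1 - tb) * T + 1)\<close>, which has the sign that
  the preceding lemma asks for because \<open>tb\<close> lies in \<open>[0,1]\<close>.\<close>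

lemma functional_ode_ex1:
  assumes T: "0 < T" and d: "0 < \<delta>" and tb: "0 \<le> tb" "tb \<le> 1"
  shows "\<exists>!Z. Z \<in> CT T \<and> solves_functional_ode T x0 z0 \<delta> tb \<kappa> Z"
proof -
  define D where "D = (1 - tb) * T + 1"
  have D: "D > 0" using T tb by (auto simp: D_def intro: add_nonneg_pos)
  define c where "c = \<delta> * (tb * (1 - tb) / D)"
  define h where "h t = \<delta> * (x0 / (T + 1) - tb * ((x0 + \<kappa> / 4 * (3 * T\<^sup>2 + 4 * T)) / D) / (T + 1)
     + \<kappa> / 4 * (T + 1 + 2 * t - 1 / (T + 1)))" for t
  have c: "0 \<le> c" using d tb D by (simp add: c_def)
  have h: "continuous_on {0..T} h" unfolding h_def by (intro continuous_intros)
  have "\<delta> * G T x0 tb \<kappa> t Z = h t - c * (LBINT v:{0..T}. Z v)" if "Z \<in> CT T" "t \<in> {0..T}" for Z t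
  proof -
    have alg: "(x - b * A + k) / E + A = (x + k) / E + A * ((1 - b) * S) / E"
      if "E \<noteq> 0" "E = (1 - b) * (S - 1) + 1" for x b A k E S :: real
    proof -
      have "(1 - b) * S = E - b" using that(2) by (simp add: algebra_simps)
      then show ?thesis using that(1) by (simp only:) (simp add: field_simps)
    qed
    have alg2: "d * (p - b * (m + A * (e * S) / E) / S + q) = d * (p - b * m / S + q) - d * (b * e / E) * A"
      if "E \<noteq> 0" "S \<noteq> 0" for d p b m A e E S q :: real
      using that by (simp add: field_simps)
    have "continuous_on {0..T} Z" using that by (simp add: CT_def)
    from G_eq[OF T this D[unfolded D_def] that(2)] mean_terminal_wealth_eq[OF T this D[unfolded D_def]]
    have "G T x0 tb \<kappa> t Z = x0 / (T + 1)
     - tb * ((x0 - tb * (LBINT v:{0..T}. Z v) + \<kappa> / 4 * (3 * T\<^sup>2 + 4 * T)) / D + (LBINT v:{0..T}. Z v)) / (T + 1)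
     + \<kappa> / 4 * (T + 1 + 2 * t - 1 / (T + 1))" by (simp add: D_def)
    also have "(x0 - tb * (LBINT v:{0..T}. Z v) + \<kappa> / 4 * (3 * T\<^sup>2 + 4 * T)) / D + (LBINT v:{0..T}. Z v)
      = (x0 + \<kappa> / 4 * (3 * T\<^sup>2 + 4 * T)) / D + (LBINT v:{0..T}. Z v) * ((1 - tb) * (T + 1)) / D"
      using D by (intro alg) (auto simp: D_def)
    finally show ?thesis unfolding h_def c_def
      using T D by (simp only:) (intro alg2, auto)
  qed
  then have e: "(- \<delta> + \<delta> * tb) * Z t + \<delta> * G T x0 tb \<kappa> t Z
      = - (\<delta> * (1 - tb)) * Z t + (h t - c * (LBINT v:{0..T}. Z v))" if "Z \<in> CT T" "t \<in> {0..T}" for Z t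
    using that by (simp add: algebra_simps)
  have "Z \<in> CT T \<and> solves_functional_ode T x0 z0 \<delta> tb \<kappa> Z \<longleftrightarrow>
      Z \<in> CT T \<and> (\<forall>t\<in>{0..T}. (Z has_real_derivative
      (- (\<delta> * (1 - tb)) * Z t + (h t - c * (LBINT v:{0..T}. Z v)))) (at t within {0..T})) \<and> Z 0 = z0" for Z
    unfolding solves_functional_ode_def by (intro conj_cong ball_cong refl) (simp only: e)
  then show ?thesis using nonlocal_ode_ex1[OF T h c, of "\<delta> * (1 - tb)" z0] by presburger
qed

section \<open>Time intervals as measure spaces\<close>

text \<open>Set integrals over \<open>[0,T]\<close> are rewritten as integrals over this finite measure space, where the
  theorems on product measures apply.\<close>

abbreviation leb :: "real \<Rightarrow> real measure" where
  "leb T \<equiv> restrict_space lborel {0..T}"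

lemma space_leb [simp]: "space (leb T) = {0..T}"
  by (simp add: space_restrict_space)

lemma sets_leb: "sets (leb T) = sets (restrict_space borel {0..T})"
  by (simp add: sets_restrict_space)

lemma finite_measure_leb: "finite_measure (leb T)"
  by (rule finite_measureI) (simp add: emeasure_restrict_space emeasure_lborel_Icc_eq)

lemma sigma_finite_leb: "sigma_finite_measure (leb T)"
  using finite_measure_leb by (rule finite_measure.axioms(1))

lemma nn_integral_leb: "(\<integral>\<^sup>+s. f s \<partial>leb T) = (\<integral>\<^sup>+s\<in>{0..T}. f s \<partial>lborel)"
  by (simp add: nn_integral_restrict_space)

lemma set_integrable_iff_leb:
  fixes f :: "real \<Rightarrow> real"
  shows "set_integrable lborel {0..T} f \<longleftrightarrow> integrable (leb T) f"
  unfolding set_integrable_def by (subst integrable_restrict_space) auto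

lemma set_integral_leb:
  fixes f :: "real \<Rightarrow> real"
  shows "(LBINT s:{0..T}. f s) = (\<integral>s. f s \<partial>leb T)"
  unfolding set_lebesgue_integral_def by (subst integral_restrict_space) auto

lemma set_integral_sub_leb:
  fixes f :: "real \<Rightarrow> real"
  assumes "t \<le> T" "0 \<le> u"
  shows "(LBINT s:{u..t}. f s) = (\<integral>s. indicator {u..t} s * f s \<partial>leb T)"
proof -
  have "(LBINT s:{u..t}. f s) = (LBINT s:{0..T}. indicator {u..t} s * f s)"
    unfolding set_lebesgue_integral_def using assms
    by (intro Bochner_Integration.integral_cong) (auto simp: indicator_def)
  then show ?thesis by (simp add: set_integral_leb)
qed

lemma AE_pair_snd:
  assumes "sigma_finite_measure M" and "AE w in M. Q w"
  shows "AE (s, w) in N \<Otimes>\<^sub>M M. Q w"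
proof -
  interpret sigma_finite_measure M by fact
  obtain A where A: "{w \<in> space M. \<not> Q w} \<subseteq> A" "emeasure M A = 0" "A \<in> sets M"
    using AE_E[OF assms(2)] by blast
  have "emeasure (N \<Otimes>\<^sub>M M) (space N \<times> A) = emeasure N (space N) * emeasure M A"
    using A by (intro emeasure_pair_measure_Times) auto
  then have "space N \<times> A \<in> null_sets (N \<Otimes>\<^sub>M M)" using A by (auto simp: null_sets_def)
  then show ?thesis by (rule AE_I') (use A in \<open>auto simp: space_pair_measure\<close>)
qed

text \<open>This approximation runs through countably many values whatever \<open>s\<close> is. It serves to discretise
  processes in time, and to pass from countably many times to all of them.\<close>

lemma floor_approximation:
  fixes s :: real
  shows "(\<lambda>n. real_of_int \<lfloor>s * real (Suc n)\<rfloor> / real (Suc n)) \<longlonglongrightarrow> s"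
proof (rule tendsto_sandwich)
  show "\<forall>\<^sub>F n in sequentially. s - 1 / real (Suc n) \<le> real_of_int \<lfloor>s * real (Suc n)\<rfloor> / real (Suc n)"
  proof (intro always_eventually allI)
    fix n
    have "s * real (Suc n) - 1 \<le> real_of_int \<lfloor>s * real (Suc n)\<rfloor>" by linarith
    then have "(s * real (Suc n) - 1) / real (Suc n) \<le> real_of_int \<lfloor>s * real (Suc n)\<rfloor> / real (Suc n)"
      by (intro divide_right_mono) auto
    then show "s - 1 / real (Suc n) \<le> real_of_int \<lfloor>s * real (Suc n)\<rfloor> / real (Suc n)"
      by (simp add: diff_divide_distrib)
  qed
  show "\<forall>\<^sub>F n in sequentially. real_of_int \<lfloor>s * real (Suc n)\<rfloor> / real (Suc n) \<le> s"
  proof (intro always_eventually allI)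
    fix n
    have "real_of_int \<lfloor>s * real (Suc n)\<rfloor> \<le> s * real (Suc n)" by simp
    then show "real_of_int \<lfloor>s * real (Suc n)\<rfloor> / real (Suc n) \<le> s" by (simp add: divide_le_eq)
  qed
  have "(\<lambda>n. s - 1 / real (Suc n)) \<longlonglongrightarrow> s - 0"
    using LIMSEQ_inverse_real_of_nat by (intro tendsto_diff tendsto_const) (simp add: inverse_eq_divide)
  then show "(\<lambda>n. s - 1 / real (Suc n)) \<longlonglongrightarrow> s" by simp
qed simp

section \<open>Squares\<close>

lemma square_add3_le: "ennreal ((x + y + z)\<^sup>2) \<le> 3 * ennreal (x\<^sup>2) + 3 * ennreal (y\<^sup>2) + 3 * ennreal (z\<^sup>2)"
proof -
  have "(x + y + z)\<^sup>2 \<le> 3 * x\<^sup>2 + 3 * y\<^sup>2 + 3 * z\<^sup>2"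
    using zero_le_power2[of "x - y"] zero_le_power2[of "y - z"] zero_le_power2[of "x - z"]
    by (simp add: power2_eq_square algebra_simps)
  then have "ennreal ((x + y + z)\<^sup>2) \<le> ennreal (3 * x\<^sup>2 + 3 * y\<^sup>2 + 3 * z\<^sup>2)" by (rule ennreal_leI)
  then show ?thesis by (simp add: ennreal_plus ennreal_mult)
qed

lemma nn_integral_square_add3_le:
  assumes [measurable]: "f \<in> borel_measurable N" "g \<in> borel_measurable N" "h \<in> borel_measurable N"
  shows "(\<integral>\<^sup>+x. ennreal ((f x + g x + h x)\<^sup>2) \<partial>N) \<le>
    3 * (\<integral>\<^sup>+x. ennreal ((f x)\<^sup>2) \<partial>N) + 3 * (\<integral>\<^sup>+x. ennreal ((g x)\<^sup>2) \<partial>N) + 3 * (\<integral>\<^sup>+x. ennreal ((h x)\<^sup>2) \<partial>N)"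
proof -
  have "(\<integral>\<^sup>+x. ennreal ((f x + g x + h x)\<^sup>2) \<partial>N)
      \<le> (\<integral>\<^sup>+x. 3 * ennreal ((f x)\<^sup>2) + 3 * ennreal ((g x)\<^sup>2) + 3 * ennreal ((h x)\<^sup>2) \<partial>N)"
    by (intro nn_integral_mono square_add3_le)
  also have "\<dots> = 3 * (\<integral>\<^sup>+x. ennreal ((f x)\<^sup>2) \<partial>N) + 3 * (\<integral>\<^sup>+x. ennreal ((g x)\<^sup>2) \<partial>N) + 3 * (\<integral>\<^sup>+x. ennreal ((h x)\<^sup>2) \<partial>N)"
    by (simp add: nn_integral_add nn_integral_cmult)
  finally show ?thesis .
qed

lemma integrable_square_iff:
  fixes f :: "'b \<Rightarrow> real"
  assumes "f \<in> borel_measurable N"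
  shows "integrable N (\<lambda>x. (f x)\<^sup>2) \<longleftrightarrow> (\<integral>\<^sup>+x. ennreal ((f x)\<^sup>2) \<partial>N) < \<infinity>"
  using assms by (auto simp: integrable_iff_bounded)

lemma integrable_mult_square:
  fixes f g :: "'b \<Rightarrow> real"
  assumes [measurable]: "f \<in> borel_measurable N" "g \<in> borel_measurable N"
    and "integrable N (\<lambda>x. (f x)\<^sup>2)" "integrable N (\<lambda>x. (g x)\<^sup>2)"
  shows "integrable N (\<lambda>x. f x * g x)"
proof (rule Bochner_Integration.integrable_bound)
  show "integrable N (\<lambda>x. (f x)\<^sup>2 + (g x)\<^sup>2)" using assms by auto
  show "AE x in N. norm (f x * g x) \<le> norm ((f x)\<^sup>2 + (g x)\<^sup>2)"
  proof (rule AE_I2)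
    fix x
    have "2 * (\<bar>f x\<bar> * \<bar>g x\<bar>) \<le> (f x)\<^sup>2 + (g x)\<^sup>2"
      using zero_le_power2[of "\<bar>f x\<bar> - \<bar>g x\<bar>"] by (simp add: power2_eq_square algebra_simps)
    moreover have "0 \<le> \<bar>f x\<bar> * \<bar>g x\<bar>" by (intro mult_nonneg_nonneg) auto
    ultimately have "\<bar>f x\<bar> * \<bar>g x\<bar> \<le> (f x)\<^sup>2 + (g x)\<^sup>2" by linarith
    then show "norm (f x * g x) \<le> norm ((f x)\<^sup>2 + (g x)\<^sup>2)" by (simp add: abs_mult)
  qed
qed simp

lemma (in finite_measure) integrable_of_square:
  fixes f :: "'a \<Rightarrow> real"
  assumes "f \<in> borel_measurable M" "integrable M (\<lambda>x. (f x)\<^sup>2)"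
  shows "integrable M f"
  using integrable_mult_square[of f M "\<lambda>_. 1"] assms by simp

lemma square_integral_mult_le:
  fixes f g :: "'b \<Rightarrow> real"
  assumes [measurable]: "f \<in> borel_measurable N" "g \<in> borel_measurable N"
  shows "ennreal ((\<integral>x. f x * g x \<partial>N)\<^sup>2) \<le> (\<integral>\<^sup>+x. ennreal ((f x)\<^sup>2) \<partial>N) * (\<integral>\<^sup>+x. ennreal ((g x)\<^sup>2) \<partial>N)"
proof (cases "integrable N (\<lambda>x. f x * g x)")
  case True
  have "ennreal \<bar>\<integral>x. f x * g x \<partial>N\<bar> \<le> (\<integral>\<^sup>+x. ennreal \<bar>f x\<bar> * ennreal \<bar>g x\<bar> \<partial>N)"
    using integral_norm_bound_ennreal[OF True] by (simp add: abs_mult ennreal_mult)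
  then have "(ennreal \<bar>\<integral>x. f x * g x \<partial>N\<bar>)\<^sup>2 \<le> (\<integral>\<^sup>+x. ennreal \<bar>f x\<bar> * ennreal \<bar>g x\<bar> \<partial>N)\<^sup>2"
    by (intro power_mono) auto
  also have "\<dots> \<le> (\<integral>\<^sup>+x. (ennreal \<bar>f x\<bar>)\<^sup>2 \<partial>N) * (\<integral>\<^sup>+x. (ennreal \<bar>g x\<bar>)\<^sup>2 \<partial>N)"
    by (rule Cauchy_Schwarz_nn_integral) measurable
  finally show ?thesis by (simp add: ennreal_power)
qed (simp add: not_integrable_integral_eq)

lemma square_set_integral_le:
  fixes f :: "real \<Rightarrow> real"
  assumes f: "f \<in> borel_measurable (leb T)" and u: "0 \<le> u" "u \<le> t" "t \<le> T"
  shows "ennreal ((LBINT s:{u..t}. f s)\<^sup>2) \<le> ennreal (t - u) * (\<integral>\<^sup>+s\<in>{u..t}. ennreal ((f s)\<^sup>2) \<partial>lborel)"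
proof -
  have [measurable]: "{u..t} \<in> sets (leb T)" using u by (auto simp: sets_restrict_space)
  have "(LBINT s:{u..t}. f s) = (\<integral>s. indicator {u..t} s * (indicator {u..t} s * f s) \<partial>leb T)"
    using u by (subst set_integral_sub_leb) (auto intro!: Bochner_Integration.integral_cong simp: indicator_def)
  also have "ennreal (\<dots>\<^sup>2) \<le> (\<integral>\<^sup>+s. ennreal ((indicator {u..t} s)\<^sup>2) \<partial>leb T) * (\<integral>\<^sup>+s. ennreal ((indicator {u..t} s * f s)\<^sup>2) \<partial>leb T)"
    using f by (intro square_integral_mult_le) auto
  also have "(\<integral>\<^sup>+s. ennreal ((indicator {u..t} s)\<^sup>2) \<partial>leb T) = ennreal (t - u)"
  proof -
    have "(\<integral>\<^sup>+s. ennreal ((indicator {u..t} s)\<^sup>2) \<partial>leb T) = (\<integral>\<^sup>+s. indicator {u..t} s \<partial>lborel)"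
      unfolding nn_integral_leb using u by (intro nn_integral_cong) (auto simp: indicator_def)
    then show ?thesis using u by simp
  qed
  also have "(\<integral>\<^sup>+s. ennreal ((indicator {u..t} s * f s)\<^sup>2) \<partial>leb T) = (\<integral>\<^sup>+s\<in>{u..t}. ennreal ((f s)\<^sup>2) \<partial>lborel)"
    unfolding nn_integral_leb using u by (intro nn_integral_cong) (auto simp: indicator_def)
  finally show ?thesis .
qed

text \<open>Integration against a fixed square-integrable function is continuous in \<open>L\<^sup>2\<close>; this carries
  identities over from step processes to their \<open>L\<^sup>2\<close> limits.\<close>

lemma L2_pairing_tendsto_0:
  fixes g :: "'b \<Rightarrow> real"
  assumes g: "g \<in> borel_measurable N" "integrable N (\<lambda>x. (g x)\<^sup>2)"
    and d: "\<And>m. d m \<in> borel_measurable N" "(\<lambda>m. \<integral>\<^sup>+x. ennreal ((d m x)\<^sup>2) \<partial>N) \<longlonglongrightarrow> 0"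
  shows "(\<lambda>m. \<integral>x. g x * d m x \<partial>N) \<longlonglongrightarrow> 0"
proof -
  have fin: "(\<integral>\<^sup>+x. ennreal ((g x)\<^sup>2) \<partial>N) < \<infinity>" using integrable_square_iff[OF g(1)] g(2) by simp
  have "(\<lambda>m. (\<integral>\<^sup>+x. ennreal ((g x)\<^sup>2) \<partial>N) * (\<integral>\<^sup>+x. ennreal ((d m x)\<^sup>2) \<partial>N))
      \<longlonglongrightarrow> (\<integral>\<^sup>+x. ennreal ((g x)\<^sup>2) \<partial>N) * 0"
    using fin by (intro ennreal_tendsto_cmult d(2)) auto
  then have lim: "(\<lambda>m. (\<integral>\<^sup>+x. ennreal ((g x)\<^sup>2) \<partial>N) * (\<integral>\<^sup>+x. ennreal ((d m x)\<^sup>2) \<partial>N)) \<longlonglongrightarrow> 0"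
    by simp
  have "(\<lambda>m. ennreal ((\<integral>x. g x * d m x \<partial>N)\<^sup>2)) \<longlonglongrightarrow> 0"
  proof (rule tendsto_sandwich[OF _ _ tendsto_const lim])
    show "\<forall>\<^sub>F m in sequentially. ennreal ((\<integral>x. g x * d m x \<partial>N)\<^sup>2)
        \<le> (\<integral>\<^sup>+x. ennreal ((g x)\<^sup>2) \<partial>N) * (\<integral>\<^sup>+x. ennreal ((d m x)\<^sup>2) \<partial>N)"
      by (intro always_eventually allI square_integral_mult_le g d)
  qed simp_all
  then have "(\<lambda>m. ennreal ((\<integral>x. g x * d m x \<partial>N)\<^sup>2)) \<longlonglongrightarrow> ennreal 0" by simp
  then have "(\<lambda>m. (\<integral>x. g x * d m x \<partial>N)\<^sup>2) \<longlonglongrightarrow> 0"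
    by (subst (asm) tendsto_ennreal_iff) auto
  then have "(\<lambda>m. sqrt ((\<integral>x. g x * d m x \<partial>N)\<^sup>2)) \<longlonglongrightarrow> sqrt 0" by (intro tendsto_real_sqrt)
  then show ?thesis by (simp add: tendsto_rabs_zero_iff)
qed

section \<open>Exponentially tilted Gaussian moments\<close>

text \<open>Completing the square: weighting a centred Gaussian exponentially shifts its mean. This is the
  one-step form of the change of measure below.\<close>

lemma normal_density_tilt:
  assumes "v > 0"
  shows "normal_density 0 (sqrt v) x * exp (- l * x) = exp (l\<^sup>2 * v / 2) * normal_density (- l * v) (sqrt v) x"
proof -
  have "- (x - 0)\<^sup>2 / (2 * (sqrt v)\<^sup>2) + (- l * x) = l\<^sup>2 * v / 2 + (- (x - (- l * v))\<^sup>2 / (2 * (sqrt v)\<^sup>2))"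
    using assms by (simp add: field_simps power2_eq_square)
  then show ?thesis unfolding normal_density_def by (simp add: mult.assoc mult.left_commute flip: exp_add)
qed

lemma normal_tilted_moments:
  assumes v: "v > 0"
  shows "has_bochner_integral lborel (\<lambda>x. normal_density 0 (sqrt v) x * exp (- l * x)) (exp (l\<^sup>2 * v / 2))"
    and "has_bochner_integral lborel (\<lambda>x. normal_density 0 (sqrt v) x * (exp (- l * x) * x)) (- l * v * exp (l\<^sup>2 * v / 2))"
proof -
  have s: "0 < sqrt v" using v by simp
  have "has_bochner_integral lborel (normal_density (- l * v) (sqrt v)) 1"
    using integrable_normal_density[OF s] integral_normal_density[OF s] by (simp add: has_bochner_integral_iff)
  from has_bochner_integral_mult_right[OF this, of "exp (l\<^sup>2 * v / 2)"]
  show "has_bochner_integral lborel (\<lambda>x. normal_density 0 (sqrt v) x * exp (- l * x)) (exp (l\<^sup>2 * v / 2))"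
    unfolding normal_density_tilt[OF v] by simp
  have "normal_density 0 (sqrt v) x * (exp (- l * x) * x)
      = exp (l\<^sup>2 * v / 2) * (normal_density (- l * v) (sqrt v) x * x)" for x
    unfolding mult.assoc[symmetric] normal_density_tilt[OF v] ..
  moreover from has_bochner_integral_mult_right[OF normal_moment_nz_1[OF s, of "- l * v"], of "exp (l\<^sup>2 * v / 2)"]
  have "has_bochner_integral lborel (\<lambda>x. exp (l\<^sup>2 * v / 2) * (normal_density (- l * v) (sqrt v) x * x))
      (- l * v * exp (l\<^sup>2 * v / 2))"
    by (simp add: mult.commute)
  ultimately show "has_bochner_integral lborel (\<lambda>x. normal_density 0 (sqrt v) x * (exp (- l * x) * x)) (- l * v * exp (l\<^sup>2 * v / 2))"
    by (simp only:)
qed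

lemma simple_integrand_times:
  assumes "simple_integrand M T F n \<tau> \<xi>" "i \<le> n"
  shows "\<tau> i \<in> {0..T}"
proof -
  have mono: "\<tau> i \<le> \<tau> j" if "i \<le> j" "j \<le> n" for i j
    using that
  proof (induction rule: dec_induct)
    case (step k)
    moreover have "\<tau> k \<le> \<tau> (Suc k)" using assms step by (auto simp: simple_integrand_def)
    ultimately show ?case by auto
  qed simp
  show ?thesis using mono[of 0 i] mono[of i n] assms by (auto simp: simple_integrand_def)
qed

section \<open>Brownian increments\<close>

text \<open>The paths are regular everywhere, so that path integrals and pathwise formulas hold at every
  point of the sample space and adapted functionals of the paths are measurable.\<close>

locale brownian_setup = prob_space M for M :: "'a measure" +
  fixes T :: real and F :: "real \<Rightarrow> 'a measure" and W :: "real \<Rightarrow> 'a \<Rightarrow> real"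
  assumes T_pos: "0 < T"
    and subalg: "\<And>t. t \<in> {0..T} \<Longrightarrow> subalgebra M (F t)"
    and filt_mono: "\<And>s t. s \<in> {0..T} \<Longrightarrow> t \<in> {0..T} \<Longrightarrow> s \<le> t \<Longrightarrow> sets (F s) \<subseteq> sets (F t)"
    and bm: "brownian_motion M T F W"
    and W_0: "\<And>\<omega>. \<omega> \<in> space M \<Longrightarrow> W 0 \<omega> = 0"
    and W_cont: "\<And>\<omega>. \<omega> \<in> space M \<Longrightarrow> continuous_on {0..T} (\<lambda>t. W t \<omega>)"
begin

lemma space_F: "t \<in> {0..T} \<Longrightarrow> space (F t) = space M"
  using subalg by (auto simp: subalgebra_def)

lemma F_mono:
  assumes "f \<in> measurable (F s) N" "0 \<le> s" "s \<le> t" "t \<le> T"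
  shows "f \<in> measurable (F t) N"
proof (rule measurable_from_subalg[OF _ assms(1)])
  show "subalgebra (F t) (F s)"
    using assms filt_mono[of s t] space_F[of s] space_F[of t] by (auto simp: subalgebra_def)
qed

lemma F_meas_M: "f \<in> measurable (F s) N \<Longrightarrow> s \<in> {0..T} \<Longrightarrow> f \<in> measurable M N"
  by (rule measurable_from_subalg[OF subalg])

lemma W_F: "0 \<le> s \<Longrightarrow> s \<le> t \<Longrightarrow> t \<le> T \<Longrightarrow> W s \<in> borel_measurable (F t)"
  using bm by (intro F_mono[of "W s" s borel t]) (simp_all add: brownian_motion_def)

lemma W_M: "0 \<le> s \<Longrightarrow> s \<le> T \<Longrightarrow> W s \<in> borel_measurable M"
  by (rule F_meas_M[OF W_F[of s s]]) simp_all

text \<open>The increment after \<open>s\<close> is independent of \<open>F s\<close>, so the expectation factorises. All moments of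
  increments used below are instances, with \<open>f\<close> a monomial, an exponential or a product of both.\<close>

lemma increment_product:
  assumes s: "0 \<le> s" "s < t" "t \<le> T" and Z: "Z \<in> borel_measurable (F s)" "integrable M Z"
    and f: "f \<in> borel_measurable borel"
    and fi: "has_bochner_integral lborel (\<lambda>x. normal_density 0 (sqrt (t - s)) x * f x) c"
  shows "has_bochner_integral M (\<lambda>\<omega>. Z \<omega> * f (W t \<omega> - W s \<omega>)) (expectation Z * c)"
proof -
  have D: "distributed M lborel (\<lambda>\<omega>. W t \<omega> - W s \<omega>) (normal_density 0 (sqrt (t - s)))"
    and I: "indep_set (sets (F s)) (sets (vimage_algebra (space M) (\<lambda>\<omega>. W t \<omega> - W s \<omega>) borel))"
    using bm s by (auto simp: brownian_motion_def)
  have [measurable]: "W t \<in> borel_measurable M" "W s \<in> borel_measurable M" "f \<in> borel_measurable borel"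
    using W_M s f by simp_all
  have int: "integrable M (\<lambda>\<omega>. f (W t \<omega> - W s \<omega>))"
    using distributed_integrable[OF D, of f] f fi by (simp add: has_bochner_integral_iff)
  have c: "expectation (\<lambda>\<omega>. f (W t \<omega> - W s \<omega>)) = c"
    using distributed_integral[OF D, of f] f fi by (simp add: has_bochner_integral_iff)
  have "indep_var borel Z borel (\<lambda>\<omega>. f (W t \<omega> - W s \<omega>))"
    unfolding indep_var_eq
  proof (intro conjI)
    show "random_variable borel Z" using Z(2) by auto
    show "random_variable borel (\<lambda>\<omega>. f (W t \<omega> - W s \<omega>))" by measurable
    have a: "sigma_sets (space M) {Z -` A \<inter> space M |A. A \<in> sets borel} \<subseteq> sets (F s)"
    proof -
      have "{Z -` A \<inter> space M |A. A \<in> sets borel} \<subseteq> sets (F s)"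
        using measurable_sets[OF Z(1)] space_F[of s] s by auto
      then show ?thesis using sets.sigma_sets_subset[of _ "F s"] space_F[of s] s by auto
    qed
    have b: "sigma_sets (space M) {(\<lambda>\<omega>. f (W t \<omega> - W s \<omega>)) -` A \<inter> space M |A. A \<in> sets borel}
       \<subseteq> sets (vimage_algebra (space M) (\<lambda>\<omega>. W t \<omega> - W s \<omega>) borel)" (is "sigma_sets _ ?G \<subseteq> sets ?V")
    proof -
      have "(\<lambda>\<omega>. W t \<omega> - W s \<omega>) \<in> measurable ?V borel"
        by (rule measurable_vimage_algebra1) auto
      then have "(\<lambda>\<omega>. f (W t \<omega> - W s \<omega>)) \<in> measurable ?V borel" by measurable
      from measurable_sets[OF this] have "?G \<subseteq> sets ?V" by auto
      then show ?thesis using sets.sigma_sets_subset[of _ ?V] by simp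
    qed
    show "indep_set (sigma_sets (space M) {Z -` A \<inter> space M |A. A \<in> sets borel})
      (sigma_sets (space M) {(\<lambda>\<omega>. f (W t \<omega> - W s \<omega>)) -` A \<inter> space M |A. A \<in> sets borel})"
      unfolding indep_sets2_eq
    proof (intro conjI ballI)
      have I': "sets (F s) \<subseteq> events" "sets (vimage_algebra (space M) (\<lambda>\<omega>. W t \<omega> - W s \<omega>) borel) \<subseteq> events"
        and prod: "\<And>x y. x \<in> sets (F s) \<Longrightarrow> y \<in> sets (vimage_algebra (space M) (\<lambda>\<omega>. W t \<omega> - W s \<omega>) borel)
          \<Longrightarrow> prob (x \<inter> y) = prob x * prob y"
        using I unfolding indep_sets2_eq by simp_all
      show "sigma_sets (space M) {Z -` A \<inter> space M |A. A \<in> sets borel} \<subseteq> events"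
        by (rule subset_trans[OF a I'(1)])
      show "sigma_sets (space M) {(\<lambda>\<omega>. f (W t \<omega> - W s \<omega>)) -` A \<inter> space M |A. A \<in> sets borel} \<subseteq> events"
        by (rule subset_trans[OF b I'(2)])
      show "prob (x \<inter> y) = prob x * prob y"
        if "x \<in> sigma_sets (space M) {Z -` A \<inter> space M |A. A \<in> sets borel}"
          "y \<in> sigma_sets (space M) {(\<lambda>\<omega>. f (W t \<omega> - W s \<omega>)) -` A \<inter> space M |A. A \<in> sets borel}" for x y
        by (rule prod[OF subsetD[OF a that(1)] subsetD[OF b that(2)]])
    qed
  qed
  from indep_var_integrable[OF this Z(2) int] indep_var_lebesgue_integral[OF this Z(2) int]
  show ?thesis by (simp add: has_bochner_integral_iff c)
qed

lemma increment_mean_zero: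
  assumes s: "0 \<le> s" "s \<le> t" "t \<le> T" and Z: "Z \<in> borel_measurable (F s)" "integrable M Z"
  shows "has_bochner_integral M (\<lambda>\<omega>. Z \<omega> * (W t \<omega> - W s \<omega>)) 0"
proof (cases "s = t")
  case False
  have "has_bochner_integral lborel (\<lambda>x. normal_density 0 (sqrt (t - s)) x * x) 0"
    using normal_moment_nz_1[of "sqrt (t - s)" 0] False s by simp
  from increment_product[OF s(1) _ s(3) Z _ this] False s show ?thesis by simp
qed (simp add: has_bochner_integral_zero)

lemma increment_variance:
  assumes s: "0 \<le> s" "s \<le> t" "t \<le> T" and Z: "Z \<in> borel_measurable (F s)" "integrable M Z"
  shows "has_bochner_integral M (\<lambda>\<omega>. Z \<omega> * (W t \<omega> - W s \<omega>)\<^sup>2) (expectation Z * (t - s))"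
proof (cases "s = t")
  case False
  then have "has_bochner_integral lborel (\<lambda>x. normal_density 0 (sqrt (t - s)) x * x\<^sup>2) ((2 * t - 2 * s) / 2)"
    using normal_moment_even[of "sqrt (t - s)" 0 1] s by (simp add: fact_2)
  moreover have "(2 * t - 2 * s) / 2 = t - s" by simp
  ultimately have "has_bochner_integral lborel (\<lambda>x. normal_density 0 (sqrt (t - s)) x * x\<^sup>2) (t - s)"
    by (simp only:)
  from increment_product[OF s(1) _ s(3) Z _ this] False s show ?thesis by simp
qed (simp add: has_bochner_integral_zero)

lemma integrable_mult_bounded:
  fixes f g :: "'a \<Rightarrow> real"
  assumes "integrable M f" "g \<in> borel_measurable M" "\<forall>\<omega>\<in>space M. \<bar>g \<omega>\<bar> \<le> B"
  shows "integrable M (\<lambda>\<omega>. g \<omega> * f \<omega>)"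
proof (rule Bochner_Integration.integrable_bound)
  show "integrable M (\<lambda>\<omega>. B * \<bar>f \<omega>\<bar>)" using assms by auto
  show "(\<lambda>\<omega>. g \<omega> * f \<omega>) \<in> borel_measurable M" using assms by auto
  show "AE \<omega> in M. norm (g \<omega> * f \<omega>) \<le> norm (B * \<bar>f \<omega>\<bar>)"
  proof (rule AE_I2)
    fix \<omega> assume "\<omega> \<in> space M"
    then have "\<bar>g \<omega>\<bar> \<le> B" using assms by auto
    then have "\<bar>g \<omega>\<bar> * \<bar>f \<omega>\<bar> \<le> \<bar>B\<bar> * \<bar>f \<omega>\<bar>" by (intro mult_right_mono) auto
    then show "norm (g \<omega> * f \<omega>) \<le> norm (B * \<bar>f \<omega>\<bar>)" by (simp add: abs_mult)
  qed
qed

lemma integrable_bounded: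
  fixes g :: "'a \<Rightarrow> real"
  assumes "g \<in> borel_measurable M" "\<forall>\<omega>\<in>space M. \<bar>g \<omega>\<bar> \<le> B"
  shows "integrable M g"
  using integrable_mult_bounded[of "\<lambda>_. 1" g B] assms by simp

lemma F_times_increment:
  assumes "f \<in> borel_measurable (F s)" "0 \<le> p" "p \<le> q" "q \<le> s" "s \<le> T"
  shows "(\<lambda>\<omega>. f \<omega> * (W q \<omega> - W p \<omega>)) \<in> borel_measurable (F s)"
proof -
  have [measurable]: "W q \<in> borel_measurable (F s)" "W p \<in> borel_measurable (F s)" "f \<in> borel_measurable (F s)"
    using assms W_F[of q s] W_F[of p s] by simp_all
  show ?thesis by measurable
qed

text \<open>The Ito isometry in bilinear form, for two integrands that consist of a single step each.
  Stating it for overlapping intervals avoids every common refinement of partitions below.\<close>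

lemma step_product_ordered:
  assumes a: "0 \<le> a" "a \<le> b" "b \<le> T" and u: "a \<le> u" "u \<le> v" "v \<le> T"
    and \<xi>: "\<xi> \<in> borel_measurable (F a)" "\<forall>\<omega>\<in>space M. \<bar>\<xi> \<omega>\<bar> \<le> B"
    and \<eta>: "\<eta> \<in> borel_measurable (F u)" "\<forall>\<omega>\<in>space M. \<bar>\<eta> \<omega>\<bar> \<le> C"
  shows "has_bochner_integral M (\<lambda>\<omega>. (\<xi> \<omega> * (W b \<omega> - W a \<omega>)) * (\<eta> \<omega> * (W v \<omega> - W u \<omega>)))
    (expectation (\<lambda>\<omega>. \<xi> \<omega> * \<eta> \<omega>) * max 0 (min b v - u))"
proof -
  have \<xi>u: "\<xi> \<in> borel_measurable (F u)" using F_mono[OF \<xi>(1)] a u by auto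
  have [measurable]: "\<xi> \<in> borel_measurable M" "\<eta> \<in> borel_measurable M"
    using F_meas_M[OF \<xi>u] F_meas_M[OF \<eta>(1)] a u by simp_all
  have \<xi>\<eta>: "(\<lambda>\<omega>. \<xi> \<omega> * \<eta> \<omega>) \<in> borel_measurable (F u)" using \<xi>u \<eta> by auto
  have \<xi>\<eta>i: "integrable M (\<lambda>\<omega>. \<xi> \<omega> * \<eta> \<omega>)"
    by (rule integrable_mult_bounded[OF integrable_bounded[OF _ \<eta>(2)] _ \<xi>(2)]) auto
  have inc: "integrable M (\<lambda>\<omega>. \<xi> \<omega> * \<eta> \<omega> * (W t \<omega> - W s \<omega>))" if "0 \<le> s" "s \<le> t" "t \<le> T" for s t
  proof -
    have "has_bochner_integral M (\<lambda>\<omega>. 1 * (W t \<omega> - W s \<omega>)) 0"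
      using that by (intro increment_mean_zero) auto
    then have "integrable M (\<lambda>\<omega>. W t \<omega> - W s \<omega>)" by (simp add: has_bochner_integral_iff)
    then show ?thesis
      using integrable_mult_bounded[OF integrable_mult_bounded[OF _ _ \<eta>(2)] _ \<xi>(2)] by (simp add: mult.assoc)
  qed
  show ?thesis
  proof (cases "b \<le> u")
    case True
    have "has_bochner_integral M (\<lambda>\<omega>. (\<xi> \<omega> * \<eta> \<omega> * (W b \<omega> - W a \<omega>)) * (W v \<omega> - W u \<omega>)) 0"
      using a u True by (intro increment_mean_zero inc F_times_increment \<xi>\<eta>) simp_all
    moreover have "max 0 (min b v - u) = 0" using True by auto
    ultimately show ?thesis by (simp add: mult_ac)
  next
    case False
    define m where "m = min b v"
    have m: "u \<le> m" "m \<le> b" "m \<le> v" "m \<le> T" "0 \<le> u" "0 \<le> m" using False u a by (auto simp: m_def)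
    have \<xi>\<eta>m: "(\<lambda>\<omega>. \<xi> \<omega> * \<eta> \<omega>) \<in> borel_measurable (F m)" by (rule F_mono[OF \<xi>\<eta>]) (use m in auto)
    have 1: "has_bochner_integral M (\<lambda>\<omega>. (\<xi> \<omega> * \<eta> \<omega> * (W u \<omega> - W a \<omega>)) * (W v \<omega> - W u \<omega>)) 0"
      using a u False by (intro increment_mean_zero inc F_times_increment \<xi>\<eta>) simp_all
    have 2: "has_bochner_integral M (\<lambda>\<omega>. (\<xi> \<omega> * \<eta> \<omega>) * (W m \<omega> - W u \<omega>)\<^sup>2) (expectation (\<lambda>\<omega>. \<xi> \<omega> * \<eta> \<omega>) * (m - u))"
      using m \<xi>\<eta> \<xi>\<eta>i by (intro increment_variance) auto
    have 3: "has_bochner_integral M (\<lambda>\<omega>. (\<xi> \<omega> * \<eta> \<omega> * (W m \<omega> - W u \<omega>)) * (W b \<omega> - W m \<omega>)) 0"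
      using a m by (intro increment_mean_zero inc F_times_increment \<xi>\<eta>m) simp_all
    have 4: "has_bochner_integral M (\<lambda>\<omega>. (\<xi> \<omega> * \<eta> \<omega> * (W m \<omega> - W u \<omega>)) * (W v \<omega> - W m \<omega>)) 0"
      using u m by (intro increment_mean_zero inc F_times_increment \<xi>\<eta>m) simp_all
    have alg: "(x * (wb - wa)) * (y * (wv - wu)) = (x * y * (wu - wa)) * (wv - wu) + (x * y) * (wm - wu)\<^sup>2
        + (x * y * (wm - wu)) * (wb - wm) + (x * y * (wm - wu)) * (wv - wm)"
      if "wm = wb \<or> wm = wv" for x y wa wb wm wu wv :: real
      using that by (auto simp: algebra_simps power2_eq_square)
    have eq: "(\<xi> \<omega> * (W b \<omega> - W a \<omega>)) * (\<eta> \<omega> * (W v \<omega> - W u \<omega>))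
      = (\<xi> \<omega> * \<eta> \<omega> * (W u \<omega> - W a \<omega>)) * (W v \<omega> - W u \<omega>) + (\<xi> \<omega> * \<eta> \<omega>) * (W m \<omega> - W u \<omega>)\<^sup>2
        + (\<xi> \<omega> * \<eta> \<omega> * (W m \<omega> - W u \<omega>)) * (W b \<omega> - W m \<omega>)
        + (\<xi> \<omega> * \<eta> \<omega> * (W m \<omega> - W u \<omega>)) * (W v \<omega> - W m \<omega>)" for \<omega>
      by (rule alg) (simp add: m_def min_def)
    have "has_bochner_integral M (\<lambda>\<omega>. (\<xi> \<omega> * (W b \<omega> - W a \<omega>)) * (\<eta> \<omega> * (W v \<omega> - W u \<omega>)))
        (0 + expectation (\<lambda>\<omega>. \<xi> \<omega> * \<eta> \<omega>) * (m - u) + 0 + 0)"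
      unfolding eq by (intro has_bochner_integral_add 1 2 3 4)
    then show ?thesis using False u by (simp add: m_def max_def)
  qed
qed

lemma step_product:
  assumes a: "0 \<le> a" "a \<le> b" "b \<le> T" and u: "0 \<le> u" "u \<le> v" "v \<le> T" and t: "0 \<le> t" "t \<le> T"
    and \<xi>: "\<xi> \<in> borel_measurable (F a)" "\<forall>\<omega>\<in>space M. \<bar>\<xi> \<omega>\<bar> \<le> B"
    and \<eta>: "\<eta> \<in> borel_measurable (F u)" "\<forall>\<omega>\<in>space M. \<bar>\<eta> \<omega>\<bar> \<le> C"
  shows "has_bochner_integral M
    (\<lambda>\<omega>. (\<xi> \<omega> * (W (min t b) \<omega> - W (min t a) \<omega>)) * (\<eta> \<omega> * (W (min t v) \<omega> - W (min t u) \<omega>)))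
    (expectation (\<lambda>\<omega>. \<xi> \<omega> * \<eta> \<omega>) * measure lborel ({a<..b} \<inter> {u<..v} \<inter> {0..t}))"
proof -
  have set: "{a<..b} \<inter> {u<..v} \<inter> {0..t} = {max a u<..min (min t b) (min t v)}" using a u t by auto
  have meas: "measure lborel ({a<..b} \<inter> {u<..v} \<inter> {0..t}) = max 0 (min (min t b) (min t v) - max a u)"
    unfolding set by (cases "max a u \<le> min (min t b) (min t v)") (auto simp: max_def)
  show ?thesis
  proof (cases "t \<le> a \<or> t \<le> u")
    case True
    then have "(\<lambda>\<omega>. (\<xi> \<omega> * (W (min t b) \<omega> - W (min t a) \<omega>)) * (\<eta> \<omega> * (W (min t v) \<omega> - W (min t u) \<omega>))) = (\<lambda>_. 0)"
      using a u by (auto simp: min_def fun_eq_iff)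
    moreover have "max 0 (min (min t b) (min t v) - max a u) = 0" using True a u by (auto simp: max_def min_def)
    ultimately show ?thesis unfolding meas by (simp add: has_bochner_integral_zero)
  next
    case False
    then have *: "min t a = a" "min t u = u" by auto
    show ?thesis
    proof (cases "a \<le> u")
      case True
      have "has_bochner_integral M (\<lambda>\<omega>. (\<xi> \<omega> * (W (min t b) \<omega> - W a \<omega>)) * (\<eta> \<omega> * (W (min t v) \<omega> - W u \<omega>)))
        (expectation (\<lambda>\<omega>. \<xi> \<omega> * \<eta> \<omega>) * max 0 (min (min t b) (min t v) - u))"
        using a u t False True by (intro step_product_ordered[OF _ _ _ _ _ _ \<xi> \<eta>]) auto
      then show ?thesis unfolding meas * using True by (simp add: max_absorb2)
    next
      case F2: False
      have "has_bochner_integral M (\<lambda>\<omega>. (\<eta> \<omega> * (W (min t v) \<omega> - W u \<omega>)) * (\<xi> \<omega> * (W (min t b) \<omega> - W a \<omega>)))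
        (expectation (\<lambda>\<omega>. \<eta> \<omega> * \<xi> \<omega>) * max 0 (min (min t v) (min t b) - a))"
        using a u t False F2 by (intro step_product_ordered[OF _ _ _ _ _ _ \<eta> \<xi>]) auto
      then show ?thesis unfolding meas * using F2 by (simp add: max_absorb1 mult.commute min.commute)
    qed
  qed
qed

section \<open>Integrals of step processes\<close>

text \<open>Step processes are indexed by an arbitrary finite set of intervals that may overlap, so that
  the difference of two of them is again one.\<close>

definition step_data :: "'i set \<Rightarrow> ('i \<Rightarrow> 'a \<Rightarrow> real) \<Rightarrow> ('i \<Rightarrow> real) \<Rightarrow> ('i \<Rightarrow> real) \<Rightarrow> bool" where
  "step_data J \<xi> a b \<longleftrightarrow> finite J \<and> (\<forall>j\<in>J. 0 \<le> a j \<and> a j \<le> b j \<and> b j \<le> T \<and>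
     \<xi> j \<in> borel_measurable (F (a j)) \<and> (\<exists>B. \<forall>\<omega>\<in>space M. \<bar>\<xi> j \<omega>\<bar> \<le> B))"

definition step_process :: "'i set \<Rightarrow> ('i \<Rightarrow> 'a \<Rightarrow> real) \<Rightarrow> ('i \<Rightarrow> real) \<Rightarrow> ('i \<Rightarrow> real) \<Rightarrow> real \<Rightarrow> 'a \<Rightarrow> real" where
  "step_process J \<xi> a b s \<omega> = (\<Sum>j\<in>J. \<xi> j \<omega> * indicator {a j<..b j} s)"

definition step_integral :: "'i set \<Rightarrow> ('i \<Rightarrow> 'a \<Rightarrow> real) \<Rightarrow> ('i \<Rightarrow> real) \<Rightarrow> ('i \<Rightarrow> real) \<Rightarrow> real \<Rightarrow> 'a \<Rightarrow> real" where
  "step_integral J \<xi> a b t \<omega> = (\<Sum>j\<in>J. \<xi> j \<omega> * (W (min t (b j)) \<omega> - W (min t (a j)) \<omega>))"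

text \<open>The squared norm in \<open>L\<^sup>2([0,t] \<times> \<Omega>)\<close>, with the order of integration that admissibility uses.\<close>

definition energy :: "real \<Rightarrow> (real \<Rightarrow> 'a \<Rightarrow> real) \<Rightarrow> ennreal" where
  "energy t H = (\<integral>\<^sup>+\<omega>. (\<integral>\<^sup>+s\<in>{0..t}. ennreal ((H s \<omega>)\<^sup>2) \<partial>lborel) \<partial>M)"

lemma simple_step_data:
  assumes "simple_integrand M T F n \<tau> \<xi>"
  shows "step_data {..<n} \<xi> \<tau> (\<lambda>i. \<tau> (Suc i))"
proof -
  have "0 \<le> \<tau> i \<and> \<tau> (Suc i) \<le> T" if "i < n" for i
    using simple_integrand_times[OF assms, of i] simple_integrand_times[OF assms, of "Suc i"] that by simp
  then show ?thesis using assms by (auto simp: step_data_def simple_integrand_def)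
qed

lemma simple_process_eq: "simple_process n \<tau> \<xi> = step_process {..<n} \<xi> \<tau> (\<lambda>i. \<tau> (Suc i))"
  by (intro ext) (simp add: simple_process_def step_process_def)

lemma simple_integral_eq: "simple_integral W n \<tau> \<xi> = step_integral {..<n} \<xi> \<tau> (\<lambda>i. \<tau> (Suc i))"
  by (intro ext) (simp add: simple_integral_def step_integral_def)

lemma step_diff:
  assumes "step_data J \<xi> a b" "step_data J' \<xi>' a' b'"
  shows "\<exists>\<zeta> c d. step_data (J <+> J') \<zeta> c d \<and>
    (\<forall>s \<omega>. step_process (J <+> J') \<zeta> c d s \<omega> = step_process J \<xi> a b s \<omega> - step_process J' \<xi>' a' b' s \<omega>) \<and>
    (\<forall>t \<omega>. step_integral (J <+> J') \<zeta> c d t \<omega> = step_integral J \<xi> a b t \<omega> - step_integral J' \<xi>' a' b' t \<omega>)"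
proof (intro exI conjI allI)
  let ?\<zeta> = "case_sum \<xi> (\<lambda>j \<omega>. - \<xi>' j \<omega>)" and ?c = "case_sum a a'" and ?d = "case_sum b b'"
  show "step_data (J <+> J') ?\<zeta> ?c ?d"
    using assms unfolding step_data_def by auto
  have fin: "finite J" "finite J'" using assms by (auto simp: step_data_def)
  show "step_process (J <+> J') ?\<zeta> ?c ?d s \<omega> = step_process J \<xi> a b s \<omega> - step_process J' \<xi>' a' b' s \<omega>" for s \<omega>
    unfolding step_process_def by (simp only: sum.Plus[OF fin] comp_def sum.case mult_minus_left sum_negf diff_conv_add_uminus)
  show "step_integral (J <+> J') ?\<zeta> ?c ?d t \<omega> = step_integral J \<xi> a b t \<omega> - step_integral J' \<xi>' a' b' t \<omega>" for t \<omega>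
    unfolding step_integral_def by (simp only: sum.Plus[OF fin] comp_def sum.case mult_minus_left sum_negf diff_conv_add_uminus)
qed

text \<open>Expanding both squares gives the same double sum, term by term by \<open>step_product\<close>.\<close>

lemma step_isometry:
  assumes st: "step_data J \<xi> a b" and t: "t \<in> {0..T}"
  shows "(\<integral>\<^sup>+\<omega>. ennreal ((step_integral J \<xi> a b t \<omega>)\<^sup>2) \<partial>M) = energy t (step_process J \<xi> a b)" (is "?L = _")
    and "energy t (step_process J \<xi> a b) < \<infinity>"
proof -
  have st': "finite J" "\<And>j. j \<in> J \<Longrightarrow> 0 \<le> a j \<and> a j \<le> b j \<and> b j \<le> T \<and> \<xi> j \<in> borel_measurable (F (a j))"
    using st by (auto simp: step_data_def)
  obtain B where B: "\<And>j. j \<in> J \<Longrightarrow> \<forall>\<omega>\<in>space M. \<bar>\<xi> j \<omega>\<bar> \<le> B j"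
    using st unfolding step_data_def by metis
  have \<xi>M: "\<xi> j \<in> borel_measurable M" if "j \<in> J" for j
  proof (rule F_meas_M)
    show "\<xi> j \<in> borel_measurable (F (a j))" using st'(2)[OF that] by simp
    show "a j \<in> {0..T}" using st'(2)[OF that] by simp
  qed
  let ?m = "\<lambda>i j. measure lborel ({a i<..b i} \<inter> {a j<..b j} \<inter> {0..t})"
  define E where "E = (\<Sum>i\<in>J. \<Sum>j\<in>J. expectation (\<lambda>\<omega>. \<xi> i \<omega> * \<xi> j \<omega>) * ?m i j)"
  have "has_bochner_integral M (\<lambda>\<omega>. \<Sum>i\<in>J. \<Sum>j\<in>J. (\<xi> i \<omega> * (W (min t (b i)) \<omega> - W (min t (a i)) \<omega>)) *
      (\<xi> j \<omega> * (W (min t (b j)) \<omega> - W (min t (a j)) \<omega>))) E"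
    unfolding E_def using st' t B by (intro has_bochner_integral_sum step_product) auto
  then have L: "has_bochner_integral M (\<lambda>\<omega>. (step_integral J \<xi> a b t \<omega>)\<^sup>2) E"
    by (simp add: step_integral_def power2_eq_square sum_product)
  then have L': "?L = ennreal E"
    by (simp add: has_bochner_integral_iff nn_integral_eq_integral)
  have hb: "has_bochner_integral lborel (\<lambda>s. (step_process J \<xi> a b s \<omega>)\<^sup>2 * indicator {0..t} s)
       (\<Sum>i\<in>J. \<Sum>j\<in>J. \<xi> i \<omega> * \<xi> j \<omega> * ?m i j)" for \<omega>
  proof -
    have "(step_process J \<xi> a b s \<omega>)\<^sup>2 * indicator {0..t} s
        = (\<Sum>i\<in>J. \<Sum>j\<in>J. \<xi> i \<omega> * \<xi> j \<omega> * indicator ({a i<..b i} \<inter> {a j<..b j} \<inter> {0..t}) s)" for s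
      unfolding step_process_def power2_eq_square sum_product unfolding sum_distrib_right
      by (simp only: indicator_inter_arith mult_ac)
    moreover have "has_bochner_integral lborel (\<lambda>s. \<Sum>i\<in>J. \<Sum>j\<in>J. \<xi> i \<omega> * \<xi> j \<omega> * indicator ({a i<..b i} \<inter> {a j<..b j} \<inter> {0..t}) s)
       (\<Sum>i\<in>J. \<Sum>j\<in>J. \<xi> i \<omega> * \<xi> j \<omega> * ?m i j)"
    proof (intro has_bochner_integral_sum has_bochner_integral_mult_right has_bochner_integral_real_indicator)
      fix i j
      have "emeasure lborel ({a i<..b i} \<inter> {a j<..b j} \<inter> {0..t}) \<le> emeasure lborel {0..t}"
        by (intro emeasure_mono) auto
      also have "\<dots> < \<infinity>" by (simp add: emeasure_lborel_Icc_eq)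
      finally show "emeasure lborel ({a i<..b i} \<inter> {a j<..b j} \<inter> {0..t}) < \<infinity>" .
    qed auto
    ultimately show ?thesis by (simp only:)
  qed
  have R: "(\<integral>\<^sup>+s\<in>{0..t}. ennreal ((step_process J \<xi> a b s \<omega>)\<^sup>2) \<partial>lborel)
      = ennreal (\<Sum>i\<in>J. \<Sum>j\<in>J. \<xi> i \<omega> * \<xi> j \<omega> * ?m i j)" for \<omega>
  proof -
    have "(\<integral>\<^sup>+s\<in>{0..t}. ennreal ((step_process J \<xi> a b s \<omega>)\<^sup>2) \<partial>lborel)
        = (\<integral>\<^sup>+s. ennreal ((step_process J \<xi> a b s \<omega>)\<^sup>2 * indicator {0..t} s) \<partial>lborel)"
      by (intro nn_integral_cong) (auto simp: indicator_def)
    also have "\<dots> = ennreal (\<integral>s. (step_process J \<xi> a b s \<omega>)\<^sup>2 * indicator {0..t} s \<partial>lborel)"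
      using hb[of \<omega>] by (intro nn_integral_eq_integral) (auto simp: has_bochner_integral_iff)
    finally show ?thesis by (simp only: has_bochner_integral_integral_eq[OF hb])
  qed
  have "has_bochner_integral M (\<lambda>\<omega>. \<Sum>i\<in>J. \<Sum>j\<in>J. \<xi> i \<omega> * \<xi> j \<omega> * ?m i j) E"
    unfolding E_def
  proof (intro has_bochner_integral_sum has_bochner_integral_mult_left)
    fix i j assume ij: "i \<in> J" "j \<in> J"
    have "integrable M (\<lambda>\<omega>. \<xi> i \<omega> * \<xi> j \<omega>)"
      using ij by (intro integrable_mult_bounded[OF integrable_bounded[OF _ B[OF ij(2)]] _ B[OF ij(1)]] \<xi>M)
    then show "has_bochner_integral M (\<lambda>\<omega>. \<xi> i \<omega> * \<xi> j \<omega>) (expectation (\<lambda>\<omega>. \<xi> i \<omega> * \<xi> j \<omega>))"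
      by (simp add: has_bochner_integral_iff)
  qed
  moreover have "0 \<le> (\<Sum>i\<in>J. \<Sum>j\<in>J. \<xi> i \<omega> * \<xi> j \<omega> * ?m i j)" for \<omega>
    unfolding has_bochner_integral_integral_eq[OF hb, symmetric]
    by (rule Bochner_Integration.integral_nonneg) simp
  ultimately have "(\<integral>\<^sup>+\<omega>. ennreal (\<Sum>i\<in>J. \<Sum>j\<in>J. \<xi> i \<omega> * \<xi> j \<omega> * ?m i j) \<partial>M) = ennreal E"
    by (simp add: has_bochner_integral_iff nn_integral_eq_integral)
  then have R': "energy t (step_process J \<xi> a b) = ennreal E" unfolding energy_def R .
  show "?L = energy t (step_process J \<xi> a b)" "energy t (step_process J \<xi> a b) < \<infinity>"
    using L' R' by auto
qed

end

context brownian_setup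
begin

section \<open>Progressive measurability and joint measurability\<close>

text \<open>The measurability that Fubini asks for. It makes no reference to the filtration, so it also covers
  processes such as terminal state prices, which anticipate.\<close>

definition joint :: "(real \<Rightarrow> 'a \<Rightarrow> real) \<Rightarrow> bool" where
  "joint H \<longleftrightarrow> (\<lambda>x. H (fst x) (snd x)) \<in> borel_measurable (leb T \<Otimes>\<^sub>M M)"

lemma jointD: "joint H \<Longrightarrow> (\<lambda>x. H (fst x) (snd x)) \<in> borel_measurable (leb T \<Otimes>\<^sub>M M)"
  by (simp add: joint_def)

lemma pair_sf: "pair_sigma_finite (leb T) M"
  using sigma_finite_leb sigma_finite_measure_axioms by (simp add: pair_sigma_finite_def)

lemma prog_joint:
  assumes "prog_measurable T F H"
  shows "joint H"
proof -
  have T: "T \<in> {0..T}" using T_pos by auto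
  have H: "(\<lambda>(s, \<omega>). H s \<omega>) \<in> borel_measurable (restrict_space borel {0..T} \<Otimes>\<^sub>M F T)"
    using assms T by (simp add: prog_measurable_def)
  have "(\<lambda>x. (fst x, snd x)) \<in> leb T \<Otimes>\<^sub>M M \<rightarrow>\<^sub>M restrict_space borel {0..T} \<Otimes>\<^sub>M F T"
  proof (rule measurable_Pair)
    have "(\<lambda>x. x) \<in> leb T \<rightarrow>\<^sub>M restrict_space borel {0..T}"
      using measurable_cong_sets[OF sets_leb refl] measurable_ident by (auto simp: id_def)
    then show "fst \<in> leb T \<Otimes>\<^sub>M M \<rightarrow>\<^sub>M restrict_space borel {0..T}"
      by (rule measurable_compose[OF measurable_fst])
    have "(\<lambda>x. x) \<in> M \<rightarrow>\<^sub>M F T"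
      using measurable_ident by (intro F_meas_M[OF _ T]) (auto simp: id_def)
    then show "snd \<in> leb T \<Otimes>\<^sub>M M \<rightarrow>\<^sub>M F T"
      by (rule measurable_compose[OF measurable_snd])
  qed
  from measurable_compose[OF this H] show ?thesis by (simp add: joint_def)
qed

lemma prog_section:
  assumes "prog_measurable T F H" "t \<in> {0..T}"
  shows "H t \<in> borel_measurable (F t)"
proof -
  have "(\<lambda>(s, \<omega>). H s \<omega>) \<in> borel_measurable (restrict_space borel {0..t} \<Otimes>\<^sub>M F t)"
    using assms by (simp add: prog_measurable_def)
  moreover have "Pair t \<in> F t \<rightarrow>\<^sub>M restrict_space borel {0..t} \<Otimes>\<^sub>M F t"
    using assms by (intro measurable_Pair1') (auto simp: space_restrict_space)
  ultimately have "(\<lambda>\<omega>. (\<lambda>(s, \<omega>). H s \<omega>) (t, \<omega>)) \<in> borel_measurable (F t)"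
    using measurable_compose by blast
  then show ?thesis by simp
qed

lemma prog_section_M: "prog_measurable T F H \<Longrightarrow> t \<in> {0..T} \<Longrightarrow> H t \<in> borel_measurable M"
  using F_meas_M[OF prog_section] .

lemma joint_path:
  assumes "joint H" "\<omega> \<in> space M"
  shows "(\<lambda>s. H s \<omega>) \<in> borel_measurable (leb T)"
  using measurable_compose[OF measurable_Pair2'[OF assms(2), of "leb T"] jointD[OF assms(1)]] by simp

lemma joint_const: "f \<in> borel_measurable M \<Longrightarrow> joint (\<lambda>_. f)"
  unfolding joint_def by (rule measurable_compose[OF measurable_snd])

lemma joint_det: "f \<in> borel_measurable (leb T) \<Longrightarrow> joint (\<lambda>s _. f s)"
  unfolding joint_def by (rule measurable_compose[OF measurable_fst])

lemma joint_Icc: "joint (\<lambda>s _. indicator {u..t} s)"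
  by (intro joint_det measurable_restrict_space1) simp

lemma joint_add: "joint H' \<Longrightarrow> joint H \<Longrightarrow> joint (\<lambda>s \<omega>. H' s \<omega> + H s \<omega>)"
  and joint_diff: "joint H' \<Longrightarrow> joint H \<Longrightarrow> joint (\<lambda>s \<omega>. H' s \<omega> - H s \<omega>)"
  and joint_mult: "joint H' \<Longrightarrow> joint H \<Longrightarrow> joint (\<lambda>s \<omega>. H' s \<omega> * H s \<omega>)"
  unfolding joint_def by (rule borel_measurable_add borel_measurable_diff borel_measurable_times, assumption+)+

lemma joint_integral_M:
  assumes "joint H" "0 \<le> u" "t \<le> T"
  shows "(\<lambda>\<omega>. LBINT s:{u..t}. H s \<omega>) \<in> borel_measurable M"
proof -
  interpret leb: sigma_finite_measure "leb T" by (rule sigma_finite_leb)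
  have "(\<lambda>x. indicator {u..t} (fst x) * H (fst x) (snd x)) \<in> borel_measurable (leb T \<Otimes>\<^sub>M M)"
    using joint_mult[OF joint_Icc assms(1)] by (rule jointD)
  from measurable_compose[OF measurable_pair_swap'[of M "leb T"] this]
  have "(\<lambda>(\<omega>, s). indicator {u..t} s * H s \<omega>) \<in> borel_measurable (M \<Otimes>\<^sub>M leb T)"
    by (simp add: case_prod_beta')
  from leb.borel_measurable_lebesgue_integral[OF this]
  show ?thesis using assms by (subst set_integral_sub_leb) auto
qed

text \<open>An adapted process all of whose paths are continuous is the limit of its left-point
  discretisations.\<close>

lemma continuous_adapted_prog:
  assumes ad: "\<And>t. t \<in> {0..T} \<Longrightarrow> V t \<in> borel_measurable (F t)"
    and cont: "\<And>\<omega>. \<omega> \<in> space M \<Longrightarrow> continuous_on {0..T} (\<lambda>t. V t \<omega>)"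
  shows "prog_measurable T F V"
  unfolding prog_measurable_def
proof
  fix t assume t: "t \<in> {0..T}"
  let ?N = "restrict_space borel {0..t} \<Otimes>\<^sub>M F t"
  define g where "g i n = max 0 (min t (real_of_int i / real (Suc n)))" for i :: int and n
  have g: "0 \<le> g i n" "g i n \<le> t" for i n using t by (auto simp: g_def)
  show "(\<lambda>(s, \<omega>). V s \<omega>) \<in> borel_measurable ?N"
  proof (rule borel_measurable_LIMSEQ_real)
    show "(\<lambda>x. V (g \<lfloor>fst x * real (Suc n)\<rfloor> n) (snd x)) \<in> borel_measurable ?N" for n
    proof (rule measurable_compose_countable[of "\<lambda>i x. V (g i n) (snd x)"])
      show "(\<lambda>x. V (g i n) (snd x)) \<in> borel_measurable ?N" for i
        using g[of i n] t by (intro measurable_compose[OF measurable_snd] F_mono[OF ad]) auto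
      have "(\<lambda>x. fst x) \<in> borel_measurable ?N"
        by (rule measurable_compose[OF measurable_fst]) (intro measurable_restrict_space1, simp)
      then show "(\<lambda>x. \<lfloor>fst x * real (Suc n)\<rfloor>) \<in> ?N \<rightarrow>\<^sub>M count_space UNIV"
        by measurable
    qed
    fix x assume x: "x \<in> space ?N"
    obtain s \<omega> where xs: "x = (s, \<omega>)" by (cases x)
    then have s: "0 \<le> s" "s \<le> t" "\<omega> \<in> space M"
      using x space_F[OF t] by (auto simp: space_pair_measure space_restrict_space)
    have geq: "g \<lfloor>s * real (Suc n)\<rfloor> n = real_of_int \<lfloor>s * real (Suc n)\<rfloor> / real (Suc n)" for n
    proof -
      have "real_of_int \<lfloor>s * real (Suc n)\<rfloor> \<le> s * real (Suc n)" by simp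
      then have "real_of_int \<lfloor>s * real (Suc n)\<rfloor> / real (Suc n) \<le> s" by (simp add: divide_le_eq)
      moreover have "0 \<le> real_of_int \<lfloor>s * real (Suc n)\<rfloor> / real (Suc n)" using s by simp
      ultimately show ?thesis using s by (simp add: g_def)
    qed
    have "(\<lambda>n. real_of_int \<lfloor>s * real (Suc n)\<rfloor> / real (Suc n)) \<longlonglongrightarrow> s"
      by (rule floor_approximation)
    then have "(\<lambda>n. g \<lfloor>s * real (Suc n)\<rfloor> n) \<longlonglongrightarrow> s" by (simp only: geq)
    moreover have "((\<lambda>r. V r \<omega>) \<longlongrightarrow> V s \<omega>) (at s within {0..T})"
      using cont[OF s(3)] s t by (auto simp: continuous_on)
    ultimately have "(\<lambda>n. V (g \<lfloor>s * real (Suc n)\<rfloor> n) \<omega>) \<longlonglongrightarrow> V s \<omega>"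
      using cont[OF s(3)] s t g
      by (intro continuous_on_tendsto_compose[of "{0..T}" "\<lambda>r. V r \<omega>" _ s]) (auto intro!: always_eventually order_trans[OF g(2)])
    then show "(\<lambda>n. V (g \<lfloor>fst x * real (Suc n)\<rfloor> n) (snd x)) \<longlonglongrightarrow> (case x of (s, \<omega>) \<Rightarrow> V s \<omega>)"
      by (simp add: xs)
  qed
qed

lemma joint_W: "joint W"
  by (rule prog_joint[OF continuous_adapted_prog[OF W_F W_cont]]) simp_all

lemma step_joint:
  assumes "step_data J \<xi> a b"
  shows "joint (step_process J \<xi> a b)"
proof -
  have "\<xi> j \<in> borel_measurable M" if "j \<in> J" for j
    using assms that by (intro F_meas_M[of "\<xi> j" "a j"]) (auto simp: step_data_def)
  moreover have "(\<lambda>s. indicator {a j<..b j} s :: real) \<in> borel_measurable (leb T)" for j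
    by (intro measurable_restrict_space1) simp
  ultimately show ?thesis unfolding joint_def step_process_def
    by (intro borel_measurable_sum borel_measurable_times)
      (auto intro: measurable_compose[OF measurable_snd] measurable_compose[OF measurable_fst])
qed

lemma step_integral_M:
  assumes "step_data J \<xi> a b" "t \<in> {0..T}"
  shows "step_integral J \<xi> a b t \<in> borel_measurable M"
proof -
  have "\<xi> j \<in> borel_measurable M" if "j \<in> J" for j
    using assms that by (intro F_meas_M[of "\<xi> j" "a j"]) (auto simp: step_data_def)
  moreover have "W (min t (a j)) \<in> borel_measurable M" "W (min t (b j)) \<in> borel_measurable M" if "j \<in> J" for j
    using assms that by (auto intro!: W_M simp: step_data_def min_def)
  ultimately have "(\<lambda>\<omega>. \<Sum>j\<in>J. \<xi> j \<omega> * (W (min t (b j)) \<omega> - W (min t (a j)) \<omega>)) \<in> borel_measurable M"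
    by (intro borel_measurable_sum borel_measurable_times borel_measurable_diff) auto
  then show ?thesis by (simp add: step_integral_def[abs_def])
qed

section \<open>The energy of an integrand\<close>

lemma energy_eq:
  assumes H: "joint H" and t: "t \<in> {0..T}"
  shows "energy t H = (\<integral>\<^sup>+x. ennreal ((indicator {0..t} (fst x) * H (fst x) (snd x))\<^sup>2) \<partial>(leb T \<Otimes>\<^sub>M M))"
proof -
  interpret pair_sigma_finite "leb T" M by (rule pair_sf)
  have "(\<lambda>x. indicator {0..t} (fst x) * H (fst x) (snd x)) \<in> borel_measurable (leb T \<Otimes>\<^sub>M M)"
    using joint_mult[OF joint_Icc H] by (rule jointD)
  then have "(\<lambda>x. ennreal ((indicator {0..t} (fst x) * H (fst x) (snd x))\<^sup>2)) \<in> borel_measurable (leb T \<Otimes>\<^sub>M M)"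
    by measurable
  from nn_integral_snd[OF this]
  have "(\<integral>\<^sup>+x. ennreal ((indicator {0..t} (fst x) * H (fst x) (snd x))\<^sup>2) \<partial>(leb T \<Otimes>\<^sub>M M))
      = (\<integral>\<^sup>+\<omega>. (\<integral>\<^sup>+s. ennreal ((indicator {0..t} s * H s \<omega>)\<^sup>2) \<partial>leb T) \<partial>M)" by simp
  also have "\<dots> = energy t H"
    unfolding energy_def nn_integral_leb
    using t by (intro nn_integral_cong) (auto simp: indicator_def)
  finally show ?thesis by simp
qed

lemma energy_add3_le:
  assumes "joint H'" "joint H" "joint K" and t: "t \<in> {0..T}"
  shows "energy t (\<lambda>s \<omega>. H' s \<omega> + H s \<omega> + K s \<omega>) \<le> 3 * energy t H' + 3 * energy t H + 3 * energy t K"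
proof -
  have j: "joint (\<lambda>s \<omega>. H' s \<omega> + H s \<omega> + K s \<omega>)" by (intro joint_add assms)
  show ?thesis
    using nn_integral_square_add3_le[OF jointD[OF joint_mult[OF joint_Icc[of 0 t] assms(1)]]
      jointD[OF joint_mult[OF joint_Icc[of 0 t] assms(2)]] jointD[OF joint_mult[OF joint_Icc[of 0 t] assms(3)]]]
    unfolding energy_eq[OF j t] energy_eq[OF assms(1) t] energy_eq[OF assms(2) t] energy_eq[OF assms(3) t]
    by (simp only: distrib_left)
qed

lemma energy_mono: "t \<le> u \<Longrightarrow> energy t H \<le> energy u H"
  unfolding energy_def by (intro nn_integral_mono) (auto simp: indicator_def)

lemma energy_uminus: "energy t (\<lambda>s \<omega>. H' s \<omega> - H s \<omega>) = energy t (\<lambda>s \<omega>. H s \<omega> - H' s \<omega>)"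
  unfolding energy_def by (simp add: power2_commute)

lemma path_energy_M:
  assumes "joint H" "0 \<le> u" "t \<le> T"
  shows "(\<lambda>\<omega>. \<integral>\<^sup>+s\<in>{u..t}. ennreal ((H s \<omega>)\<^sup>2) \<partial>lborel) \<in> borel_measurable M"
proof -
  interpret leb: sigma_finite_measure "leb T" by (rule sigma_finite_leb)
  have "(\<lambda>x. indicator {u..t} (fst x) * H (fst x) (snd x)) \<in> borel_measurable (leb T \<Otimes>\<^sub>M M)"
    using joint_mult[OF joint_Icc assms(1)] by (rule jointD)
  from measurable_compose[OF measurable_pair_swap'[of M "leb T"] this]
  have "(\<lambda>(\<omega>, s). indicator {u..t} s * H s \<omega>) \<in> borel_measurable (M \<Otimes>\<^sub>M leb T)"
    by (simp add: case_prod_beta')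
  then have "(\<lambda>x. ennreal ((indicator {u..t} (snd x) * H (snd x) (fst x))\<^sup>2)) \<in> borel_measurable (M \<Otimes>\<^sub>M leb T)"
    unfolding case_prod_beta' by measurable
  from leb.borel_measurable_nn_integral_fst[OF this]
  have "(\<lambda>\<omega>. \<integral>\<^sup>+s. ennreal ((indicator {u..t} s * H s \<omega>)\<^sup>2) \<partial>leb T) \<in> borel_measurable M" by simp
  moreover have "(\<integral>\<^sup>+s. ennreal ((indicator {u..t} s * H s \<omega>)\<^sup>2) \<partial>leb T) = (\<integral>\<^sup>+s\<in>{u..t}. ennreal ((H s \<omega>)\<^sup>2) \<partial>lborel)" for \<omega>
    unfolding nn_integral_leb using assms by (intro nn_integral_cong) (auto simp: indicator_def)
  ultimately show ?thesis by simp
qed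

text \<open>Cauchy-Schwarz in time. The factor \<open>t - u\<close> makes such integrals small on short intervals.\<close>

lemma square_integral_le_energy:
  assumes H: "joint H" and t: "0 \<le> u" "u \<le> t" "t \<le> T"
  shows "(\<integral>\<^sup>+\<omega>. ennreal ((LBINT s:{u..t}. H s \<omega>)\<^sup>2) \<partial>M)
    \<le> ennreal (t - u) * (\<integral>\<^sup>+\<omega>. (\<integral>\<^sup>+s\<in>{u..t}. ennreal ((H s \<omega>)\<^sup>2) \<partial>lborel) \<partial>M)"
proof -
  have "(\<integral>\<^sup>+\<omega>. ennreal ((LBINT s:{u..t}. H s \<omega>)\<^sup>2) \<partial>M)
      \<le> (\<integral>\<^sup>+\<omega>. ennreal (t - u) * (\<integral>\<^sup>+s\<in>{u..t}. ennreal ((H s \<omega>)\<^sup>2) \<partial>lborel) \<partial>M)"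
  proof (rule nn_integral_mono)
    fix \<omega> assume \<omega>: "\<omega> \<in> space M"
    show "ennreal ((LBINT s:{u..t}. H s \<omega>)\<^sup>2) \<le> ennreal (t - u) * (\<integral>\<^sup>+s\<in>{u..t}. ennreal ((H s \<omega>)\<^sup>2) \<partial>lborel)"
      by (rule square_set_integral_le[OF joint_path[OF H \<omega>] t])
  qed
  also have "\<dots> = ennreal (t - u) * (\<integral>\<^sup>+\<omega>. (\<integral>\<^sup>+s\<in>{u..t}. ennreal ((H s \<omega>)\<^sup>2) \<partial>lborel) \<partial>M)"
    using path_energy_M[OF H t(1,3)] by (rule nn_integral_cmult)
  finally show ?thesis .
qed

lemma energy_AE_integrable:
  assumes H: "joint H" and e: "energy T H < \<infinity>"
  shows "AE \<omega> in M. integrable (leb T) (\<lambda>s. H s \<omega>)"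
proof -
  interpret leb: finite_measure "leb T" by (rule finite_measure_leb)
  have "AE \<omega> in M. (\<integral>\<^sup>+s\<in>{0..T}. ennreal ((H s \<omega>)\<^sup>2) \<partial>lborel) \<noteq> \<infinity>"
    using e T_pos by (intro nn_integral_PInf_AE path_energy_M H) (auto simp: energy_def)
  with AE_space show ?thesis
  proof eventually_elim
    case (elim \<omega>)
    then have m: "(\<lambda>s. H s \<omega>) \<in> borel_measurable (leb T)" by (intro joint_path[OF H])
    have "integrable (leb T) (\<lambda>s. (H s \<omega>)\<^sup>2)"
      unfolding integrable_square_iff[OF m] nn_integral_leb using elim(2) by (simp add: less_top)
    with m show ?case by (rule leb.integrable_of_square)
  qed
qed

abbreviation PM :: "(real \<times> 'a) measure" where
  "PM \<equiv> leb T \<Otimes>\<^sub>M M"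

lemma PM_nn_integral:
  assumes "joint f"
  shows "(\<integral>\<^sup>+\<omega>. (\<integral>\<^sup>+s\<in>{0..T}. ennreal (f s \<omega>) \<partial>lborel) \<partial>M) = (\<integral>\<^sup>+x. ennreal (f (fst x) (snd x)) \<partial>PM)"
  using pair_sigma_finite.nn_integral_snd[OF pair_sf, of "\<lambda>x. ennreal (f (fst x) (snd x))"] jointD[OF assms]
  by (simp add: nn_integral_leb)

lemma energy_bounded:
  assumes jK: "joint K" and K: "\<And>s. s \<in> {0..T} \<Longrightarrow> (\<integral>\<^sup>+\<omega>. ennreal ((K s \<omega>)\<^sup>2) \<partial>M) \<le> ennreal D"
  shows "energy T K \<le> ennreal D * ennreal T"
proof -
  have T: "T \<in> {0..T}" using T_pos by auto
  have "energy T K = (\<integral>\<^sup>+x. ennreal ((K (fst x) (snd x))\<^sup>2) \<partial>(leb T \<Otimes>\<^sub>M M))"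
    unfolding energy_eq[OF jK T] by (intro nn_integral_cong) (auto simp: space_pair_measure)
  also have "\<dots> = (\<integral>\<^sup>+s. (\<integral>\<^sup>+\<omega>. ennreal ((K s \<omega>)\<^sup>2) \<partial>M) \<partial>leb T)"
    using nn_integral_fst[of "\<lambda>x. ennreal ((K (fst x) (snd x))\<^sup>2)" "leb T"] jointD[OF jK] by simp
  also have "\<dots> \<le> (\<integral>\<^sup>+s. ennreal D \<partial>leb T)" by (intro nn_integral_mono K) simp
  also have "\<dots> = ennreal D * ennreal T"
    using T_pos by (simp add: emeasure_restrict_space emeasure_lborel_Icc_eq)
  finally show ?thesis .
qed

lemma energy_square_integrable:
  assumes "joint K" "energy T K < \<infinity>"
  shows "integrable PM (\<lambda>x. (K (fst x) (snd x))\<^sup>2)"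
proof -
  have "joint (\<lambda>s \<omega>. (K s \<omega>)\<^sup>2)" unfolding power2_eq_square by (intro joint_mult assms)
  from PM_nn_integral[OF this] assms(2) show ?thesis
    unfolding integrable_square_iff[OF jointD[OF assms(1)]] by (simp add: energy_def)
qed

lemma energy_product_integrable:
  assumes "joint K" "energy T K < \<infinity>" "joint L" "energy T L < \<infinity>"
  shows "integrable PM (\<lambda>x. K (fst x) (snd x) * L (fst x) (snd x))"
  by (intro integrable_mult_square jointD energy_square_integrable assms)

lemma energy_integrable:
  assumes "joint K" "energy T K < \<infinity>"
  shows "integrable PM (\<lambda>x. K (fst x) (snd x))"
proof -
  have j: "joint (\<lambda>_ _. 1)" by (intro joint_const) simp
  have "energy T (\<lambda>_ _. 1) \<le> ennreal 1 * ennreal T"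
    by (rule energy_bounded[OF j]) (simp add: emeasure_space_1)
  then have "energy T (\<lambda>_ _. 1) < \<infinity>" by (rule le_less_trans) simp
  from energy_product_integrable[OF assms j this] show ?thesis by simp
qed

lemma energy_diff_finite:
  assumes j: "joint K" "joint L" and e: "energy T K < \<infinity>" "energy T L < \<infinity>"
  shows "energy T (\<lambda>s \<omega>. K s \<omega> - L s \<omega>) < \<infinity>"
proof -
  have T: "T \<in> {0..T}" using T_pos by auto
  have j0: "joint (\<lambda>_ _. 0)" by (intro joint_const) simp
  have jm: "joint (\<lambda>s \<omega>. 0 - L s \<omega>)" by (intro joint_diff j0 j)
  have "energy T (\<lambda>s \<omega>. K s \<omega> + (0 - L s \<omega>) + 0) \<le> 3 * energy T K + 3 * energy T (\<lambda>s \<omega>. 0 - L s \<omega>) + 3 * energy T (\<lambda>_ _. 0)"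
    by (rule energy_add3_le[OF j(1) jm j0 T])
  also have "energy T (\<lambda>s \<omega>. 0 - L s \<omega>) = energy T L" by (simp add: energy_def)
  also have "3 * energy T K + 3 * energy T L + 3 * energy T (\<lambda>_ _. 0) < \<infinity>"
    using e by (simp add: ennreal_mult_less_top) (simp add: energy_def)
  finally show ?thesis by simp
qed

lemma admissible_consumption:
  assumes "admissible M T F P C"
  shows "prog_measurable T F C" "joint C" "energy T C < \<infinity>" "prog_measurable T F P" "joint P"
proof -
  show p: "prog_measurable T F C" "prog_measurable T F P" using assms by (simp_all add: admissible_def)
  then show "joint C" "joint P" by (auto intro: prog_joint)
  have "energy T C \<le> (\<integral>\<^sup>+\<omega>. (\<integral>\<^sup>+s\<in>{0..T}. ennreal ((P s \<omega>)\<^sup>2 + (C s \<omega>)\<^sup>2) \<partial>lborel) \<partial>M)"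
    unfolding energy_def by (intro nn_integral_mono mult_right_mono ennreal_leI) auto
  also have "\<dots> < \<infinity>" using assms by (simp only: admissible_def)
  finally show "energy T C < \<infinity>" .
qed

section \<open>The Ito integral\<close>

lemma ito_approx:
  assumes "ito_integral M T F W H I"
  obtains J :: "nat \<Rightarrow> nat set" and \<xi> a b where
    "\<And>m. step_data (J m) (\<xi> m) (a m) (b m)"
    "(\<lambda>m. energy T (\<lambda>s \<omega>. H s \<omega> - step_process (J m) (\<xi> m) (a m) (b m) s \<omega>)) \<longlonglongrightarrow> 0"
    "\<And>t. t \<in> {0..T} \<Longrightarrow> (\<lambda>m. \<integral>\<^sup>+\<omega>. ennreal ((I t \<omega> - step_integral (J m) (\<xi> m) (a m) (b m) t \<omega>)\<^sup>2) \<partial>M) \<longlonglongrightarrow> 0"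
proof -
  obtain n \<tau> \<xi> where si: "\<And>m. simple_integrand M T F (n m) (\<tau> m) (\<xi> m)"
    and a: "(\<lambda>m. \<integral>\<^sup>+\<omega>. (\<integral>\<^sup>+s\<in>{0..T}. ennreal ((H s \<omega> - simple_process (n m) (\<tau> m) (\<xi> m) s \<omega>)\<^sup>2) \<partial>lborel) \<partial>M) \<longlonglongrightarrow> 0"
    and b: "\<And>t. t \<in> {0..T} \<Longrightarrow> (\<lambda>m. \<integral>\<^sup>+\<omega>. ennreal ((I t \<omega> - simple_integral W (n m) (\<tau> m) (\<xi> m) t \<omega>)\<^sup>2) \<partial>M) \<longlonglongrightarrow> 0"
    using assms unfolding ito_integral_def by blast
  show thesis
    by (rule that[of "\<lambda>m. {..<n m}" \<xi> \<tau> "\<lambda>m i. \<tau> m (Suc i)"])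
      (use simple_step_data[OF si] a b in \<open>simp_all only: energy_def simple_process_eq simple_integral_eq\<close>)
qed

lemma ito_prog:
  assumes "ito_integral M T F W H I"
  shows "prog_measurable T F H" "prog_measurable T F I"
  using assms by (auto simp: ito_integral_def)

lemma ennreal_le_of_tendsto_0:
  fixes x y :: ennreal
  assumes "\<And>m. x \<le> y + 27 * e m" "e \<longlonglongrightarrow> 0"
  shows "x \<le> y"
proof -
  have "(\<lambda>m. y + 27 * e m) \<longlonglongrightarrow> y + 27 * 0"
    using assms(2) by (intro tendsto_add tendsto_const ennreal_tendsto_cmult) auto
  then show ?thesis using assms(1) by (intro LIMSEQ_le_const[of _ y]) auto
qed

text \<open>The Ito isometry for differences, up to the harmless factor \<open>9\<close> that two uses of
  \<open>(x + y + z)\<^sup>2 \<le> 3 x\<^sup>2 + 3 y\<^sup>2 + 3 z\<^sup>2\<close> cost. A constant does no harm, as the inequalities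
  serve to show that one side vanishes with the other, or is a small multiple of itself.\<close>

lemma ito_isometry:
  assumes i1: "ito_integral M T F W H1 I1" and i2: "ito_integral M T F W H2 I2" and t: "t \<in> {0..T}"
  shows "energy t (\<lambda>s \<omega>. H1 s \<omega> - H2 s \<omega>) \<le> 9 * (\<integral>\<^sup>+\<omega>. ennreal ((I1 t \<omega> - I2 t \<omega>)\<^sup>2) \<partial>M)" (is ?A)
    and "(\<integral>\<^sup>+\<omega>. ennreal ((I1 t \<omega> - I2 t \<omega>)\<^sup>2) \<partial>M) \<le> 9 * energy t (\<lambda>s \<omega>. H1 s \<omega> - H2 s \<omega>)" (is ?B)
proof -
  obtain J1 :: "nat \<Rightarrow> nat set" and \<xi>1 a1 b1 where s1: "\<And>m. step_data (J1 m) (\<xi>1 m) (a1 m) (b1 m)"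
    and e1: "(\<lambda>m. energy T (\<lambda>s \<omega>. H1 s \<omega> - step_process (J1 m) (\<xi>1 m) (a1 m) (b1 m) s \<omega>)) \<longlonglongrightarrow> 0"
    and c1: "\<And>t. t \<in> {0..T} \<Longrightarrow> (\<lambda>m. \<integral>\<^sup>+\<omega>. ennreal ((I1 t \<omega> - step_integral (J1 m) (\<xi>1 m) (a1 m) (b1 m) t \<omega>)\<^sup>2) \<partial>M) \<longlonglongrightarrow> 0"
    using ito_approx[OF i1] by blast
  obtain J2 :: "nat \<Rightarrow> nat set" and \<xi>2 a2 b2 where s2: "\<And>m. step_data (J2 m) (\<xi>2 m) (a2 m) (b2 m)"
    and e2: "(\<lambda>m. energy T (\<lambda>s \<omega>. H2 s \<omega> - step_process (J2 m) (\<xi>2 m) (a2 m) (b2 m) s \<omega>)) \<longlonglongrightarrow> 0"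
    and c2: "\<And>t. t \<in> {0..T} \<Longrightarrow> (\<lambda>m. \<integral>\<^sup>+\<omega>. ennreal ((I2 t \<omega> - step_integral (J2 m) (\<xi>2 m) (a2 m) (b2 m) t \<omega>)\<^sup>2) \<partial>M) \<longlonglongrightarrow> 0"
    using ito_approx[OF i2] by blast
  define h1 where "h1 m = step_process (J1 m) (\<xi>1 m) (a1 m) (b1 m)" for m
  define h2 where "h2 m = step_process (J2 m) (\<xi>2 m) (a2 m) (b2 m)" for m
  define S1 where "S1 m = step_integral (J1 m) (\<xi>1 m) (a1 m) (b1 m) t" for m
  define S2 where "S2 m = step_integral (J2 m) (\<xi>2 m) (a2 m) (b2 m) t" for m
  define N where "N f = (\<integral>\<^sup>+\<omega>. ennreal ((f \<omega>)\<^sup>2) \<partial>M)" for f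
  have jH: "joint H1" "joint H2" using ito_prog[OF i1] ito_prog[OF i2] by (auto intro: prog_joint)
  have jh: "joint (h1 m)" "joint (h2 m)" for m unfolding h1_def h2_def by (intro step_joint s1 s2)+
  have MI [measurable]: "I1 t \<in> borel_measurable M" "I2 t \<in> borel_measurable M"
    using ito_prog[OF i1] ito_prog[OF i2] t by (auto intro: prog_section_M)
  have MS [measurable]: "S1 m \<in> borel_measurable M" "S2 m \<in> borel_measurable M" for m
    unfolding S1_def S2_def by (intro step_integral_M s1 s2 t)+
  have iso: "N (\<lambda>\<omega>. S1 m \<omega> - S2 m \<omega>) = energy t (\<lambda>s \<omega>. h1 m s \<omega> - h2 m s \<omega>)" for m
  proof -
    obtain \<zeta> c d where z: "step_data (J1 m <+> J2 m) \<zeta> c d"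
      "\<And>s \<omega>. step_process (J1 m <+> J2 m) \<zeta> c d s \<omega> = h1 m s \<omega> - h2 m s \<omega>"
      "\<And>t \<omega>. step_integral (J1 m <+> J2 m) \<zeta> c d t \<omega> = step_integral (J1 m) (\<xi>1 m) (a1 m) (b1 m) t \<omega> - step_integral (J2 m) (\<xi>2 m) (a2 m) (b2 m) t \<omega>"
      using step_diff[OF s1 s2, of m m] unfolding h1_def h2_def by blast
    have "step_process (J1 m <+> J2 m) \<zeta> c d = (\<lambda>s \<omega>. h1 m s \<omega> - h2 m s \<omega>)"
      by (intro ext z(2))
    then show ?thesis using step_isometry(1)[OF z(1) t] by (simp only: N_def S1_def S2_def z(3))
  qed
  define e where "e m = energy T (\<lambda>s \<omega>. H1 s \<omega> - h1 m s \<omega>) + energy T (\<lambda>s \<omega>. H2 s \<omega> - h2 m s \<omega>)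
     + (N (\<lambda>\<omega>. I1 t \<omega> - S1 m \<omega>) + N (\<lambda>\<omega>. I2 t \<omega> - S2 m \<omega>))" for m
  have "e \<longlonglongrightarrow> 0 + 0 + (0 + 0)"
    unfolding e_def[abs_def] N_def h1_def h2_def S1_def S2_def by (intro tendsto_add e1 e2 c1 c2 t)
  then have e0: "e \<longlonglongrightarrow> 0" by simp
  have en: "energy t (\<lambda>s \<omega>. H1 s \<omega> - h1 m s \<omega>) \<le> energy T (\<lambda>s \<omega>. H1 s \<omega> - h1 m s \<omega>)"
    "energy t (\<lambda>s \<omega>. H2 s \<omega> - h2 m s \<omega>) \<le> energy T (\<lambda>s \<omega>. H2 s \<omega> - h2 m s \<omega>)" for m
    using t by (auto intro: energy_mono)
  have sym: "N (\<lambda>\<omega>. f \<omega> - g \<omega>) = N (\<lambda>\<omega>. g \<omega> - f \<omega>)" for f g by (simp add: N_def power2_commute)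
  have tri1: "energy t (\<lambda>s \<omega>. H1 s \<omega> - H2 s \<omega>) \<le> 3 * energy T (\<lambda>s \<omega>. H1 s \<omega> - h1 m s \<omega>)
      + 3 * energy t (\<lambda>s \<omega>. h1 m s \<omega> - h2 m s \<omega>) + 3 * energy T (\<lambda>s \<omega>. H2 s \<omega> - h2 m s \<omega>)" for m
  proof -
    have "energy t (\<lambda>s \<omega>. H1 s \<omega> - H2 s \<omega>)
        = energy t (\<lambda>s \<omega>. (H1 s \<omega> - h1 m s \<omega>) + (h1 m s \<omega> - h2 m s \<omega>) + (h2 m s \<omega> - H2 s \<omega>))" by simp
    also have "\<dots> \<le> 3 * energy t (\<lambda>s \<omega>. H1 s \<omega> - h1 m s \<omega>) + 3 * energy t (\<lambda>s \<omega>. h1 m s \<omega> - h2 m s \<omega>)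
        + 3 * energy t (\<lambda>s \<omega>. h2 m s \<omega> - H2 s \<omega>)"
      by (intro energy_add3_le joint_diff jH jh t)
    also have "energy t (\<lambda>s \<omega>. h2 m s \<omega> - H2 s \<omega>) = energy t (\<lambda>s \<omega>. H2 s \<omega> - h2 m s \<omega>)"
      by (rule energy_uminus)
    finally show ?thesis
      by (rule order_trans) (intro add_mono mult_left_mono en order_refl, auto)
  qed
  have tri2: "energy t (\<lambda>s \<omega>. h1 m s \<omega> - h2 m s \<omega>) \<le> 3 * energy T (\<lambda>s \<omega>. H1 s \<omega> - h1 m s \<omega>)
      + 3 * energy t (\<lambda>s \<omega>. H1 s \<omega> - H2 s \<omega>) + 3 * energy T (\<lambda>s \<omega>. H2 s \<omega> - h2 m s \<omega>)" for m
  proof -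
    have "energy t (\<lambda>s \<omega>. h1 m s \<omega> - h2 m s \<omega>)
        = energy t (\<lambda>s \<omega>. (h1 m s \<omega> - H1 s \<omega>) + (H1 s \<omega> - H2 s \<omega>) + (H2 s \<omega> - h2 m s \<omega>))" by simp
    also have "\<dots> \<le> 3 * energy t (\<lambda>s \<omega>. h1 m s \<omega> - H1 s \<omega>) + 3 * energy t (\<lambda>s \<omega>. H1 s \<omega> - H2 s \<omega>)
        + 3 * energy t (\<lambda>s \<omega>. H2 s \<omega> - h2 m s \<omega>)"
      by (intro energy_add3_le joint_diff jH jh t)
    also have "energy t (\<lambda>s \<omega>. h1 m s \<omega> - H1 s \<omega>) = energy t (\<lambda>s \<omega>. H1 s \<omega> - h1 m s \<omega>)"
      by (rule energy_uminus)
    finally show ?thesis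
      by (rule order_trans) (intro add_mono mult_left_mono en order_refl, auto)
  qed
  have tri3: "N (\<lambda>\<omega>. S1 m \<omega> - S2 m \<omega>) \<le> 3 * N (\<lambda>\<omega>. I1 t \<omega> - S1 m \<omega>) + 3 * N (\<lambda>\<omega>. I1 t \<omega> - I2 t \<omega>)
      + 3 * N (\<lambda>\<omega>. I2 t \<omega> - S2 m \<omega>)" for m
  proof -
    have "N (\<lambda>\<omega>. S1 m \<omega> - S2 m \<omega>) = N (\<lambda>\<omega>. (S1 m \<omega> - I1 t \<omega>) + (I1 t \<omega> - I2 t \<omega>) + (I2 t \<omega> - S2 m \<omega>))" by simp
    also have "\<dots> \<le> 3 * N (\<lambda>\<omega>. S1 m \<omega> - I1 t \<omega>) + 3 * N (\<lambda>\<omega>. I1 t \<omega> - I2 t \<omega>) + 3 * N (\<lambda>\<omega>. I2 t \<omega> - S2 m \<omega>)"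
      unfolding N_def by (rule nn_integral_square_add3_le) measurable
    finally show ?thesis by (simp only: sym[of "S1 m"])
  qed
  have tri4: "N (\<lambda>\<omega>. I1 t \<omega> - I2 t \<omega>) \<le> 3 * N (\<lambda>\<omega>. I1 t \<omega> - S1 m \<omega>) + 3 * N (\<lambda>\<omega>. S1 m \<omega> - S2 m \<omega>)
      + 3 * N (\<lambda>\<omega>. I2 t \<omega> - S2 m \<omega>)" for m
  proof -
    have "N (\<lambda>\<omega>. I1 t \<omega> - I2 t \<omega>) = N (\<lambda>\<omega>. (I1 t \<omega> - S1 m \<omega>) + (S1 m \<omega> - S2 m \<omega>) + (S2 m \<omega> - I2 t \<omega>))" by simp
    also have "\<dots> \<le> 3 * N (\<lambda>\<omega>. I1 t \<omega> - S1 m \<omega>) + 3 * N (\<lambda>\<omega>. S1 m \<omega> - S2 m \<omega>) + 3 * N (\<lambda>\<omega>. S2 m \<omega> - I2 t \<omega>)"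
      unfolding N_def by (rule nn_integral_square_add3_le) measurable
    finally show ?thesis by (simp only: sym[of "S2 m"])
  qed
  \<comment> \<open>The errors are given the common factor \<open>27\<close> so that they add up to \<open>e\<close>.\<close>
  have arith: "x \<le> 9 * w + 27 * (p + q + (r + s))"
    if "x \<le> 3 * p + 3 * y + 3 * q" "y \<le> 3 * r + 3 * w + 3 * s" for x y w p q r s :: ennreal
  proof -
    have "x \<le> 3 * p + 3 * (3 * r + 3 * w + 3 * s) + 3 * q"
      by (rule order_trans[OF that(1)]) (intro add_mono mult_left_mono that(2) order_refl, simp_all)
    also have "\<dots> = 9 * w + (3 * p + 3 * q + (9 * r + 9 * s))" by (simp add: distrib_left mult.assoc[symmetric] add_ac)
    also have "\<dots> \<le> 9 * w + (27 * p + 27 * q + (27 * r + 27 * s))"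
      by (intro add_mono mult_right_mono order_refl) auto
    finally show ?thesis by (simp add: distrib_left)
  qed
  show ?A unfolding N_def[symmetric]
  proof (rule ennreal_le_of_tendsto_0[OF _ e0])
    show "energy t (\<lambda>s \<omega>. H1 s \<omega> - H2 s \<omega>) \<le> 9 * N (\<lambda>\<omega>. I1 t \<omega> - I2 t \<omega>) + 27 * e m" for m
      unfolding e_def using arith[OF tri1 tri3[unfolded iso]] .
  qed
  show ?B unfolding N_def[symmetric]
  proof (rule ennreal_le_of_tendsto_0[OF _ e0])
    show "N (\<lambda>\<omega>. I1 t \<omega> - I2 t \<omega>) \<le> 9 * energy t (\<lambda>s \<omega>. H1 s \<omega> - H2 s \<omega>) + 27 * e m" for m
      unfolding e_def using arith[OF tri4[unfolded iso] tri2] by (simp add: add_ac)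
  qed
qed

lemma ito_square_integrable:
  assumes ito: "ito_integral M T F W H I"
  shows "energy T H < \<infinity>" and "t \<in> {0..T} \<Longrightarrow> integrable M (\<lambda>\<omega>. (I t \<omega>)\<^sup>2)"
proof -
  obtain J :: "nat \<Rightarrow> nat set" and \<xi> a b where s: "\<And>m. step_data (J m) (\<xi> m) (a m) (b m)"
    and e: "(\<lambda>m. energy T (\<lambda>s \<omega>. H s \<omega> - step_process (J m) (\<xi> m) (a m) (b m) s \<omega>)) \<longlonglongrightarrow> 0"
    and c: "\<And>t. t \<in> {0..T} \<Longrightarrow> (\<lambda>m. \<integral>\<^sup>+\<omega>. ennreal ((I t \<omega> - step_integral (J m) (\<xi> m) (a m) (b m) t \<omega>)\<^sup>2) \<partial>M) \<longlonglongrightarrow> 0"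
    using ito_approx[OF ito] by blast
  have T: "T \<in> {0..T}" using T_pos by auto
  have "\<forall>\<^sub>F m in sequentially. energy T (\<lambda>s \<omega>. H s \<omega> - step_process (J m) (\<xi> m) (a m) (b m) s \<omega>) < 1"
    using e by (rule order_tendstoD(2)) simp
  then obtain m where m: "energy T (\<lambda>s \<omega>. H s \<omega> - step_process (J m) (\<xi> m) (a m) (b m) s \<omega>) < 1"
    by (auto simp: eventually_sequentially)
  have jH: "joint H" using ito_prog[OF ito] by (auto intro: prog_joint)
  have j0: "joint (\<lambda>_ _. 0)" unfolding joint_def by simp
  have "energy T (\<lambda>s \<omega>. (H s \<omega> - step_process (J m) (\<xi> m) (a m) (b m) s \<omega>) + step_process (J m) (\<xi> m) (a m) (b m) s \<omega> + 0)
    \<le> 3 * energy T (\<lambda>s \<omega>. H s \<omega> - step_process (J m) (\<xi> m) (a m) (b m) s \<omega>)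
      + 3 * energy T (step_process (J m) (\<xi> m) (a m) (b m)) + 3 * energy T (\<lambda>_ _. 0)"
    by (intro energy_add3_le joint_diff jH step_joint s j0 T)
  also have "\<dots> < \<infinity>"
    using m step_isometry(2)[OF s T, of m]
    by (auto simp: ennreal_mult_less_top energy_def less_top intro: less_trans)
  finally show "energy T H < \<infinity>" by simp
  show "integrable M (\<lambda>\<omega>. (I t \<omega>)\<^sup>2)" if t: "t \<in> {0..T}"
  proof -
    have MI: "I t \<in> borel_measurable M" using ito_prog[OF ito] t by (auto intro: prog_section_M)
    have "\<forall>\<^sub>F m in sequentially. (\<integral>\<^sup>+\<omega>. ennreal ((I t \<omega> - step_integral (J m) (\<xi> m) (a m) (b m) t \<omega>)\<^sup>2) \<partial>M) < 1"
      using c[OF t] by (rule order_tendstoD(2)) simp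
    then obtain m where m: "(\<integral>\<^sup>+\<omega>. ennreal ((I t \<omega> - step_integral (J m) (\<xi> m) (a m) (b m) t \<omega>)\<^sup>2) \<partial>M) < 1"
      by (auto simp: eventually_sequentially)
    have "(\<integral>\<^sup>+\<omega>. ennreal (((I t \<omega> - step_integral (J m) (\<xi> m) (a m) (b m) t \<omega>) + step_integral (J m) (\<xi> m) (a m) (b m) t \<omega> + 0)\<^sup>2) \<partial>M)
      \<le> 3 * (\<integral>\<^sup>+\<omega>. ennreal ((I t \<omega> - step_integral (J m) (\<xi> m) (a m) (b m) t \<omega>)\<^sup>2) \<partial>M)
        + 3 * (\<integral>\<^sup>+\<omega>. ennreal ((step_integral (J m) (\<xi> m) (a m) (b m) t \<omega>)\<^sup>2) \<partial>M) + 3 * (\<integral>\<^sup>+\<omega>. ennreal (0\<^sup>2) \<partial>M)"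
      by (intro nn_integral_square_add3_le borel_measurable_diff MI step_integral_M s t) simp
    also have "\<dots> < \<infinity>"
      using m step_isometry[OF s t, of m] by (auto simp: ennreal_mult_less_top less_top intro: less_trans)
    finally show ?thesis using integrable_square_iff[OF MI] by simp
  qed
qed

lemma ito_0:
  assumes ito: "ito_integral M T F W H I"
  shows "AE \<omega> in M. I 0 \<omega> = 0"
proof -
  obtain J :: "nat \<Rightarrow> nat set" and \<xi> a b where s: "\<And>m. step_data (J m) (\<xi> m) (a m) (b m)"
    and e: "(\<lambda>m. energy T (\<lambda>s \<omega>. H s \<omega> - step_process (J m) (\<xi> m) (a m) (b m) s \<omega>)) \<longlonglongrightarrow> 0"
    and c: "\<And>t. t \<in> {0..T} \<Longrightarrow> (\<lambda>m. \<integral>\<^sup>+\<omega>. ennreal ((I t \<omega> - step_integral (J m) (\<xi> m) (a m) (b m) t \<omega>)\<^sup>2) \<partial>M) \<longlonglongrightarrow> 0"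
    using ito_approx[OF ito] by blast
  have 0: "0 \<in> {0..T}" using T_pos by auto
  have "step_integral (J m) (\<xi> m) (a m) (b m) 0 \<omega> = 0" for m \<omega>
    using s[of m] by (auto simp: step_integral_def step_data_def min_def intro!: sum.neutral)
  then have "(\<lambda>m::nat. \<integral>\<^sup>+\<omega>. ennreal ((I 0 \<omega>)\<^sup>2) \<partial>M) \<longlonglongrightarrow> 0" using c[OF 0] by simp
  then have "(\<integral>\<^sup>+\<omega>. ennreal ((I 0 \<omega>)\<^sup>2) \<partial>M) = 0" by (simp add: LIMSEQ_const_iff)
  moreover have "I 0 \<in> borel_measurable M" using ito_prog[OF ito] 0 by (auto intro: prog_section_M)
  ultimately show ?thesis by (subst (asm) nn_integral_0_iff_AE) auto
qed

end

lemma set_integral_split: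
  fixes f :: "real \<Rightarrow> real"
  assumes f: "set_integrable lborel {0..T} f" and t: "0 \<le> t" "t \<le> T"
  shows "(LBINT s:{0..T}. f s) = (LBINT s:{0..t}. f s) + (LBINT s:{t..T}. f s)"
proof -
  have "{0..T} = {0..t} \<union> {t..T}" using t by auto
  moreover have "(LBINT s:{0..t} \<union> {t..T}. f s) = (LBINT s:{0..t}. f s) + (LBINT s:{t..T}. f s)"
  proof (rule set_integral_Un_AE)
    show "AE x in lborel. \<not> (x \<in> {0..t} \<and> x \<in> {t..T})"
      using AE_lborel_singleton[of t] by eventually_elim auto
    show "set_integrable lborel {0..t} f" "set_integrable lborel {t..T} f"
      using t by (auto intro: set_integrable_subset[OF f])
  qed auto
  ultimately show ?thesis by simp
qed

context brownian_setup
begin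

section \<open>Change of measure\<close>

text \<open>\<open>Y l t\<close> is the density on \<open>F t\<close> of the measure under which \<open>W\<^sub>t + l * t\<close> is a Brownian
  motion. In the game \<open>l = \<mu> / \<sigma>\<close> is the market price of risk and \<open>Y\<close> the state price density.\<close>

definition Y :: "real \<Rightarrow> real \<Rightarrow> 'a \<Rightarrow> real" where
  "Y l t \<omega> = exp (- l * W t \<omega> - l\<^sup>2 * t / 2)"

lemma Y_pos: "0 < Y l t \<omega>"
  by (simp add: Y_def)

lemma Y_F: "0 \<le> s \<Longrightarrow> s \<le> t \<Longrightarrow> t \<le> T \<Longrightarrow> Y l s \<in> borel_measurable (F t)"
  unfolding Y_def[abs_def] using W_F[of s t] by simp

lemma Y_M: "0 \<le> t \<Longrightarrow> t \<le> T \<Longrightarrow> Y l t \<in> borel_measurable M"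
  by (rule F_meas_M[OF Y_F[of t t]]) simp_all

lemma joint_Y: "joint (Y l)"
proof -
  have W: "(\<lambda>x. W (fst x) (snd x)) \<in> borel_measurable (leb T \<Otimes>\<^sub>M M)"
    by (rule jointD[OF joint_W])
  have f: "(\<lambda>x. fst x) \<in> borel_measurable (leb T \<Otimes>\<^sub>M M)"
    by (rule measurable_compose[OF measurable_fst]) (intro measurable_restrict_space1, simp)
  have "(\<lambda>x. - l * W (fst x) (snd x) - l\<^sup>2 * fst x / 2) \<in> borel_measurable (leb T \<Otimes>\<^sub>M M)"
    by (intro borel_measurable_diff borel_measurable_times borel_measurable_divide borel_measurable_const W f)
  from measurable_compose[OF this borel_measurable_exp]
  have "(\<lambda>x. exp (- l * W (fst x) (snd x) - l\<^sup>2 * fst x / 2)) \<in> borel_measurable (leb T \<Otimes>\<^sub>M M)" .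
  then show ?thesis unfolding joint_def Y_def .
qed

text \<open>Conditionally on \<open>F s\<close> the increment of \<open>W\<close> is Gaussian, and the quotient \<open>Y l t / Y l s\<close> is an
  exponential tilt of it, with total mass \<open>1\<close> and mean \<open>- l * (t - s)\<close>.\<close>

lemma Y_step:
  assumes s: "0 \<le> s" "s \<le> t" "t \<le> T" and \<zeta>: "\<zeta> \<in> borel_measurable (F s)" "integrable M (\<lambda>\<omega>. Y l s \<omega> * \<zeta> \<omega>)"
  shows Y_martingale: "has_bochner_integral M (\<lambda>\<omega>. Y l t \<omega> * \<zeta> \<omega>) (expectation (\<lambda>\<omega>. Y l s \<omega> * \<zeta> \<omega>))"
    and Y_increment: "has_bochner_integral M (\<lambda>\<omega>. Y l t \<omega> * (\<zeta> \<omega> * (W t \<omega> - W s \<omega>)))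
      (- l * (t - s) * expectation (\<lambda>\<omega>. Y l s \<omega> * \<zeta> \<omega>))"
proof -
  let ?E = "expectation (\<lambda>\<omega>. Y l s \<omega> * \<zeta> \<omega>)"
  have "has_bochner_integral M (\<lambda>\<omega>. Y l t \<omega> * \<zeta> \<omega>) ?E \<and>
    has_bochner_integral M (\<lambda>\<omega>. Y l t \<omega> * (\<zeta> \<omega> * (W t \<omega> - W s \<omega>))) (- l * (t - s) * ?E)"
  proof (cases "s = t")
    case True
    then show ?thesis using \<zeta> by (simp add: has_bochner_integral_iff)
  next
    case False
    then have v: "t - s > 0" using s by simp
    let ?c = "exp (- (l\<^sup>2 * (t - s) / 2))"
    have Z: "(\<lambda>\<omega>. Y l s \<omega> * \<zeta> \<omega>) \<in> borel_measurable (F s)"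
      using Y_F[of s s l] \<zeta>(1) s by simp
    have Yt: "Y l t \<omega> = Y l s \<omega> * (exp (- l * (W t \<omega> - W s \<omega>)) * ?c)" for \<omega>
    proof -
      have "- l * W t \<omega> - l\<^sup>2 * t / 2 = (- l * W s \<omega> - l\<^sup>2 * s / 2) + (- l * (W t \<omega> - W s \<omega>) + - (l\<^sup>2 * (t - s) / 2))"
        by (simp add: field_simps)
      then show ?thesis unfolding Y_def by (simp only: exp_add)
    qed
    have cancel: "exp (l\<^sup>2 * (t - s) / 2) * ?c = 1" by (simp flip: exp_add)
    have "has_bochner_integral lborel (\<lambda>x. normal_density 0 (sqrt (t - s)) x * (exp (- l * x) * ?c)) 1"
      using has_bochner_integral_mult_left[OF normal_tilted_moments(1)[OF v, of l], of ?c] cancel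
      by (simp only: mult.assoc)
    from increment_product[OF s(1) _ s(3) Z \<zeta>(2) _ this] v
    have 1: "has_bochner_integral M (\<lambda>\<omega>. Y l s \<omega> * \<zeta> \<omega> * (exp (- l * (W t \<omega> - W s \<omega>)) * ?c)) ?E" by simp
    have "has_bochner_integral lborel (\<lambda>x. normal_density 0 (sqrt (t - s)) x * (exp (- l * x) * x) * ?c)
      (- l * (t - s) * exp (l\<^sup>2 * (t - s) / 2) * ?c)"
      by (rule has_bochner_integral_mult_left[OF normal_tilted_moments(2)[OF v, of l]])
    then have "has_bochner_integral lborel (\<lambda>x. normal_density 0 (sqrt (t - s)) x * (exp (- l * x) * x * ?c)) (- l * (t - s))"
      unfolding mult.assoc[of _ _ ?c] cancel by (simp only: mult_1_right mult.assoc)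
    from increment_product[OF s(1) _ s(3) Z \<zeta>(2) _ this] v
    have 2: "has_bochner_integral M (\<lambda>\<omega>. Y l s \<omega> * \<zeta> \<omega> * (exp (- l * (W t \<omega> - W s \<omega>)) * (W t \<omega> - W s \<omega>) * ?c)) (?E * (- l * (t - s)))"
      by simp
    have e1: "Y l t \<omega> * \<zeta> \<omega> = Y l s \<omega> * \<zeta> \<omega> * (exp (- l * (W t \<omega> - W s \<omega>)) * ?c)" for \<omega>
      unfolding Yt by (simp only: mult_ac)
    have e2: "Y l t \<omega> * (\<zeta> \<omega> * (W t \<omega> - W s \<omega>))
        = Y l s \<omega> * \<zeta> \<omega> * (exp (- l * (W t \<omega> - W s \<omega>)) * (W t \<omega> - W s \<omega>) * ?c)" for \<omega>
      unfolding Yt by (simp only: mult_ac)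
    show ?thesis unfolding e1 e2 using 1 2 by (simp only: mult.commute[of ?E] simp_thms)
  qed
  then show "has_bochner_integral M (\<lambda>\<omega>. Y l t \<omega> * \<zeta> \<omega>) ?E"
    "has_bochner_integral M (\<lambda>\<omega>. Y l t \<omega> * (\<zeta> \<omega> * (W t \<omega> - W s \<omega>))) (- l * (t - s) * ?E)" by auto
qed

lemma Y_mean: "t \<in> {0..T} \<Longrightarrow> has_bochner_integral M (Y l t) 1"
proof -
  assume t: "t \<in> {0..T}"
  have e: "Y l 0 \<omega> = 1" if "\<omega> \<in> space M" for \<omega> using W_0[OF that] by (simp add: Y_def)
  have "has_bochner_integral M (\<lambda>\<omega>. Y l 0 \<omega> * 1) 1 \<longleftrightarrow> has_bochner_integral M (\<lambda>_. 1) (1::real)"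
    by (rule has_bochner_integral_cong) (simp_all add: e)
  moreover have "has_bochner_integral M (\<lambda>_. 1) (1::real)" by (simp add: has_bochner_integral_iff prob_space)
  ultimately have "has_bochner_integral M (\<lambda>\<omega>. Y l 0 \<omega> * 1) 1" by simp
  then show ?thesis
    using Y_martingale[of 0 t "\<lambda>_. 1" l] t by (simp add: has_bochner_integral_iff)
qed

text \<open>The square of \<open>Y\<close> is a multiple of the same martingale for the parameter \<open>2 * l\<close>.\<close>

lemma Y_square:
  assumes "t \<in> {0..T}"
  shows "has_bochner_integral M (\<lambda>\<omega>. (Y l t \<omega>)\<^sup>2) (exp (l\<^sup>2 * t))"
proof -
  have "(Y l t \<omega>)\<^sup>2 = exp (l\<^sup>2 * t) * Y (2 * l) t \<omega>" for \<omega>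
  proof -
    have "2 * (- l * W t \<omega> - l\<^sup>2 * t / 2) = l\<^sup>2 * t + (- (2 * l) * W t \<omega> - (2 * l)\<^sup>2 * t / 2)"
      by (simp add: power2_eq_square field_simps)
    then show ?thesis unfolding Y_def by (simp only: exp_add[symmetric] exp_double[symmetric])
  qed
  then show ?thesis using has_bochner_integral_mult_right[OF Y_mean[OF assms, of "2 * l"], of "exp (l\<^sup>2 * t)"] by simp
qed

lemma Y_bounded_square:
  assumes "t \<in> {0..T}" "\<eta> \<in> borel_measurable M" "\<forall>\<omega>\<in>space M. \<bar>\<eta> \<omega>\<bar> \<le> B"
  shows "integrable M (\<lambda>\<omega>. (Y l t \<omega> * \<eta> \<omega>)\<^sup>2)"
proof -
  have "integrable M (\<lambda>\<omega>. (\<eta> \<omega>)\<^sup>2 * (Y l t \<omega>)\<^sup>2)"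
  proof (rule integrable_mult_bounded)
    show "integrable M (\<lambda>\<omega>. (Y l t \<omega>)\<^sup>2)" using Y_square[OF assms(1)] by (simp add: has_bochner_integral_iff)
    show "(\<lambda>\<omega>. (\<eta> \<omega>)\<^sup>2) \<in> borel_measurable M" using assms(2) by simp
    show "\<forall>\<omega>\<in>space M. \<bar>(\<eta> \<omega>)\<^sup>2\<bar> \<le> B\<^sup>2"
    proof
      fix \<omega> assume "\<omega> \<in> space M"
      then have "\<bar>\<eta> \<omega>\<bar>\<^sup>2 \<le> B\<^sup>2" using assms(3) by (intro power_mono) auto
      then show "\<bar>(\<eta> \<omega>)\<^sup>2\<bar> \<le> B\<^sup>2" by simp
    qed
  qed
  then show ?thesis by (simp add: power_mult_distrib mult.commute)
qed

lemma Y_bounded_integrable: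
  assumes t: "t \<in> {0..T}" "\<eta> \<in> borel_measurable M" "\<forall>\<omega>\<in>space M. \<bar>\<eta> \<omega>\<bar> \<le> B"
  shows "integrable M (\<lambda>\<omega>. Y l t \<omega> * \<eta> \<omega>)"
  using integrable_of_square[OF _ Y_bounded_square[OF t]] t Y_M by simp

lemma step_process_integral:
  assumes st: "step_data J \<xi> a b" and t0: "t0 \<in> {0..T}"
  shows "(LBINT s:{t0..T}. step_process J \<xi> a b s \<omega>) = (\<Sum>j\<in>J. \<xi> j \<omega> * (max t0 (b j) - max t0 (a j)))"
proof -
  have "has_bochner_integral lborel (\<lambda>s. \<Sum>j\<in>J. \<xi> j \<omega> * indicator ({a j<..b j} \<inter> {t0..T}) s)
    (\<Sum>j\<in>J. \<xi> j \<omega> * (max t0 (b j) - max t0 (a j)))"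
  proof (intro has_bochner_integral_sum has_bochner_integral_mult_right)
    fix j assume "j \<in> J"
    then have j: "0 \<le> a j" "a j \<le> b j" "b j \<le> T" using st by (auto simp: step_data_def)
    have "emeasure lborel ({a j<..b j} \<inter> {t0..T}) = ennreal (max t0 (b j) - max t0 (a j))"
    proof (cases "t0 \<le> a j")
      case True
      then have "{a j<..b j} \<inter> {t0..T} = {a j<..b j}" using j by auto
      then show ?thesis using True j by simp
    next
      case False
      then have "{a j<..b j} \<inter> {t0..T} = {t0..b j}" using j by auto
      then show ?thesis using False j by (auto simp: emeasure_lborel_Icc_eq max_def)
    qed
    moreover have "0 \<le> max t0 (b j) - max t0 (a j)" using j by auto
    ultimately show "has_bochner_integral lborel (indicator ({a j<..b j} \<inter> {t0..T})) (max t0 (b j) - max t0 (a j))"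
      using has_bochner_integral_real_indicator[of "{a j<..b j} \<inter> {t0..T}" lborel] by (simp add: measure_def)
  qed
  moreover have "(\<lambda>s. \<Sum>j\<in>J. \<xi> j \<omega> * indicator ({a j<..b j} \<inter> {t0..T}) s)
      = (\<lambda>s. indicator {t0..T} s *\<^sub>R step_process J \<xi> a b s \<omega>)"
    by (rule ext) (simp only: step_process_def real_scaleR_def sum_distrib_left indicator_inter_arith mult_ac)
  ultimately show ?thesis unfolding set_lebesgue_integral_def
    by (simp only: has_bochner_integral_integral_eq)
qed

text \<open>A step that straddles \<open>t0\<close> is cut there; each remaining step contributes by \<open>Y_increment\<close>, and the
  density may be replaced by its value at any later time by \<open>Y_martingale\<close>.\<close>

lemma step_duality:
  assumes st: "step_data J \<xi> a b" and t0: "t0 \<in> {0..T}"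
    and \<eta>: "\<eta> \<in> borel_measurable (F t0)" "\<forall>\<omega>\<in>space M. \<bar>\<eta> \<omega>\<bar> \<le> B"
  shows "expectation (\<lambda>\<omega>. (Y l T \<omega> * \<eta> \<omega>) * (step_integral J \<xi> a b T \<omega> - step_integral J \<xi> a b t0 \<omega>))
    = - l * expectation (\<lambda>\<omega>. (Y l T \<omega> * \<eta> \<omega>) * (LBINT s:{t0..T}. step_process J \<xi> a b s \<omega>))"
proof -
  define u v where "u j = max t0 (a j)" and "v j = max t0 (b j)" for j
  let ?E = "\<lambda>j. expectation (\<lambda>\<omega>. Y l T \<omega> * (\<eta> \<omega> * \<xi> j \<omega>))"
  have T: "T \<in> {0..T}" using T_pos by auto
  have key: "has_bochner_integral M (\<lambda>\<omega>. Y l T \<omega> * (\<eta> \<omega> * \<xi> j \<omega> * (W (v j) \<omega> - W (u j) \<omega>))) (- l * ((v j - u j) * ?E j))"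
    "integrable M (\<lambda>\<omega>. Y l T \<omega> * (\<eta> \<omega> * \<xi> j \<omega>))" if j: "j \<in> J" for j
  proof -
    have ab: "0 \<le> a j" "a j \<le> b j" "b j \<le> T" and \<xi>: "\<xi> j \<in> borel_measurable (F (a j))"
      using st j by (auto simp: step_data_def)
    obtain C where C: "\<forall>\<omega>\<in>space M. \<bar>\<xi> j \<omega>\<bar> \<le> C" using st j unfolding step_data_def by blast
    have uv: "0 \<le> u j" "u j \<le> v j" "v j \<le> T" "t0 \<le> u j" "a j \<le> u j" "u j \<in> {0..T}"
      using ab t0 by (auto simp: u_def v_def)
    have \<zeta>: "(\<lambda>\<omega>. \<eta> \<omega> * \<xi> j \<omega>) \<in> borel_measurable (F (u j))"
    proof (rule borel_measurable_times)
      show "\<eta> \<in> borel_measurable (F (u j))" by (rule F_mono[OF \<eta>(1)]) (use uv t0 in auto)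
      show "\<xi> j \<in> borel_measurable (F (u j))" by (rule F_mono[OF \<xi>]) (use uv ab in auto)
    qed
    have \<zeta>M: "(\<lambda>\<omega>. \<eta> \<omega> * \<xi> j \<omega>) \<in> borel_measurable M" by (rule F_meas_M[OF \<zeta> uv(6)])
    have bd: "\<forall>\<omega>\<in>space M. \<bar>\<eta> \<omega> * \<xi> j \<omega>\<bar> \<le> B * C"
    proof
      fix \<omega> assume "\<omega> \<in> space M"
      then have "\<bar>\<eta> \<omega>\<bar> \<le> B" "\<bar>\<xi> j \<omega>\<bar> \<le> C" using \<eta>(2) C by auto
      then have "\<bar>\<eta> \<omega>\<bar> * \<bar>\<xi> j \<omega>\<bar> \<le> B * C" by (intro mult_mono) auto
      then show "\<bar>\<eta> \<omega> * \<xi> j \<omega>\<bar> \<le> B * C" by (simp add: abs_mult)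
    qed
    have int: "integrable M (\<lambda>\<omega>. Y l (u j) \<omega> * (\<eta> \<omega> * \<xi> j \<omega>))"
      by (rule Y_bounded_integrable[OF uv(6) \<zeta>M bd])
    have E: "?E j = expectation (\<lambda>\<omega>. Y l (u j) \<omega> * (\<eta> \<omega> * \<xi> j \<omega>))"
      using Y_martingale[OF uv(1) _ _ \<zeta> int, of T] uv by (simp add: has_bochner_integral_iff)
    have m: "has_bochner_integral M (\<lambda>\<omega>. Y l (v j) \<omega> * (\<eta> \<omega> * \<xi> j \<omega> * (W (v j) \<omega> - W (u j) \<omega>))) (- l * (v j - u j) * ?E j)"
      unfolding E by (rule Y_increment[OF uv(1-3) \<zeta> int])
    have "(\<lambda>\<omega>. \<eta> \<omega> * \<xi> j \<omega>) \<in> borel_measurable (F (v j))" by (rule F_mono[OF \<zeta>]) (use uv in auto)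
    then have \<zeta>': "(\<lambda>\<omega>. \<eta> \<omega> * \<xi> j \<omega> * (W (v j) \<omega> - W (u j) \<omega>)) \<in> borel_measurable (F (v j))"
      using uv by (intro F_times_increment) auto
    have "has_bochner_integral M (\<lambda>\<omega>. Y l T \<omega> * (\<eta> \<omega> * \<xi> j \<omega> * (W (v j) \<omega> - W (u j) \<omega>)))
       (expectation (\<lambda>\<omega>. Y l (v j) \<omega> * (\<eta> \<omega> * \<xi> j \<omega> * (W (v j) \<omega> - W (u j) \<omega>))))"
      using m uv by (intro Y_martingale[OF _ _ _ \<zeta>']) (auto simp: has_bochner_integral_iff)
    then show "has_bochner_integral M (\<lambda>\<omega>. Y l T \<omega> * (\<eta> \<omega> * \<xi> j \<omega> * (W (v j) \<omega> - W (u j) \<omega>))) (- l * ((v j - u j) * ?E j))"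
      using has_bochner_integral_integral_eq[OF m] by (simp only: mult.assoc)
    show "integrable M (\<lambda>\<omega>. Y l T \<omega> * (\<eta> \<omega> * \<xi> j \<omega>))"
      by (rule Y_bounded_integrable[OF T \<zeta>M bd])
  qed
  have "step_integral J \<xi> a b T \<omega> - step_integral J \<xi> a b t0 \<omega> = (\<Sum>j\<in>J. \<xi> j \<omega> * (W (v j) \<omega> - W (u j) \<omega>))" for \<omega>
    unfolding step_integral_def sum_subtractf[symmetric]
  proof (rule sum.cong[OF refl])
    fix j assume "j \<in> J"
    then have ab: "a j \<le> b j" "b j \<le> T" using st by (auto simp: step_data_def)
    then show "\<xi> j \<omega> * (W (min T (b j)) \<omega> - W (min T (a j)) \<omega>) - \<xi> j \<omega> * (W (min t0 (b j)) \<omega> - W (min t0 (a j)) \<omega>)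
       = \<xi> j \<omega> * (W (v j) \<omega> - W (u j) \<omega>)"
      by (auto simp: u_def v_def min_def max_def algebra_simps)
  qed
  then have L: "(Y l T \<omega> * \<eta> \<omega>) * (step_integral J \<xi> a b T \<omega> - step_integral J \<xi> a b t0 \<omega>)
     = (\<Sum>j\<in>J. Y l T \<omega> * (\<eta> \<omega> * \<xi> j \<omega> * (W (v j) \<omega> - W (u j) \<omega>)))" for \<omega>
    by (simp only: sum_distrib_left mult.assoc)
  have R: "(Y l T \<omega> * \<eta> \<omega>) * (LBINT s:{t0..T}. step_process J \<xi> a b s \<omega>)
     = (\<Sum>j\<in>J. (v j - u j) * (Y l T \<omega> * (\<eta> \<omega> * \<xi> j \<omega>)))" for \<omega>
    unfolding step_process_integral[OF st t0] u_def v_def by (simp only: sum_distrib_left mult_ac)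
  have "has_bochner_integral M (\<lambda>\<omega>. \<Sum>j\<in>J. Y l T \<omega> * (\<eta> \<omega> * \<xi> j \<omega> * (W (v j) \<omega> - W (u j) \<omega>)))
      (\<Sum>j\<in>J. - l * ((v j - u j) * ?E j))"
    by (intro has_bochner_integral_sum key(1))
  then have "expectation (\<lambda>\<omega>. (Y l T \<omega> * \<eta> \<omega>) * (step_integral J \<xi> a b T \<omega> - step_integral J \<xi> a b t0 \<omega>))
      = (\<Sum>j\<in>J. - l * ((v j - u j) * ?E j))"
    unfolding L by (rule has_bochner_integral_integral_eq)
  also have "\<dots> = - l * (\<Sum>j\<in>J. (v j - u j) * ?E j)" by (rule sum_distrib_left[symmetric])
  also have "(\<Sum>j\<in>J. (v j - u j) * ?E j) = expectation (\<lambda>\<omega>. \<Sum>j\<in>J. (v j - u j) * (Y l T \<omega> * (\<eta> \<omega> * \<xi> j \<omega>)))"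
    by (subst Bochner_Integration.integral_sum) (use key(2) in auto)
  finally show ?thesis unfolding R .
qed

text \<open>Under the density \<open>Y l T\<close> the Ito integral of \<open>H\<close> has drift \<open>- l * H\<close>. Both sides are
  continuous in the \<open>L\<^sup>2\<close>-norms that define the Ito integral, so step processes suffice.\<close>

lemma ito_duality:
  assumes ito: "ito_integral M T F W H I" and t0: "t0 \<in> {0..T}"
    and \<eta>: "\<eta> \<in> borel_measurable (F t0)" "\<forall>\<omega>\<in>space M. \<bar>\<eta> \<omega>\<bar> \<le> B"
  shows "integrable M (\<lambda>\<omega>. (Y l T \<omega> * \<eta> \<omega>) * (I T \<omega> - I t0 \<omega>))"
    and "integrable M (\<lambda>\<omega>. (Y l T \<omega> * \<eta> \<omega>) * (LBINT s:{t0..T}. H s \<omega>))"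
    and "expectation (\<lambda>\<omega>. (Y l T \<omega> * \<eta> \<omega>) * (I T \<omega> - I t0 \<omega>))
      = - l * expectation (\<lambda>\<omega>. (Y l T \<omega> * \<eta> \<omega>) * (LBINT s:{t0..T}. H s \<omega>))"
proof -
  have T: "T \<in> {0..T}" using T_pos by auto
  have \<eta>M: "\<eta> \<in> borel_measurable M" using F_meas_M[OF \<eta>(1) t0] .
  define g where "g \<omega> = Y l T \<omega> * \<eta> \<omega>" for \<omega>
  have gM: "g \<in> borel_measurable M" unfolding g_def[abs_def] using Y_M[of T l] \<eta>M T by simp
  have g2: "integrable M (\<lambda>\<omega>. (g \<omega>)\<^sup>2)" unfolding g_def by (rule Y_bounded_square[OF T \<eta>M \<eta>(2)])
  obtain J :: "nat \<Rightarrow> nat set" and \<xi> a b where s: "\<And>m. step_data (J m) (\<xi> m) (a m) (b m)"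
    and e: "(\<lambda>m. energy T (\<lambda>s \<omega>. H s \<omega> - step_process (J m) (\<xi> m) (a m) (b m) s \<omega>)) \<longlonglongrightarrow> 0"
    and c: "\<And>t. t \<in> {0..T} \<Longrightarrow> (\<lambda>m. \<integral>\<^sup>+\<omega>. ennreal ((I t \<omega> - step_integral (J m) (\<xi> m) (a m) (b m) t \<omega>)\<^sup>2) \<partial>M) \<longlonglongrightarrow> 0"
    using ito_approx[OF ito] by blast
  define h where "h m = step_process (J m) (\<xi> m) (a m) (b m)" for m
  define S where "S m = step_integral (J m) (\<xi> m) (a m) (b m)" for m
  have jH: "joint H" using ito_prog[OF ito] by (auto intro: prog_joint)
  have jh: "joint (h m)" for m unfolding h_def by (intro step_joint s)
  have MI: "I t \<in> borel_measurable M" if "t \<in> {0..T}" for t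
    using ito_prog[OF ito] that by (auto intro: prog_section_M)
  have MS: "S m t \<in> borel_measurable M" if "t \<in> {0..T}" for m t unfolding S_def by (intro step_integral_M s that)
  have I2: "integrable M (\<lambda>\<omega>. (I t \<omega>)\<^sup>2)" if "t \<in> {0..T}" for t by (rule ito_square_integrable(2)[OF ito that])
  have S2: "integrable M (\<lambda>\<omega>. (S m t \<omega>)\<^sup>2)" if "t \<in> {0..T}" for m t
    using integrable_square_iff[OF MS[OF that, of m]] step_isometry[OF s that, of m] by (simp add: S_def)
  have gI: "integrable M (\<lambda>\<omega>. g \<omega> * I t \<omega>)" if "t \<in> {0..T}" for t
    by (rule integrable_mult_square[OF gM MI[OF that] g2 I2[OF that]])
  have gS: "integrable M (\<lambda>\<omega>. g \<omega> * S m t \<omega>)" if "t \<in> {0..T}" for m t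
    by (rule integrable_mult_square[OF gM MS[OF that] g2 S2[OF that]])
  define A where "A K \<omega> = (LBINT s:{t0..T}. K s \<omega>)" for K :: "real \<Rightarrow> 'a \<Rightarrow> real" and \<omega>
  have AM: "A K \<in> borel_measurable M" if "joint K" for K
    unfolding A_def[abs_def] using joint_integral_M[OF that] t0 by simp
  have Abd: "(\<integral>\<^sup>+\<omega>. ennreal ((A K \<omega>)\<^sup>2) \<partial>M) \<le> ennreal T * energy T K" if "joint K" for K
  proof -
    have "(\<integral>\<^sup>+\<omega>. ennreal ((A K \<omega>)\<^sup>2) \<partial>M) \<le> ennreal (T - t0) * (\<integral>\<^sup>+\<omega>. (\<integral>\<^sup>+s\<in>{t0..T}. ennreal ((K s \<omega>)\<^sup>2) \<partial>lborel) \<partial>M)"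
      unfolding A_def using square_integral_le_energy[OF that] t0 by simp
    also have "\<dots> \<le> ennreal T * energy T K"
      unfolding energy_def using t0
      by (intro mult_mono nn_integral_mono ennreal_leI) (auto simp: indicator_def)
    finally show ?thesis .
  qed
  have A2: "integrable M (\<lambda>\<omega>. (A K \<omega>)\<^sup>2)" if "joint K" "energy T K < \<infinity>" for K
    using integrable_square_iff[OF AM[OF that(1)]] Abd[OF that(1)] that(2)
    by (auto simp: ennreal_mult_less_top intro: le_less_trans)
  have eH: "energy T H < \<infinity>" by (rule ito_square_integrable(1)[OF ito])
  have eh: "energy T (h m) < \<infinity>" for m unfolding h_def by (rule step_isometry(2)[OF s T])
  have gA: "integrable M (\<lambda>\<omega>. g \<omega> * A K \<omega>)" if "joint K" "energy T K < \<infinity>" for K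
    by (rule integrable_mult_square[OF gM AM[OF that(1)] g2 A2[OF that]])
  show 1: "integrable M (\<lambda>\<omega>. (Y l T \<omega> * \<eta> \<omega>) * (I T \<omega> - I t0 \<omega>))"
    using Bochner_Integration.integrable_diff[OF gI[OF T] gI[OF t0]] by (simp add: g_def right_diff_distrib)
  show 2: "integrable M (\<lambda>\<omega>. (Y l T \<omega> * \<eta> \<omega>) * (LBINT s:{t0..T}. H s \<omega>))"
    using gA[OF jH eH] by (simp add: g_def A_def)
  have lim: "(\<lambda>m. expectation (\<lambda>\<omega>. g \<omega> * (I t \<omega> - S m t \<omega>))) \<longlonglongrightarrow> 0" if "t \<in> {0..T}" for t
    using c[OF that] by (intro L2_pairing_tendsto_0 gM g2 borel_measurable_diff MI MS that) (simp add: S_def)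
  have limA: "(\<lambda>m. expectation (\<lambda>\<omega>. g \<omega> * (A H \<omega> - A (h m) \<omega>))) \<longlonglongrightarrow> 0"
  proof (intro L2_pairing_tendsto_0 gM g2 borel_measurable_diff AM jH jh)
    have AE_eq: "AE \<omega> in M. A H \<omega> - A (h m) \<omega> = A (\<lambda>s \<omega>. H s \<omega> - h m s \<omega>) \<omega>" for m
      using energy_AE_integrable[OF jH eH] energy_AE_integrable[OF jh eh, of m]
    proof eventually_elim
      case (elim \<omega>)
      have "set_integrable lborel {t0..T} (\<lambda>s. H s \<omega>)" "set_integrable lborel {t0..T} (\<lambda>s. h m s \<omega>)"
        using elim t0 by (auto simp: set_integrable_iff_leb[symmetric] intro: set_integrable_subset)
      then show ?case unfolding A_def by (simp add: set_integral_diff)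
    qed
    have le: "(\<integral>\<^sup>+\<omega>. ennreal ((A H \<omega> - A (h m) \<omega>)\<^sup>2) \<partial>M) \<le> ennreal T * energy T (\<lambda>s \<omega>. H s \<omega> - h m s \<omega>)" for m
    proof -
      have "(\<integral>\<^sup>+\<omega>. ennreal ((A H \<omega> - A (h m) \<omega>)\<^sup>2) \<partial>M) = (\<integral>\<^sup>+\<omega>. ennreal ((A (\<lambda>s \<omega>. H s \<omega> - h m s \<omega>) \<omega>)\<^sup>2) \<partial>M)"
        using AE_eq[of m] by (intro nn_integral_cong_AE) auto
      also have "\<dots> \<le> ennreal T * energy T (\<lambda>s \<omega>. H s \<omega> - h m s \<omega>)" by (intro Abd joint_diff jH jh)
      finally show ?thesis .
    qed
    have "(\<lambda>m. ennreal T * energy T (\<lambda>s \<omega>. H s \<omega> - h m s \<omega>)) \<longlonglongrightarrow> ennreal T * 0"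
      using e unfolding h_def by (intro ennreal_tendsto_cmult) auto
    then have lim0: "(\<lambda>m. ennreal T * energy T (\<lambda>s \<omega>. H s \<omega> - h m s \<omega>)) \<longlonglongrightarrow> 0" by simp
    show "(\<lambda>m. \<integral>\<^sup>+\<omega>. ennreal ((A H \<omega> - A (h m) \<omega>)\<^sup>2) \<partial>M) \<longlonglongrightarrow> 0"
      by (rule tendsto_sandwich[OF _ _ tendsto_const lim0]) (simp_all add: le)
  qed
  have step: "expectation (\<lambda>\<omega>. g \<omega> * (S m T \<omega> - S m t0 \<omega>)) = - l * expectation (\<lambda>\<omega>. g \<omega> * A (h m) \<omega>)" for m
    unfolding g_def S_def A_def h_def by (rule step_duality[OF s t0 \<eta>])
  have alg: "x1 - x2 + l * x3 = x4 + l * a0" if "x5 = - l * a" "x1 = i1 - s1" "x2 = i0 - s0" "x3 = a0 - a"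
      "x4 = i1 - i0" "x5 = s1 - s0" for x1 x2 x3 x4 x5 a a0 i1 i0 s1 s0 :: real
  proof -
    have "l * x3 = l * a0 - l * a" using that(4) by (simp add: right_diff_distrib)
    then show ?thesis using that by linarith
  qed
  have "expectation (\<lambda>\<omega>. g \<omega> * (I T \<omega> - S m T \<omega>)) - expectation (\<lambda>\<omega>. g \<omega> * (I t0 \<omega> - S m t0 \<omega>))
      + l * expectation (\<lambda>\<omega>. g \<omega> * (A H \<omega> - A (h m) \<omega>))
     = expectation (\<lambda>\<omega>. g \<omega> * (I T \<omega> - I t0 \<omega>)) + l * expectation (\<lambda>\<omega>. g \<omega> * A H \<omega>)" for m
    unfolding right_diff_distrib
  proof (rule alg)
    show "expectation (\<lambda>\<omega>. g \<omega> * S m T \<omega> - g \<omega> * S m t0 \<omega>) = - l * expectation (\<lambda>\<omega>. g \<omega> * A (h m) \<omega>)"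
      using step[of m] unfolding right_diff_distrib .
  qed (rule Bochner_Integration.integral_diff gI[OF T] gI[OF t0] gS[OF T] gS[OF t0] gA[OF jH eH] gA[OF jh eh])+
  moreover have "(\<lambda>m. expectation (\<lambda>\<omega>. g \<omega> * (I T \<omega> - S m T \<omega>)) - expectation (\<lambda>\<omega>. g \<omega> * (I t0 \<omega> - S m t0 \<omega>))
      + l * expectation (\<lambda>\<omega>. g \<omega> * (A H \<omega> - A (h m) \<omega>))) \<longlonglongrightarrow> 0 - 0 + l * 0"
    by (intro tendsto_intros lim limA T t0)
  ultimately have "(\<lambda>m::nat. expectation (\<lambda>\<omega>. g \<omega> * (I T \<omega> - I t0 \<omega>)) + l * expectation (\<lambda>\<omega>. g \<omega> * A H \<omega>)) \<longlonglongrightarrow> 0"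
    by simp
  then have "expectation (\<lambda>\<omega>. g \<omega> * (I T \<omega> - I t0 \<omega>)) + l * expectation (\<lambda>\<omega>. g \<omega> * A H \<omega>) = 0"
    by (simp add: LIMSEQ_const_iff)
  then show "expectation (\<lambda>\<omega>. (Y l T \<omega> * \<eta> \<omega>) * (I T \<omega> - I t0 \<omega>))
      = - l * expectation (\<lambda>\<omega>. (Y l T \<omega> * \<eta> \<omega>) * (LBINT s:{t0..T}. H s \<omega>))"
    by (simp add: g_def A_def)
qed

text \<open>Since \<open>Y\<close> is a martingale, terminal and running state prices give an adapted consumption
  stream the same value.\<close>

lemma consumption_value:
  assumes pC: "prog_measurable T F C" and e: "energy T C < \<infinity>" and t0: "t0 \<in> {0..T}"
    and \<eta>: "\<eta> \<in> borel_measurable (F t0)" "\<forall>\<omega>\<in>space M. \<bar>\<eta> \<omega>\<bar> \<le> B"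
  shows "integrable M (\<lambda>\<omega>. (Y l T \<omega> * \<eta> \<omega>) * (LBINT s:{t0..T}. C s \<omega>))"
    and "integrable M (\<lambda>\<omega>. \<eta> \<omega> * (LBINT s:{t0..T}. Y l s \<omega> * C s \<omega>))"
    and "expectation (\<lambda>\<omega>. (Y l T \<omega> * \<eta> \<omega>) * (LBINT s:{t0..T}. C s \<omega>))
      = expectation (\<lambda>\<omega>. \<eta> \<omega> * (LBINT s:{t0..T}. Y l s \<omega> * C s \<omega>))"
proof -
  interpret pair_sigma_finite "leb T" M by (rule pair_sf)
  interpret leb: finite_measure "leb T" by (rule finite_measure_leb)
  have T: "T \<in> {0..T}" using T_pos by auto
  have \<eta>M: "\<eta> \<in> borel_measurable M" using F_meas_M[OF \<eta>(1) t0] .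
  have jC: "joint C" by (rule prog_joint[OF pC])
  have C2: "integrable PM (\<lambda>x. (C (fst x) (snd x))\<^sup>2)" by (rule energy_square_integrable[OF jC e])
  have jYT: "joint (\<lambda>_. Y l T)" by (intro joint_const Y_M) (use T in auto)
  have Ybd: "(\<integral>\<^sup>+\<omega>. ennreal ((Y l s \<omega>)\<^sup>2) \<partial>M) \<le> ennreal (exp (l\<^sup>2 * T))" if s: "s \<in> {0..T}" for s
  proof -
    have "(\<integral>\<^sup>+\<omega>. ennreal ((Y l s \<omega>)\<^sup>2) \<partial>M) = ennreal (exp (l\<^sup>2 * s))"
      using Y_square[OF s, of l] by (simp add: has_bochner_integral_iff nn_integral_eq_integral)
    then show ?thesis using s by (auto intro!: ennreal_leI mult_left_mono)
  qed
  define \<phi> where "\<phi> s \<omega> = indicator {t0..T} s * \<eta> \<omega>" for s and \<omega>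
  have j\<phi>: "joint \<phi>" unfolding \<phi>_def[abs_def] by (intro joint_mult joint_Icc joint_const \<eta>M)
  have prod: "integrable (leb T \<Otimes>\<^sub>M M) (\<lambda>(s, \<omega>). \<phi> s \<omega> * (K s \<omega> * C s \<omega>))"
    if jK: "joint K" and K: "\<And>s. s \<in> {0..T} \<Longrightarrow> (\<integral>\<^sup>+\<omega>. ennreal ((K s \<omega>)\<^sup>2) \<partial>M) \<le> ennreal D" for K D
  proof -
    have i: "integrable (leb T \<Otimes>\<^sub>M M) (\<lambda>x. K (fst x) (snd x) * C (fst x) (snd x))"
      by (rule energy_product_integrable[OF jK le_less_trans[OF energy_bounded[OF jK K]] jC e])
        (simp_all add: ennreal_mult_less_top)
    have "integrable (leb T \<Otimes>\<^sub>M M) (\<lambda>x. \<phi> (fst x) (snd x) * (K (fst x) (snd x) * C (fst x) (snd x)))"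
    proof (rule Bochner_Integration.integrable_bound)
      show "integrable (leb T \<Otimes>\<^sub>M M) (\<lambda>x. B * \<bar>K (fst x) (snd x) * C (fst x) (snd x)\<bar>)" using i by auto
      show "(\<lambda>x. \<phi> (fst x) (snd x) * (K (fst x) (snd x) * C (fst x) (snd x))) \<in> borel_measurable (leb T \<Otimes>\<^sub>M M)"
        by (intro borel_measurable_times jointD j\<phi> jK jC)
      show "AE x in leb T \<Otimes>\<^sub>M M. norm (\<phi> (fst x) (snd x) * (K (fst x) (snd x) * C (fst x) (snd x)))
          \<le> norm (B * \<bar>K (fst x) (snd x) * C (fst x) (snd x)\<bar>)"
      proof (rule AE_I2)
        fix x assume "x \<in> space (leb T \<Otimes>\<^sub>M M)"
        then have "\<bar>\<eta> (snd x)\<bar> \<le> B" using \<eta>(2) by (auto simp: space_pair_measure)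
        then have "\<bar>\<phi> (fst x) (snd x)\<bar> \<le> \<bar>B\<bar>" by (auto simp: \<phi>_def indicator_def)
        then show "norm (\<phi> (fst x) (snd x) * (K (fst x) (snd x) * C (fst x) (snd x)))
          \<le> norm (B * \<bar>K (fst x) (snd x) * C (fst x) (snd x)\<bar>)"
          unfolding real_norm_def abs_mult[of "\<phi> _ _"] abs_mult[of B] abs_idempotent by (intro mult_right_mono) auto
      qed
    qed
    then show ?thesis by (simp add: case_prod_beta')
  qed
  have p1: "integrable (leb T \<Otimes>\<^sub>M M) (\<lambda>(s, \<omega>). \<phi> s \<omega> * (Y l T \<omega> * C s \<omega>))"
    by (rule prod[OF jYT]) (rule Ybd[OF T])
  have p2: "integrable (leb T \<Otimes>\<^sub>M M) (\<lambda>(s, \<omega>). \<phi> s \<omega> * (Y l s \<omega> * C s \<omega>))"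
    by (rule prod[OF joint_Y]) (rule Ybd)
  have i1: "(\<integral>s. \<phi> s \<omega> * (Y l T \<omega> * C s \<omega>) \<partial>leb T) = (Y l T \<omega> * \<eta> \<omega>) * (LBINT s:{t0..T}. C s \<omega>)" for \<omega>
    using t0 unfolding set_integral_sub_leb[of T T t0, OF order_refl conjunct1[OF t0[unfolded atLeastAtMost_iff]]]
    by (simp add: \<phi>_def mult_ac flip: Bochner_Integration.integral_mult_right_zero)
  have i2: "(\<integral>s. \<phi> s \<omega> * (Y l s \<omega> * C s \<omega>) \<partial>leb T) = \<eta> \<omega> * (LBINT s:{t0..T}. Y l s \<omega> * C s \<omega>)" for \<omega>
    using t0 unfolding set_integral_sub_leb[of T T t0, OF order_refl conjunct1[OF t0[unfolded atLeastAtMost_iff]]]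
    by (simp add: \<phi>_def mult_ac flip: Bochner_Integration.integral_mult_right_zero)
  show "integrable M (\<lambda>\<omega>. (Y l T \<omega> * \<eta> \<omega>) * (LBINT s:{t0..T}. C s \<omega>))"
    using integrable_snd[OF p1] unfolding i1 .
  show "integrable M (\<lambda>\<omega>. \<eta> \<omega> * (LBINT s:{t0..T}. Y l s \<omega> * C s \<omega>))"
    using integrable_snd[OF p2] unfolding i2 .
  have "AE s in leb T. integrable M (\<lambda>\<omega>. (C s \<omega>)\<^sup>2)"
    using AE_integrable_fst[of "\<lambda>s \<omega>. (C s \<omega>)\<^sup>2"] C2 by (simp add: case_prod_beta')
  with AE_space have ae: "AE s in leb T. (\<integral>\<omega>. \<phi> s \<omega> * (Y l T \<omega> * C s \<omega>) \<partial>M) = (\<integral>\<omega>. \<phi> s \<omega> * (Y l s \<omega> * C s \<omega>) \<partial>M)"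
  proof eventually_elim
    case (elim s)
    then have s: "s \<in> {0..T}" by simp
    show ?case
    proof (cases "t0 \<le> s")
      case True
      have CM: "C s \<in> borel_measurable M" by (rule prog_section_M[OF pC s])
      have "(\<lambda>\<omega>. \<eta> \<omega> * C s \<omega>) \<in> borel_measurable (F s)"
      proof (rule borel_measurable_times)
        show "\<eta> \<in> borel_measurable (F s)" by (rule F_mono[OF \<eta>(1)]) (use True s t0 in auto)
        show "C s \<in> borel_measurable (F s)" by (rule prog_section[OF pC s])
      qed
      moreover have "integrable M (\<lambda>\<omega>. Y l s \<omega> * (\<eta> \<omega> * C s \<omega>))"
        using integrable_mult_square[OF _ CM Y_bounded_square[OF s \<eta>M \<eta>(2), of l] elim(2)] Y_M[of s l] s \<eta>M
        by (simp add: mult.assoc)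
      ultimately have "has_bochner_integral M (\<lambda>\<omega>. Y l T \<omega> * (\<eta> \<omega> * C s \<omega>)) (\<integral>\<omega>. Y l s \<omega> * (\<eta> \<omega> * C s \<omega>) \<partial>M)"
        using s by (intro Y_martingale) auto
      from has_bochner_integral_integral_eq[OF this] show ?thesis using True s
        by (simp add: \<phi>_def mult.left_commute)
    qed (simp add: \<phi>_def)
  qed
  have "expectation (\<lambda>\<omega>. (Y l T \<omega> * \<eta> \<omega>) * (LBINT s:{t0..T}. C s \<omega>)) = (\<integral>s. (\<integral>\<omega>. \<phi> s \<omega> * (Y l T \<omega> * C s \<omega>) \<partial>M) \<partial>leb T)"
    unfolding i1[symmetric] integral_snd[OF p1] integral_fst[OF p1] ..
  also have "\<dots> = (\<integral>s. (\<integral>\<omega>. \<phi> s \<omega> * (Y l s \<omega> * C s \<omega>) \<partial>M) \<partial>leb T)"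
    using integrable_fst[OF p1] integrable_fst[OF p2] ae by (intro integral_cong_AE) auto
  also have "\<dots> = expectation (\<lambda>\<omega>. \<eta> \<omega> * (LBINT s:{t0..T}. Y l s \<omega> * C s \<omega>))"
    unfolding i2[symmetric] integral_snd[OF p2] integral_fst[OF p2] ..
  finally show "expectation (\<lambda>\<omega>. (Y l T \<omega> * \<eta> \<omega>) * (LBINT s:{t0..T}. C s \<omega>))
      = expectation (\<lambda>\<omega>. \<eta> \<omega> * (LBINT s:{t0..T}. Y l s \<omega> * C s \<omega>))" .
qed

text \<open>The budget equation: on an event on which the type is known, discounted wealth plus
  accumulated discounted consumption is a martingale.\<close>

lemma budget:
  assumes w: "wealth M T F W x0 \<mu> \<sigma> P C X" and adm: "admissible M T F P C" and t0: "t0 \<in> {0..T}"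
    and A: "A \<in> sets (F t0)" "\<forall>\<omega>\<in>A. \<mu> \<omega> = m \<and> \<sigma> \<omega> = s" and s: "s \<noteq> 0"
  shows "integrable M (\<lambda>\<omega>. indicator A \<omega> * (LBINT r:{t0..T}. Y (m / s) r \<omega> * C r \<omega>))"
    and "integrable M (\<lambda>\<omega>. indicator A \<omega> * (Y (m / s) T \<omega> * (X T \<omega> - X t0 \<omega>)))"
    and "expectation (\<lambda>\<omega>. indicator A \<omega> * (LBINT r:{t0..T}. Y (m / s) r \<omega> * C r \<omega>))
      + expectation (\<lambda>\<omega>. indicator A \<omega> * (Y (m / s) T \<omega> * (X T \<omega> - X t0 \<omega>))) = 0"
proof -
  define l where "l = m / s"
  have T: "T \<in> {0..T}" using T_pos by auto
  obtain I where ito: "ito_integral M T F W (\<lambda>s \<omega>. P s \<omega> * \<sigma> \<omega>) I"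
    and X: "AE \<omega> in M. \<forall>t\<in>{0..T}. X t \<omega> = x0 + (LBINT s:{0..t}. P s \<omega> * \<mu> \<omega>) + I t \<omega> - (LBINT s:{0..t}. C s \<omega>)"
    and int: "AE \<omega> in M. set_integrable lborel {0..T} (\<lambda>s. P s \<omega> * \<mu> \<omega>)" "AE \<omega> in M. set_integrable lborel {0..T} (\<lambda>s. C s \<omega>)"
    and pX: "prog_measurable T F X"
    using w unfolding wealth_def by blast
  have \<eta>: "(indicator A :: 'a \<Rightarrow> real) \<in> borel_measurable (F t0)" "\<forall>\<omega>\<in>space M. \<bar>indicator A \<omega> :: real\<bar> \<le> 1"
    using A by (auto simp: indicator_def)
  have AM: "A \<in> sets M" using A(1) subalg[OF t0] by (auto simp: subalgebra_def)
  note d = ito_duality[OF ito t0 \<eta>, of l]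
  note c = consumption_value[OF admissible_consumption(1,3)[OF adm] t0 \<eta>, of l]
  show 1: "integrable M (\<lambda>\<omega>. indicator A \<omega> * (LBINT r:{t0..T}. Y (m / s) r \<omega> * C r \<omega>))"
    using c(2) by (simp add: l_def)
  have ae: "AE \<omega> in M. l * ((Y l T \<omega> * indicator A \<omega>) * (LBINT r:{t0..T}. P r \<omega> * \<sigma> \<omega>))
      + (Y l T \<omega> * indicator A \<omega>) * (I T \<omega> - I t0 \<omega>) - (Y l T \<omega> * indicator A \<omega>) * (LBINT r:{t0..T}. C r \<omega>)
      = indicator A \<omega> * (Y l T \<omega> * (X T \<omega> - X t0 \<omega>))"
    using X int
  proof eventually_elim
    case (elim \<omega>)
    show ?case
    proof (cases "\<omega> \<in> A")
      case True
      then have ms: "\<mu> \<omega> = m" "\<sigma> \<omega> = s" using A by auto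
      have t: "0 \<le> t0" "t0 \<le> T" using t0 by auto
      have "(LBINT r:{t0..T}. P r \<omega> * \<mu> \<omega>) = (LBINT r:{t0..T}. l * (P r \<omega> * \<sigma> \<omega>))"
        using s by (simp add: ms l_def)
      then have "(LBINT r:{t0..T}. P r \<omega> * \<mu> \<omega>) = l * (LBINT r:{t0..T}. P r \<omega> * \<sigma> \<omega>)" by simp
      moreover have "X T \<omega> - X t0 \<omega> = (LBINT r:{t0..T}. P r \<omega> * \<mu> \<omega>) + (I T \<omega> - I t0 \<omega>) - (LBINT r:{t0..T}. C r \<omega>)"
        using elim(1) T t0 set_integral_split[OF elim(2) t] set_integral_split[OF elim(3) t] by simp
      ultimately have x: "X T \<omega> - X t0 \<omega> = l * (LBINT r:{t0..T}. P r \<omega> * \<sigma> \<omega>) + (I T \<omega> - I t0 \<omega>) - (LBINT r:{t0..T}. C r \<omega>)"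
        by simp
      show ?thesis unfolding x using True by (simp add: algebra_simps)
    qed simp
  qed
  have li: "integrable M (\<lambda>\<omega>. l * ((Y l T \<omega> * indicator A \<omega>) * (LBINT r:{t0..T}. P r \<omega> * \<sigma> \<omega>))
      + (Y l T \<omega> * indicator A \<omega>) * (I T \<omega> - I t0 \<omega>) - (Y l T \<omega> * indicator A \<omega>) * (LBINT r:{t0..T}. C r \<omega>))"
    by (intro Bochner_Integration.integrable_diff Bochner_Integration.integrable_add
      Bochner_Integration.integrable_mult_right d c)
  have meas: "(\<lambda>\<omega>. indicator A \<omega> * (Y l T \<omega> * (X T \<omega> - X t0 \<omega>))) \<in> borel_measurable M"
    using AM T t0 by (intro borel_measurable_times borel_measurable_diff Y_M prog_section_M[OF pX]) auto
  show 2: "integrable M (\<lambda>\<omega>. indicator A \<omega> * (Y (m / s) T \<omega> * (X T \<omega> - X t0 \<omega>)))"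
    using integrable_cong_AE_imp[OF li meas] ae by (simp add: l_def eq_commute)
  have "expectation (\<lambda>\<omega>. indicator A \<omega> * (Y l T \<omega> * (X T \<omega> - X t0 \<omega>)))
     = expectation (\<lambda>\<omega>. l * ((Y l T \<omega> * indicator A \<omega>) * (LBINT r:{t0..T}. P r \<omega> * \<sigma> \<omega>))
      + (Y l T \<omega> * indicator A \<omega>) * (I T \<omega> - I t0 \<omega>) - (Y l T \<omega> * indicator A \<omega>) * (LBINT r:{t0..T}. C r \<omega>))"
    using ae li meas by (intro integral_cong_AE) auto
  also have "\<dots> = l * expectation (\<lambda>\<omega>. (Y l T \<omega> * indicator A \<omega>) * (LBINT r:{t0..T}. P r \<omega> * \<sigma> \<omega>))
      + expectation (\<lambda>\<omega>. (Y l T \<omega> * indicator A \<omega>) * (I T \<omega> - I t0 \<omega>))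
      - expectation (\<lambda>\<omega>. (Y l T \<omega> * indicator A \<omega>) * (LBINT r:{t0..T}. C r \<omega>))"
    using Bochner_Integration.integral_diff[OF Bochner_Integration.integrable_add[OF
        Bochner_Integration.integrable_mult_right[OF d(2), of l] d(1)] c(1)]
      Bochner_Integration.integral_add[OF Bochner_Integration.integrable_mult_right[OF d(2), of l] d(1)]
    by simp
  also have "\<dots> = - expectation (\<lambda>\<omega>. indicator A \<omega> * (LBINT r:{t0..T}. Y l r \<omega> * C r \<omega>))"
    using d(3) c(3) by simp
  finally show "expectation (\<lambda>\<omega>. indicator A \<omega> * (LBINT r:{t0..T}. Y (m / s) r \<omega> * C r \<omega>))
      + expectation (\<lambda>\<omega>. indicator A \<omega> * (Y (m / s) T \<omega> * (X T \<omega> - X t0 \<omega>))) = 0"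
    by (simp add: l_def)
qed

end

context brownian_setup
begin

section \<open>The integral of a deterministic linear integrand\<close>

lemma prog_integral_F:
  assumes "prog_measurable T F H" "t \<in> {0..T}"
  shows "(\<lambda>\<omega>. LBINT s:{0..t}. H s \<omega>) \<in> borel_measurable (F t)"
proof -
  interpret leb: sigma_finite_measure "leb t" by (rule sigma_finite_leb)
  have "(\<lambda>(s, \<omega>). H s \<omega>) \<in> borel_measurable (restrict_space borel {0..t} \<Otimes>\<^sub>M F t)"
    using assms by (simp add: prog_measurable_def)
  also have "borel_measurable (restrict_space borel {0..t} \<Otimes>\<^sub>M F t) = borel_measurable (leb t \<Otimes>\<^sub>M F t)"
    by (intro measurable_cong_sets sets_pair_measure_cong sets_leb[symmetric] refl)
  finally have "(\<lambda>(s, \<omega>). H s \<omega>) \<in> borel_measurable (leb t \<Otimes>\<^sub>M F t)" .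
  from measurable_compose[OF measurable_pair_swap'[of "F t" "leb t"] this]
  have "(\<lambda>(\<omega>, s). H s \<omega>) \<in> borel_measurable (F t \<Otimes>\<^sub>M leb t)"
    by (simp add: case_prod_beta')
  from leb.borel_measurable_lebesgue_integral[OF this] show ?thesis by (simp add: set_integral_leb)
qed

lemma prog_add: "prog_measurable T F H \<Longrightarrow> prog_measurable T F K \<Longrightarrow> prog_measurable T F (\<lambda>s \<omega>. H s \<omega> + K s \<omega>)"
  and prog_mult: "prog_measurable T F H \<Longrightarrow> prog_measurable T F K \<Longrightarrow> prog_measurable T F (\<lambda>s \<omega>. H s \<omega> * K s \<omega>)"
  unfolding prog_measurable_def case_prod_beta'
  by (rule ballI, rule borel_measurable_add borel_measurable_times,
      erule (1) bspec, erule (1) bspec)+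

lemma prog_det: "continuous_on {0..T} f \<Longrightarrow> prog_measurable T F (\<lambda>s _. f s)"
  by (rule continuous_adapted_prog) auto

lemma prog_const:
  assumes c: "c \<in> borel_measurable (F 0)"
  shows "prog_measurable T F (\<lambda>_. c)"
proof (rule continuous_adapted_prog)
  show "c \<in> borel_measurable (F t)" if "t \<in> {0..T}" for t
    by (rule F_mono[OF c]) (use that in auto)
qed auto

lemma prog_W: "prog_measurable T F W"
  by (rule continuous_adapted_prog[OF W_F W_cont]) simp_all

lemma W_increment_square:
  assumes "0 \<le> r" "r \<le> p" "p \<le> T"
  shows "(\<integral>\<^sup>+\<omega>. ennreal ((W r \<omega> - W p \<omega>)\<^sup>2) \<partial>M) = ennreal (p - r)"
proof -
  have "has_bochner_integral M (\<lambda>\<omega>. 1 * (W p \<omega> - W r \<omega>)\<^sup>2) (expectation (\<lambda>_. 1) * (p - r))"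
    using assms by (intro increment_variance) auto
  then have "has_bochner_integral M (\<lambda>\<omega>. (W r \<omega> - W p \<omega>)\<^sup>2) (p - r)"
    by (simp add: prob_space power2_commute)
  then show ?thesis by (simp add: has_bochner_integral_iff nn_integral_eq_integral)
qed

lemma energy_W: "energy T W \<le> ennreal T * ennreal T"
proof (rule energy_bounded[OF joint_W])
  fix s assume s: "s \<in> {0..T}"
  have "(\<integral>\<^sup>+\<omega>. ennreal ((W s \<omega>)\<^sup>2) \<partial>M) = (\<integral>\<^sup>+\<omega>. ennreal ((W 0 \<omega> - W s \<omega>)\<^sup>2) \<partial>M)"
    by (intro nn_integral_cong) (simp add: W_0)
  also have "\<dots> = ennreal (s - 0)" using s by (intro W_increment_square) auto
  finally show "(\<integral>\<^sup>+\<omega>. ennreal ((W s \<omega>)\<^sup>2) \<partial>M) \<le> ennreal T" using s by (simp add: ennreal_leI)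
qed

text \<open>The integral is over an interval of length \<open>v - u\<close> on which the increment has variance at most
  \<open>v - u\<close>; Cauchy-Schwarz supplies the third factor.\<close>

lemma W_average_square:
  assumes u: "0 \<le> u" "u \<le> v" "v \<le> T"
  shows "(\<integral>\<^sup>+\<omega>. ennreal ((LBINT r:{u..v}. W r \<omega> - W v \<omega>)\<^sup>2) \<partial>M) \<le> ennreal ((v - u) ^ 3)"
proof -
  let ?K = "\<lambda>r \<omega>. indicator {u..v} r * (W r \<omega> - W v \<omega>)"
  have j: "joint (\<lambda>r \<omega>. W r \<omega> - W v \<omega>)"
    using u by (intro joint_diff joint_W joint_const W_M) auto
  have jK: "joint ?K" by (intro joint_mult joint_Icc j)
  have "(\<integral>\<^sup>+\<omega>. (\<integral>\<^sup>+r\<in>{u..v}. ennreal ((W r \<omega> - W v \<omega>)\<^sup>2) \<partial>lborel) \<partial>M) = (\<integral>\<^sup>+\<omega>. (\<integral>\<^sup>+r. ennreal ((?K r \<omega>)\<^sup>2) \<partial>leb T) \<partial>M)"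
    unfolding nn_integral_leb using u by (intro nn_integral_cong) (auto simp: indicator_def)
  also have "\<dots> = (\<integral>\<^sup>+x. ennreal ((?K (fst x) (snd x))\<^sup>2) \<partial>(leb T \<Otimes>\<^sub>M M))"
    using pair_sigma_finite.nn_integral_snd[OF pair_sf, of "\<lambda>x. ennreal ((?K (fst x) (snd x))\<^sup>2)"] jointD[OF jK] by simp
  also have "\<dots> = (\<integral>\<^sup>+r. (\<integral>\<^sup>+\<omega>. ennreal ((?K r \<omega>)\<^sup>2) \<partial>M) \<partial>leb T)"
    using nn_integral_fst[of "\<lambda>x. ennreal ((?K (fst x) (snd x))\<^sup>2)" "leb T"] jointD[OF jK] by simp
  also have "\<dots> \<le> (\<integral>\<^sup>+r. ennreal (v - u) * indicator {u..v} r \<partial>leb T)"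
  proof (rule nn_integral_mono)
    fix r assume "r \<in> space (leb T)"
    show "(\<integral>\<^sup>+\<omega>. ennreal ((?K r \<omega>)\<^sup>2) \<partial>M) \<le> ennreal (v - u) * indicator {u..v} r"
    proof (cases "r \<in> {u..v}")
      case True
      then have "(\<integral>\<^sup>+\<omega>. ennreal ((?K r \<omega>)\<^sup>2) \<partial>M) = ennreal (v - r)"
        using W_increment_square[of r v] u by simp
      then show ?thesis using True by (simp add: ennreal_leI)
    qed simp
  qed
  also have "\<dots> = ennreal (v - u) * (\<integral>\<^sup>+r. indicator {u..v} r \<partial>lborel)"
  proof -
    have "(\<integral>\<^sup>+r. ennreal (v - u) * indicator {u..v} r \<partial>leb T) = (\<integral>\<^sup>+r. ennreal (v - u) * indicator {u..v} r \<partial>lborel)"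
      unfolding nn_integral_leb using u by (intro nn_integral_cong) (auto simp: indicator_def)
    then show ?thesis by (simp add: nn_integral_cmult)
  qed
  also have "\<dots> = ennreal ((v - u) * (v - u))"
    using u by (simp add: emeasure_lborel_Icc_eq ennreal_mult)
  finally have i: "(\<integral>\<^sup>+\<omega>. (\<integral>\<^sup>+r\<in>{u..v}. ennreal ((W r \<omega> - W v \<omega>)\<^sup>2) \<partial>lborel) \<partial>M) \<le> ennreal ((v - u) * (v - u))" .
  have "(\<integral>\<^sup>+\<omega>. ennreal ((LBINT r:{u..v}. W r \<omega> - W v \<omega>)\<^sup>2) \<partial>M)
      \<le> ennreal (v - u) * (\<integral>\<^sup>+\<omega>. (\<integral>\<^sup>+r\<in>{u..v}. ennreal ((W r \<omega> - W v \<omega>)\<^sup>2) \<partial>lborel) \<partial>M)"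
    by (rule square_integral_le_energy[OF j u])
  also have "\<dots> \<le> ennreal (v - u) * ennreal ((v - u) * (v - u))" by (intro mult_left_mono i) simp
  also have "\<dots> = ennreal ((v - u) ^ 3)"
    using u by (simp add: ennreal_mult[symmetric] power3_eq_cube mult.assoc)
  finally show ?thesis .
qed

lemma W_path_integrable:
  assumes "\<omega> \<in> space M" "0 \<le> u" "v \<le> T"
  shows "set_integrable lborel {u..v} (\<lambda>r. W r \<omega>)"
  by (rule borel_integrable_atLeastAtMost'[OF continuous_on_subset[OF W_cont[OF assms(1)]]])
    (use assms in auto)

text \<open>\<open>primitive\<close> is \<open>\<integral>\<^sub>0 (T + 1 - s) dW\<^sub>s\<close> after integration by parts.\<close>

definition primitive :: "real \<Rightarrow> 'a \<Rightarrow> real" where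
  "primitive t \<omega> = (T + 1 - t) * W t \<omega> + (LBINT r:{0..t}. W r \<omega>)"

lemma primitive_0: "\<omega> \<in> space M \<Longrightarrow> primitive 0 \<omega> = 0"
  using set_integral_eq_HK[of 0 0 "\<lambda>r. W r \<omega>"] by (simp add: primitive_def W_0)

lemma primitive_increment:
  assumes \<omega>: "\<omega> \<in> space M" and u: "0 \<le> u" "u \<le> v" "v \<le> T"
  shows "primitive v \<omega> - primitive u \<omega> - (T + 1 - u) * (W v \<omega> - W u \<omega>) = (LBINT r:{u..v}. W r \<omega> - W v \<omega>)"
proof -
  have 1: "(LBINT r:{0..v}. W r \<omega>) = (LBINT r:{0..u}. W r \<omega>) + (LBINT r:{u..v}. W r \<omega>)"
    using u by (intro set_integral_split W_path_integrable \<omega>) auto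
  have c: "set_integrable lborel {u..v} (\<lambda>r. W v \<omega>)"
    by (intro borel_integrable_atLeastAtMost' continuous_intros)
  have 2: "(LBINT r:{u..v}. W r \<omega> - W v \<omega>) = (LBINT r:{u..v}. W r \<omega>) - (LBINT r:{u..v}. W v \<omega>)"
    using u by (intro set_integral_diff W_path_integrable \<omega> c) auto
  have 3: "(LBINT r:{u..v}. W v \<omega>) = (v - u) * W v \<omega>"
    using u by (subst set_integral_eq_HK) auto
  show ?thesis unfolding primitive_def 1 2 3 by (simp add: algebra_simps)
qed

lemma primitive_cont: "\<omega> \<in> space M \<Longrightarrow> continuous_on {0..T} (\<lambda>t. primitive t \<omega>)"
proof -
  assume \<omega>: "\<omega> \<in> space M"
  have c: "continuous_on {0..T} (\<lambda>t. (T + 1 - t) * W t \<omega> + integral {0..t} (\<lambda>r. W r \<omega>))"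
    by (intro continuous_intros W_cont[OF \<omega>] DERIV_continuous_on[OF integral_has_real_derivative[OF W_cont[OF \<omega>]]])
  have eq: "(LBINT r:{0..t}. W r \<omega>) = integral {0..t} (\<lambda>r. W r \<omega>)" if "t \<in> {0..T}" for t
    using that by (intro set_integral_eq_HK continuous_on_subset[OF W_cont[OF \<omega>]]) auto
  show ?thesis by (rule continuous_on_eq[OF c]) (simp add: primitive_def eq)
qed

lemma primitive_F: "t \<in> {0..T} \<Longrightarrow> primitive t \<in> borel_measurable (F t)"
  unfolding primitive_def[abs_def]
  using W_F[of t t] prog_integral_F[OF prog_W, of t] by simp

lemma indicator_partition:
  fixes \<tau> :: "nat \<Rightarrow> real"
  assumes "\<And>i. \<tau> i \<le> \<tau> (Suc i)"
  shows "(\<Sum>i<n. indicator {\<tau> i<..\<tau> (Suc i)} s) = (indicator {\<tau> 0<..\<tau> n} s :: real)"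
proof (induction n)
  case (Suc n)
  have "\<tau> 0 \<le> \<tau> n" using assms by (rule lift_Suc_mono_le) simp
  then show ?case using Suc assms[of n] by (auto simp: indicator_def)
qed simp

text \<open>On each interval of a partition of mesh \<open>T / n\<close>, the increment of \<open>primitive\<close> and the corresponding
  term of the Riemann sum differ by an integral of Brownian increments (\<open>primitive_increment\<close>), of second
  moment at most \<open>(T / n)\<^sup>3\<close>. Summing \<open>n\<close> of these errors costs at most a factor \<open>n\<^sup>2\<close> in the second
  moment, which leaves \<open>T\<^sup>3 / n\<close>.\<close>

lemma ito_linear_integrand:
  assumes c: "c \<in> borel_measurable (F 0)" and B: "AE \<omega> in M. \<bar>c \<omega>\<bar> \<le> B"
    and "prog_measurable T F H" and H: "AE \<omega> in M. \<forall>s\<in>{0..T}. H s \<omega> = c \<omega> * (T + 1 - s)"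
  shows "ito_integral M T F W H (\<lambda>t \<omega>. c \<omega> * primitive t \<omega>)"
  unfolding ito_integral_def
proof (intro conjI)
  show "prog_measurable T F H" by fact
  show pI: "prog_measurable T F (\<lambda>t \<omega>. c \<omega> * primitive t \<omega>)"
    by (intro prog_mult prog_const c continuous_adapted_prog primitive_F primitive_cont)
  show "AE \<omega> in M. continuous_on {0..T} (\<lambda>t. c \<omega> * primitive t \<omega>)"
    by (intro AE_I2 continuous_intros primitive_cont)
  define B' where "B' = \<bar>B\<bar>"
  \<comment> \<open>The coefficients of simple integrands have to be bounded everywhere.\<close>
  define c' where "c' \<omega> = (if \<bar>c \<omega>\<bar> \<le> B' then c \<omega> else 0)" for \<omega>
  have c'F: "c' \<in> borel_measurable (F 0)" unfolding c'_def[abs_def] using c by measurable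
  have c'b: "\<bar>c' \<omega>\<bar> \<le> B'" for \<omega> by (auto simp: c'_def B'_def)
  have c'c: "AE \<omega> in M. c \<omega> = c' \<omega>" using B by eventually_elim (auto simp: c'_def B'_def)
  define n where "n m = Suc m" for m :: nat
  define \<Delta> where "\<Delta> m = T / real (n m)" for m
  define \<tau> where "\<tau> m i = \<Delta> m * real i" for m i
  define \<xi> where "\<xi> m i \<omega> = c' \<omega> * (T + 1 - \<tau> m i)" for m i and \<omega>
  have \<Delta>: "0 < \<Delta> m" for m using T_pos by (simp add: \<Delta>_def n_def)
  have \<tau>n: "\<tau> m (n m) = T" "\<tau> m 0 = 0" for m by (simp_all add: \<tau>_def \<Delta>_def n_def)
  have \<tau>s: "\<tau> m (Suc i) = \<tau> m i + \<Delta> m" for m i by (simp add: \<tau>_def algebra_simps)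
  have \<tau>m: "\<tau> m i \<le> \<tau> m (Suc i)" for m i using \<Delta>[of m] by (simp add: \<tau>s)
  have \<tau>p: "0 \<le> \<tau> m i" for m i using \<Delta>[of m] by (simp add: \<tau>_def)
  have \<tau>T: "\<tau> m i \<le> T" if "i \<le> n m" for m i
    using that \<Delta>[of m] \<tau>n(1)[of m] unfolding \<tau>_def by (metis mult_left_mono of_nat_mono less_imp_le)
  show "\<exists>n \<tau> \<xi>. (\<forall>m. simple_integrand M T F (n m) (\<tau> m) (\<xi> m)) \<and>
      (\<lambda>m. \<integral>\<^sup>+\<omega>. (\<integral>\<^sup>+s\<in>{0..T}. ennreal ((H s \<omega> - simple_process (n m) (\<tau> m) (\<xi> m) s \<omega>)\<^sup>2) \<partial>lborel) \<partial>M) \<longlonglongrightarrow> 0 \<and>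
      (\<forall>t\<in>{0..T}. (\<lambda>m. \<integral>\<^sup>+\<omega>. ennreal ((c \<omega> * primitive t \<omega> - simple_integral W (n m) (\<tau> m) (\<xi> m) t \<omega>)\<^sup>2) \<partial>M) \<longlonglongrightarrow> 0)"
  proof (intro exI conjI allI ballI)
    show "simple_integrand M T F (n m) (\<tau> m) (\<xi> m)" for m
      unfolding simple_integrand_def
    proof (intro conjI allI impI)
      show "0 \<le> \<tau> m 0" "\<tau> m (n m) \<le> T" by (simp_all add: \<tau>n)
      fix i assume i: "i < n m"
      show "\<tau> m i \<le> \<tau> m (Suc i)" by (rule \<tau>m)
      have "c' \<in> borel_measurable (F (\<tau> m i))"
        using i by (intro F_mono[OF c'F] \<tau>p \<tau>T) auto
      then show "\<xi> m i \<in> borel_measurable (F (\<tau> m i))" unfolding \<xi>_def[abs_def] by simp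
      show "\<exists>B. \<forall>\<omega>\<in>space M. \<bar>\<xi> m i \<omega>\<bar> \<le> B"
        using c'b by (intro exI[of _ "B' * \<bar>T + 1 - \<tau> m i\<bar>"]) (auto simp: \<xi>_def abs_mult intro: mult_right_mono)
    qed
    have lim: "(\<lambda>m. ennreal (D / real (Suc m))) \<longlonglongrightarrow> 0" for D
    proof -
      have "(\<lambda>m. D * inverse (real (Suc m))) \<longlonglongrightarrow> D * 0"
        by (intro tendsto_mult tendsto_const LIMSEQ_inverse_real_of_nat)
      then have "(\<lambda>m. ennreal (D / real (Suc m))) \<longlonglongrightarrow> ennreal 0"
        by (intro tendsto_ennrealI) (simp add: divide_inverse)
      then show ?thesis by simp
    qed
    have e: "(\<integral>\<^sup>+\<omega>. (\<integral>\<^sup>+s\<in>{0..T}. ennreal ((H s \<omega> - simple_process (n m) (\<tau> m) (\<xi> m) s \<omega>)\<^sup>2) \<partial>lborel) \<partial>M)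
        \<le> ennreal (T * (B' * T)\<^sup>2 / real (Suc m))" for m
    proof -
      have "(\<integral>\<^sup>+\<omega>. (\<integral>\<^sup>+s\<in>{0..T}. ennreal ((H s \<omega> - simple_process (n m) (\<tau> m) (\<xi> m) s \<omega>)\<^sup>2) \<partial>lborel) \<partial>M)
          \<le> (\<integral>\<^sup>+\<omega>. ennreal (T * (B' * \<Delta> m)\<^sup>2) \<partial>M)"
      proof (rule nn_integral_mono_AE)
        show "AE \<omega> in M. (\<integral>\<^sup>+s\<in>{0..T}. ennreal ((H s \<omega> - simple_process (n m) (\<tau> m) (\<xi> m) s \<omega>)\<^sup>2) \<partial>lborel)
            \<le> ennreal (T * (B' * \<Delta> m)\<^sup>2)"
          using c'c H
        proof eventually_elim
          case (elim \<omega>)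
          have pt: "(H s \<omega> - simple_process (n m) (\<tau> m) (\<xi> m) s \<omega>)\<^sup>2 \<le> (B' * \<Delta> m)\<^sup>2" if s: "s \<in> {0..T}" "s \<noteq> 0" for s
          proof -
            let ?i = "\<lambda>i. indicator {\<tau> m i<..\<tau> m (Suc i)} s :: real"
            have one: "(\<Sum>i<n m. ?i i) = 1"
              using indicator_partition[of "\<tau> m", OF \<tau>m, of s "n m"] s by (simp add: \<tau>n)
            have "H s \<omega> = (\<Sum>i<n m. c' \<omega> * (T + 1 - s) * ?i i)"
              unfolding sum_distrib_left[symmetric] one using elim s by simp
            then have "H s \<omega> - simple_process (n m) (\<tau> m) (\<xi> m) s \<omega> = (\<Sum>i<n m. c' \<omega> * (\<tau> m i - s) * ?i i)"
              unfolding simple_process_def \<xi>_def by (simp only: sum_subtractf[symmetric]) (simp add: algebra_simps)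
            also have "\<bar>\<dots>\<bar> \<le> (\<Sum>i<n m. \<bar>c' \<omega> * (\<tau> m i - s) * ?i i\<bar>)" by (rule sum_abs)
            also have "\<dots> \<le> (\<Sum>i<n m. (B' * \<Delta> m) * ?i i)"
            proof (rule sum_mono)
              fix i
              have "\<bar>c' \<omega>\<bar> * \<bar>\<tau> m i - s\<bar> \<le> B' * \<Delta> m" if "\<tau> m i < s" "s \<le> \<tau> m (Suc i)"
                using that c'b \<Delta>[of m] by (intro mult_mono) (auto simp: \<tau>s B'_def)
              then show "\<bar>c' \<omega> * (\<tau> m i - s) * ?i i\<bar> \<le> (B' * \<Delta> m) * ?i i"
                by (auto simp: indicator_def abs_mult)
            qed
            also have "\<dots> = B' * \<Delta> m" unfolding sum_distrib_left[symmetric] one by simp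
            finally show ?thesis using abs_le_square_iff[of _ "B' * \<Delta> m"] by (simp add: abs_le_square_iff[symmetric])
          qed
          have "(\<integral>\<^sup>+s\<in>{0..T}. ennreal ((H s \<omega> - simple_process (n m) (\<tau> m) (\<xi> m) s \<omega>)\<^sup>2) \<partial>lborel)
              \<le> (\<integral>\<^sup>+s. ennreal ((B' * \<Delta> m)\<^sup>2) * indicator {0..T} s \<partial>lborel)"
          proof (rule nn_integral_mono_AE)
            show "AE s in lborel. ennreal ((H s \<omega> - simple_process (n m) (\<tau> m) (\<xi> m) s \<omega>)\<^sup>2) * indicator {0..T} s
                \<le> ennreal ((B' * \<Delta> m)\<^sup>2) * indicator {0..T} s"
              using AE_lborel_singleton[of 0]
              by eventually_elim (auto simp: indicator_def intro!: ennreal_leI pt)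
          qed
          also have "\<dots> = ennreal ((B' * \<Delta> m)\<^sup>2) * ennreal T"
            using T_pos by (simp add: nn_integral_cmult emeasure_lborel_Icc_eq)
          also have "\<dots> = ennreal (T * (B' * \<Delta> m)\<^sup>2)" using T_pos by (simp add: ennreal_mult[symmetric] mult.commute)
          finally show ?case .
        qed
      qed
      also have "\<dots> = ennreal (T * (B' * \<Delta> m)\<^sup>2)" by (simp add: emeasure_space_1)
      also have "\<dots> \<le> ennreal (T * (B' * T)\<^sup>2 / real (Suc m))"
      proof (rule ennreal_leI)
        have "(B' * \<Delta> m)\<^sup>2 = (B' * T)\<^sup>2 / (real (Suc m))\<^sup>2" by (simp add: \<Delta>_def n_def power_divide power_mult_distrib)
        also have "\<dots> \<le> (B' * T)\<^sup>2 / real (Suc m)"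
          by (intro divide_left_mono) (auto simp: power2_eq_square)
        finally have "T * (B' * \<Delta> m)\<^sup>2 \<le> T * ((B' * T)\<^sup>2 / real (Suc m))"
          using T_pos by (intro mult_left_mono) auto
        then show "T * (B' * \<Delta> m)\<^sup>2 \<le> T * (B' * T)\<^sup>2 / real (Suc m)" by simp
      qed
      finally show ?thesis .
    qed
    show "(\<lambda>m. \<integral>\<^sup>+\<omega>. (\<integral>\<^sup>+s\<in>{0..T}. ennreal ((H s \<omega> - simple_process (n m) (\<tau> m) (\<xi> m) s \<omega>)\<^sup>2) \<partial>lborel) \<partial>M) \<longlonglongrightarrow> 0"
      by (rule tendsto_sandwich[OF _ _ tendsto_const lim[of "T * (B' * T)\<^sup>2"]])
        (intro always_eventually allI e zero_le)+
    fix t assume t: "t \<in> {0..T}"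
    have N: "(\<integral>\<^sup>+\<omega>. ennreal ((c \<omega> * primitive t \<omega> - simple_integral W (n m) (\<tau> m) (\<xi> m) t \<omega>)\<^sup>2) \<partial>M)
        \<le> ennreal (B'\<^sup>2 * T ^ 3 / real (Suc m))" for m
    proof -
      define p where "p i = min t (\<tau> m i)" for i
      define R where "R i \<omega> = (LBINT r:{p i..p (Suc i)}. W r \<omega> - W (p (Suc i)) \<omega>)" for i \<omega>
      have p: "0 \<le> p i" "p i \<le> p (Suc i)" "p i \<le> T" "p (Suc i) - p i \<le> \<Delta> m" for i
        using t \<tau>p[of m i] \<tau>m[of m i] \<tau>s[of m i] \<Delta>[of m] by (auto simp: p_def min_def)
      have RM: "R i \<in> borel_measurable M" for i
        unfolding R_def[abs_def] using p by (intro joint_integral_M joint_diff joint_W joint_const W_M) auto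
      have "AE \<omega> in M. ennreal ((c \<omega> * primitive t \<omega> - simple_integral W (n m) (\<tau> m) (\<xi> m) t \<omega>)\<^sup>2)
          \<le> ennreal (B'\<^sup>2 * real (n m)) * (\<Sum>i<n m. ennreal ((R i \<omega>)\<^sup>2))"
        using c'c AE_space
      proof eventually_elim
        case (elim \<omega>)
        have "primitive t \<omega> = (\<Sum>i<n m. primitive (p (Suc i)) \<omega> - primitive (p i) \<omega>)"
          unfolding sum_lessThan_telescope[of "\<lambda>i. primitive (p i) \<omega>" "n m"]
          using t elim by (simp add: p_def \<tau>n primitive_0)
        moreover have "simple_integral W (n m) (\<tau> m) (\<xi> m) t \<omega>
            = c' \<omega> * (\<Sum>i<n m. (T + 1 - p i) * (W (p (Suc i)) \<omega> - W (p i) \<omega>))"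
          unfolding simple_integral_def \<xi>_def sum_distrib_left
        proof (rule sum.cong[OF refl])
          fix i
          show "c' \<omega> * (T + 1 - \<tau> m i) * (W (min t (\<tau> m (Suc i))) \<omega> - W (min t (\<tau> m i)) \<omega>)
            = c' \<omega> * ((T + 1 - p i) * (W (p (Suc i)) \<omega> - W (p i) \<omega>))"
            using \<tau>m[of m i] by (cases "t \<le> \<tau> m i") (auto simp: p_def min_def)
        qed
        ultimately have "c \<omega> * primitive t \<omega> - simple_integral W (n m) (\<tau> m) (\<xi> m) t \<omega>
            = c' \<omega> * (\<Sum>i<n m. primitive (p (Suc i)) \<omega> - primitive (p i) \<omega> - (T + 1 - p i) * (W (p (Suc i)) \<omega> - W (p i) \<omega>))"
          using elim(1) by (simp only: sum_subtractf right_diff_distrib)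
        also have "\<dots> = c' \<omega> * (\<Sum>i<n m. R i \<omega>)"
          unfolding R_def using primitive_increment[OF elim(2) p(1,2,3)] by simp
        finally have "(c \<omega> * primitive t \<omega> - simple_integral W (n m) (\<tau> m) (\<xi> m) t \<omega>)\<^sup>2 = (c' \<omega>)\<^sup>2 * (\<Sum>i<n m. R i \<omega>)\<^sup>2"
          by (simp add: power_mult_distrib)
        also have "\<dots> \<le> B'\<^sup>2 * ((\<Sum>i<n m. (R i \<omega>)\<^sup>2) * real (card {..<n m}))"
        proof (rule mult_mono)
          have "\<bar>c' \<omega>\<bar>\<^sup>2 \<le> B'\<^sup>2" using c'b by (intro power_mono) auto
          then show "(c' \<omega>)\<^sup>2 \<le> B'\<^sup>2" by simp
          show "(\<Sum>i<n m. R i \<omega>)\<^sup>2 \<le> (\<Sum>i<n m. (R i \<omega>)\<^sup>2) * real (card {..<n m})"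
            by (rule sum_squared_le_sum_of_squares)
        qed auto
        finally have "(c \<omega> * primitive t \<omega> - simple_integral W (n m) (\<tau> m) (\<xi> m) t \<omega>)\<^sup>2
            \<le> (B'\<^sup>2 * real (n m)) * (\<Sum>i<n m. (R i \<omega>)\<^sup>2)" by (simp add: mult_ac)
        then have "ennreal ((c \<omega> * primitive t \<omega> - simple_integral W (n m) (\<tau> m) (\<xi> m) t \<omega>)\<^sup>2)
            \<le> ennreal ((B'\<^sup>2 * real (n m)) * (\<Sum>i<n m. (R i \<omega>)\<^sup>2))" by (rule ennreal_leI)
        then show ?case by (simp add: ennreal_mult sum_ennreal sum_nonneg)
      qed
      then have "(\<integral>\<^sup>+\<omega>. ennreal ((c \<omega> * primitive t \<omega> - simple_integral W (n m) (\<tau> m) (\<xi> m) t \<omega>)\<^sup>2) \<partial>M)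
          \<le> (\<integral>\<^sup>+\<omega>. ennreal (B'\<^sup>2 * real (n m)) * (\<Sum>i<n m. ennreal ((R i \<omega>)\<^sup>2)) \<partial>M)"
        by (rule nn_integral_mono_AE)
      also have "\<dots> = ennreal (B'\<^sup>2 * real (n m)) * (\<Sum>i<n m. (\<integral>\<^sup>+\<omega>. ennreal ((R i \<omega>)\<^sup>2) \<partial>M))"
        using RM by (simp add: nn_integral_cmult nn_integral_sum del: sum_ennreal)
      also have "\<dots> \<le> ennreal (B'\<^sup>2 * real (n m)) * (\<Sum>i<n m. ennreal (\<Delta> m ^ 3))"
      proof (intro mult_left_mono sum_mono)
        fix i
        have "(\<integral>\<^sup>+\<omega>. ennreal ((R i \<omega>)\<^sup>2) \<partial>M) \<le> ennreal ((p (Suc i) - p i) ^ 3)"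
          unfolding R_def by (rule W_average_square[OF p(1,2,3)])
        also have "\<dots> \<le> ennreal (\<Delta> m ^ 3)" using p[of i] by (intro ennreal_leI power_mono) auto
        finally show "(\<integral>\<^sup>+\<omega>. ennreal ((R i \<omega>)\<^sup>2) \<partial>M) \<le> ennreal (\<Delta> m ^ 3)" .
      qed simp
      also have "(\<Sum>i<n m. ennreal (\<Delta> m ^ 3)) = ennreal (real (n m) * \<Delta> m ^ 3)"
        using \<Delta>[of m] by (simp add: ennreal_mult ennreal_of_nat_eq_real_of_nat)
      also have "ennreal (B'\<^sup>2 * real (n m)) * ennreal (real (n m) * \<Delta> m ^ 3) = ennreal (B'\<^sup>2 * real (n m) * (real (n m) * \<Delta> m ^ 3))"
        using \<Delta>[of m] by (simp add: ennreal_mult[symmetric])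
      also have "B'\<^sup>2 * real (n m) * (real (n m) * \<Delta> m ^ 3) = B'\<^sup>2 * T ^ 3 / real (Suc m)"
        by (simp add: \<Delta>_def n_def power_divide power3_eq_cube del: of_nat_Suc)
      finally show ?thesis .
    qed
    show "(\<lambda>m. \<integral>\<^sup>+\<omega>. ennreal ((c \<omega> * primitive t \<omega> - simple_integral W (n m) (\<tau> m) (\<xi> m) t \<omega>)\<^sup>2) \<partial>M) \<longlonglongrightarrow> 0"
      by (rule tendsto_sandwich[OF _ _ tendsto_const lim[of "B'\<^sup>2 * T ^ 3"]])
        (intro always_eventually allI N zero_le)+
  qed
qed

end

section \<open>The explicit solution along a path\<close>

text \<open>Wealth and consumption of an agent of type \<open>(m, s, b, h)\<close> when the Brownian motion is at
  \<open>w\<close> at time \<open>t\<close>: the feedback equation is linear in the wealth and solved by variation of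
  constants. \<open>base_level\<close> collects the terms that do not depend on time.\<close>

definition base_level :: "real \<Rightarrow> real \<Rightarrow> (real \<Rightarrow> real) \<Rightarrow> real \<Rightarrow> real \<Rightarrow> real" where
  "base_level T x0 Z Xb h = x0 / (T + 1) - h * (Xb + (LBINT v:{0..T}. Z v)) / (T + 1)"

definition opt_consumption ::
    "real \<Rightarrow> real \<Rightarrow> (real \<Rightarrow> real) \<Rightarrow> real \<Rightarrow> real \<Rightarrow> real \<Rightarrow> real \<Rightarrow> real \<Rightarrow> real \<Rightarrow> real \<Rightarrow> real" where
  "opt_consumption T x0 Z Xb m s b h t w = base_level T x0 Z Xb h + h * Z t
     + 1 / 4 * b * (m / s)\<^sup>2 * (T + 1 + 2 * t - 1 / (T + 1)) + b * (m / s) * w"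

definition opt_wealth ::
    "real \<Rightarrow> real \<Rightarrow> (real \<Rightarrow> real) \<Rightarrow> real \<Rightarrow> real \<Rightarrow> real \<Rightarrow> real \<Rightarrow> real \<Rightarrow> real \<Rightarrow> real \<Rightarrow> real" where
  "opt_wealth T x0 Z Xb m s b h t w = x0 + b * (m / s)\<^sup>2 * ((T + 1) * t - t\<^sup>2 / 2)
     + b * (m / s) * ((T + 1 - t) * w) - base_level T x0 Z Xb h * t - h * integral {0..t} Z
     - 1 / 4 * b * (m / s)\<^sup>2 * ((T + 1 - 1 / (T + 1)) * t + t\<^sup>2)"

lemma feedback_consumption_opt_wealth:
  assumes T: "0 < T" and Z: "continuous_on {0..T} Z" and t: "t \<in> {0..T}"
  shows "feedback_consumption T Z Xb m s b h t (opt_wealth T x0 Z Xb m s b h t w)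
    = opt_consumption T x0 Z Xb m s b h t w"
proof -
  define S r q g K A J where "S = T + 1" and "r = T + 1 - t" and "q = b * (m / s)\<^sup>2" and "g = b * (m / s)"
    and "K = base_level T x0 Z Xb h" and "A = (LBINT v:{0..T}. Z v)" and "J = integral {0..t} Z"
  have S: "S \<noteq> 0" and r: "r \<noteq> 0" "r = S - t" using T t by (auto simp: S_def r_def)
  have K: "S * K = x0 - h * (Xb + A)" 
    unfolding K_def base_level_def S_def[symmetric] A_def[symmetric] using S by (simp add: right_diff_distrib)
  define X where "X = x0 + q * (S * t - t\<^sup>2 / 2) + g * (r * w) - K * t - h * J - 1 / 4 * q * ((S - 1 / S) * t + t\<^sup>2)"
  have "X - h * Xb - h * (A - J) + 1 / 4 * q * (r * r - 1) = r * (K + 1 / 4 * q * (S + 2 * t - 1 / S) + g * w)"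
  proof -
    have 1: "X - h * Xb - h * (A - J) = S * K + q * (S * t - t\<^sup>2 / 2) + g * (r * w) - K * t - 1 / 4 * q * ((S - 1 / S) * t + t\<^sup>2)"
      unfolding X_def K by (simp add: algebra_simps)
    have 2: "(S * t - t\<^sup>2 / 2) - 1 / 4 * ((S - 1 / S) * t + t\<^sup>2) + 1 / 4 * (r * r - 1) = 1 / 4 * (r * (S + 2 * t - 1 / S))"
      using S unfolding r(2) by (simp add: field_simps power2_eq_square)
    have "X - h * Xb - h * (A - J) + 1 / 4 * q * (r * r - 1)
      = (S - t) * K + g * (r * w) + q * ((S * t - t\<^sup>2 / 2) - 1 / 4 * ((S - 1 / S) * t + t\<^sup>2) + 1 / 4 * (r * r - 1))"
      unfolding 1 by (simp add: algebra_simps)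
    also have "\<dots> = r * K + g * (r * w) + q * (1 / 4 * (r * (S + 2 * t - 1 / S)))"
      unfolding 2 r(2)[symmetric] ..
    finally show ?thesis by (simp add: algebra_simps)
  qed
  then have main: "X - h * Xb - h * (A - J) + 1 / 4 * q * (r * r - 1) = r * (K + 1 / 4 * q * (S + 2 * t - 1 / S) + g * w)" .
  have "(X - h * Xb) / r + h * Z t - h / r * (A - J) + 1 / 4 * q * (r - 1 / r)
      = h * Z t + (X - h * Xb - h * (A - J) + 1 / 4 * q * (r * r - 1)) / r"
    using r(1) by (simp add: field_simps)
  also have "\<dots> = h * Z t + (K + 1 / 4 * q * (S + 2 * t - 1 / S) + g * w)"
    unfolding main using r(1) by simp
  finally have "(X - h * Xb) / r + h * Z t - h / r * (A - J) + 1 / 4 * q * (r - 1 / r)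
      = K + h * Z t + 1 / 4 * q * (S + 2 * t - 1 / S) + g * w"
    by simp
  moreover have "(LBINT v:{t..T}. Z v) = A - J" unfolding A_def J_def by (rule tail_integral_eq[OF Z t])
  moreover have "opt_wealth T x0 Z Xb m s b h t w = X"
    by (simp add: opt_wealth_def X_def q_def S_def g_def r_def K_def J_def)
  ultimately show ?thesis
    unfolding feedback_consumption_def opt_consumption_def
    by (simp add: q_def S_def r_def g_def K_def mult.assoc)
qed

text \<open>The denominator \<open>T + 1 - t\<close> of the feedback is \<open>1\<close> at \<open>t = T\<close>, where utilities of consumption and of
  wealth therefore agree.\<close>

lemma opt_wealth_terminal:
  assumes T: "0 < T" and Z: "continuous_on {0..T} Z"
  shows "opt_wealth T x0 Z Xb m s b h T w - h * Xb = opt_consumption T x0 Z Xb m s b h T w - h * Z T"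
proof -
  have t: "T \<in> {0..T}" using T by auto
  have "(LBINT v:{T..T}. Z v) = 0" using tail_integral_eq[OF Z t] set_integral_eq_HK[OF Z] by simp
  then show ?thesis using feedback_consumption_opt_wealth[OF T Z t, of Xb m s b h x0 w]
    by (simp add: feedback_consumption_def)
qed

lemma integral_affine:
  fixes a c :: real
  assumes "0 \<le> t"
  shows "(LBINT s:{0..t}. a + c * s) = a * t + c * (t\<^sup>2 / 2)"
proof -
  have "((\<lambda>s. a + c * s) has_integral (a * t + c * (t\<^sup>2 / 2)) - (a * 0 + c * (0\<^sup>2 / 2))) {0..t}"
    using assms by (intro fundamental_theorem_of_calculus)
      (auto intro!: derivative_eq_intros simp: has_real_derivative_iff_has_vector_derivative[symmetric])
  moreover have "continuous_on {0..t} (\<lambda>s. a + c * s)" by (intro continuous_intros)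
  ultimately show ?thesis by (simp add: set_integral_eq_HK integral_unique)
qed

lemma opt_wealth_dynamics:
  assumes T: "0 < T" and Z: "continuous_on {0..T} Z" and w: "continuous_on {0..T} w" and t: "t \<in> {0..T}"
    and s: "s \<noteq> 0"
  shows "opt_wealth T x0 Z Xb m s b h t (w t) = x0 + (LBINT r:{0..t}. (b * (m / s\<^sup>2) * (T + 1 - r)) * m)
      + b * (m / s) * ((T + 1 - t) * w t + (LBINT r:{0..t}. w r))
      - (LBINT r:{0..t}. opt_consumption T x0 Z Xb m s b h r (w r))"
proof -
  define K where "K = base_level T x0 Z Xb h"
  have sub: "{0..t} \<subseteq> {0..T}" using t by auto
  have cZ: "continuous_on {0..t} Z" and cw: "continuous_on {0..t} w"
    using continuous_on_subset[OF Z sub] continuous_on_subset[OF w sub] by auto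
  let ?a = "K + 1 / 4 * b * (m / s)\<^sup>2 * (T + 1 - 1 / (T + 1))" and ?c = "1 / 4 * b * (m / s)\<^sup>2 * 2"
  have i1: "set_integrable lborel {0..t} (\<lambda>r. ?a + ?c * r)" "set_integrable lborel {0..t} (\<lambda>r. h * Z r)"
    "set_integrable lborel {0..t} (\<lambda>r. b * (m / s) * w r)"
    by (intro borel_integrable_atLeastAtMost' continuous_intros cZ cw)+
  have alg: "k + z + p * (u + 2 * r - v) + y = (k + p * (u - v) + p * 2 * r) + z + y" for k z p u r v y :: real
    by (simp add: algebra_simps)
  have "opt_consumption T x0 Z Xb m s b h r (w r) = (?a + ?c * r) + h * Z r + b * (m / s) * w r" for r
    unfolding opt_consumption_def K_def by (rule alg)
  then have "(LBINT r:{0..t}. opt_consumption T x0 Z Xb m s b h r (w r))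
      = (LBINT r:{0..t}. ?a + ?c * r) + (LBINT r:{0..t}. h * Z r) + (LBINT r:{0..t}. b * (m / s) * w r)"
    using i1 by (simp only: set_integral_add)
  also have "\<dots> = (?a * t + ?c * (t\<^sup>2 / 2)) + h * integral {0..t} Z + b * (m / s) * (LBINT r:{0..t}. w r)"
    using t cZ by (simp only: integral_affine set_integral_mult_right set_integral_eq_HK atLeastAtMost_iff)
  finally have C: "(LBINT r:{0..t}. opt_consumption T x0 Z Xb m s b h r (w r))
     = (?a * t + ?c * (t\<^sup>2 / 2)) + h * integral {0..t} Z + b * (m / s) * (LBINT r:{0..t}. w r)" .
  have "(b * (m / s\<^sup>2) * (T + 1 - r)) * m = b * (m / s)\<^sup>2 * (T + 1) + (- b * (m / s)\<^sup>2) * r" for r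
    using s by (simp add: power2_eq_square field_simps)
  then have P: "(LBINT r:{0..t}. (b * (m / s\<^sup>2) * (T + 1 - r)) * m)
      = b * (m / s)\<^sup>2 * (T + 1) * t + (- b * (m / s)\<^sup>2) * (t\<^sup>2 / 2)"
    using t by (simp only: integral_affine atLeastAtMost_iff)
  have alg: "x + b * q * (u * t - t2 / 2) + g * p - k * t - hJ - 1 / 4 * b * q * ((u - v) * t + t2)
     = x + (b * q * u * t + (- b * q) * (t2 / 2)) + g * (p + i)
       - ((k + 1 / 4 * b * q * (u - v)) * t + (1 / 4 * b * q * 2) * (t2 / 2) + hJ + g * i)"
    for x q u t2 g p k hJ v i :: real
    by (simp add: field_simps)
  show ?thesis unfolding C P opt_wealth_def K_def[symmetric] by (rule alg)
qed

text \<open>Two solutions of the feedback equation differ by a solution of \<open>D' = - D / (T + 1 - t)\<close>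
  starting at \<open>0\<close>.\<close>

lemma linear_integral_equation_zero:
  fixes D :: "real \<Rightarrow> real"
  assumes D: "continuous_on {0..T} D" and eq: "\<And>t. t \<in> {0..T} \<Longrightarrow> D t = - (LBINT s:{0..t}. D s / (T + 1 - s))"
    and t: "t \<in> {0..T}"
  shows "D t = 0"
proof -
  have c: "continuous_on {0..T} (\<lambda>s. D s / (T + 1 - s))" by (intro continuous_intros D) auto
  have eq': "D r = - integral {0..r} (\<lambda>s. D s / (T + 1 - s))" if "r \<in> {0..T}" for r
    unfolding eq[OF that] using that by (subst set_integral_eq_HK) (auto intro: continuous_on_subset[OF c])
  have dD: "(D has_real_derivative - (D r / (T + 1 - r))) (at r within {0..T})" if r: "r \<in> {0..T}" for r
  proof (rule has_field_derivative_transform_within[OF _ zero_less_one r])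
    show "((\<lambda>r. - integral {0..r} (\<lambda>s. D s / (T + 1 - s))) has_real_derivative - (D r / (T + 1 - r))) (at r within {0..T})"
      by (intro DERIV_minus integral_has_real_derivative[OF c r])
  qed (simp add: eq')
  have "((\<lambda>r. D r / (T + 1 - r)) has_vector_derivative 0) (at r within {0..t})" if r: "r \<in> {0..t}" for r
  proof -
    have r': "r \<in> {0..T}" using r t by auto
    have "((\<lambda>r. D r / (T + 1 - r)) has_real_derivative
      ((- (D r / (T + 1 - r))) * (T + 1 - r) - D r * (0 - 1)) / ((T + 1 - r) * (T + 1 - r))) (at r within {0..T})"
      using r' by (intro DERIV_divide dD DERIV_diff DERIV_const DERIV_ident) auto
    moreover have "(- (D r / (T + 1 - r))) * (T + 1 - r) - D r * (0 - 1) = 0" using r' by simp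
    ultimately have "((\<lambda>r. D r / (T + 1 - r)) has_real_derivative 0) (at r within {0..T})" by simp
    then have "((\<lambda>r. D r / (T + 1 - r)) has_real_derivative 0) (at r within {0..t})"
      by (rule DERIV_subset) (use t in auto)
    then show ?thesis by (simp add: has_real_derivative_iff_has_vector_derivative)
  qed
  then have "((\<lambda>_. 0) has_integral (D t / (T + 1 - t) - D 0 / (T + 1 - 0))) {0..t}"
    using t by (intro fundamental_theorem_of_calculus) auto
  then have "D t / (T + 1 - t) - D 0 / (T + 1 - 0) = 0"
    by (simp add: has_integral_is_0 has_integral_unique[OF _ has_integral_0])
  moreover have "D 0 = 0" using eq'[of 0] t by simp
  ultimately show ?thesis using t by simp
qed

context brownian_setup
begin

text \<open>Continuous paths that agree at all rational times agree everywhere.\<close>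

lemma AE_all_times:
  assumes ae: "\<And>t. t \<in> {0..T} \<Longrightarrow> AE \<omega> in M. X t \<omega> = X' t \<omega>"
    and c: "AE \<omega> in M. continuous_on {0..T} (\<lambda>t. X t \<omega>)" "AE \<omega> in M. continuous_on {0..T} (\<lambda>t. X' t \<omega>)"
  shows "AE \<omega> in M. \<forall>t\<in>{0..T}. X t \<omega> = (X' t \<omega> :: real)"
proof -
  let ?q = "\<lambda>k n. real_of_int k / real (Suc n)"
  have "AE \<omega> in M. \<forall>k n. ?q k n \<in> {0..T} \<longrightarrow> X (?q k n) \<omega> = X' (?q k n) \<omega>"
    unfolding AE_all_countable using ae by auto
  with c show ?thesis
  proof eventually_elim
    case (elim \<omega>)
    show ?case
    proof
      fix s assume s: "s \<in> {0..T}"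
      let ?k = "\<lambda>n. \<lfloor>s * real (Suc n)\<rfloor>"
      have q: "?q (?k n) n \<in> {0..T}" for n
      proof -
        have "real_of_int (?k n) \<le> s * real (Suc n)" by simp
        then have "?q (?k n) n \<le> s" by (simp add: divide_le_eq)
        moreover have "0 \<le> ?q (?k n) n" using s by simp
        ultimately show ?thesis using s by simp
      qed
      have "(\<lambda>n. X (?q (?k n) n) \<omega>) \<longlonglongrightarrow> X s \<omega>"
        by (rule continuous_on_tendsto_compose[OF elim(1) floor_approximation s]) (intro always_eventually allI q)
      moreover have "(\<lambda>n. X' (?q (?k n) n) \<omega>) \<longlonglongrightarrow> X' s \<omega>"
        by (rule continuous_on_tendsto_compose[OF elim(2) floor_approximation s]) (intro always_eventually allI q)
      moreover have "X (?q (?k n) n) \<omega> = X' (?q (?k n) n) \<omega>" for n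
        using elim(3) q by blast
      ultimately show "X s \<omega> = X' s \<omega>" by (simp only: LIMSEQ_unique)
    qed
  qed
qed

lemma ito_unique:
  assumes i: "ito_integral M T F W H I" "ito_integral M T F W H' I'"
    and e: "energy T (\<lambda>s \<omega>. H s \<omega> - H' s \<omega>) = 0"
  shows "AE \<omega> in M. \<forall>t\<in>{0..T}. I t \<omega> = I' t \<omega>"
proof (rule AE_all_times)
  fix t assume t: "t \<in> {0..T}"
  have "energy t (\<lambda>s \<omega>. H s \<omega> - H' s \<omega>) \<le> energy T (\<lambda>s \<omega>. H s \<omega> - H' s \<omega>)"
    using t by (intro energy_mono) auto
  then have "(\<integral>\<^sup>+\<omega>. ennreal ((I t \<omega> - I' t \<omega>)\<^sup>2) \<partial>M) = 0"
    using ito_isometry(2)[OF i t] e by simp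
  moreover have "I t \<in> borel_measurable M" "I' t \<in> borel_measurable M"
    using i t by (auto intro: prog_section_M ito_prog)
  ultimately show "AE \<omega> in M. I t \<omega> = I' t \<omega>"
    by (subst (asm) nn_integral_0_iff_AE) auto
qed (use i in \<open>auto simp: ito_integral_def\<close>)

end

section \<open>Agents with a random type\<close>

text \<open>\<open>S\<close> is a finite set of possible types. Its finiteness gives uniform bounds on all coefficients and
  allows arguments to be carried out type by type.\<close>

locale game = brownian_setup M T F W
  for M :: "'a measure" and T :: real and F :: "real \<Rightarrow> 'a measure" and W :: "real \<Rightarrow> 'a \<Rightarrow> real" +
  fixes \<mu> \<sigma> \<beta> \<theta> :: "'a \<Rightarrow> real" and S :: "(real \<times> real \<times> real \<times> real) set" and x0 :: real
  assumes S_fin: "finite S"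
    and S_pos: "\<And>m s b h. (m, s, b, h) \<in> S \<Longrightarrow> 0 < m \<and> 0 < s \<and> 0 < b \<and> 0 < h \<and> h \<le> 1"
    and type_F: "(\<lambda>\<omega>. (\<mu> \<omega>, \<sigma> \<omega>, \<beta> \<omega>, \<theta> \<omega>)) \<in> borel_measurable (F 0)"
    and type_S: "AE \<omega> in M. (\<mu> \<omega>, \<sigma> \<omega>, \<beta> \<omega>, \<theta> \<omega>) \<in> S"
begin

lemma zero_T: "0 \<in> {0..T}" "T \<in> {0..T}"
  using T_pos by auto

lemma types_F:
  shows \<mu>_F: "\<mu> \<in> borel_measurable (F 0)" and \<sigma>_F: "\<sigma> \<in> borel_measurable (F 0)"
    and \<beta>_F: "\<beta> \<in> borel_measurable (F 0)" and \<theta>_F: "\<theta> \<in> borel_measurable (F 0)"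
proof -
  have "(fst :: real \<times> real \<times> real \<times> real \<Rightarrow> real) \<in> borel_measurable borel"
    "(\<lambda>x :: real \<times> real \<times> real \<times> real. fst (snd x)) \<in> borel_measurable borel"
    "(\<lambda>x :: real \<times> real \<times> real \<times> real. fst (snd (snd x))) \<in> borel_measurable borel"
    "(\<lambda>x :: real \<times> real \<times> real \<times> real. snd (snd (snd x))) \<in> borel_measurable borel"
    by (intro borel_measurable_continuous_onI continuous_intros)+
  from this[THEN measurable_compose[OF type_F]]
  show "\<mu> \<in> borel_measurable (F 0)" "\<sigma> \<in> borel_measurable (F 0)" "\<beta> \<in> borel_measurable (F 0)" "\<theta> \<in> borel_measurable (F 0)"
    by simp_all
qed

lemma types_Ft:
  assumes "t \<in> {0..T}"
  shows "\<mu> \<in> borel_measurable (F t)" "\<sigma> \<in> borel_measurable (F t)"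
    "\<beta> \<in> borel_measurable (F t)" "\<theta> \<in> borel_measurable (F t)"
  using assms by (auto intro: F_mono[OF \<mu>_F] F_mono[OF \<sigma>_F] F_mono[OF \<beta>_F] F_mono[OF \<theta>_F])

lemma types_M:
  shows "\<mu> \<in> borel_measurable M" "\<sigma> \<in> borel_measurable M" "\<beta> \<in> borel_measurable M" "\<theta> \<in> borel_measurable M"
  using F_meas_M[OF _ zero_T(1)] types_F by auto

lemma type_pos: "AE \<omega> in M. 0 < \<mu> \<omega> \<and> 0 < \<sigma> \<omega> \<and> 0 < \<beta> \<omega> \<and> 0 < \<theta> \<omega> \<and> \<theta> \<omega> \<le> 1"
  using type_S by eventually_elim (use S_pos in blast)

lemma type_bound:
  fixes f :: "real \<Rightarrow> real \<Rightarrow> real \<Rightarrow> real \<Rightarrow> real"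
  obtains B where "0 \<le> B" "AE \<omega> in M. \<bar>f (\<mu> \<omega>) (\<sigma> \<omega>) (\<beta> \<omega>) (\<theta> \<omega>)\<bar> \<le> B"
proof
  let ?g = "\<lambda>(m, s, b, h). \<bar>f m s b h\<bar>"
  show "0 \<le> sum ?g S" by (intro sum_nonneg) auto
  show "AE \<omega> in M. \<bar>f (\<mu> \<omega>) (\<sigma> \<omega>) (\<beta> \<omega>) (\<theta> \<omega>)\<bar> \<le> sum ?g S"
    using type_S
  proof eventually_elim
    case (elim \<omega>)
    have "?g (\<mu> \<omega>, \<sigma> \<omega>, \<beta> \<omega>, \<theta> \<omega>) \<le> sum ?g S"
      by (rule member_le_sum[OF elim _ S_fin]) auto
    then show ?case by simp
  qed
qed

text \<open>The explicit investment, consumption and wealth of the representative agent against the mean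
  field \<open>(Z, Xb)\<close>.\<close>

definition invest :: "real \<Rightarrow> 'a \<Rightarrow> real" where
  "invest t \<omega> = \<beta> \<omega> * (\<mu> \<omega> / (\<sigma> \<omega>)\<^sup>2) * (T + 1 - t)"

definition consume :: "(real \<Rightarrow> real) \<Rightarrow> real \<Rightarrow> real \<Rightarrow> 'a \<Rightarrow> real" where
  "consume Z Xb t \<omega> = opt_consumption T x0 Z Xb (\<mu> \<omega>) (\<sigma> \<omega>) (\<beta> \<omega>) (\<theta> \<omega>) t (W t \<omega>)"

definition capital :: "(real \<Rightarrow> real) \<Rightarrow> real \<Rightarrow> real \<Rightarrow> 'a \<Rightarrow> real" where
  "capital Z Xb t \<omega> = opt_wealth T x0 Z Xb (\<mu> \<omega>) (\<sigma> \<omega>) (\<beta> \<omega>) (\<theta> \<omega>) t (W t \<omega>)"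

lemma feedback_investment_eq: "feedback_investment T (\<mu> \<omega>) (\<sigma> \<omega>) (\<beta> \<omega>) t x = invest t \<omega>"
  by (simp add: feedback_investment_def invest_def)

lemma prog_type_linear:
  assumes "c \<in> borel_measurable (F 0)"
  shows "prog_measurable T F (\<lambda>t \<omega>. c \<omega> * (T + 1 - t))"
proof (rule prog_mult[OF prog_const[OF assms] prog_det])
  show "continuous_on {0..T} (\<lambda>t. T + 1 - t)" by (intro continuous_intros)
qed

lemma prog_invest: "prog_measurable T F invest"
proof -
  have "(\<lambda>\<omega>. \<beta> \<omega> * (\<mu> \<omega> / (\<sigma> \<omega>)\<^sup>2)) \<in> borel_measurable (F 0)"
    using types_F by simp
  from prog_type_linear[OF this] show ?thesis by (simp add: invest_def[abs_def])
qed

lemma consume_cont: "continuous_on {0..T} Z \<Longrightarrow> \<omega> \<in> space M \<Longrightarrow> continuous_on {0..T} (\<lambda>t. consume Z Xb t \<omega>)"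
  unfolding consume_def opt_consumption_def by (intro continuous_intros W_cont)

lemma consume_F: "t \<in> {0..T} \<Longrightarrow> consume Z Xb t \<in> borel_measurable (F t)"
  unfolding consume_def[abs_def] opt_consumption_def base_level_def
  using types_Ft[of t] W_F[of t t] by simp

lemma capital_cont:
  assumes "continuous_on {0..T} Z" "\<omega> \<in> space M"
  shows "continuous_on {0..T} (\<lambda>t. capital Z Xb t \<omega>)"
proof -
  have "continuous_on {0..T} (\<lambda>t. integral {0..t} Z)"
    by (rule DERIV_continuous_on[OF integral_has_real_derivative[OF assms(1)]])
  moreover have "continuous_on {0..T} (\<lambda>t. a + c * ((T + 1) * t - t\<^sup>2 / 2) + d * ((T + 1 - t) * w t) - k * t - h * J t
      - e * ((T + 1 - 1 / (T + 1)) * t + t\<^sup>2))"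
    if "continuous_on {0..T} J" "continuous_on {0..T} w" for a c d k h e and J w :: "real \<Rightarrow> real"
    by (intro continuous_on_add continuous_on_diff continuous_on_mult continuous_on_divide continuous_on_power
      continuous_on_const continuous_on_id that) (use T_pos in simp_all)
  ultimately show ?thesis
    unfolding capital_def opt_wealth_def using W_cont[OF assms(2)] by blast
qed

lemma capital_F: "t \<in> {0..T} \<Longrightarrow> capital Z Xb t \<in> borel_measurable (F t)"
  unfolding capital_def[abs_def] opt_wealth_def base_level_def
  using types_Ft[of t] W_F[of t t]
  by (intro borel_measurable_add borel_measurable_diff borel_measurable_times borel_measurable_divide
    borel_measurable_power borel_measurable_const) simp_all

lemma prog_consume:
  assumes "continuous_on {0..T} Z"
  shows "prog_measurable T F (consume Z Xb)"
proof (rule continuous_adapted_prog)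
  show "consume Z Xb t \<in> borel_measurable (F t)" if "t \<in> {0..T}" for t by (rule consume_F[OF that])
  show "continuous_on {0..T} (\<lambda>t. consume Z Xb t \<omega>)" if "\<omega> \<in> space M" for \<omega> by (rule consume_cont[OF assms that])
qed

lemma prog_capital:
  assumes "continuous_on {0..T} Z"
  shows "prog_measurable T F (capital Z Xb)"
proof (rule continuous_adapted_prog)
  show "capital Z Xb t \<in> borel_measurable (F t)" if "t \<in> {0..T}" for t by (rule capital_F[OF that])
  show "continuous_on {0..T} (\<lambda>t. capital Z Xb t \<omega>)" if "\<omega> \<in> space M" for \<omega> by (rule capital_cont[OF assms that])
qed

lemma feedback_capital:
  "continuous_on {0..T} Z \<Longrightarrow> t \<in> {0..T} \<Longrightarrow>
    feedback_consumption T Z Xb (\<mu> \<omega>) (\<sigma> \<omega>) (\<beta> \<omega>) (\<theta> \<omega>) t (capital Z Xb t \<omega>) = consume Z Xb t \<omega>"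
  unfolding capital_def consume_def by (rule feedback_consumption_opt_wealth[OF T_pos])

lemma ito_invest:
  "ito_integral M T F W (\<lambda>t \<omega>. invest t \<omega> * \<sigma> \<omega>) (\<lambda>t \<omega>. \<beta> \<omega> * (\<mu> \<omega> / \<sigma> \<omega>) * primitive t \<omega>)"
proof -
  obtain B where B: "AE \<omega> in M. \<bar>\<beta> \<omega> * (\<mu> \<omega> / \<sigma> \<omega>)\<bar> \<le> B"
    using type_bound[of "\<lambda>m s b h. b * (m / s)"] by blast
  show ?thesis
  proof (rule ito_linear_integrand[OF _ B])
    show "(\<lambda>\<omega>. \<beta> \<omega> * (\<mu> \<omega> / \<sigma> \<omega>)) \<in> borel_measurable (F 0)" using types_F by simp
    show "prog_measurable T F (\<lambda>t \<omega>. invest t \<omega> * \<sigma> \<omega>)" by (intro prog_mult prog_invest prog_const \<sigma>_F)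
    show "AE \<omega> in M. \<forall>t\<in>{0..T}. invest t \<omega> * \<sigma> \<omega> = \<beta> \<omega> * (\<mu> \<omega> / \<sigma> \<omega>) * (T + 1 - t)"
      using type_pos by eventually_elim (auto simp: invest_def power2_eq_square)
  qed
qed

lemma wealth_explicit:
  assumes Z: "continuous_on {0..T} Z" and C: "\<And>t \<omega>. t \<in> {0..T} \<Longrightarrow> C t \<omega> = consume Z Xb t \<omega>"
  shows "wealth M T F W x0 \<mu> \<sigma> invest C (capital Z Xb)"
  unfolding wealth_def
proof (intro conjI exI)
  show "prog_measurable T F (capital Z Xb)" by (rule prog_capital[OF Z])
  show "AE \<omega> in M. continuous_on {0..T} (\<lambda>t. capital Z Xb t \<omega>)" by (intro AE_I2 capital_cont[OF Z])
  show "AE \<omega> in M. set_integrable lborel {0..T} (\<lambda>s. invest s \<omega> * \<mu> \<omega>)"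
    unfolding invest_def by (intro AE_I2 borel_integrable_atLeastAtMost' continuous_intros)
  show "AE \<omega> in M. set_integrable lborel {0..T} (\<lambda>s. C s \<omega>)"
  proof (rule AE_I2)
    fix \<omega> assume \<omega>: "\<omega> \<in> space M"
    have "continuous_on {0..T} (\<lambda>t. C t \<omega>)"
      by (rule continuous_on_eq[OF consume_cont[OF Z \<omega>, of Xb]]) (simp add: C)
    then show "set_integrable lborel {0..T} (\<lambda>s. C s \<omega>)" by (rule borel_integrable_atLeastAtMost')
  qed
  show "ito_integral M T F W (\<lambda>t \<omega>. invest t \<omega> * \<sigma> \<omega>) (\<lambda>t \<omega>. \<beta> \<omega> * (\<mu> \<omega> / \<sigma> \<omega>) * primitive t \<omega>)" by (rule ito_invest)
  show "AE \<omega> in M. \<forall>t\<in>{0..T}. capital Z Xb t \<omega> = x0 + (LBINT s:{0..t}. invest s \<omega> * \<mu> \<omega>)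
      + \<beta> \<omega> * (\<mu> \<omega> / \<sigma> \<omega>) * primitive t \<omega> - (LBINT s:{0..t}. C s \<omega>)"
    using type_pos AE_space
  proof eventually_elim
    case (elim \<omega>)
    show ?case
    proof
      fix t assume t: "t \<in> {0..T}"
      have "(LBINT s:{0..t}. C s \<omega>) = (LBINT s:{0..t}. consume Z Xb s \<omega>)"
        using t by (intro set_lebesgue_integral_cong) (auto simp: C)
      then show "capital Z Xb t \<omega> = x0 + (LBINT s:{0..t}. invest s \<omega> * \<mu> \<omega>)
        + \<beta> \<omega> * (\<mu> \<omega> / \<sigma> \<omega>) * primitive t \<omega> - (LBINT s:{0..t}. C s \<omega>)"
        using opt_wealth_dynamics[OF T_pos Z W_cont[OF elim(2)] t, of "\<sigma> \<omega>" x0 Xb "\<mu> \<omega>" "\<beta> \<omega>" "\<theta> \<omega>"] elim(1)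
        by (simp add: capital_def consume_def invest_def primitive_def)
    qed
  qed
qed

lemma feedback_wealth_unique:
  assumes Z: "continuous_on {0..T} Z"
    and w: "wealth M T F W x0 \<mu> \<sigma> invest (\<lambda>t \<omega>. feedback_consumption T Z Xb (\<mu> \<omega>) (\<sigma> \<omega>) (\<beta> \<omega>) (\<theta> \<omega>) t (X t \<omega>)) X"
  shows "AE \<omega> in M. \<forall>t\<in>{0..T}. X t \<omega> = capital Z Xb t \<omega>"
proof -
  let ?C = "\<lambda>X t \<omega>. feedback_consumption T Z Xb (\<mu> \<omega>) (\<sigma> \<omega>) (\<beta> \<omega>) (\<theta> \<omega>) t (X t \<omega>)"
  obtain I where I: "ito_integral M T F W (\<lambda>t \<omega>. invest t \<omega> * \<sigma> \<omega>) I"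
    and X: "AE \<omega> in M. \<forall>t\<in>{0..T}. X t \<omega> = x0 + (LBINT s:{0..t}. invest s \<omega> * \<mu> \<omega>) + I t \<omega> - (LBINT s:{0..t}. ?C X s \<omega>)"
    and cX: "AE \<omega> in M. continuous_on {0..T} (\<lambda>t. X t \<omega>)" and iC: "AE \<omega> in M. set_integrable lborel {0..T} (\<lambda>s. ?C X s \<omega>)"
    using w unfolding wealth_def by blast
  have w': "wealth M T F W x0 \<mu> \<sigma> invest (?C (capital Z Xb)) (capital Z Xb)"
    by (intro wealth_explicit[OF Z] feedback_capital[OF Z])
  obtain I' where I': "ito_integral M T F W (\<lambda>t \<omega>. invest t \<omega> * \<sigma> \<omega>) I'"
    and X': "AE \<omega> in M. \<forall>t\<in>{0..T}. capital Z Xb t \<omega> = x0 + (LBINT s:{0..t}. invest s \<omega> * \<mu> \<omega>) + I' t \<omega> - (LBINT s:{0..t}. ?C (capital Z Xb) s \<omega>)"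
    and iC': "AE \<omega> in M. set_integrable lborel {0..T} (\<lambda>s. ?C (capital Z Xb) s \<omega>)"
    using w' unfolding wealth_def by blast
  have "AE \<omega> in M. \<forall>t\<in>{0..T}. I t \<omega> = I' t \<omega>"
    by (rule ito_unique[OF I I']) (simp add: energy_def)
  with X X' cX iC iC' AE_space show ?thesis
  proof eventually_elim
    case (elim \<omega>)
    let ?D = "\<lambda>t. X t \<omega> - capital Z Xb t \<omega>"
    have cD: "continuous_on {0..T} ?D" by (intro continuous_on_diff elim(3) capital_cont[OF Z elim(6)])
    have eq: "?D t = - (LBINT s:{0..t}. ?D s / (T + 1 - s))" if t: "t \<in> {0..T}" for t
    proof -
      have i: "set_integrable lborel {0..t} (\<lambda>s. ?C X s \<omega>)" "set_integrable lborel {0..t} (\<lambda>s. ?C (capital Z Xb) s \<omega>)"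
        using t by (auto intro: set_integrable_subset[OF elim(4)] set_integrable_subset[OF elim(5)])
      have "?D s / (T + 1 - s) = ?C X s \<omega> - ?C (capital Z Xb) s \<omega>" for s
        by (simp add: feedback_consumption_def diff_divide_distrib)
      then have "(LBINT s:{0..t}. ?D s / (T + 1 - s)) = (LBINT s:{0..t}. ?C X s \<omega>) - (LBINT s:{0..t}. ?C (capital Z Xb) s \<omega>)"
        using set_integral_diff(2)[OF i] by simp
      then show ?thesis using elim(1,2,7) t by simp
    qed
    show ?case
    proof
      fix t assume t: "t \<in> {0..T}"
      have "?D t = 0" by (rule linear_integral_equation_zero[OF cD eq t])
      then show "X t \<omega> = capital Z Xb t \<omega>" by simp
    qed
  qed
qed

lemma admissible_explicit:
  assumes Z: "continuous_on {0..T} Z" and pC: "prog_measurable T F C"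
    and C: "AE \<omega> in M. \<forall>t\<in>{0..T}. C t \<omega> = consume Z Xb t \<omega>"
  shows "admissible M T F invest C"
  unfolding admissible_def
proof (intro conjI prog_invest pC)
  obtain B1 where B1: "0 \<le> B1" "AE \<omega> in M. \<bar>\<beta> \<omega> * (\<mu> \<omega> / (\<sigma> \<omega>)\<^sup>2)\<bar> \<le> B1"
    using type_bound[of "\<lambda>m s b h. b * (m / s\<^sup>2)"] by blast
  obtain B2 where B2: "0 \<le> B2" "AE \<omega> in M. \<bar>base_level T x0 Z Xb (\<theta> \<omega>)\<bar> \<le> B2"
    using type_bound[of "\<lambda>m s b h. base_level T x0 Z Xb h"] by blast
  obtain B3 where B3: "0 \<le> B3" "AE \<omega> in M. \<bar>1 / 4 * \<beta> \<omega> * (\<mu> \<omega> / \<sigma> \<omega>)\<^sup>2\<bar> \<le> B3"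
    using type_bound[of "\<lambda>m s b h. 1 / 4 * b * (m / s)\<^sup>2"] by blast
  obtain B4 where B4: "0 \<le> B4" "AE \<omega> in M. \<bar>\<beta> \<omega> * (\<mu> \<omega> / \<sigma> \<omega>)\<bar> \<le> B4"
    using type_bound[of "\<lambda>m s b h. b * (m / s)"] by blast
  have "compact (Z ` {0..T})" by (intro compact_continuous_image Z) simp
  then obtain BZ where BZ: "\<And>t. t \<in> {0..T} \<Longrightarrow> \<bar>Z t\<bar> \<le> BZ"
    using compact_imp_bounded bounded_iff by (metis imageI real_norm_def)
  define D where "D = B2 + BZ + B3 * (3 * T + 1)"
  have D: "0 \<le> D" using BZ[OF zero_T(1)] B2 B3 T_pos by (auto simp: D_def intro!: add_nonneg_nonneg mult_nonneg_nonneg)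
  have "AE \<omega> in M. (\<integral>\<^sup>+s\<in>{0..T}. ennreal ((invest s \<omega>)\<^sup>2 + (C s \<omega>)\<^sup>2) \<partial>lborel)
      \<le> ennreal ((B1 * (T + 1))\<^sup>2 + 2 * D\<^sup>2) * ennreal T + ennreal (2 * B4\<^sup>2) * (\<integral>\<^sup>+s\<in>{0..T}. ennreal ((W s \<omega>)\<^sup>2) \<partial>lborel)"
    using B1(2) B2(2) B3(2) B4(2) C type_pos AE_space
  proof eventually_elim
    case (elim \<omega>)
    have "(invest s \<omega>)\<^sup>2 + (C s \<omega>)\<^sup>2 \<le> ((B1 * (T + 1))\<^sup>2 + 2 * D\<^sup>2) + 2 * B4\<^sup>2 * (W s \<omega>)\<^sup>2" if s: "s \<in> {0..T}" for s
    proof -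
      have "\<bar>invest s \<omega>\<bar> \<le> B1 * (T + 1)"
        unfolding invest_def abs_mult[of _ "T + 1 - s"] using s elim(1) B1(1) by (intro mult_mono) auto
      then have 1: "(invest s \<omega>)\<^sup>2 \<le> (B1 * (T + 1))\<^sup>2" using abs_le_square_iff[of "invest s \<omega>" "B1 * (T + 1)"] by simp
      define x where "x = base_level T x0 Z Xb (\<theta> \<omega>) + \<theta> \<omega> * Z s + 1 / 4 * \<beta> \<omega> * (\<mu> \<omega> / \<sigma> \<omega>)\<^sup>2 * (T + 1 + 2 * s - 1 / (T + 1))"
      define y where "y = \<beta> \<omega> * (\<mu> \<omega> / \<sigma> \<omega>) * W s \<omega>"
      have Cxy: "C s \<omega> = x + y" using elim(5) s by (simp add: consume_def opt_consumption_def x_def y_def)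
      have f0: "0 \<le> T + 1 + 2 * s - 1 / (T + 1)" "T + 1 + 2 * s - 1 / (T + 1) \<le> 3 * T + 1"
      proof -
        have "1 / (T + 1) \<le> 1" "0 \<le> 1 / (T + 1)" using T_pos by auto
        then show "0 \<le> T + 1 + 2 * s - 1 / (T + 1)" "T + 1 + 2 * s - 1 / (T + 1) \<le> 3 * T + 1"
          using s T_pos unfolding atLeastAtMost_iff by linarith+
      qed
      have "\<bar>\<theta> \<omega> * Z s\<bar> \<le> 1 * BZ" unfolding abs_mult using elim(6) BZ[OF s] by (intro mult_mono) auto
      moreover have "\<bar>1 / 4 * \<beta> \<omega> * (\<mu> \<omega> / \<sigma> \<omega>)\<^sup>2 * (T + 1 + 2 * s - 1 / (T + 1))\<bar> \<le> B3 * (3 * T + 1)"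
        unfolding abs_mult[of _ "T + 1 + 2 * s - 1 / (T + 1)"] abs_of_nonneg[OF f0(1)]
        by (rule mult_mono[OF elim(3) f0(2) B3(1) f0(1)])
      ultimately have "\<bar>x\<bar> \<le> D" using elim(2) unfolding x_def D_def by linarith
      then have 2: "x\<^sup>2 \<le> D\<^sup>2" using abs_le_square_iff[of x D] D by simp
      have "\<bar>y\<bar> \<le> B4 * \<bar>W s \<omega>\<bar>" unfolding y_def abs_mult[of _ "W s \<omega>"] using elim(4) by (intro mult_right_mono) auto
      then have "\<bar>y\<bar>\<^sup>2 \<le> (B4 * \<bar>W s \<omega>\<bar>)\<^sup>2" by (intro power_mono) auto
      then have 3: "y\<^sup>2 \<le> B4\<^sup>2 * (W s \<omega>)\<^sup>2" by (simp add: power_mult_distrib)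
      have "(x + y)\<^sup>2 \<le> 2 * x\<^sup>2 + 2 * y\<^sup>2"
        using zero_le_power2[of "x - y"] by (simp add: power2_eq_square algebra_simps)
      then show ?thesis unfolding Cxy using 1 2 3 by linarith
    qed
    then have "(\<integral>\<^sup>+s\<in>{0..T}. ennreal ((invest s \<omega>)\<^sup>2 + (C s \<omega>)\<^sup>2) \<partial>lborel)
      \<le> (\<integral>\<^sup>+s\<in>{0..T}. ennreal (((B1 * (T + 1))\<^sup>2 + 2 * D\<^sup>2) + 2 * B4\<^sup>2 * (W s \<omega>)\<^sup>2) \<partial>lborel)"
      by (intro nn_integral_mono) (auto simp: indicator_def simp del: ennreal_plus intro!: ennreal_leI)
    also have "\<dots> = (\<integral>\<^sup>+s. (ennreal ((B1 * (T + 1))\<^sup>2 + 2 * D\<^sup>2) + ennreal (2 * B4\<^sup>2) * ennreal ((W s \<omega>)\<^sup>2)) \<partial>leb T)"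
      unfolding nn_integral_leb
    proof (intro nn_integral_cong arg_cong2[where f="(*)"] refl)
      fix s
      have "ennreal (((B1 * (T + 1))\<^sup>2 + 2 * D\<^sup>2) + 2 * B4\<^sup>2 * (W s \<omega>)\<^sup>2)
          = ennreal ((B1 * (T + 1))\<^sup>2 + 2 * D\<^sup>2) + ennreal (2 * B4\<^sup>2 * (W s \<omega>)\<^sup>2)"
        by (rule ennreal_plus) simp_all
      also have "ennreal (2 * B4\<^sup>2 * (W s \<omega>)\<^sup>2) = ennreal (2 * B4\<^sup>2) * ennreal ((W s \<omega>)\<^sup>2)"
        by (rule ennreal_mult) simp_all
      finally show "ennreal (((B1 * (T + 1))\<^sup>2 + 2 * D\<^sup>2) + 2 * B4\<^sup>2 * (W s \<omega>)\<^sup>2)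
          = ennreal ((B1 * (T + 1))\<^sup>2 + 2 * D\<^sup>2) + ennreal (2 * B4\<^sup>2) * ennreal ((W s \<omega>)\<^sup>2)" .
    qed
    also have "\<dots> = ennreal ((B1 * (T + 1))\<^sup>2 + 2 * D\<^sup>2) * emeasure (leb T) {0..T} + ennreal (2 * B4\<^sup>2) * (\<integral>\<^sup>+s. ennreal ((W s \<omega>)\<^sup>2) \<partial>leb T)"
      using joint_path[OF joint_W elim(7)] by (simp add: nn_integral_add nn_integral_cmult del: ennreal_plus)
    also have "emeasure (leb T) {0..T} = ennreal T"
      using T_pos by (simp add: emeasure_restrict_space emeasure_lborel_Icc_eq)
    finally show ?case unfolding nn_integral_leb .
  qed
  then have "(\<integral>\<^sup>+\<omega>. (\<integral>\<^sup>+s\<in>{0..T}. ennreal ((invest s \<omega>)\<^sup>2 + (C s \<omega>)\<^sup>2) \<partial>lborel) \<partial>M)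
      \<le> (\<integral>\<^sup>+\<omega>. (ennreal ((B1 * (T + 1))\<^sup>2 + 2 * D\<^sup>2) * ennreal T + ennreal (2 * B4\<^sup>2) * (\<integral>\<^sup>+s\<in>{0..T}. ennreal ((W s \<omega>)\<^sup>2) \<partial>lborel)) \<partial>M)"
    by (rule nn_integral_mono_AE)
  also have "\<dots> = ennreal ((B1 * (T + 1))\<^sup>2 + 2 * D\<^sup>2) * ennreal T + ennreal (2 * B4\<^sup>2) * energy T W"
    unfolding energy_def using path_energy_M[OF joint_W, of 0 T]
    by (simp add: nn_integral_add nn_integral_cmult emeasure_space_1 del: ennreal_plus)
  also have "\<dots> < \<infinity>"
  proof -
    have "energy T W < \<infinity>" by (rule le_less_trans[OF energy_W]) (simp add: ennreal_mult_less_top)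
    then show ?thesis by (simp add: ennreal_mult_less_top del: ennreal_plus)
  qed
  finally show "(\<integral>\<^sup>+\<omega>. (\<integral>\<^sup>+s\<in>{0..T}. ennreal ((invest s \<omega>)\<^sup>2 + (C s \<omega>)\<^sup>2) \<partial>lborel) \<partial>M) < \<infinity>" .
qed

end

section \<open>Optimality\<close>

text \<open>For equality, halving the exponent gives \<open>(1 + z / 2)\<^sup>2 \<le> exp z = 1 + z\<close> for \<open>z = y - x\<close>, hence
  \<open>z\<^sup>2 / 4 \<le> 0\<close>.\<close>

lemma exp_tangent:
  fixes x y :: real
  shows "exp x * (1 + (y - x)) \<le> exp y" and "exp y = exp x * (1 + (y - x)) \<Longrightarrow> y = x"
proof -
  have e: "exp y = exp x * exp (y - x)" by (simp flip: exp_add)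
  show "exp x * (1 + (y - x)) \<le> exp y" unfolding e by (intro mult_left_mono) auto
  have strict: "z = 0" if "exp z = 1 + z" for z :: real
  proof (cases "- 2 \<le> z")
    case True
    have "(1 + z / 2)\<^sup>2 \<le> (exp (z / 2))\<^sup>2" using True by (intro power_mono) auto
    also have "(exp (z / 2))\<^sup>2 = 1 + z" using that by (simp flip: exp_double)
    finally have "z\<^sup>2 \<le> 0" by (simp add: power2_eq_square algebra_simps)
    then show ?thesis by simp
  next
    case False
    then have "1 + z < 0" by simp
    then show ?thesis using that exp_gt_zero[of z] by linarith
  qed
  assume "exp y = exp x * (1 + (y - x))"
  then have "exp (y - x) = 1 + (y - x)" unfolding e by simp
  from strict[OF this] show "y = x" by simp
qed

lemma set_integral_point:
  fixes a :: real and f :: "real \<Rightarrow> real"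
  shows "(LBINT s:{a..a}. f s) = 0"
proof -
  have "AE x in lborel. indicator {a..a} x *\<^sub>R f x = 0"
    using AE_lborel_singleton[of a]
  proof eventually_elim
    case (elim x)
    then have "x \<notin> {a..a}" by auto
    then show ?case by simp
  qed
  then show ?thesis unfolding set_lebesgue_integral_def by (rule integral_eq_zero_AE)
qed

context brownian_setup
begin

lemma AE_PM_swap:
  assumes j: "joint K" "joint L" and ae: "AE (s, \<omega>) in PM. K s \<omega> = L s \<omega>"
  shows "AE s in leb T. AE \<omega> in M. K s \<omega> = L s \<omega>" and "AE \<omega> in M. AE s in leb T. K s \<omega> = L s \<omega>"
proof -
  interpret pair_sigma_finite "leb T" M by (rule pair_sf)
  show 1: "AE s in leb T. AE \<omega> in M. K s \<omega> = L s \<omega>"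
    using AE_pair[OF ae] by simp
  have "{x \<in> space PM. K (fst x) (snd x) = L (fst x) (snd x)} \<in> sets PM"
    using jointD[OF j(1)] jointD[OF j(2)] by (rule borel_measurable_eq)
  from AE_commute[OF this] 1 show "AE \<omega> in M. AE s in leb T. K s \<omega> = L s \<omega>" by simp
qed

lemma same_integrals:
  assumes j: "joint K" "joint L" and ae: "AE (s, \<omega>) in PM. K s \<omega> = L s \<omega>" and t: "0 \<le> u" "t \<le> T"
  shows "AE \<omega> in M. (LBINT s:{u..t}. K s \<omega>) = (LBINT s:{u..t}. L s \<omega>)"
  using AE_PM_swap(2)[OF j ae] AE_space
proof eventually_elim
  case (elim \<omega>)
  have m: "(\<lambda>s. indicator {u..t} s * K s \<omega>) \<in> borel_measurable (leb T)" "(\<lambda>s. indicator {u..t} s * L s \<omega>) \<in> borel_measurable (leb T)"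
    using joint_path[OF joint_mult[OF joint_Icc j(1)] elim(2)] joint_path[OF joint_mult[OF joint_Icc j(2)] elim(2)] by auto
  have "(\<integral>s. indicator {u..t} s * K s \<omega> \<partial>leb T) = (\<integral>s. indicator {u..t} s * L s \<omega> \<partial>leb T)"
  proof (rule integral_cong_AE[OF m])
    show "AE s in leb T. indicator {u..t} s * K s \<omega> = indicator {u..t} s * L s \<omega>"
      using elim(1) by eventually_elim simp
  qed
  then show ?case unfolding set_integral_sub_leb[OF t(2,1)] .
qed

lemma wealth_0:
  assumes "wealth M T F W x0 \<mu> \<sigma> P C X"
  shows "AE \<omega> in M. X 0 \<omega> = x0"
proof -
  obtain I where I: "ito_integral M T F W (\<lambda>s \<omega>. P s \<omega> * \<sigma> \<omega>) I"
    and X: "AE \<omega> in M. \<forall>t\<in>{0..T}. X t \<omega> = x0 + (LBINT s:{0..t}. P s \<omega> * \<mu> \<omega>) + I t \<omega> - (LBINT s:{0..t}. C s \<omega>)"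
    using assms unfolding wealth_def by blast
  have z: "0 \<in> {0..T}" using T_pos by auto
  show ?thesis using X ito_0[OF I]
  proof eventually_elim
    case (elim \<omega>)
    from bspec[OF elim(1) z] show ?case unfolding set_integral_point using elim(2) by simp
  qed
qed

end

context game
begin

definition type_event :: "real \<times> real \<times> real \<times> real \<Rightarrow> 'a set" where
  "type_event v = {\<omega> \<in> space M. (\<mu> \<omega>, \<sigma> \<omega>, \<beta> \<omega>, \<theta> \<omega>) = v}"

lemma type_event_F: "t \<in> {0..T} \<Longrightarrow> type_event v \<in> sets (F t)"
proof -
  assume t: "t \<in> {0..T}"
  have "(\<lambda>\<omega>. (\<mu> \<omega>, \<sigma> \<omega>, \<beta> \<omega>, \<theta> \<omega>)) -` {v} \<inter> space (F 0) \<in> sets (F 0)"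
    by (rule measurable_sets[OF type_F]) simp
  also have "(\<lambda>\<omega>. (\<mu> \<omega>, \<sigma> \<omega>, \<beta> \<omega>, \<theta> \<omega>)) -` {v} \<inter> space (F 0) = type_event v"
    using space_F[OF zero_T(1)] by (auto simp: type_event_def)
  finally show ?thesis using filt_mono[OF zero_T(1) t] t by auto
qed

lemma type_event_M: "type_event v \<in> sets M"
  using type_event_F[OF zero_T(1), of v] subalg[OF zero_T(1)] unfolding subalgebra_def by blast

definition price_of_risk :: "real \<times> real \<times> real \<times> real \<Rightarrow> real" where
  "price_of_risk v = fst v / fst (snd v)"

definition tolerance :: "real \<times> real \<times> real \<times> real \<Rightarrow> real" where
  "tolerance v = fst (snd (snd v))"

text \<open>The marginal utility, times \<open>\<beta>\<close>, of the explicit control at time \<open>0\<close>.\<close>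

definition price_level :: "(real \<Rightarrow> real) \<Rightarrow> real \<Rightarrow> real \<times> real \<times> real \<times> real \<Rightarrow> real" where
  "price_level Z Xb v = exp (- (1 / tolerance v) * (base_level T x0 Z Xb (snd (snd (snd v)))
     + 1 / 4 * tolerance v * (price_of_risk v)\<^sup>2 * (T + 1 - 1 / (T + 1))))"

text \<open>The state price density of every type, up to a constant that only depends on the type. Along
  the candidate it coincides with the marginal utility (times \<open>\<beta>\<close>).\<close>

definition state_price :: "(real \<Rightarrow> real) \<Rightarrow> real \<Rightarrow> real \<Rightarrow> 'a \<Rightarrow> real" where
  "state_price Z Xb s \<omega> = (\<Sum>v\<in>S. indicator (type_event v) \<omega> * (price_level Z Xb v * Y (price_of_risk v) s \<omega>))"

lemma sum_type_event:
  fixes f :: "real \<times> real \<times> real \<times> real \<Rightarrow> real"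
  assumes "v \<in> S" "\<omega> \<in> type_event v"
  shows "(\<Sum>w\<in>S. indicator (type_event w) \<omega> * f w) = f v"
proof -
  have "(\<Sum>w\<in>S. indicator (type_event w) \<omega> * f w) = (\<Sum>w\<in>S. if w = v then f w else 0)"
    using assms(2) by (intro sum.cong) (auto simp: type_event_def indicator_def)
  then show ?thesis using assms(1) S_fin by simp
qed

lemma state_price_eq: "v \<in> S \<Longrightarrow> \<omega> \<in> type_event v \<Longrightarrow> state_price Z Xb s \<omega> = price_level Z Xb v * Y (price_of_risk v) s \<omega>"
  unfolding state_price_def by (rule sum_type_event)

lemma joint_state_price: "joint (state_price Z Xb)"
proof -
  have "(\<lambda>x. \<Sum>v\<in>S. indicator (type_event v) (snd x) * (price_level Z Xb v * Y (price_of_risk v) (fst x) (snd x))) \<in> borel_measurable PM"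
  proof (intro borel_measurable_sum borel_measurable_times borel_measurable_const jointD[OF joint_Y])
    show "(\<lambda>x. indicator (type_event v) (snd x) :: real) \<in> borel_measurable PM" for v
      using jointD[OF joint_const[of "indicator (type_event v)"]] type_event_M[of v] by simp
  qed
  then show ?thesis unfolding joint_def state_price_def .
qed

lemma state_price_M: "t \<in> {0..T} \<Longrightarrow> state_price Z Xb t \<in> borel_measurable M"
  unfolding state_price_def[abs_def] using type_event_M Y_M by (intro borel_measurable_sum borel_measurable_times) auto

lemma state_price_square:
  assumes s: "s \<in> {0..T}"
  shows "(\<integral>\<^sup>+\<omega>. ennreal ((state_price Z Xb s \<omega>)\<^sup>2) \<partial>M) \<le> ennreal (\<Sum>v\<in>S. (price_level Z Xb v)\<^sup>2 * exp ((price_of_risk v)\<^sup>2 * T))"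
proof -
  have le: "(state_price Z Xb s \<omega>)\<^sup>2 \<le> (\<Sum>v\<in>S. (price_level Z Xb v)\<^sup>2 * (Y (price_of_risk v) s \<omega>)\<^sup>2)" if "\<omega> \<in> space M" for \<omega>
  proof (cases "\<exists>v\<in>S. \<omega> \<in> type_event v")
    case True
    then obtain v where v: "v \<in> S" "\<omega> \<in> type_event v" by blast
    have "(price_level Z Xb v)\<^sup>2 * (Y (price_of_risk v) s \<omega>)\<^sup>2 \<le> (\<Sum>v\<in>S. (price_level Z Xb v)\<^sup>2 * (Y (price_of_risk v) s \<omega>)\<^sup>2)"
      by (rule member_le_sum[OF v(1) _ S_fin]) simp
    then show ?thesis unfolding state_price_eq[OF v] by (simp add: power_mult_distrib)
  next
    case False
    then have "state_price Z Xb s \<omega> = 0" unfolding state_price_def by (intro sum.neutral) auto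
    then show ?thesis by (simp add: sum_nonneg)
  qed
  have hb: "has_bochner_integral M (\<lambda>\<omega>. \<Sum>v\<in>S. (price_level Z Xb v)\<^sup>2 * (Y (price_of_risk v) s \<omega>)\<^sup>2)
      (\<Sum>v\<in>S. (price_level Z Xb v)\<^sup>2 * exp ((price_of_risk v)\<^sup>2 * s))"
    by (intro has_bochner_integral_sum has_bochner_integral_mult_right Y_square s)
  have "(\<integral>\<^sup>+\<omega>. ennreal ((state_price Z Xb s \<omega>)\<^sup>2) \<partial>M) \<le> (\<integral>\<^sup>+\<omega>. ennreal (\<Sum>v\<in>S. (price_level Z Xb v)\<^sup>2 * (Y (price_of_risk v) s \<omega>)\<^sup>2) \<partial>M)"
    by (intro nn_integral_mono ennreal_leI le)
  also have "\<dots> = ennreal (\<Sum>v\<in>S. (price_level Z Xb v)\<^sup>2 * exp ((price_of_risk v)\<^sup>2 * s))"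
    using nn_integral_eq_integral[of M "\<lambda>\<omega>. \<Sum>v\<in>S. (price_level Z Xb v)\<^sup>2 * (Y (price_of_risk v) s \<omega>)\<^sup>2"] hb
    by (simp add: has_bochner_integral_iff sum_nonneg)
  also have "\<dots> \<le> ennreal (\<Sum>v\<in>S. (price_level Z Xb v)\<^sup>2 * exp ((price_of_risk v)\<^sup>2 * T))"
    using s by (intro ennreal_leI sum_mono mult_left_mono) (auto intro: mult_left_mono)
  finally show ?thesis .
qed

lemma energy_state_price: "energy T (state_price Z Xb) < \<infinity>"
  by (rule le_less_trans[OF energy_bounded[OF joint_state_price state_price_square]]) (simp_all add: ennreal_mult_less_top)

text \<open>The coefficient of \<open>W\<close> in \<open>consume\<close> is \<open>\<beta> * (\<mu> / \<sigma>)\<close>, so dividing by \<open>- \<beta>\<close> leaves the exponent of \<open>Y\<close>; the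
  remaining terms match because half of \<open>(\<mu> / \<sigma>)\<^sup>2 * \<beta> * t\<close> appears in the deterministic drift.\<close>

lemma marginal_utility:
  assumes Z: "continuous_on {0..T} Z"
  shows "AE \<omega> in M. 0 < \<beta> \<omega> \<and> (\<forall>s\<in>{0..T}. exp (- (1 / \<beta> \<omega>) * (consume Z Xb s \<omega> - \<theta> \<omega> * Z s)) = state_price Z Xb s \<omega>)
    \<and> exp (- (1 / \<beta> \<omega>) * (capital Z Xb T \<omega> - \<theta> \<omega> * Xb)) = state_price Z Xb T \<omega>"
  using type_S AE_space
proof eventually_elim
  case (elim \<omega>)
  define v where "v = (\<mu> \<omega>, \<sigma> \<omega>, \<beta> \<omega>, \<theta> \<omega>)"
  have v: "v \<in> S" "\<omega> \<in> type_event v" using elim by (auto simp: v_def type_event_def)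
  have b: "0 < \<beta> \<omega>" using S_pos elim(1) by blast
  have alg: "- (1 / b) * (k + z + 1 / 4 * b * l\<^sup>2 * (u + 2 * s - i) + b * l * w - z)
      = - (1 / b) * (k + 1 / 4 * b * l\<^sup>2 * (u - i)) + (- l * w - l\<^sup>2 * s / 2)"
    if "b \<noteq> 0" for b k z l u s i w :: real
    using that by (simp add: field_simps)
  have 1: "exp (- (1 / \<beta> \<omega>) * (consume Z Xb s \<omega> - \<theta> \<omega> * Z s)) = state_price Z Xb s \<omega>" for s
    unfolding state_price_eq[OF v] consume_def opt_consumption_def alg[OF less_imp_neq[OF b, symmetric]] exp_add
    by (simp add: price_level_def Y_def v_def price_of_risk_def tolerance_def)
  have "capital Z Xb T \<omega> - \<theta> \<omega> * Xb = consume Z Xb T \<omega> - \<theta> \<omega> * Z T"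
    unfolding capital_def consume_def by (rule opt_wealth_terminal[OF T_pos Z])
  then show ?case using 1 b by simp
qed

text \<open>Both wealths start at \<open>x0\<close>, so the difference of the two budget equations has no initial term.\<close>

lemma budget_difference:
  assumes w: "wealth M T F W x0 \<mu> \<sigma> P C X" and adm: "admissible M T F P C"
    and w': "wealth M T F W x0 \<mu> \<sigma> P' C' X'" and adm': "admissible M T F P' C'" and v: "v \<in> S"
  shows "integrable PM (\<lambda>x. indicator (type_event v) (snd x) * (Y (price_of_risk v) (fst x) (snd x) * (C' (fst x) (snd x) - C (fst x) (snd x))))"
    and "integrable M (\<lambda>\<omega>. indicator (type_event v) \<omega> * (Y (price_of_risk v) T \<omega> * (X' T \<omega> - X T \<omega>)))"
    and "(\<integral>x. indicator (type_event v) (snd x) * (Y (price_of_risk v) (fst x) (snd x) * (C' (fst x) (snd x) - C (fst x) (snd x))) \<partial>PM)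
      + expectation (\<lambda>\<omega>. indicator (type_event v) \<omega> * (Y (price_of_risk v) T \<omega> * (X' T \<omega> - X T \<omega>))) = 0"
proof -
  interpret pair_sigma_finite "leb T" M by (rule pair_sf)
  obtain m s b h where v4: "v = (m, s, b, h)" by (cases v)
  have s: "s \<noteq> 0" using S_pos[of m s b h] v v4 by auto
  let ?A = "type_event v" and ?l = "m / s"
  have l: "price_of_risk v = ?l" by (simp add: price_of_risk_def v4)
  have A: "?A \<in> sets (F 0)" "\<forall>\<omega>\<in>?A. \<mu> \<omega> = m \<and> \<sigma> \<omega> = s"
    using type_event_F[OF zero_T(1)] by (auto simp: type_event_def v4)
  have iA: "(indicator ?A :: 'a \<Rightarrow> real) \<in> borel_measurable M" using type_event_M by simp
  have eY: "energy T (\<lambda>s \<omega>. indicator ?A \<omega> * Y ?l s \<omega>) < \<infinity>"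
  proof -
    have "energy T (\<lambda>s \<omega>. indicator ?A \<omega> * Y ?l s \<omega>) \<le> ennreal (exp (?l\<^sup>2 * T)) * ennreal T"
    proof (rule energy_bounded)
      show "joint (\<lambda>s \<omega>. indicator ?A \<omega> * Y ?l s \<omega>)" by (intro joint_mult joint_const iA joint_Y)
      fix r assume r: "r \<in> {0..T}"
      have "(\<integral>\<^sup>+\<omega>. ennreal ((indicator ?A \<omega> * Y ?l r \<omega>)\<^sup>2) \<partial>M) \<le> (\<integral>\<^sup>+\<omega>. ennreal ((Y ?l r \<omega>)\<^sup>2) \<partial>M)"
        by (intro nn_integral_mono ennreal_leI) (auto simp: indicator_def)
      also have "\<dots> = ennreal (exp (?l\<^sup>2 * r))"
        using Y_square[OF r, of ?l] by (simp add: has_bochner_integral_iff nn_integral_eq_integral)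
      also have "\<dots> \<le> ennreal (exp (?l\<^sup>2 * T))" using r by (auto intro!: ennreal_leI mult_left_mono)
      finally show "(\<integral>\<^sup>+\<omega>. ennreal ((indicator ?A \<omega> * Y ?l r \<omega>)\<^sup>2) \<partial>M) \<le> ennreal (exp (?l\<^sup>2 * T))" .
    qed
    also have "\<dots> < \<infinity>" by (simp add: ennreal_mult_less_top)
    finally show ?thesis .
  qed
  have jY: "joint (\<lambda>s \<omega>. indicator ?A \<omega> * Y ?l s \<omega>)" by (intro joint_mult joint_const iA joint_Y)
  have one: "integrable PM (\<lambda>(s, \<omega>). indicator ?A \<omega> * (Y ?l s \<omega> * K s \<omega>))"
    "(\<integral>(s, \<omega>). indicator ?A \<omega> * (Y ?l s \<omega> * K s \<omega>) \<partial>PM) = expectation (\<lambda>\<omega>. indicator ?A \<omega> * (LBINT r:{0..T}. Y ?l r \<omega> * K r \<omega>))"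
    if K: "joint K" "energy T K < \<infinity>" for K
  proof -
    show i: "integrable PM (\<lambda>(s, \<omega>). indicator ?A \<omega> * (Y ?l s \<omega> * K s \<omega>))"
      using energy_product_integrable[OF jY eY K] by (simp add: case_prod_beta' mult.assoc)
    show "(\<integral>(s, \<omega>). indicator ?A \<omega> * (Y ?l s \<omega> * K s \<omega>) \<partial>PM) = expectation (\<lambda>\<omega>. indicator ?A \<omega> * (LBINT r:{0..T}. Y ?l r \<omega> * K r \<omega>))"
      unfolding integral_snd[OF i, symmetric] set_integral_leb by simp
  qed
  note c = admissible_consumption[OF adm] and c' = admissible_consumption[OF adm']
  have eq: "(\<lambda>x. indicator ?A (snd x) * (Y (price_of_risk v) (fst x) (snd x) * (C' (fst x) (snd x) - C (fst x) (snd x))))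
      = (\<lambda>x. (case x of (s, \<omega>) \<Rightarrow> indicator ?A \<omega> * (Y ?l s \<omega> * C' s \<omega>)) - (case x of (s, \<omega>) \<Rightarrow> indicator ?A \<omega> * (Y ?l s \<omega> * C s \<omega>)))"
    by (rule ext) (simp add: l right_diff_distrib case_prod_beta')
  show "integrable PM (\<lambda>x. indicator ?A (snd x) * (Y (price_of_risk v) (fst x) (snd x) * (C' (fst x) (snd x) - C (fst x) (snd x))))"
    unfolding eq by (intro Bochner_Integration.integrable_diff one c c')
  have I: "(\<integral>x. indicator ?A (snd x) * (Y (price_of_risk v) (fst x) (snd x) * (C' (fst x) (snd x) - C (fst x) (snd x))) \<partial>PM)
      = expectation (\<lambda>\<omega>. indicator ?A \<omega> * (LBINT r:{0..T}. Y ?l r \<omega> * C' r \<omega>))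
        - expectation (\<lambda>\<omega>. indicator ?A \<omega> * (LBINT r:{0..T}. Y ?l r \<omega> * C r \<omega>))"
    unfolding eq Bochner_Integration.integral_diff[OF one(1)[OF c'(2,3)] one(1)[OF c(2,3)]] one(2)[OF c'(2,3)] one(2)[OF c(2,3)] ..
  note bd = budget[OF w adm zero_T(1) A s] and bd' = budget[OF w' adm' zero_T(1) A s]
  have pX: "prog_measurable T F X" "prog_measurable T F X'" using w w' by (simp_all add: wealth_def)
  have meas: "(\<lambda>\<omega>. indicator ?A \<omega> * (Y ?l T \<omega> * (X' T \<omega> - X T \<omega>))) \<in> borel_measurable M"
    using T_pos by (intro borel_measurable_times borel_measurable_diff iA Y_M prog_section_M[OF pX(1) zero_T(2)] prog_section_M[OF pX(2) zero_T(2)]) auto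
  have ae: "AE \<omega> in M. indicator ?A \<omega> * (Y ?l T \<omega> * (X' T \<omega> - X' 0 \<omega>)) - indicator ?A \<omega> * (Y ?l T \<omega> * (X T \<omega> - X 0 \<omega>))
      = indicator ?A \<omega> * (Y ?l T \<omega> * (X' T \<omega> - X T \<omega>))"
    using wealth_0[OF w] wealth_0[OF w'] by eventually_elim (simp add: algebra_simps)
  have int: "integrable M (\<lambda>\<omega>. indicator ?A \<omega> * (Y ?l T \<omega> * (X' T \<omega> - X' 0 \<omega>)) - indicator ?A \<omega> * (Y ?l T \<omega> * (X T \<omega> - X 0 \<omega>)))"
    by (rule Bochner_Integration.integrable_diff[OF bd'(2) bd(2)])
  show "integrable M (\<lambda>\<omega>. indicator ?A \<omega> * (Y (price_of_risk v) T \<omega> * (X' T \<omega> - X T \<omega>)))"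
    unfolding l using integrable_cong_AE_imp[OF int meas] ae by (simp add: eq_commute)
  have "expectation (\<lambda>\<omega>. indicator ?A \<omega> * (Y ?l T \<omega> * (X' T \<omega> - X T \<omega>)))
      = expectation (\<lambda>\<omega>. indicator ?A \<omega> * (Y ?l T \<omega> * (X' T \<omega> - X' 0 \<omega>)) - indicator ?A \<omega> * (Y ?l T \<omega> * (X T \<omega> - X 0 \<omega>)))"
    by (rule integral_cong_AE[OF meas borel_measurable_integrable[OF int]]) (use ae in eventually_elim, simp)
  also have "\<dots> = expectation (\<lambda>\<omega>. indicator ?A \<omega> * (Y ?l T \<omega> * (X' T \<omega> - X' 0 \<omega>)))
      - expectation (\<lambda>\<omega>. indicator ?A \<omega> * (Y ?l T \<omega> * (X T \<omega> - X 0 \<omega>)))"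
    by (rule Bochner_Integration.integral_diff[OF bd'(2) bd(2)])
  finally show "(\<integral>x. indicator ?A (snd x) * (Y (price_of_risk v) (fst x) (snd x) * (C' (fst x) (snd x) - C (fst x) (snd x))) \<partial>PM)
      + expectation (\<lambda>\<omega>. indicator ?A \<omega> * (Y (price_of_risk v) T \<omega> * (X' T \<omega> - X T \<omega>))) = 0"
    unfolding I unfolding l using bd(3) bd'(3) by linarith
qed

text \<open>The derivative of the expected utility at the candidate, in the direction of any competitor, is a
  sum of budget differences over the types.\<close>

lemma first_order_condition:
  fixes Z :: "real \<Rightarrow> real" and Xb :: real
  assumes w: "wealth M T F W x0 \<mu> \<sigma> P C X" and adm: "admissible M T F P C"
    and w': "wealth M T F W x0 \<mu> \<sigma> P' C' X'" and adm': "admissible M T F P' C'"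
  defines "f \<equiv> \<lambda>x. state_price Z Xb (fst x) (snd x) * (1 / \<beta> (snd x) * (C' (fst x) (snd x) - C (fst x) (snd x)))"
    and "g \<equiv> \<lambda>\<omega>. state_price Z Xb T \<omega> * (1 / \<beta> \<omega> * (X' T \<omega> - X T \<omega>))"
  shows "integrable PM f" "integrable M g" "(\<integral>x. f x \<partial>PM) + (\<integral>\<omega>. g \<omega> \<partial>M) = 0"
proof -
  let ?c = "\<lambda>v. price_level Z Xb v / tolerance v"
  let ?f = "\<lambda>v x. indicator (type_event v) (snd x) * (Y (price_of_risk v) (fst x) (snd x) * (C' (fst x) (snd x) - C (fst x) (snd x)))"
  let ?g = "\<lambda>v \<omega>. indicator (type_event v) \<omega> * (Y (price_of_risk v) T \<omega> * (X' T \<omega> - X T \<omega>))"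
  note b = budget_difference[OF w adm w' adm']
  have ind: "indicator (type_event v) \<omega> * (k * y) * (1 / \<beta> \<omega> * d) = k / tolerance v * (indicator (type_event v) \<omega> * (y * d))"
    for v \<omega> k y d
    by (auto simp: indicator_def type_event_def tolerance_def)
  have f: "f = (\<lambda>x. \<Sum>v\<in>S. ?c v * ?f v x)"
    unfolding f_def state_price_def sum_distrib_right ind ..
  have g: "g = (\<lambda>\<omega>. \<Sum>v\<in>S. ?c v * ?g v \<omega>)"
    unfolding g_def state_price_def sum_distrib_right ind ..
  show "integrable PM f" unfolding f
    by (intro Bochner_Integration.integrable_sum Bochner_Integration.integrable_mult_right b(1))
  show "integrable M g" unfolding g
    by (intro Bochner_Integration.integrable_sum Bochner_Integration.integrable_mult_right b(2))
  have "(\<integral>x. f x \<partial>PM) = (\<Sum>v\<in>S. ?c v * (\<integral>x. ?f v x \<partial>PM))"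
    unfolding f by (subst Bochner_Integration.integral_sum)
      (intro Bochner_Integration.integrable_mult_right b(1), assumption, simp only: integral_mult_right_zero)
  moreover have "(\<integral>\<omega>. g \<omega> \<partial>M) = (\<Sum>v\<in>S. ?c v * (\<integral>\<omega>. ?g v \<omega> \<partial>M))"
    unfolding g by (subst Bochner_Integration.integral_sum)
      (intro Bochner_Integration.integrable_mult_right b(2), assumption, simp only: integral_mult_right_zero)
  ultimately have "(\<integral>x. f x \<partial>PM) + (\<integral>\<omega>. g \<omega> \<partial>M) = (\<Sum>v\<in>S. ?c v * ((\<integral>x. ?f v x \<partial>PM) + (\<integral>\<omega>. ?g v \<omega> \<partial>M)))"
    by (simp only: sum.distrib distrib_left)
  also have "\<dots> = 0" by (intro sum.neutral ballI) (simp only: b(3) mult_zero_right)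
  finally show "(\<integral>x. f x \<partial>PM) + (\<integral>\<omega>. g \<omega> \<partial>M) = 0" .
qed

text \<open>The negative of the payoff, kept in \<open>ennreal\<close> because a competitor may have infinite cost.\<close>

definition cost :: "(real \<Rightarrow> real) \<Rightarrow> real \<Rightarrow> (real \<Rightarrow> 'a \<Rightarrow> real) \<Rightarrow> (real \<Rightarrow> 'a \<Rightarrow> real) \<Rightarrow> ennreal" where
  "cost Z Xb C X = (\<integral>\<^sup>+\<omega>. ((\<integral>\<^sup>+s\<in>{0..T}. ennreal (exp (- (1 / \<beta> \<omega>) * (C s \<omega> - \<theta> \<omega> * Z s))) \<partial>lborel)
     + ennreal (exp (- (1 / \<beta> \<omega>) * (X T \<omega> - \<theta> \<omega> * Xb)))) \<partial>M)"

lemma payoff_eq: "payoff M T \<beta> \<theta> Z Xb C X = - enn2ereal (cost Z Xb C X)"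
  by (simp add: payoff_def cost_def)

lemma cost_eq:
  assumes Z: "continuous_on {0..T} Z" and j: "joint C" and X: "X T \<in> borel_measurable M"
  shows "joint (\<lambda>s \<omega>. exp (- (1 / \<beta> \<omega>) * (C s \<omega> - \<theta> \<omega> * Z s)))"
    and "(\<lambda>\<omega>. exp (- (1 / \<beta> \<omega>) * (X T \<omega> - \<theta> \<omega> * Xb))) \<in> borel_measurable M"
    and "cost Z Xb C X = (\<integral>\<^sup>+x. ennreal (exp (- (1 / \<beta> (snd x)) * (C (fst x) (snd x) - \<theta> (snd x) * Z (fst x)))) \<partial>PM)
      + (\<integral>\<^sup>+\<omega>. ennreal (exp (- (1 / \<beta> \<omega>) * (X T \<omega> - \<theta> \<omega> * Xb))) \<partial>M)"
proof -
  have jZ: "joint (\<lambda>s _. Z s)" by (intro prog_joint prog_det Z)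
  have jb: "joint (\<lambda>_ \<omega>. - (1 / \<beta> \<omega>))" using types_M by (intro joint_const) simp
  have jt: "joint (\<lambda>_. \<theta>)" using types_M by (intro joint_const) simp
  have "joint (\<lambda>s \<omega>. - (1 / \<beta> \<omega>) * (C s \<omega> - \<theta> \<omega> * Z s))"
    by (intro joint_mult joint_diff jb j jt jZ)
  from measurable_compose[OF jointD[OF this] borel_measurable_exp]
  show je: "joint (\<lambda>s \<omega>. exp (- (1 / \<beta> \<omega>) * (C s \<omega> - \<theta> \<omega> * Z s)))" unfolding joint_def .
  show m: "(\<lambda>\<omega>. exp (- (1 / \<beta> \<omega>) * (X T \<omega> - \<theta> \<omega> * Xb))) \<in> borel_measurable M"
    using types_M X by simp
  interpret leb: sigma_finite_measure "leb T" by (rule sigma_finite_leb)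
  have "(\<lambda>x. ennreal (exp (- (1 / \<beta> (fst x)) * (C (snd x) (fst x) - \<theta> (fst x) * Z (snd x))))) \<in> borel_measurable (M \<Otimes>\<^sub>M leb T)"
    using measurable_compose[OF measurable_pair_swap'[of M "leb T"] measurable_compose[OF jointD[OF je] measurable_ennreal]]
    by (simp add: case_prod_beta')
  from leb.borel_measurable_nn_integral_fst[OF this]
  have "(\<lambda>\<omega>. \<integral>\<^sup>+s\<in>{0..T}. ennreal (exp (- (1 / \<beta> \<omega>) * (C s \<omega> - \<theta> \<omega> * Z s))) \<partial>lborel) \<in> borel_measurable M"
    by (simp add: nn_integral_leb)
  then have "cost Z Xb C X = (\<integral>\<^sup>+\<omega>. (\<integral>\<^sup>+s\<in>{0..T}. ennreal (exp (- (1 / \<beta> \<omega>) * (C s \<omega> - \<theta> \<omega> * Z s))) \<partial>lborel) \<partial>M)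
      + (\<integral>\<^sup>+\<omega>. ennreal (exp (- (1 / \<beta> \<omega>) * (X T \<omega> - \<theta> \<omega> * Xb))) \<partial>M)"
    unfolding cost_def using m by (intro nn_integral_add) auto
  then show "cost Z Xb C X = (\<integral>\<^sup>+x. ennreal (exp (- (1 / \<beta> (snd x)) * (C (fst x) (snd x) - \<theta> (snd x) * Z (fst x)))) \<partial>PM)
      + (\<integral>\<^sup>+\<omega>. ennreal (exp (- (1 / \<beta> \<omega>) * (X T \<omega> - \<theta> \<omega> * Xb))) \<partial>M)"
    unfolding PM_nn_integral[OF je] .
qed

text \<open>The candidate beats every competitor because the exponential lies above its tangent at the
  candidate, and the linear term of the tangent integrates to \<open>0\<close> by the budget equation. Equality
  forces the two consumptions and the two terminal wealths to coincide, since the tangent touches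
  only once.\<close>

lemma verification:
  assumes Z: "continuous_on {0..T} Z"
    and w: "wealth M T F W x0 \<mu> \<sigma> P C X" and adm: "admissible M T F P C"
    and C: "AE \<omega> in M. \<forall>s\<in>{0..T}. C s \<omega> = consume Z Xb s \<omega>" and X: "AE \<omega> in M. X T \<omega> = capital Z Xb T \<omega>"
    and w': "wealth M T F W x0 \<mu> \<sigma> P' C' X'" and adm': "admissible M T F P' C'"
    and le: "cost Z Xb C' X' \<le> cost Z Xb C X"
  shows "AE (s, \<omega>) in PM. C' s \<omega> = C s \<omega>" and "AE \<omega> in M. X' T \<omega> = X T \<omega>"
proof -
  note c = admissible_consumption[OF adm] and c' = admissible_consumption[OF adm']
  have pX: "prog_measurable T F X" "prog_measurable T F X'" using w w' by (simp_all add: wealth_def)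
  note XM = prog_section_M[OF pX(1) zero_T(2)] prog_section_M[OF pX(2) zero_T(2)]
  let ?u = "\<lambda>C x. exp (- (1 / \<beta> (snd x)) * (C (fst x) (snd x) - \<theta> (snd x) * Z (fst x)))"
  let ?v = "\<lambda>X \<omega>. exp (- (1 / \<beta> \<omega>) * (X T \<omega> - \<theta> \<omega> * Xb))"
  let ?d = "\<lambda>x. state_price Z Xb (fst x) (snd x)" and ?dT = "state_price Z Xb T"
  note cost = cost_eq(1)[where C = C and X = X, OF Z c(2) XM(1)]
    cost_eq(2,3)[where C = C and X = X and Xb = Xb, OF Z c(2) XM(1)]
  note cost' = cost_eq(1)[where C = C' and X = X', OF Z c'(2) XM(2)]
    cost_eq(2,3)[where C = C' and X = X' and Xb = Xb, OF Z c'(2) XM(2)]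
  have aeM: "AE \<omega> in M. 0 < \<beta> \<omega> \<and> (\<forall>s\<in>{0..T}. ?u C (s, \<omega>) = state_price Z Xb s \<omega>) \<and> ?v X \<omega> = ?dT \<omega>"
    using marginal_utility[OF Z, of Xb] C X by eventually_elim simp
  have ae1: "AE x in PM. 0 < \<beta> (snd x) \<and> ?u C x = ?d x"
    using AE_pair_snd[OF sigma_finite_measure_axioms aeM, of "leb T"] AE_space
  proof eventually_elim
    case (elim x)
    then show ?case by (auto simp: space_pair_measure)
  qed
  have di: "integrable PM ?d" by (rule energy_integrable[OF joint_state_price energy_state_price])
  have dTM: "?dT \<in> borel_measurable M" by (rule state_price_M[OF zero_T(2)])
  have "integrable M (\<lambda>\<omega>. (?dT \<omega>)\<^sup>2)"
    unfolding integrable_square_iff[OF dTM] by (rule le_less_trans[OF state_price_square[OF zero_T(2)]]) simp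
  then have dTi: "integrable M ?dT" by (rule integrable_of_square[OF dTM])
  have ui: "integrable PM (?u C)"
    by (rule integrable_cong_AE_imp[OF di jointD[OF cost(1)]]) (use ae1 in eventually_elim, simp)
  have vi: "integrable M (?v X)"
    by (rule integrable_cong_AE_imp[OF dTi cost(2)]) (use aeM in eventually_elim, simp)
  have nnu: "(\<integral>\<^sup>+x. ennreal (?u C x) \<partial>PM) = ennreal (\<integral>x. ?u C x \<partial>PM)" by (rule nn_integral_eq_integral[OF ui]) simp
  have nnv: "(\<integral>\<^sup>+\<omega>. ennreal (?v X \<omega>) \<partial>M) = ennreal (\<integral>\<omega>. ?v X \<omega> \<partial>M)" by (rule nn_integral_eq_integral[OF vi]) simp
  have fin: "cost Z Xb C X < \<infinity>" unfolding cost(3) nnu nnv by simp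
  have fin': "(\<integral>\<^sup>+x. ennreal (?u C' x) \<partial>PM) < \<infinity>" "(\<integral>\<^sup>+\<omega>. ennreal (?v X' \<omega>) \<partial>M) < \<infinity>"
    using le_less_trans[OF le fin] unfolding cost'(3) by simp_all
  have ui': "integrable PM (?u C')"
    by (rule integrableI_nonneg[OF jointD[OF cost'(1)] _ fin'(1)]) simp
  have vi': "integrable M (?v X')"
    by (rule integrableI_nonneg[OF cost'(2) _ fin'(2)]) simp
  have nnu': "(\<integral>\<^sup>+x. ennreal (?u C' x) \<partial>PM) = ennreal (\<integral>x. ?u C' x \<partial>PM)" by (rule nn_integral_eq_integral[OF ui']) simp
  have nnv': "(\<integral>\<^sup>+\<omega>. ennreal (?v X' \<omega>) \<partial>M) = ennreal (\<integral>\<omega>. ?v X' \<omega> \<partial>M)" by (rule nn_integral_eq_integral[OF vi']) simp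
  have nonneg: "0 \<le> (\<integral>x. ?u C x \<partial>PM)" "0 \<le> (\<integral>\<omega>. ?v X \<omega> \<partial>M)" "0 \<le> (\<integral>x. ?u C' x \<partial>PM)" "0 \<le> (\<integral>\<omega>. ?v X' \<omega> \<partial>M)"
    by (rule Bochner_Integration.integral_nonneg, simp)+
  have le': "(\<integral>x. ?u C' x \<partial>PM) + (\<integral>\<omega>. ?v X' \<omega> \<partial>M) \<le> (\<integral>x. ?u C x \<partial>PM) + (\<integral>\<omega>. ?v X \<omega> \<partial>M)"
    using le nonneg unfolding cost(3) cost'(3) nnu nnv nnu' nnv'
    by (simp add: ennreal_plus[symmetric] del: ennreal_plus)
  let ?f = "\<lambda>x. ?d x * (1 / \<beta> (snd x) * (C' (fst x) (snd x) - C (fst x) (snd x)))"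
  let ?g = "\<lambda>\<omega>. ?dT \<omega> * (1 / \<beta> \<omega> * (X' T \<omega> - X T \<omega>))"
  note foc = first_order_condition[OF w adm w' adm', of Z Xb]
  \<comment> \<open>The distances of the exponential from its tangent at the candidate; their integrals add up to at most \<open>0\<close>.\<close>
  define gap1 where "gap1 x = ?u C' x - ?u C x + ?f x" for x
  define gap2 where "gap2 \<omega> = ?v X' \<omega> - ?v X \<omega> + ?g \<omega>" for \<omega>
  have gi: "integrable PM gap1" "integrable M gap2"
    unfolding gap1_def[abs_def] gap2_def[abs_def] using ui ui' vi vi' foc by auto
  have tangent: "0 \<le> exp (- (1 / b) * (x' - k)) - exp (- (1 / b) * (x - k)) + exp (- (1 / b) * (x - k)) * (1 / b * (x' - x))"
    "exp (- (1 / b) * (x' - k)) - exp (- (1 / b) * (x - k)) + exp (- (1 / b) * (x - k)) * (1 / b * (x' - x)) = 0 \<Longrightarrow> x' = x"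
    if "0 < b" for b x x' k :: real
  proof -
    have e: "- (1 / b) * (x' - k) - (- (1 / b) * (x - k)) = - (1 / b * (x' - x))" by (simp add: diff_divide_distrib)
    have m: "exp (- (1 / b) * (x - k)) * (1 + - (1 / b * (x' - x))) = exp (- (1 / b) * (x - k)) - exp (- (1 / b) * (x - k)) * (1 / b * (x' - x))"
      by (simp only: right_diff_distrib mult_1_right add_uminus_conv_diff)
    from exp_tangent(1)[of "- (1 / b) * (x - k)" "- (1 / b) * (x' - k)", unfolded e m]
    show "0 \<le> exp (- (1 / b) * (x' - k)) - exp (- (1 / b) * (x - k)) + exp (- (1 / b) * (x - k)) * (1 / b * (x' - x))"
      by linarith
    assume "exp (- (1 / b) * (x' - k)) - exp (- (1 / b) * (x - k)) + exp (- (1 / b) * (x - k)) * (1 / b * (x' - x)) = 0"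
    then have "exp (- (1 / b) * (x' - k)) = exp (- (1 / b) * (x - k)) * (1 + - (1 / b * (x' - x)))"
      unfolding m by linarith
    from exp_tangent(2)[of "- (1 / b) * (x' - k)" "- (1 / b) * (x - k)", unfolded e, OF this]
    show "x' = x" using that by simp
  qed
  have g1': "AE x in PM. 0 \<le> gap1 x \<and> (gap1 x = 0 \<longrightarrow> C' (fst x) (snd x) = C (fst x) (snd x))"
    using ae1
  proof eventually_elim
    case (elim x)
    then have b: "0 < \<beta> (snd x)" and d: "?d x = ?u C x" by auto
    show ?case unfolding gap1_def d
      by (intro conjI impI tangent(1)[OF b]) (erule tangent(2)[OF b])
  qed
  have g2': "AE \<omega> in M. 0 \<le> gap2 \<omega> \<and> (gap2 \<omega> = 0 \<longrightarrow> X' T \<omega> = X T \<omega>)"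
    using aeM
  proof eventually_elim
    case (elim \<omega>)
    then have b: "0 < \<beta> \<omega>" and d: "?dT \<omega> = ?v X \<omega>" by auto
    show ?case unfolding gap2_def d
      by (intro conjI impI tangent(1)[OF b]) (erule tangent(2)[OF b])
  qed
  have g1: "AE x in PM. 0 \<le> gap1 x" and z1: "AE x in PM. gap1 x = 0 \<longrightarrow> C' (fst x) (snd x) = C (fst x) (snd x)"
    using g1' by simp_all
  have g2: "AE \<omega> in M. 0 \<le> gap2 \<omega>" and z2: "AE \<omega> in M. gap2 \<omega> = 0 \<longrightarrow> X' T \<omega> = X T \<omega>"
    using g2' by simp_all
  have "(\<integral>x. gap1 x \<partial>PM) = (\<integral>x. ?u C' x \<partial>PM) - (\<integral>x. ?u C x \<partial>PM) + (\<integral>x. ?f x \<partial>PM)"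
    unfolding gap1_def
    by (simp only: Bochner_Integration.integral_add[OF Bochner_Integration.integrable_diff[OF ui' ui] foc(1)]
      Bochner_Integration.integral_diff[OF ui' ui])
  moreover have "(\<integral>\<omega>. gap2 \<omega> \<partial>M) = (\<integral>\<omega>. ?v X' \<omega> \<partial>M) - (\<integral>\<omega>. ?v X \<omega> \<partial>M) + (\<integral>\<omega>. ?g \<omega> \<partial>M)"
    unfolding gap2_def
    by (simp only: Bochner_Integration.integral_add[OF Bochner_Integration.integrable_diff[OF vi' vi] foc(2)]
      Bochner_Integration.integral_diff[OF vi' vi])
  ultimately have "(\<integral>x. gap1 x \<partial>PM) + (\<integral>\<omega>. gap2 \<omega> \<partial>M) \<le> 0" using le' foc(3) by linarith
  moreover have "0 \<le> (\<integral>x. gap1 x \<partial>PM)" "0 \<le> (\<integral>\<omega>. gap2 \<omega> \<partial>M)"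
    using g1 g2 by (auto intro: integral_nonneg_AE)
  ultimately have zero: "(\<integral>x. gap1 x \<partial>PM) = 0" "(\<integral>\<omega>. gap2 \<omega> \<partial>M) = 0" by linarith+
  have "AE x in PM. gap1 x = 0" using zero(1) integral_nonneg_eq_0_iff_AE[OF gi(1) g1] by simp
  with z1 have "AE x in PM. C' (fst x) (snd x) = C (fst x) (snd x)" by eventually_elim simp
  then show "AE (s, \<omega>) in PM. C' s \<omega> = C s \<omega>" by (simp add: case_prod_beta')
  have "AE \<omega> in M. gap2 \<omega> = 0" using zero(2) integral_nonneg_eq_0_iff_AE[OF gi(2) g2] by simp
  with z2 show "AE \<omega> in M. X' T \<omega> = X T \<omega>" by eventually_elim simp
qed

section \<open>Consumption and terminal wealth determine the control\<close>

text \<open>Discounted wealth plus discounted consumption is a martingale, hence determined by its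
  terminal value. Concretely, the budget equations from time \<open>t\<close> on, applied to the event that one
  wealth exceeds the other, show that this event has measure zero.\<close>

lemma state_le:
  assumes w: "wealth M T F W x0 \<mu> \<sigma> P C X" and adm: "admissible M T F P C"
    and w': "wealth M T F W x0 \<mu> \<sigma> P' C' X'" and adm': "admissible M T F P' C'"
    and CC: "AE (s, \<omega>) in PM. C' s \<omega> = C s \<omega>" and XX: "AE \<omega> in M. X' T \<omega> = X T \<omega>" and t: "t \<in> {0..T}"
  shows "AE \<omega> in M. X' t \<omega> \<le> X t \<omega>"
proof -
  note c = admissible_consumption[OF adm] and c' = admissible_consumption[OF adm']
  have pX: "prog_measurable T F X" "prog_measurable T F X'" using w w' by (simp_all add: wealth_def)
  have per_type: "AE \<omega> in M. \<omega> \<in> type_event v \<longrightarrow> X' t \<omega> \<le> X t \<omega>" if v: "v \<in> S" for v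
  proof -
    obtain m s b h where v4: "v = (m, s, b, h)" by (cases v)
    have s: "s \<noteq> 0" using S_pos[of m s b h] v v4 by auto
    define A where "A = type_event v \<inter> {\<omega> \<in> space (F t). X t \<omega> < X' t \<omega>}"
    have "{\<omega> \<in> space (F t). X t \<omega> < X' t \<omega>} \<in> sets (F t)"
      by (rule borel_measurable_less[OF prog_section[OF pX(1) t] prog_section[OF pX(2) t]])
    then have A: "A \<in> sets (F t)" "\<forall>\<omega>\<in>A. \<mu> \<omega> = m \<and> \<sigma> \<omega> = s"
      using type_event_F[OF t] by (auto simp: A_def type_event_def v4)
    let ?l = "m / s"
    note bd = budget[OF w adm t A s] and bd' = budget[OF w' adm' t A s]
    have ae: "AE \<omega> in M. indicator A \<omega> * (LBINT r:{t..T}. Y ?l r \<omega> * C' r \<omega>) = indicator A \<omega> * (LBINT r:{t..T}. Y ?l r \<omega> * C r \<omega>)"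
    proof -
      have "AE (s, \<omega>) in PM. Y ?l s \<omega> * C' s \<omega> = Y ?l s \<omega> * C s \<omega>" using CC by eventually_elim auto
      then have "AE \<omega> in M. (LBINT r:{t..T}. Y ?l r \<omega> * C' r \<omega>) = (LBINT r:{t..T}. Y ?l r \<omega> * C r \<omega>)"
        using t by (intro same_integrals joint_mult joint_Y c c') auto
      then show ?thesis by eventually_elim simp
    qed
    have "expectation (\<lambda>\<omega>. indicator A \<omega> * (LBINT r:{t..T}. Y ?l r \<omega> * C' r \<omega>))
        = expectation (\<lambda>\<omega>. indicator A \<omega> * (LBINT r:{t..T}. Y ?l r \<omega> * C r \<omega>))"
      by (rule integral_cong_AE[OF borel_measurable_integrable[OF bd'(1)] borel_measurable_integrable[OF bd(1)] ae])
    then have e0: "expectation (\<lambda>\<omega>. indicator A \<omega> * (Y ?l T \<omega> * (X T \<omega> - X t \<omega>)) - indicator A \<omega> * (Y ?l T \<omega> * (X' T \<omega> - X' t \<omega>))) = 0"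
      using bd(3) bd'(3) by (simp add: Bochner_Integration.integral_diff[OF bd(2) bd'(2)])
    let ?q = "\<lambda>\<omega>. indicator A \<omega> * (Y ?l T \<omega> * (X T \<omega> - X t \<omega>)) - indicator A \<omega> * (Y ?l T \<omega> * (X' T \<omega> - X' t \<omega>))"
    have q: "AE \<omega> in M. ?q \<omega> = indicator A \<omega> * (Y ?l T \<omega> * (X' t \<omega> - X t \<omega>))"
      using XX by eventually_elim (simp add: algebra_simps)
    have q0: "AE \<omega> in M. 0 \<le> ?q \<omega>"
      using q
    proof eventually_elim
      case (elim \<omega>)
      have "0 \<le> indicator A \<omega> * (Y ?l T \<omega> * (X' t \<omega> - X t \<omega>))"
      proof (cases "\<omega> \<in> A")
        case True
        then have "X t \<omega> < X' t \<omega>" by (simp add: A_def)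
        then have "0 \<le> Y ?l T \<omega> * (X' t \<omega> - X t \<omega>)" using Y_pos[of ?l T \<omega>] by (intro mult_nonneg_nonneg) auto
        then show ?thesis by simp
      qed simp
      then show ?case using elim by simp
    qed
    have qi: "integrable M ?q" by (rule Bochner_Integration.integrable_diff[OF bd(2) bd'(2)])
    have "AE \<omega> in M. ?q \<omega> = 0" using e0 integral_nonneg_eq_0_iff_AE[OF qi q0] by simp
    with q show ?thesis using AE_space
    proof eventually_elim
      case (elim \<omega>)
      show ?case
      proof (intro impI, rule ccontr)
        assume "\<omega> \<in> type_event v" "\<not> X' t \<omega> \<le> X t \<omega>"
        then have "\<omega> \<in> A" "X t \<omega> < X' t \<omega>" using elim(3) space_F[OF t] by (auto simp: A_def)
        then show False using elim(1,2) Y_pos[of ?l T \<omega>] by simp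
      qed
    qed
  qed
  have "AE \<omega> in M. \<forall>v\<in>S. \<omega> \<in> type_event v \<longrightarrow> X' t \<omega> \<le> X t \<omega>"
    by (rule AE_finite_allI[OF S_fin per_type])
  with type_S AE_space show ?thesis
    by eventually_elim (auto simp: type_event_def)
qed

lemma AE_PM_sym: "AE (s, \<omega>) in PM. K s \<omega> = L s \<omega> \<Longrightarrow> AE (s, \<omega>) in PM. L s \<omega> = K s \<omega>"
  by (erule AE_mp) (intro AE_I2, auto)

lemma state_determined:
  assumes w: "wealth M T F W x0 \<mu> \<sigma> P C X" and adm: "admissible M T F P C"
    and w': "wealth M T F W x0 \<mu> \<sigma> P' C' X'" and adm': "admissible M T F P' C'"
    and CC: "AE (s, \<omega>) in PM. C' s \<omega> = C s \<omega>" and XX: "AE \<omega> in M. X' T \<omega> = X T \<omega>" and t: "t \<in> {0..T}"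
  shows "AE \<omega> in M. X' t \<omega> = X t \<omega>"
proof -
  have XX': "AE \<omega> in M. X T \<omega> = X' T \<omega>" using XX by eventually_elim simp
  show ?thesis
    using state_le[OF w adm w' adm' CC XX t] state_le[OF w' adm' w adm AE_PM_sym[OF CC] XX' t]
    by eventually_elim simp
qed

text \<open>If wealth and consumption agree, the difference of the stochastic integrals has finite
  variation: it is \<open>- \<integral> (\<mu> / \<sigma>) K ds\<close> with \<open>K = (P' - P) \<sigma>\<close>. By the isometry the energy of \<open>K\<close> up to
  \<open>t\<close> is then at most \<open>9 \<Lambda>\<^sup>2 (t - r)\<close> times itself once \<open>K\<close> vanishes up to \<open>r\<close>, so it vanishes
  on one short interval after the other.\<close>

lemma control_determined:
  assumes w: "wealth M T F W x0 \<mu> \<sigma> P C X" and adm: "admissible M T F P C"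
    and w': "wealth M T F W x0 \<mu> \<sigma> P' C' X'" and adm': "admissible M T F P' C'"
    and CC: "AE (s, \<omega>) in PM. C' s \<omega> = C s \<omega>" and XX: "AE \<omega> in M. X' T \<omega> = X T \<omega>"
  shows "AE (s, \<omega>) in PM. P' s \<omega> = P s \<omega>"
proof -
  note c = admissible_consumption[OF adm] and c' = admissible_consumption[OF adm']
  obtain I where I: "ito_integral M T F W (\<lambda>s \<omega>. P s \<omega> * \<sigma> \<omega>) I"
    and X: "AE \<omega> in M. \<forall>t\<in>{0..T}. X t \<omega> = x0 + (LBINT s:{0..t}. P s \<omega> * \<mu> \<omega>) + I t \<omega> - (LBINT s:{0..t}. C s \<omega>)"
    and iP: "AE \<omega> in M. set_integrable lborel {0..T} (\<lambda>s. P s \<omega> * \<mu> \<omega>)"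
    using w unfolding wealth_def by blast
  obtain I' where I': "ito_integral M T F W (\<lambda>s \<omega>. P' s \<omega> * \<sigma> \<omega>) I'"
    and X': "AE \<omega> in M. \<forall>t\<in>{0..T}. X' t \<omega> = x0 + (LBINT s:{0..t}. P' s \<omega> * \<mu> \<omega>) + I' t \<omega> - (LBINT s:{0..t}. C' s \<omega>)"
    and iP': "AE \<omega> in M. set_integrable lborel {0..T} (\<lambda>s. P' s \<omega> * \<mu> \<omega>)"
    using w' unfolding wealth_def by blast
  define K where "K s \<omega> = P' s \<omega> * \<sigma> \<omega> - P s \<omega> * \<sigma> \<omega>" for s \<omega>
  have jH: "joint (\<lambda>s \<omega>. P s \<omega> * \<sigma> \<omega>)" "joint (\<lambda>s \<omega>. P' s \<omega> * \<sigma> \<omega>)"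
    using prog_joint[OF ito_prog(1)[OF I]] prog_joint[OF ito_prog(1)[OF I']] by auto
  have jK: "joint K" unfolding K_def[abs_def] by (intro joint_diff jH)
  have eK: "energy T K < \<infinity>" unfolding K_def[abs_def]
    by (intro energy_diff_finite jH ito_square_integrable(1)[OF I] ito_square_integrable(1)[OF I'])
  obtain \<Lambda> where \<Lambda>: "0 \<le> \<Lambda>" "AE \<omega> in M. \<bar>\<mu> \<omega> / \<sigma> \<omega>\<bar> \<le> \<Lambda>"
    using type_bound[of "\<lambda>m s b h. m / s"] by blast
  have iK: "AE \<omega> in M. set_integrable lborel {0..T} (\<lambda>s. K s \<omega>)"
    using energy_AE_integrable[OF jK eK] by (simp add: set_integrable_iff_leb)
  have step: "energy t K \<le> ennreal (9 * \<Lambda>\<^sup>2 * (t - r)) * energy t K"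
    if r: "0 \<le> r" "r \<le> t" "t \<le> T" and z: "energy r K = 0" for r t
  proof -
    have t: "t \<in> {0..T}" using r by auto
    let ?A = "\<lambda>\<omega>. LBINT s:{r..t}. K s \<omega>"
    have AM: "?A \<in> borel_measurable M" using joint_integral_M[OF jK] r by simp
    have "(\<integral>\<^sup>+\<omega>. ennreal ((LBINT s:{0..r}. K s \<omega>)\<^sup>2) \<partial>M) \<le> ennreal (r - 0) * energy r K"
      unfolding energy_def using r by (intro square_integral_le_energy jK) auto
    then have "(\<integral>\<^sup>+\<omega>. ennreal ((LBINT s:{0..r}. K s \<omega>)\<^sup>2) \<partial>M) = 0" using z by simp
    moreover have "(\<lambda>\<omega>. LBINT s:{0..r}. K s \<omega>) \<in> borel_measurable M" using joint_integral_M[OF jK, of 0 r] r by simp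
    ultimately have r0: "AE \<omega> in M. (LBINT s:{0..r}. K s \<omega>) = 0" by (subst (asm) nn_integral_0_iff_AE) auto
    have "AE (s, \<omega>) in PM. C' s \<omega> = C s \<omega>" by (rule CC)
    from same_integrals[OF c'(2) c(2) this, of 0 t] r
    have Ceq: "AE \<omega> in M. (LBINT s:{0..t}. C' s \<omega>) = (LBINT s:{0..t}. C s \<omega>)" by simp
    have sq: "AE \<omega> in M. (I' t \<omega> - I t \<omega>)\<^sup>2 \<le> \<Lambda>\<^sup>2 * (?A \<omega>)\<^sup>2"
      using X X' iP iP' iK r0 Ceq state_determined[OF w adm w' adm' CC XX t] type_pos \<Lambda>(2)
    proof eventually_elim
      case (elim \<omega>)
      have i: "set_integrable lborel {0..t} (\<lambda>s. P s \<omega> * \<mu> \<omega>)" "set_integrable lborel {0..t} (\<lambda>s. P' s \<omega> * \<mu> \<omega>)"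
        "set_integrable lborel {0..t} (\<lambda>s. K s \<omega>)"
        using t by (auto intro: set_integrable_subset[OF elim(3)] set_integrable_subset[OF elim(4)] set_integrable_subset[OF elim(5)])
      have "I' t \<omega> - I t \<omega> = - ((LBINT s:{0..t}. P' s \<omega> * \<mu> \<omega>) - (LBINT s:{0..t}. P s \<omega> * \<mu> \<omega>))"
        using bspec[OF elim(1) t] bspec[OF elim(2) t] elim(7,8) by linarith
      also have "(LBINT s:{0..t}. P' s \<omega> * \<mu> \<omega>) - (LBINT s:{0..t}. P s \<omega> * \<mu> \<omega>) = (LBINT s:{0..t}. P' s \<omega> * \<mu> \<omega> - P s \<omega> * \<mu> \<omega>)"
        by (rule set_integral_diff(2)[OF i(2,1), symmetric])
      also have "\<dots> = (LBINT s:{0..t}. \<mu> \<omega> / \<sigma> \<omega> * K s \<omega>)"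
        using elim(9) by (intro set_lebesgue_integral_cong) (auto simp: K_def field_simps)
      also have "\<dots> = \<mu> \<omega> / \<sigma> \<omega> * (LBINT s:{0..t}. K s \<omega>)" by (rule set_integral_mult_right)
      also have "(LBINT s:{0..t}. K s \<omega>) = ?A \<omega>"
        using set_integral_split[OF i(3) r(1,2)] elim(6) by simp
      finally have "(I' t \<omega> - I t \<omega>)\<^sup>2 = (\<mu> \<omega> / \<sigma> \<omega>)\<^sup>2 * (?A \<omega>)\<^sup>2"
        by (simp only: power2_minus power_mult_distrib)
      also have "\<dots> \<le> \<Lambda>\<^sup>2 * (?A \<omega>)\<^sup>2"
      proof (rule mult_right_mono)
        have "\<bar>\<mu> \<omega> / \<sigma> \<omega>\<bar>\<^sup>2 \<le> \<Lambda>\<^sup>2" by (rule power_mono[OF elim(10)]) simp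
        then show "(\<mu> \<omega> / \<sigma> \<omega>)\<^sup>2 \<le> \<Lambda>\<^sup>2" by (simp only: power2_abs)
      qed simp
      finally show ?case .
    qed
    have "(\<integral>\<^sup>+\<omega>. ennreal ((I' t \<omega> - I t \<omega>)\<^sup>2) \<partial>M) \<le> (\<integral>\<^sup>+\<omega>. ennreal (\<Lambda>\<^sup>2) * ennreal ((?A \<omega>)\<^sup>2) \<partial>M)"
      by (rule nn_integral_mono_AE) (use sq in eventually_elim, simp add: ennreal_mult[symmetric] ennreal_leI)
    also have "\<dots> = ennreal (\<Lambda>\<^sup>2) * (\<integral>\<^sup>+\<omega>. ennreal ((?A \<omega>)\<^sup>2) \<partial>M)"
      using AM by (intro nn_integral_cmult) simp
    also have "\<dots> \<le> ennreal (\<Lambda>\<^sup>2) * (ennreal (t - r) * energy t K)"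
    proof (intro mult_left_mono)
      have "(\<integral>\<^sup>+\<omega>. ennreal ((?A \<omega>)\<^sup>2) \<partial>M) \<le> ennreal (t - r) * (\<integral>\<^sup>+\<omega>. (\<integral>\<^sup>+s\<in>{r..t}. ennreal ((K s \<omega>)\<^sup>2) \<partial>lborel) \<partial>M)"
        by (rule square_integral_le_energy[OF jK r])
      also have "\<dots> \<le> ennreal (t - r) * energy t K"
        unfolding energy_def using r by (intro mult_left_mono nn_integral_mono) (auto simp: indicator_def)
      finally show "(\<integral>\<^sup>+\<omega>. ennreal ((?A \<omega>)\<^sup>2) \<partial>M) \<le> ennreal (t - r) * energy t K" .
    qed simp
    finally have "9 * (\<integral>\<^sup>+\<omega>. ennreal ((I' t \<omega> - I t \<omega>)\<^sup>2) \<partial>M) \<le> 9 * (ennreal (\<Lambda>\<^sup>2) * (ennreal (t - r) * energy t K))"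
      by (rule mult_left_mono) simp
    moreover have "energy t K \<le> 9 * (\<integral>\<^sup>+\<omega>. ennreal ((I' t \<omega> - I t \<omega>)\<^sup>2) \<partial>M)"
      unfolding K_def[abs_def] by (rule ito_isometry(1)[OF I' I t])
    moreover have "9 * (ennreal (\<Lambda>\<^sup>2) * (ennreal (t - r) * energy t K)) = ennreal (9 * \<Lambda>\<^sup>2 * (t - r)) * energy t K"
      using r by (simp add: ennreal_mult mult.assoc)
    ultimately show ?thesis by simp
  qed
  \<comment> \<open>Short enough that the factor \<open>9 * \<Lambda>\<^sup>2 * (t - r)\<close> is at most \<open>1 / 2\<close>, and finite energy absorbs it.\<close>
  have contract: "x = 0" if le: "x \<le> ennreal q * x" and q: "q \<le> 1 / 2" "0 \<le> q" and fin: "x < \<infinity>" for x :: ennreal and q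
  proof -
    obtain y where y: "x = ennreal y" "0 \<le> y" using fin by (cases x) auto
    have "ennreal y \<le> ennreal (q * y)" using le q y by (simp add: ennreal_mult)
    then have "y \<le> q * y" using y q by (simp add: ennreal_le_iff)
    also have "\<dots> \<le> 1 / 2 * y" using q(1) y(2) by (rule mult_right_mono)
    finally show ?thesis using y by simp
  qed
  define \<eta> where "\<eta> = 1 / (18 * \<Lambda>\<^sup>2 + 1)"
  have pos: "0 < 18 * \<Lambda>\<^sup>2 + 1" by (simp add: add_nonneg_pos)
  have \<eta>: "0 < \<eta>" "9 * \<Lambda>\<^sup>2 * \<eta> \<le> 1 / 2" unfolding \<eta>_def using pos by (simp_all add: pos_divide_le_eq)
  have grid: "energy (min T (real k * \<eta>)) K = 0" for k
  proof (induction k)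
    case 0
    have "energy 0 K = 0"
    proof -
      have "(\<integral>\<^sup>+s\<in>{0..0}. ennreal ((K s \<omega>)\<^sup>2) \<partial>lborel) = (\<integral>\<^sup>+s. 0 \<partial>(lborel :: real measure))" for \<omega>
      proof (rule nn_integral_cong_AE)
        show "AE s in lborel. ennreal ((K s \<omega>)\<^sup>2) * indicator {0..0} s = 0"
          using AE_lborel_singleton[of "0 :: real"]
        proof eventually_elim
          case (elim s)
          then have "s \<notin> {0..0}" by auto
          then show ?case by simp
        qed
      qed
      then show ?thesis by (simp add: energy_def)
    qed
    then show ?case using T_pos by simp
  next
    case (Suc k)
    let ?r = "min T (real k * \<eta>)" and ?t = "min T (real (Suc k) * \<eta>)"
    have r: "0 \<le> ?r" "?r \<le> ?t" "?t \<le> T" "?t - ?r \<le> \<eta>"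
      using T_pos \<eta>(1) by (auto simp: min_def algebra_simps)
    show ?case
    proof (rule contract[OF step[OF r(1-3) Suc]])
      have "9 * \<Lambda>\<^sup>2 * (?t - ?r) \<le> 9 * \<Lambda>\<^sup>2 * \<eta>" using r(4) by (intro mult_left_mono) auto
      then show "9 * \<Lambda>\<^sup>2 * (?t - ?r) \<le> 1 / 2" using \<eta>(2) by linarith
      show "0 \<le> 9 * \<Lambda>\<^sup>2 * (?t - ?r)" using r(2) by (intro mult_nonneg_nonneg) auto
      show "energy ?t K < \<infinity>" by (rule le_less_trans[OF energy_mono eK]) (rule r(3))
    qed
  qed
  obtain k :: nat where "T / \<eta> \<le> real k" using real_arch_simple by blast
  then have "T \<le> real k * \<eta>" using \<eta>(1) by (simp add: divide_le_eq)
  then have "energy T K = 0" using grid[of k] by (simp add: min_def)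
  then have "(\<integral>\<^sup>+x. ennreal ((K (fst x) (snd x))\<^sup>2) \<partial>PM) = 0"
    using PM_nn_integral[of "\<lambda>s \<omega>. (K s \<omega>)\<^sup>2"] joint_mult[OF jK jK] by (simp add: energy_def power2_eq_square)
  then have "AE x in PM. K (fst x) (snd x) = 0"
    using jointD[OF jK] by (subst (asm) nn_integral_0_iff_AE) auto
  with AE_pair_snd[OF sigma_finite_measure_axioms type_pos, of "leb T"]
  show ?thesis by eventually_elim (auto simp: K_def)
qed

text \<open>The converse direction: a control determines its wealth, since the stochastic integrals of
  integrands at distance \<open>0\<close> coincide.\<close>

lemma wealth_determined:
  assumes w: "wealth M T F W x0 \<mu> \<sigma> P C X" and adm: "admissible M T F P C"
    and w': "wealth M T F W x0 \<mu> \<sigma> P' C' X'" and adm': "admissible M T F P' C'"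
    and CC: "AE (s, \<omega>) in PM. C' s \<omega> = C s \<omega>" and PP: "AE (s, \<omega>) in PM. P' s \<omega> = P s \<omega>"
    and t: "t \<in> {0..T}"
  shows "AE \<omega> in M. X' t \<omega> = X t \<omega>"
proof -
  note c = admissible_consumption[OF adm] and c' = admissible_consumption[OF adm']
  obtain I where I: "ito_integral M T F W (\<lambda>s \<omega>. P s \<omega> * \<sigma> \<omega>) I"
    and X: "AE \<omega> in M. \<forall>t\<in>{0..T}. X t \<omega> = x0 + (LBINT s:{0..t}. P s \<omega> * \<mu> \<omega>) + I t \<omega> - (LBINT s:{0..t}. C s \<omega>)"
    using w unfolding wealth_def by blast
  obtain I' where I': "ito_integral M T F W (\<lambda>s \<omega>. P' s \<omega> * \<sigma> \<omega>) I'"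
    and X': "AE \<omega> in M. \<forall>t\<in>{0..T}. X' t \<omega> = x0 + (LBINT s:{0..t}. P' s \<omega> * \<mu> \<omega>) + I' t \<omega> - (LBINT s:{0..t}. C' s \<omega>)"
    using w' unfolding wealth_def by blast
  let ?K = "\<lambda>s \<omega>. P' s \<omega> * \<sigma> \<omega> - P s \<omega> * \<sigma> \<omega>"
  have jK: "joint ?K"
    by (intro joint_diff prog_joint ito_prog(1)[OF I] ito_prog(1)[OF I'])
  have "AE x in PM. ?K (fst x) (snd x) = 0" using PP by eventually_elim auto
  then have "(\<integral>\<^sup>+x. ennreal ((?K (fst x) (snd x))\<^sup>2) \<partial>PM) = 0"
    using jointD[OF jK] by (subst nn_integral_0_iff_AE) auto
  then have "energy T ?K = 0"
    using PM_nn_integral[of "\<lambda>s \<omega>. (?K s \<omega>)\<^sup>2"] joint_mult[OF jK jK] by (simp add: energy_def power2_eq_square)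
  from ito_unique[OF I' I this] have II: "AE \<omega> in M. \<forall>t\<in>{0..T}. I' t \<omega> = I t \<omega>" .
  have m: "joint (\<lambda>_. \<mu>)" by (rule joint_const) (rule types_M)
  have "AE (s, \<omega>) in PM. P' s \<omega> * \<mu> \<omega> = P s \<omega> * \<mu> \<omega>" using PP by eventually_elim auto
  from same_integrals[OF joint_mult[OF c'(5) m] joint_mult[OF c(5) m] this, of 0 t] t
  have "AE \<omega> in M. (LBINT s:{0..t}. P' s \<omega> * \<mu> \<omega>) = (LBINT s:{0..t}. P s \<omega> * \<mu> \<omega>)" by simp
  moreover from same_integrals[OF c'(2) c(2) CC, of 0 t] t
  have "AE \<omega> in M. (LBINT s:{0..t}. C' s \<omega>) = (LBINT s:{0..t}. C s \<omega>)" by simp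
  ultimately show ?thesis using X X' II
  proof eventually_elim
    case (elim \<omega>)
    then show ?case using bspec[OF elim(3) t] bspec[OF elim(4) t] bspec[OF elim(5) t] by simp
  qed
qed

end

context game
begin

section \<open>Consistency\<close>

lemma type_integrable:
  fixes f :: "real \<Rightarrow> real \<Rightarrow> real \<Rightarrow> real \<Rightarrow> real"
  assumes "(\<lambda>\<omega>. f (\<mu> \<omega>) (\<sigma> \<omega>) (\<beta> \<omega>) (\<theta> \<omega>)) \<in> borel_measurable M"
  shows "integrable M (\<lambda>\<omega>. f (\<mu> \<omega>) (\<sigma> \<omega>) (\<beta> \<omega>) (\<theta> \<omega>))"
proof -
  obtain B where B: "AE \<omega> in M. \<bar>f (\<mu> \<omega>) (\<sigma> \<omega>) (\<beta> \<omega>) (\<theta> \<omega>)\<bar> \<le> B" using type_bound[of f] by blast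
  show ?thesis by (rule integrable_const_bound[OF _ assms]) (use B in simp)
qed

abbreviation tb :: real where "tb \<equiv> expectation \<theta>"

abbreviation \<kappa> :: real where "\<kappa> \<equiv> expectation (\<lambda>\<omega>. (\<mu> \<omega> / \<sigma> \<omega>)\<^sup>2 * \<beta> \<omega>)"

lemma \<theta>_integrable: "integrable M \<theta>"
  by (rule type_integrable[of "\<lambda>m s b h. h"]) (rule types_M)

lemma tb_bounds: "0 \<le> tb" "tb \<le> 1"
proof -
  show "0 \<le> tb" by (rule integral_nonneg_AE) (use type_pos in eventually_elim, simp)
  have "tb \<le> expectation (\<lambda>_. 1)"
    by (rule integral_mono_AE[OF \<theta>_integrable]) (simp, use type_pos in eventually_elim, simp)
  then show "tb \<le> 1" by (simp add: prob_space)
qed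

lemma D_pos: "0 < (1 - tb) * T + 1"
  using tb_bounds T_pos by (intro add_nonneg_pos mult_nonneg_nonneg) auto

text \<open>The Brownian term has mean zero because the type is known at time \<open>0\<close>.\<close>

lemma mean_consume:
  assumes s: "s \<in> {0..T}"
  shows "integrable M (consume Z Xb s)"
    and "expectation (consume Z Xb s) = tb * Z s + (x0 / (T + 1) - tb * (Xb + (LBINT v:{0..T}. Z v)) / (T + 1)
      + \<kappa> / 4 * (T + 1 + 2 * s - 1 / (T + 1)))"
proof -
  let ?A = "LBINT v:{0..T}. Z v" and ?g = "T + 1 + 2 * s - 1 / (T + 1)"
  have m: "(\<lambda>\<omega>. (\<mu> \<omega> / \<sigma> \<omega>)\<^sup>2 * \<beta> \<omega>) \<in> borel_measurable M" using types_M by simp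
  have k: "integrable M (\<lambda>\<omega>. (\<mu> \<omega> / \<sigma> \<omega>)\<^sup>2 * \<beta> \<omega>)"
    by (rule type_integrable[of "\<lambda>m s b h. (m / s)\<^sup>2 * b"]) (rule m)
  have cF: "(\<lambda>\<omega>. \<beta> \<omega> * (\<mu> \<omega> / \<sigma> \<omega>)) \<in> borel_measurable (F 0)" using types_F by simp
  have "integrable M (\<lambda>\<omega>. \<beta> \<omega> * (\<mu> \<omega> / \<sigma> \<omega>))"
    by (rule type_integrable[of "\<lambda>m s b h. b * (m / s)"]) (rule F_meas_M[OF cF zero_T(1)])
  then have w: "has_bochner_integral M (\<lambda>\<omega>. \<beta> \<omega> * (\<mu> \<omega> / \<sigma> \<omega>) * (W s \<omega> - W 0 \<omega>)) 0"
    using s by (intro increment_mean_zero cF) auto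
  have "has_bochner_integral M (\<lambda>\<omega>. x0 / (T + 1) + (Z s - (Xb + ?A) / (T + 1)) * \<theta> \<omega> + (?g / 4) * ((\<mu> \<omega> / \<sigma> \<omega>)\<^sup>2 * \<beta> \<omega>)
      + \<beta> \<omega> * (\<mu> \<omega> / \<sigma> \<omega>) * (W s \<omega> - W 0 \<omega>)) (x0 / (T + 1) + (Z s - (Xb + ?A) / (T + 1)) * tb + (?g / 4) * \<kappa> + 0)"
  proof (intro has_bochner_integral_add has_bochner_integral_mult_right w)
    show "has_bochner_integral M (\<lambda>\<omega>. x0 / (T + 1)) (x0 / (T + 1))" by (simp add: has_bochner_integral_iff prob_space)
    show "has_bochner_integral M \<theta> tb" using \<theta>_integrable by (simp add: has_bochner_integral_iff)
    show "has_bochner_integral M (\<lambda>\<omega>. (\<mu> \<omega> / \<sigma> \<omega>)\<^sup>2 * \<beta> \<omega>) \<kappa>" using k by (simp add: has_bochner_integral_iff)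
  qed
  moreover have "consume Z Xb s \<omega> = x0 / (T + 1) + (Z s - (Xb + ?A) / (T + 1)) * \<theta> \<omega> + (?g / 4) * ((\<mu> \<omega> / \<sigma> \<omega>)\<^sup>2 * \<beta> \<omega>)
      + \<beta> \<omega> * (\<mu> \<omega> / \<sigma> \<omega>) * (W s \<omega> - W 0 \<omega>)" if "\<omega> \<in> space M" for \<omega>
  proof -
    have alg: "(x - h * a / u) + h * z + 1 / 4 * b * q * g + c * w = x + (z - a / u) * h + g / 4 * (q * b) + c * (w - 0)"
      for x h a u z b q g c w :: real
      by (simp add: algebra_simps)
    show ?thesis unfolding consume_def opt_consumption_def base_level_def W_0[OF that] by (rule alg)
  qed
  ultimately have hb: "has_bochner_integral M (consume Z Xb s) (x0 / (T + 1) + (Z s - (Xb + ?A) / (T + 1)) * tb + (?g / 4) * \<kappa> + 0)"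
    by (simp cong: has_bochner_integral_cong)
  show "integrable M (consume Z Xb s)" using hb by (simp add: has_bochner_integral_iff)
  have alg: "x + (z - a / u) * h + g / 4 * k + 0 = h * z + (x - h * a / u + k / 4 * g)" for x z a u h g k :: real
    by (simp add: algebra_simps)
  show "expectation (consume Z Xb s) = tb * Z s + (x0 / (T + 1) - tb * (Xb + ?A) / (T + 1) + \<kappa> / 4 * ?g)"
    unfolding has_bochner_integral_integral_eq[OF hb] by (rule alg)
qed

text \<open>The mean of the explicit terminal wealth is affine in \<open>Xb\<close>. Solving the fixed point equation
  for \<open>Xb\<close> gives \<open>mean_terminal_wealth\<close> in the form of \<open>mean_terminal_wealth_eq\<close>.\<close>

lemma terminal_consistency:
  assumes Z: "continuous_on {0..T} Z"
  shows "Xb = expectation (capital Z Xb T) \<longleftrightarrow> Xb = mean_terminal_wealth T x0 tb \<kappa> Z"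
proof -
  let ?A = "LBINT v:{0..T}. Z v" and ?D = "(1 - tb) * T + 1"
  have "capital Z Xb T \<omega> = consume Z Xb T \<omega> + (Xb - Z T) * \<theta> \<omega>" for \<omega>
    using opt_wealth_terminal[OF T_pos Z, of x0 Xb "\<mu> \<omega>" "\<sigma> \<omega>" "\<beta> \<omega>" "\<theta> \<omega>" "W T \<omega>"]
    by (simp add: capital_def consume_def algebra_simps)
  then have "expectation (capital Z Xb T) = expectation (\<lambda>\<omega>. consume Z Xb T \<omega> + (Xb - Z T) * \<theta> \<omega>)"
    by (simp add: fun_eq_iff cong: Bochner_Integration.integral_cong)
  also have "\<dots> = expectation (consume Z Xb T) + (Xb - Z T) * tb"
    by (subst Bochner_Integration.integral_add[OF mean_consume(1)[OF zero_T(2)] Bochner_Integration.integrable_mult_right[OF \<theta>_integrable]])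
      simp
  also have "\<dots> = tb * Xb + (x0 / (T + 1) - tb * (Xb + ?A) / (T + 1) + \<kappa> / 4 * (T + 1 + 2 * T - 1 / (T + 1)))"
    unfolding mean_consume(2)[OF zero_T(2)] by (simp add: algebra_simps)
  finally have E: "expectation (capital Z Xb T)
     = tb * Xb + (x0 / (T + 1) - tb * (Xb + ?A) / (T + 1) + \<kappa> / 4 * (T + 1 + 2 * T - 1 / (T + 1)))" .
  have alg0: "u * (y + (x / u - z / u + k / 4 * (g - 1 / u))) = u * y + (x - z + k / 4 * (u * g - 1))"
    if "u \<noteq> 0" for u y x z k g :: real
    using that by (simp add: field_simps)
  have alg: "X = h * X + (x / (t + 1) - h * (X + a) / (t + 1) + k / 4 * (t + 1 + 2 * t - 1 / (t + 1)))
      \<longleftrightarrow> X = (x - h * a + k / 4 * (3 * t\<^sup>2 + 4 * t)) / D"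
    if t: "t + 1 \<noteq> 0" and D: "D \<noteq> 0" "D = (1 - h) * t + 1" for X h x t a k D :: real
  proof -
    have "(t + 1) * (h * X + (x / (t + 1) - h * (X + a) / (t + 1) + k / 4 * (t + 1 + 2 * t - 1 / (t + 1))))
        = (t + 1) * (h * X) + (x - h * (X + a) + k / 4 * ((t + 1) * (t + 1 + 2 * t) - 1))"
      by (rule alg0[OF t])
    also have "(t + 1) * (t + 1 + 2 * t) - 1 = 3 * t\<^sup>2 + 4 * t" by (simp add: algebra_simps power2_eq_square)
    finally have e: "(t + 1) * (h * X + (x / (t + 1) - h * (X + a) / (t + 1) + k / 4 * (t + 1 + 2 * t - 1 / (t + 1))))
        = (t + 1) * (h * X) + (x - h * (X + a) + k / 4 * (3 * t\<^sup>2 + 4 * t))" .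
    have "X = h * X + (x / (t + 1) - h * (X + a) / (t + 1) + k / 4 * (t + 1 + 2 * t - 1 / (t + 1)))
      \<longleftrightarrow> (t + 1) * X = (t + 1) * (h * X) + (x - h * (X + a) + k / 4 * (3 * t\<^sup>2 + 4 * t))"
      unfolding e[symmetric] using t by simp
    also have "\<dots> \<longleftrightarrow> X * D = x - h * a + k / 4 * (3 * t\<^sup>2 + 4 * t)"
      unfolding D(2) by (simp add: algebra_simps)
    also have "\<dots> \<longleftrightarrow> X = (x - h * a + k / 4 * (3 * t\<^sup>2 + 4 * t)) / D"
      using D(1) by (simp add: eq_divide_eq)
    finally show ?thesis .
  qed
  show ?thesis unfolding E mean_terminal_wealth_eq[OF T_pos Z D_pos]
    using D_pos T_pos by (intro alg) auto
qed

text \<open>By \<open>G_eq\<close>, the mean consumption at time \<open>s\<close> is \<open>tb * Z s + G s Z\<close>. The consistency condition is the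
  variation of constants formula for the decay rate \<open>\<delta>\<close> with \<open>\<delta>\<close> times this mean as source.\<close>

lemma consumption_consistency:
  assumes Z: "continuous_on {0..T} Z" and Xb: "Xb = mean_terminal_wealth T x0 tb \<kappa> Z"
  shows "(\<forall>t\<in>{0..T}. Z t = z0 * exp (- \<delta> * t) + (LBINT s:{0..t}. \<delta> * exp (\<delta> * (s - t)) * expectation (consume Z Xb s)))
    \<longleftrightarrow> solves_functional_ode T x0 z0 \<delta> tb \<kappa> Z"
proof -
  define e where "e s = tb * Z s + (x0 / (T + 1) - tb * (Xb + (LBINT v:{0..T}. Z v)) / (T + 1)
      + \<kappa> / 4 * (T + 1 + 2 * s - 1 / (T + 1)))" for s
  have e: "expectation (consume Z Xb s) = e s" if "s \<in> {0..T}" for s unfolding e_def by (rule mean_consume(2)[OF that])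
  have G: "e s = tb * Z s + G T x0 tb \<kappa> s Z" if "s \<in> {0..T}" for s
    unfolding e_def G_eq[OF T_pos Z D_pos that] Xb ..
  have ce: "continuous_on {0..T} e"
    unfolding e_def
    by (intro continuous_on_add continuous_on_diff continuous_on_mult continuous_on_const continuous_on_id Z)
  then have cq: "continuous_on {0..T} (\<lambda>s. \<delta> * e s)" by (intro continuous_on_mult continuous_on_const)
  have "z0 * exp (- \<delta> * t) + (LBINT s:{0..t}. \<delta> * exp (\<delta> * (s - t)) * expectation (consume Z Xb s))
      = exp (- \<delta> * t) * (z0 + integral {0..t} (\<lambda>s. exp (\<delta> * s) * (\<delta> * e s)))" if t: "t \<in> {0..T}" for t
  proof -
    have sub: "{0..t} \<subseteq> {0..T}" using t by auto
    have "(LBINT s:{0..t}. \<delta> * exp (\<delta> * (s - t)) * expectation (consume Z Xb s))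
        = (LBINT s:{0..t}. exp (- \<delta> * t) * (exp (\<delta> * s) * (\<delta> * e s)))"
    proof (rule set_lebesgue_integral_cong)
      show "\<forall>s. s \<in> {0..t} \<longrightarrow> \<delta> * exp (\<delta> * (s - t)) * expectation (consume Z Xb s) = exp (- \<delta> * t) * (exp (\<delta> * s) * (\<delta> * e s))"
      proof (intro allI impI)
        fix s assume "s \<in> {0..t}"
        then have s: "s \<in> {0..T}" using sub by auto
        have "exp (\<delta> * (s - t)) = exp (- \<delta> * t) * exp (\<delta> * s)" by (simp flip: exp_add add: algebra_simps)
        then show "\<delta> * exp (\<delta> * (s - t)) * expectation (consume Z Xb s) = exp (- \<delta> * t) * (exp (\<delta> * s) * (\<delta> * e s))"
          unfolding e[OF s] by (simp only: mult_ac)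
      qed
    qed simp
    also have "\<dots> = exp (- \<delta> * t) * integral {0..t} (\<lambda>s. exp (\<delta> * s) * (\<delta> * e s))"
      unfolding set_integral_mult_right
      by (subst set_integral_eq_HK) (intro continuous_intros continuous_on_subset[OF ce sub], simp)
    finally show ?thesis by (simp add: algebra_simps)
  qed
  then have "(\<forall>t\<in>{0..T}. Z t = z0 * exp (- \<delta> * t) + (LBINT s:{0..t}. \<delta> * exp (\<delta> * (s - t)) * expectation (consume Z Xb s)))
    \<longleftrightarrow> (\<forall>t\<in>{0..T}. Z t = exp (- \<delta> * t) * (z0 + integral {0..t} (\<lambda>s. exp (\<delta> * s) * (\<delta> * e s))))"
    by (intro ball_cong refl) simp
  also have "\<dots> \<longleftrightarrow> (\<forall>t\<in>{0..T}. (Z has_real_derivative (- \<delta> * Z t + \<delta> * e t)) (at t within {0..T})) \<and> Z 0 = z0"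
    using linear_ode_iff[OF cq, of Z \<delta> z0] T_pos by simp
  also have "\<dots> \<longleftrightarrow> solves_functional_ode T x0 z0 \<delta> tb \<kappa> Z"
    unfolding solves_functional_ode_def
  proof (intro conj_cong ball_cong refl)
    fix t assume t: "t \<in> {0..T}"
    have "- \<delta> * Z t + \<delta> * e t = (- \<delta> + \<delta> * tb) * Z t + \<delta> * G T x0 tb \<kappa> t Z"
      unfolding G[OF t] by (simp add: algebra_simps)
    then show "(Z has_real_derivative (- \<delta> * Z t + \<delta> * e t)) (at t within {0..T})
      = (Z has_real_derivative ((- \<delta> + \<delta> * tb) * Z t + \<delta> * G T x0 tb \<kappa> t Z)) (at t within {0..T})" by (simp only:)
  qed
  finally show ?thesis .
qed

section \<open>Equilibrium\<close>

text \<open>Competitors are compared up to null sets, on which the cost does not depend.\<close>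

lemma cost_cong:
  assumes CC: "AE (s, \<omega>) in PM. C' s \<omega> = C s \<omega>" and XX: "AE \<omega> in M. X' T \<omega> = X T \<omega>"
    and j: "joint C" "joint C'"
  shows "cost Z Xb C' X' = cost Z Xb C X"
  unfolding cost_def
proof (rule nn_integral_cong_AE)
  show "AE \<omega> in M. (\<integral>\<^sup>+s\<in>{0..T}. ennreal (exp (- (1 / \<beta> \<omega>) * (C' s \<omega> - \<theta> \<omega> * Z s))) \<partial>lborel)
      + ennreal (exp (- (1 / \<beta> \<omega>) * (X' T \<omega> - \<theta> \<omega> * Xb)))
    = (\<integral>\<^sup>+s\<in>{0..T}. ennreal (exp (- (1 / \<beta> \<omega>) * (C s \<omega> - \<theta> \<omega> * Z s))) \<partial>lborel)
      + ennreal (exp (- (1 / \<beta> \<omega>) * (X T \<omega> - \<theta> \<omega> * Xb)))"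
    using AE_PM_swap(2)[OF j(2,1) CC] XX
  proof eventually_elim
    case (elim \<omega>)
    have "(\<integral>\<^sup>+s. ennreal (exp (- (1 / \<beta> \<omega>) * (C' s \<omega> - \<theta> \<omega> * Z s))) \<partial>leb T)
        = (\<integral>\<^sup>+s. ennreal (exp (- (1 / \<beta> \<omega>) * (C s \<omega> - \<theta> \<omega> * Z s))) \<partial>leb T)"
      by (rule nn_integral_cong_AE) (use elim(1) in eventually_elim, simp)
    then show ?case unfolding nn_integral_leb elim(2) by simp
  qed
qed

lemma payoff_le_iff: "payoff M T \<beta> \<theta> Z Xb C X \<le> payoff M T \<beta> \<theta> Z Xb C' X' \<longleftrightarrow> cost Z Xb C' X' \<le> cost Z Xb C X"
  by (simp add: payoff_eq less_eq_ennreal.rep_eq)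

lemma explicit_optimal:
  assumes Z: "continuous_on {0..T} Z" and w: "wealth M T F W x0 \<mu> \<sigma> P C X" and adm: "admissible M T F P C"
    and C: "AE \<omega> in M. \<forall>s\<in>{0..T}. C s \<omega> = consume Z Xb s \<omega>" and X: "AE \<omega> in M. X T \<omega> = capital Z Xb T \<omega>"
  shows "optimal M T F W x0 \<mu> \<sigma> \<beta> \<theta> Z Xb P C"
  unfolding optimal_def
proof (intro conjI adm exI[of _ X] w allI impI)
  fix P' C' X' assume adm': "admissible M T F P' C'" and w': "wealth M T F W x0 \<mu> \<sigma> P' C' X'"
  have "cost Z Xb C X \<le> cost Z Xb C' X'"
  proof (rule ccontr)
    assume not: "\<not> cost Z Xb C X \<le> cost Z Xb C' X'"
    then have le: "cost Z Xb C' X' \<le> cost Z Xb C X" by simp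
    note v = verification[OF Z w adm C X w' adm' le]
    have "cost Z Xb C' X' = cost Z Xb C X"
      by (rule cost_cong[where C = C and C' = C' and X = X and X' = X',
        OF v admissible_consumption(2)[OF adm] admissible_consumption(2)[OF adm']])
    with not show False by simp
  qed
  then show "payoff M T \<beta> \<theta> Z Xb C' X' \<le> payoff M T \<beta> \<theta> Z Xb C X" unfolding payoff_le_iff .
qed

text \<open>Against any given mean field the explicit control is the only optimal one, and it determines
  the wealth.\<close>

lemma optimal_unique:
  assumes Z: "continuous_on {0..T} Z" and opt: "optimal M T F W x0 \<mu> \<sigma> \<beta> \<theta> Z Xb P C"
    and w: "wealth M T F W x0 \<mu> \<sigma> P C X"
  shows "AE (s, \<omega>) in PM. C s \<omega> = consume Z Xb s \<omega>" "AE (s, \<omega>) in PM. P s \<omega> = invest s \<omega>"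
    and "AE \<omega> in M. X T \<omega> = capital Z Xb T \<omega>"
proof -
  have we: "wealth M T F W x0 \<mu> \<sigma> invest (consume Z Xb) (capital Z Xb)" by (rule wealth_explicit[OF Z]) simp
  have ae: "admissible M T F invest (consume Z Xb)" by (rule admissible_explicit[where Xb = Xb, OF Z prog_consume[OF Z]]) simp
  obtain X1 where adm: "admissible M T F P C" and w1: "wealth M T F W x0 \<mu> \<sigma> P C X1"
    and best: "\<And>P' C' X'. admissible M T F P' C' \<Longrightarrow> wealth M T F W x0 \<mu> \<sigma> P' C' X' \<Longrightarrow>
       payoff M T \<beta> \<theta> Z Xb C' X' \<le> payoff M T \<beta> \<theta> Z Xb C X1"
    using opt unfolding optimal_def by blast
  have le: "cost Z Xb C X1 \<le> cost Z Xb (consume Z Xb) (capital Z Xb)"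
    using best[OF ae we] unfolding payoff_le_iff .
  note v = verification[where Xb = Xb, OF Z we ae _ _ w1 adm le]
  show C: "AE (s, \<omega>) in PM. C s \<omega> = consume Z Xb s \<omega>" by (rule v(1)) simp_all
  have X1: "AE \<omega> in M. X1 T \<omega> = capital Z Xb T \<omega>" by (rule v(2)) simp_all
  show P: "AE (s, \<omega>) in PM. P s \<omega> = invest s \<omega>" by (rule control_determined[OF we ae w1 adm C X1])
  show "AE \<omega> in M. X T \<omega> = capital Z Xb T \<omega>" by (rule wealth_determined[OF we ae w adm C P zero_T(2)])
qed

lemma prog_feedback:
  assumes Z: "continuous_on {0..T} Z" and pX: "prog_measurable T F X"
  shows "prog_measurable T F (\<lambda>t \<omega>. feedback_consumption T Z Xb (\<mu> \<omega>) (\<sigma> \<omega>) (\<beta> \<omega>) (\<theta> \<omega>) t (X t \<omega>))"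
proof -
  let ?A = "\<lambda>t. LBINT v:{t..T}. Z v"
  have cA: "continuous_on {0..T} ?A" by (rule DERIV_continuous_on[OF tail_integral_deriv[OF Z]])
  have cr: "continuous_on {0..T} (\<lambda>t. 1 / (T + 1 - t))" by (intro continuous_intros) auto
  have cm: "continuous_on {0..T} (\<lambda>t. Z t - (Xb + ?A t) * (1 / (T + 1 - t)))"
    by (intro continuous_on_diff continuous_on_mult continuous_on_add continuous_on_const Z cA cr)
  have cl: "continuous_on {0..T} (\<lambda>t. (T + 1 - t) - 1 / (T + 1 - t))"
    by (intro continuous_on_diff continuous_on_const continuous_on_id cr)
  have mF: "(\<lambda>\<omega>. 1 / 4 * \<beta> \<omega> * (\<mu> \<omega> / \<sigma> \<omega>)\<^sup>2) \<in> borel_measurable (F 0)" using types_F by simp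
  have "feedback_consumption T Z Xb (\<mu> \<omega>) (\<sigma> \<omega>) (\<beta> \<omega>) (\<theta> \<omega>) t (X t \<omega>)
      = X t \<omega> * (1 / (T + 1 - t)) + \<theta> \<omega> * (Z t - (Xb + ?A t) * (1 / (T + 1 - t)))
        + 1 / 4 * \<beta> \<omega> * (\<mu> \<omega> / \<sigma> \<omega>)\<^sup>2 * ((T + 1 - t) - 1 / (T + 1 - t))" for t \<omega>
    unfolding feedback_consumption_def
    by (simp add: diff_divide_distrib add_divide_distrib distrib_left distrib_right right_diff_distrib)
  then show ?thesis
    by (simp only:) (intro prog_add prog_mult pX prog_det[OF cr] prog_det[OF cm] prog_det[OF cl] prog_const \<theta>_F mF)
qed

text \<open>An equilibrium only fixes the consumption almost everywhere, so its mean may differ from the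
  explicit one at a null set of times.\<close>

lemma mean_consumption_integral:
  assumes pC: "prog_measurable T F C" and C: "AE (s, \<omega>) in PM. C s \<omega> = consume Z Xb s \<omega>" and Z: "continuous_on {0..T} Z"
    and t: "t \<in> {0..T}"
  shows "(LBINT s:{0..t}. \<delta> * exp (\<delta> * (s - t)) * expectation (C s))
    = (LBINT s:{0..t}. \<delta> * exp (\<delta> * (s - t)) * expectation (consume Z Xb s))"
proof -
  have m: "(\<lambda>s. expectation (K s)) \<in> borel_measurable (leb T)" if "joint K" for K
    using borel_measurable_lebesgue_integral[of K "leb T"] jointD[OF that] by (simp add: case_prod_beta')
  have me: "(\<lambda>s. indicator {0..t} s * (\<delta> * exp (\<delta> * (s - t)))) \<in> borel_measurable (leb T)"
    by (intro measurable_restrict_space1) simp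
  have jC: "joint C" "joint (consume Z Xb)" by (intro prog_joint pC prog_consume Z)+
  have "(\<integral>s. indicator {0..t} s * (\<delta> * exp (\<delta> * (s - t)) * expectation (C s)) \<partial>leb T)
      = (\<integral>s. indicator {0..t} s * (\<delta> * exp (\<delta> * (s - t)) * expectation (consume Z Xb s)) \<partial>leb T)"
  proof (rule integral_cong_AE)
    show "(\<lambda>s. indicator {0..t} s * (\<delta> * exp (\<delta> * (s - t)) * expectation (C s))) \<in> borel_measurable (leb T)"
      "(\<lambda>s. indicator {0..t} s * (\<delta> * exp (\<delta> * (s - t)) * expectation (consume Z Xb s))) \<in> borel_measurable (leb T)"
      using borel_measurable_times[OF me m[OF jC(1)]] borel_measurable_times[OF me m[OF jC(2)]] by (simp_all only: mult.assoc)
    show "AE s in leb T. indicator {0..t} s * (\<delta> * exp (\<delta> * (s - t)) * expectation (C s))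
        = indicator {0..t} s * (\<delta> * exp (\<delta> * (s - t)) * expectation (consume Z Xb s))"
      using AE_PM_swap(1)[OF jC C] AE_space
    proof eventually_elim
      case (elim s)
      then have s: "s \<in> {0..T}" by simp
      have "expectation (C s) = expectation (consume Z Xb s)"
        by (rule integral_cong_AE[OF prog_section_M[OF pC s] prog_section_M[OF prog_consume[OF Z] s] elim(1)])
      then show ?case by simp
    qed
  qed
  then show ?thesis unfolding set_integral_sub_leb[OF conjunct2[OF t[unfolded atLeastAtMost_iff]] order_refl] .
qed

text \<open>A competing equilibrium is optimal for its own mean field, hence explicit; consistency makes that
  mean field a solution of the functional equation, and the solution is unique.\<close>

lemma equilibrium:
  assumes ZC: "Z \<in> CT T" and ode: "solves_functional_ode T x0 z0 \<delta> tb \<kappa> Z" and d: "0 < \<delta>"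
    and Xb: "Xb = mean_terminal_wealth T x0 tb \<kappa> Z"
    and w: "wealth M T F W x0 \<mu> \<sigma> invest (\<lambda>t \<omega>. feedback_consumption T Z Xb (\<mu> \<omega>) (\<sigma> \<omega>) (\<beta> \<omega>) (\<theta> \<omega>) t (X t \<omega>)) X"
      (is "wealth M T F W x0 \<mu> \<sigma> invest ?C X")
  shows "unique_mean_field_equilibrium M T F W x0 z0 \<delta> \<mu> \<sigma> \<beta> \<theta> invest ?C"
proof -
  have Z: "continuous_on {0..T} Z" using ZC by (simp add: CT_def)
  have pX: "prog_measurable T F X" using w by (simp add: wealth_def)
  have pC: "prog_measurable T F ?C" by (rule prog_feedback[OF Z pX])
  have XW: "AE \<omega> in M. \<forall>t\<in>{0..T}. X t \<omega> = capital Z Xb t \<omega>" by (rule feedback_wealth_unique[OF Z w])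
  then have C: "AE \<omega> in M. \<forall>s\<in>{0..T}. ?C s \<omega> = consume Z Xb s \<omega>"
    by eventually_elim (simp add: feedback_capital[OF Z])
  have XT: "AE \<omega> in M. X T \<omega> = capital Z Xb T \<omega>" using XW by eventually_elim (use zero_T(2) in blast)
  have CP: "AE (s, \<omega>) in PM. ?C s \<omega> = consume Z Xb s \<omega>"
    using AE_pair_snd[OF sigma_finite_measure_axioms C, of "leb T"] AE_space
  proof eventually_elim
    case (elim x)
    then show ?case by (cases x) (simp add: space_pair_measure)
  qed
  have adm: "admissible M T F invest ?C" by (rule admissible_explicit[OF Z pC C])
  have mfe: "mean_field_equilibrium M T F W x0 z0 \<delta> \<mu> \<sigma> \<beta> \<theta> invest ?C"
    unfolding mean_field_equilibrium_def
  proof (intro bexI[OF _ ZC] exI[of _ Xb] exI[of _ X] conjI w)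
    show "optimal M T F W x0 \<mu> \<sigma> \<beta> \<theta> Z Xb invest ?C" by (rule explicit_optimal[OF Z w adm C XT])
    show "\<forall>t\<in>{0..T}. Z t = z0 * exp (- \<delta> * t) + (LBINT s:{0..t}. \<delta> * exp (\<delta> * (s - t)) * expectation (?C s))"
      using consumption_consistency[OF Z Xb, of z0 \<delta>] ode mean_consumption_integral[OF pC CP Z, of _ \<delta>] by simp
    have "expectation (X T) = expectation (capital Z Xb T)"
      by (rule integral_cong_AE[OF prog_section_M[OF pX zero_T(2)] prog_section_M[OF prog_capital[OF Z] zero_T(2)] XT])
    then show "Xb = expectation (X T)" using terminal_consistency[OF Z, of Xb] Xb by simp
  qed
  moreover have "same_control M T P' C' invest ?C" if mfe': "mean_field_equilibrium M T F W x0 z0 \<delta> \<mu> \<sigma> \<beta> \<theta> P' C'" for P' C'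
  proof -
    obtain Z' Xb' X' where ZC': "Z' \<in> CT T" and opt: "optimal M T F W x0 \<mu> \<sigma> \<beta> \<theta> Z' Xb' P' C'"
      and con: "\<forall>t\<in>{0..T}. Z' t = z0 * exp (- \<delta> * t) + (LBINT s:{0..t}. \<delta> * exp (\<delta> * (s - t)) * expectation (C' s))"
      and w': "wealth M T F W x0 \<mu> \<sigma> P' C' X'" and Xb': "Xb' = expectation (X' T)"
      using mfe' unfolding mean_field_equilibrium_def by blast
    have Z': "continuous_on {0..T} Z'" using ZC' by (simp add: CT_def)
    have adm': "admissible M T F P' C'" using opt by (simp add: optimal_def)
    have pX': "prog_measurable T F X'" using w' by (simp add: wealth_def)
    note u = optimal_unique[OF Z' opt w']
    have "expectation (X' T) = expectation (capital Z' Xb' T)"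
      by (rule integral_cong_AE[OF prog_section_M[OF pX' zero_T(2)] prog_section_M[OF prog_capital[OF Z'] zero_T(2)] u(3)])
    then have X': "Xb' = mean_terminal_wealth T x0 tb \<kappa> Z'" using terminal_consistency[OF Z', of Xb'] Xb' by simp
    have "solves_functional_ode T x0 z0 \<delta> tb \<kappa> Z'"
      using consumption_consistency[OF Z' X', of z0 \<delta>] con
        mean_consumption_integral[OF admissible_consumption(1)[OF adm'] u(1) Z', of _ \<delta>] by simp
    then have ZZ: "Z' = Z"
      using functional_ode_ex1[OF T_pos d tb_bounds, of x0 z0 \<kappa>] ZC ZC' ode by blast
    then have "Xb' = Xb" using X' Xb by simp
    with ZZ have "AE (s, \<omega>) in PM. C' s \<omega> = consume Z Xb s \<omega>" "AE (s, \<omega>) in PM. P' s \<omega> = invest s \<omega>" using u(1,2) by simp_all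
    with CP show ?thesis unfolding same_control_def by eventually_elim auto
  qed
  ultimately show ?thesis unfolding unique_mean_field_equilibrium_def by blast
qed

theorem explicit_equilibrium:
  assumes d: "0 < \<delta>"
  shows "(\<exists>!Z. Z \<in> CT T \<and> solves_functional_ode T x0 z0 \<delta> tb \<kappa> Z) \<and>
    (\<forall>Z. Z \<in> CT T \<and> solves_functional_ode T x0 z0 \<delta> tb \<kappa> Z \<longrightarrow>
      (let Xb = mean_terminal_wealth T x0 tb \<kappa> Z;
           Pfb = (\<lambda>\<omega>. feedback_investment T (\<mu> \<omega>) (\<sigma> \<omega>) (\<beta> \<omega>));
           Cfb = (\<lambda>\<omega>. feedback_consumption T Z Xb (\<mu> \<omega>) (\<sigma> \<omega>) (\<beta> \<omega>) (\<theta> \<omega>))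
       in (\<exists>X. wealth M T F W x0 \<mu> \<sigma> (\<lambda>t \<omega>. Pfb \<omega> t (X t \<omega>)) (\<lambda>t \<omega>. Cfb \<omega> t (X t \<omega>)) X) \<and>
          (\<forall>X. wealth M T F W x0 \<mu> \<sigma> (\<lambda>t \<omega>. Pfb \<omega> t (X t \<omega>)) (\<lambda>t \<omega>. Cfb \<omega> t (X t \<omega>)) X \<longrightarrow>
             unique_mean_field_equilibrium M T F W x0 z0 \<delta> \<mu> \<sigma> \<beta> \<theta>
               (\<lambda>t \<omega>. Pfb \<omega> t (X t \<omega>)) (\<lambda>t \<omega>. Cfb \<omega> t (X t \<omega>)))))"
  unfolding Let_def feedback_investment_eq
proof (intro conjI allI impI)
  show "\<exists>!Z. Z \<in> CT T \<and> solves_functional_ode T x0 z0 \<delta> tb \<kappa> Z" by (rule functional_ode_ex1[OF T_pos d tb_bounds])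
  fix Z assume Z: "Z \<in> CT T \<and> solves_functional_ode T x0 z0 \<delta> tb \<kappa> Z"
  then have cZ: "continuous_on {0..T} Z" by (simp add: CT_def)
  let ?Xb = "mean_terminal_wealth T x0 tb \<kappa> Z"
  show "\<exists>X. wealth M T F W x0 \<mu> \<sigma> (\<lambda>t \<omega>. invest t \<omega>)
      (\<lambda>t \<omega>. feedback_consumption T Z ?Xb (\<mu> \<omega>) (\<sigma> \<omega>) (\<beta> \<omega>) (\<theta> \<omega>) t (X t \<omega>)) X"
    by (rule exI[of _ "capital Z ?Xb"], rule wealth_explicit[OF cZ], rule feedback_capital[OF cZ])
  fix X assume "wealth M T F W x0 \<mu> \<sigma> (\<lambda>t \<omega>. invest t \<omega>)
      (\<lambda>t \<omega>. feedback_consumption T Z ?Xb (\<mu> \<omega>) (\<sigma> \<omega>) (\<beta> \<omega>) (\<theta> \<omega>) t (X t \<omega>)) X"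
  then show "unique_mean_field_equilibrium M T F W x0 z0 \<delta> \<mu> \<sigma> \<beta> \<theta> (\<lambda>t \<omega>. invest t \<omega>)
      (\<lambda>t \<omega>. feedback_consumption T Z ?Xb (\<mu> \<omega>) (\<sigma> \<omega>) (\<beta> \<omega>) (\<theta> \<omega>) t (X t \<omega>))"
    by (rule equilibrium[OF conjunct1[OF Z] conjunct2[OF Z] d refl])
qed

end

section \<open>Regular versions of the Brownian motion\<close>

text \<open>The Ito integral sees the Brownian motion only through second moments of simple integrals.\<close>

lemma ito_integral_version:
  assumes ae: "AE \<omega> in M. \<forall>t\<in>{0..T}. W t \<omega> = V t \<omega>"
  shows "ito_integral M T F W = ito_integral M T F V"
proof (intro ext)
  fix H I
  have eq: "(\<integral>\<^sup>+\<omega>. ennreal ((I t \<omega> - simple_integral W n \<tau> \<xi> t \<omega>)\<^sup>2) \<partial>M)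
      = (\<integral>\<^sup>+\<omega>. ennreal ((I t \<omega> - simple_integral V n \<tau> \<xi> t \<omega>)\<^sup>2) \<partial>M)"
    if si: "simple_integrand M T F n \<tau> \<xi>" and t: "t \<in> {0..T}" for n \<tau> \<xi> t
  proof (rule nn_integral_cong_AE)
    show "AE \<omega> in M. ennreal ((I t \<omega> - simple_integral W n \<tau> \<xi> t \<omega>)\<^sup>2) = ennreal ((I t \<omega> - simple_integral V n \<tau> \<xi> t \<omega>)\<^sup>2)"
      using ae
    proof eventually_elim
      case (elim \<omega>)
      have "W (min t (\<tau> i)) \<omega> = V (min t (\<tau> i)) \<omega>" if "i \<le> n" for i
      proof -
        have "min t (\<tau> i) \<in> {0..T}" using simple_integrand_times[OF si that] t by (auto simp: min_def)
        then show ?thesis using elim by blast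
      qed
      then have "simple_integral W n \<tau> \<xi> t \<omega> = simple_integral V n \<tau> \<xi> t \<omega>"
        unfolding simple_integral_def by (intro sum.cong) simp_all
      then show ?case by simp
    qed
  qed
  show "ito_integral M T F W H I = ito_integral M T F V H I"
    unfolding ito_integral_def by (simp add: eq cong: conj_cong)
qed

lemma wealth_version:
  assumes "AE \<omega> in M. \<forall>t\<in>{0..T}. W t \<omega> = V t \<omega>"
  shows "wealth M T F W = wealth M T F V"
  by (intro ext) (simp only: wealth_def ito_integral_version[OF assms])

lemma unique_equilibrium_version:
  assumes "AE \<omega> in M. \<forall>t\<in>{0..T}. W t \<omega> = V t \<omega>"
  shows "unique_mean_field_equilibrium M T F W = unique_mean_field_equilibrium M T F V"
  by (intro ext)
    (simp only: unique_mean_field_equilibrium_def mean_field_equilibrium_def optimal_def wealth_version[OF assms])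

text \<open>Only independence needs an argument, as it concerns the generated sigma-algebra: every event in it
  agrees up to a null set with the corresponding event for the other version.\<close>

lemma (in prob_space) brownian_motion_version:
  assumes bm: "brownian_motion M T F W" and sub: "\<And>t. t \<in> {0..T} \<Longrightarrow> subalgebra M (F t)"
    and ae: "AE \<omega> in M. \<forall>t\<in>{0..T}. W t \<omega> = V t \<omega>" and T: "0 \<le> T"
    and V: "\<And>t. t \<in> {0..T} \<Longrightarrow> V t \<in> borel_measurable (F t)"
  shows "brownian_motion M T F V"
  unfolding brownian_motion_def
proof (intro conjI ballI impI)
  show "V t \<in> borel_measurable (F t)" if "t \<in> {0..T}" for t by (rule V[OF that])
  have z: "0 \<in> {0..T}" using T by simp
  have W: "AE \<omega> in M. W 0 \<omega> = 0" "AE \<omega> in M. continuous_on {0..T} (\<lambda>t. W t \<omega>)"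
    using bm by (simp_all add: brownian_motion_def)
  show "AE \<omega> in M. V 0 \<omega> = 0" using ae W(1)
  proof eventually_elim
    case (elim \<omega>)
    then show ?case using bspec[OF elim(1) z] by simp
  qed
  show "AE \<omega> in M. continuous_on {0..T} (\<lambda>t. V t \<omega>)" using ae W(2)
  proof eventually_elim
    case (elim \<omega>)
    show ?case by (rule continuous_on_eq[OF elim(2) bspec[OF elim(1)]])
  qed
  fix s t assume st: "s \<in> {0..T}" "t \<in> {0..T}" "s < t"
  let ?dW = "\<lambda>\<omega>. W t \<omega> - W s \<omega>" and ?dV = "\<lambda>\<omega>. V t \<omega> - V s \<omega>"
  have dis: "distributed M lborel ?dW (normal_density 0 (sqrt (t - s)))"
    and ind: "indep_set (sets (F s)) (sets (vimage_algebra (space M) ?dW borel))"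
    using bm st by (auto simp: brownian_motion_def)
  have WM: "W r \<in> borel_measurable M" "V r \<in> borel_measurable M" if r: "r \<in> {0..T}" for r
  proof -
    have "W r \<in> borel_measurable (F r)" using bm r by (simp add: brownian_motion_def)
    then show "W r \<in> borel_measurable M" by (rule measurable_from_subalg[OF sub[OF r]])
    show "V r \<in> borel_measurable M" by (rule measurable_from_subalg[OF sub[OF r] V[OF r]])
  qed
  have m: "?dW \<in> borel_measurable M" "?dV \<in> borel_measurable M" using WM st by auto
  have d: "AE \<omega> in M. ?dW \<omega> = ?dV \<omega>" using ae by eventually_elim (use st in auto)
  have "distr M lborel ?dV = distr M lborel ?dW"
    using d m by (intro distr_cong_AE) (auto elim: eventually_mono)
  then show "distributed M lborel ?dV (normal_density 0 (sqrt (t - s)))"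
    using dis m by (simp add: distributed_def)
  have sV: "sets (vimage_algebra (space M) f borel) = {f -` B \<inter> space M |B. B \<in> sets borel}" for f :: "'a \<Rightarrow> real"
    by (rule sets_vimage_algebra2) simp
  show "indep_set (sets (F s)) (sets (vimage_algebra (space M) ?dV borel))"
    unfolding indep_sets2_eq
  proof (intro conjI ballI)
    have I: "sets (F s) \<subseteq> events"
      and prod: "\<And>a b. a \<in> sets (F s) \<Longrightarrow> b \<in> sets (vimage_algebra (space M) ?dW borel) \<Longrightarrow> prob (a \<inter> b) = prob a * prob b"
      using ind unfolding indep_sets2_eq by simp_all
    show "sets (F s) \<subseteq> events" by (rule I)
    show "sets (vimage_algebra (space M) ?dV borel) \<subseteq> events"
      unfolding sV using measurable_sets[OF m(2)] by auto
    fix a b assume a: "a \<in> sets (F s)" and b: "b \<in> sets (vimage_algebra (space M) ?dV borel)"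
    then obtain B where B: "b = ?dV -` B \<inter> space M" "B \<in> sets borel" unfolding sV by blast
    let ?b = "?dW -` B \<inter> space M"
    have ev: "a \<in> events" "b \<in> events" "?b \<in> events"
      using a I measurable_sets[OF m(1) B(2)] measurable_sets[OF m(2) B(2)] B by auto
    have "prob (a \<inter> b) = prob (a \<inter> ?b)" "prob b = prob ?b"
      using ev d B(1) by (intro measure_eq_AE; (auto elim!: eventually_mono)?)+
    moreover have "prob (a \<inter> ?b) = prob a * prob ?b" using B(2) by (intro prod a) (auto simp: sV)
    ultimately show "prob (a \<inter> b) = prob a * prob b" by simp
  qed
qed

text \<open>Filtrations that satisfy the usual conditions contain the null sets, so the paths may be
  altered on a null set without losing adaptedness.\<close>

lemma (in prob_space) regular_version:
  assumes usual: "usual_filtration M T F" and bm: "brownian_motion M T F W" and T: "0 < T"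
  obtains V where "brownian_setup M T F V" "AE \<omega> in M. \<forall>t\<in>{0..T}. W t \<omega> = V t \<omega>"
proof -
  have sub: "\<And>t. t \<in> {0..T} \<Longrightarrow> subalgebra M (F t)"
    and mono: "\<And>s t. s \<in> {0..T} \<Longrightarrow> t \<in> {0..T} \<Longrightarrow> s \<le> t \<Longrightarrow> sets (F s) \<subseteq> sets (F t)"
    and null: "null_sets M \<subseteq> sets (F 0)"
    using usual by (auto simp: usual_filtration_def)
  have "AE \<omega> in M. W 0 \<omega> = 0 \<and> continuous_on {0..T} (\<lambda>t. W t \<omega>)"
    using bm by (simp add: brownian_motion_def)
  then obtain N where N: "{\<omega> \<in> space M. \<not> (W 0 \<omega> = 0 \<and> continuous_on {0..T} (\<lambda>t. W t \<omega>))} \<subseteq> N"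
    "emeasure M N = 0" "N \<in> sets M" by (rule AE_E)
  define V where "V t \<omega> = W t \<omega> * indicator (space M - N) \<omega>" for t \<omega>
  have NF: "space M - N \<in> sets (F t)" if t: "t \<in> {0..T}" for t
  proof -
    have "N \<in> null_sets M" using N by auto
    then have "N \<in> sets (F 0)" using null by auto
    then have "N \<in> sets (F t)" using mono[of 0 t] t by auto
    moreover have "space (F t) = space M" using sub[OF t] by (auto simp: subalgebra_def)
    ultimately show ?thesis using sets.compl_sets[of N "F t"] by simp
  qed
  have "AE \<omega> in M. \<omega> \<notin> N" using N by (intro AE_not_in) auto
  with AE_space have ae: "AE \<omega> in M. \<forall>t\<in>{0..T}. W t \<omega> = V t \<omega>"
    by eventually_elim (simp add: V_def)
  have VF: "V t \<in> borel_measurable (F t)" if t: "t \<in> {0..T}" for t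
  proof -
    have "W t \<in> borel_measurable (F t)" using bm t by (simp add: brownian_motion_def)
    moreover have "(indicator (space M - N) :: 'a \<Rightarrow> real) \<in> borel_measurable (F t)" using NF[OF t] by simp
    ultimately show ?thesis unfolding V_def[abs_def] by (rule borel_measurable_times)
  qed
  have path: "V 0 \<omega> = 0 \<and> continuous_on {0..T} (\<lambda>t. V t \<omega>)" if "\<omega> \<in> space M" for \<omega>
    using N(1) that by (cases "\<omega> \<in> N") (auto simp: V_def)
  have "brownian_setup M T F V"
  proof (unfold_locales)
    show "brownian_motion M T F V" by (rule brownian_motion_version[OF bm sub ae _ VF]) (use T in auto)
  qed (use T sub mono path in auto)
  then show thesis by (rule that[OF _ ae])
qed

theorem proposition3p3:
  fixes M :: "'a measure" and F :: "real \<Rightarrow> 'a measure" and W :: "real \<Rightarrow> 'a \<Rightarrow> real"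
    and \<mu> \<sigma> \<beta> \<theta> :: "'a \<Rightarrow> real"
    and T x0 z0 \<delta> :: real
    and K :: nat and types :: "nat \<Rightarrow> real \<times> real \<times> real \<times> real" and p :: "nat pmf"
    and tb \<kappa> :: real
  assumes "T > 0" and "x0 > 0" and "z0 > 0" and "\<delta> > 0"
    and "\<And>k m s b h. k \<in> {1..K} \<Longrightarrow> types k = (m, s, b, h) \<Longrightarrow>
           m > 0 \<and> s > 0 \<and> b > 0 \<and> 0 < h \<and> h \<le> 1"
    and "set_pmf p \<subseteq> {1..K}"
    and "prob_space M" and "usual_filtration M T F" and "brownian_motion M T F W"
    and "(\<lambda>\<omega>. (\<mu> \<omega>, \<sigma> \<omega>, \<beta> \<omega>, \<theta> \<omega>)) \<in> borel_measurable (F 0)"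
    and "prob_space.indep_set M
           (sets (vimage_algebra (space M) (\<lambda>\<omega>. (\<mu> \<omega>, \<sigma> \<omega>, \<beta> \<omega>, \<theta> \<omega>)) borel))
           (sets (vimage_algebra (space M) (\<lambda>\<omega>. \<lambda>t\<in>{0..T}. W t \<omega>) (\<Pi>\<^sub>M t\<in>{0..T}. borel)))"
    and "distr M borel (\<lambda>\<omega>. (\<mu> \<omega>, \<sigma> \<omega>, \<beta> \<omega>, \<theta> \<omega>)) = distr (measure_pmf p) borel types"
    and "tb = prob_space.expectation M \<theta>"
    and "\<kappa> = prob_space.expectation M (\<lambda>\<omega>. (\<mu> \<omega> / \<sigma> \<omega>)\<^sup>2 * \<beta> \<omega>)"
  shows "(\<exists>!Z. Z \<in> CT T \<and> solves_functional_ode T x0 z0 \<delta> tb \<kappa> Z) \<and>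
    (\<forall>Z. Z \<in> CT T \<and> solves_functional_ode T x0 z0 \<delta> tb \<kappa> Z \<longrightarrow>
      (let Xb = mean_terminal_wealth T x0 tb \<kappa> Z;
           Pfb = (\<lambda>\<omega>. feedback_investment T (\<mu> \<omega>) (\<sigma> \<omega>) (\<beta> \<omega>));
           Cfb = (\<lambda>\<omega>. feedback_consumption T Z Xb (\<mu> \<omega>) (\<sigma> \<omega>) (\<beta> \<omega>) (\<theta> \<omega>))
       in (\<exists>X. wealth M T F W x0 \<mu> \<sigma> (\<lambda>t \<omega>. Pfb \<omega> t (X t \<omega>)) (\<lambda>t \<omega>. Cfb \<omega> t (X t \<omega>)) X) \<and>
          (\<forall>X. wealth M T F W x0 \<mu> \<sigma> (\<lambda>t \<omega>. Pfb \<omega> t (X t \<omega>)) (\<lambda>t \<omega>. Cfb \<omega> t (X t \<omega>)) X \<longrightarrow>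
             unique_mean_field_equilibrium M T F W x0 z0 \<delta> \<mu> \<sigma> \<beta> \<theta>
               (\<lambda>t \<omega>. Pfb \<omega> t (X t \<omega>)) (\<lambda>t \<omega>. Cfb \<omega> t (X t \<omega>)))))"
proof -
  interpret prob_space M by fact
  obtain V where V: "brownian_setup M T F V" and ae: "AE \<omega> in M. \<forall>t\<in>{0..T}. W t \<omega> = V t \<omega>"
    by (rule regular_version[OF assms(8,9,1)])
  interpret brownian_setup M T F V by (rule V)
  have "0 \<in> {0..T}" using assms(1) by simp
  have oM: "(\<lambda>\<omega>. (\<mu> \<omega>, \<sigma> \<omega>, \<beta> \<omega>, \<theta> \<omega>)) \<in> borel_measurable M"
    by (rule F_meas_M[OF assms(10) \<open>0 \<in> {0..T}\<close>])
  have S: "{x \<in> space borel. x \<in> types ` {1..K}} \<in> sets borel"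
    using borel_closed[OF finite_imp_closed[of "types ` {1..K}"]] by simp
  have "AE k in measure_pmf p. types k \<in> types ` {1..K}"
    using assms(6) by (auto simp: AE_measure_pmf_iff)
  then have "AE x in distr (measure_pmf p) borel types. x \<in> types ` {1..K}"
    by (subst AE_distr_iff[OF _ S]) simp_all
  then have "AE x in distr M borel (\<lambda>\<omega>. (\<mu> \<omega>, \<sigma> \<omega>, \<beta> \<omega>, \<theta> \<omega>)). x \<in> types ` {1..K}"
    unfolding assms(12) .
  then have oS: "AE \<omega> in M. (\<mu> \<omega>, \<sigma> \<omega>, \<beta> \<omega>, \<theta> \<omega>) \<in> types ` {1..K}"
    by (subst (asm) AE_distr_iff[OF oM S])
  interpret game M T F V \<mu> \<sigma> \<beta> \<theta> "types ` {1..K}" x0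
  proof unfold_locales
    show "finite (types ` {1..K})" by simp
    show "0 < m \<and> 0 < s \<and> 0 < b \<and> 0 < h \<and> h \<le> 1" if v: "(m, s, b, h) \<in> types ` {1..K}" for m s b h
    proof -
      obtain k where k: "k \<in> {1..K}" "types k = (m, s, b, h)" using v by (metis imageE)
      from assms(5)[OF k] show ?thesis by simp
    qed
  qed (fact assms(10) oS)+
  show ?thesis
    unfolding wealth_version[OF ae] unique_equilibrium_version[OF ae] assms(13,14)
    by (rule explicit_equilibrium[OF assms(4)])
qed

end
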